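(* Let $n\ge2$ and let $a_1<a_2<\dots<a_{2n}$ be real numbers. In the limit $$a_1,\dots,a_n\to0\quad\text{and}\quad a_{n+1},\dots,a_{2n}\to\infty,$$ the minitwistor space $\mathscr T$ arising as the scalar $S^1$-quotient of the toric gravitational instanton of type $A_{2n-1}$ is deformed into $Q/\mathbb Z_n$, the minitwistor space of the hyperbolic orbifold $\mathbb B/\mathbb Z_n$.
   Context: $\Lambda\subset\mathbb P^n$ is a rational normal curve with affine coordinate $z$, and $C(\Lambda)\subset\mathbb P^{n+1}$ is the cone over it; away from its vertex it is the total space of $\mathscr O(n)\to\mathbb P^1$, with fiber coordinate $v$. For real $a_1<\dots<a_{2n}$, $\mathscr T$ is Hitchin's minitwistor space: the quotient of the twistor space of the toric ALE gravitational instanton of type $A_{2n-1}$ determined by the $a_i$ by the complexification of the scalar $S^1$-action (the one induced from scalar multiplication on $\mathbb C^2$). Concretely, one compactifies the affine surface $xy=(-1)^n(z-a_1)\cdots(z-a_{2n})$ in the $\mathbb P^2$-bundle $\mathbb P(\mathscr O(n)\oplus\mathscr O(n)\oplus\mathscr O)\to\mathbb P^1$ ($z$ an affine coordinate on the base, $x,y$ fiber coordinates on the two copies of $\mathscr O(n)$) and contracts the two sections at infinity, which are $(-n)$-curves. The real structure is $(x,y,z)\mapsto(\bar y,\bar x,\bar z)$. Via $v=x+y$, $\mathscr T$ is a double cover of $C(\Lambda)$ branched along the hyperelliptic curve $\{v^2=4(-1)^n(z-a_1)\cdots(z-a_{2n})\}$. $Q=\mathbb P^1\times\mathbb P^1$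 has affine coordinates $(\zeta,\eta)$ and real structure $(\zeta,\eta)\mapsto(\bar\eta,\bar\zeta)$; $\mathbb Z_n$ is generated by $(\zeta,\eta)\mapsto(e^{2\pi i/n}\zeta,e^{-2\pi i/n}\eta)$. Via $z=\zeta\eta$, $v=\zeta^n+\eta^n$, $Q/\mathbb Z_n$ is a double cover of $C(\Lambda)$ branched along $\{v^2=4z^n\}$. It is the minitwistor space of $\mathbb B/\mathbb Z_n$, the quotient of the hyperbolic three-ball $\mathbb B$ by the group of order $n$ of rotations about a geodesic. *)

theory Defs
  imports "HOL-Analysis.Analysis"
begin

section \<open>Spaces with holomorphic functions\<close>

text \<open>
  Reduced complex spaces are handled as topological spaces carrying a sheaf of complex-valued
  functions: \<open>Hol X U\<close> is the set of holomorphic functions on the open set \<open>U\<close>. Functions are total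
  in HOL; in every space constructed below, membership in \<open>Hol X U\<close> depends only on the values
  on \<open>U\<close>. The value of \<open>Hol X U\<close> at sets \<open>U\<close> that are not open is irrelevant.
\<close>

record 'a fspace =
  Top :: "'a topology"
  Hol :: "'a set \<Rightarrow> ('a \<Rightarrow> complex) set"

abbreviation pts :: "'a fspace \<Rightarrow> 'a set" where
  "pts X \<equiv> topspace (Top X)"

text \<open>\<open>\<complex>\<^sup>N\<close> is the set of sequences vanishing from index \<open>N\<close> on; the subspace topology inherited from
  the product topology is the usual one. Holomorphic means continuous and complex differentiable in
  each variable separately (Osgood).\<close>

definition cspace :: "nat \<Rightarrow> (nat \<Rightarrow> complex) set" where
  "cspace N = {p. \<forall>i\<ge>N. p i = 0}"

definition vec :: "complex list \<Rightarrow> nat \<Rightarrow> complex" where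
  "vec xs i = (if i < length xs then xs ! i else 0)"

definition affine_space :: "nat \<Rightarrow> (nat \<Rightarrow> complex) fspace" where
  "affine_space N = \<lparr> Top = top_of_set (cspace N),
     Hol = (\<lambda>U. {f. continuous_on U f \<and>
       (\<forall>p\<in>U. \<forall>i<N. (\<lambda>w. f (p(i := w))) field_differentiable (at (p i)))}) \<rparr>"

text \<open>The (reduced) structure induced on a subset: functions that locally extend to holomorphic
  functions on the ambient space.\<close>

definition subspace_on :: "'a fspace \<Rightarrow> 'a set \<Rightarrow> 'a fspace" where
  "subspace_on X S = \<lparr> Top = subtopology (Top X) S,
     Hol = (\<lambda>U. {f. \<forall>p\<in>U. \<exists>V g. openin (Top X) V \<and> p \<in> V \<and> g \<in> Hol X V \<and>
                       (\<forall>q\<in>V \<inter> U. f q = g q)}) \<rparr>"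

text \<open>Quotient by an equivalence relation \<open>R\<close> on the points of \<open>X\<close>: quotient topology, and the functions
  whose pullback to \<open>X\<close> is holomorphic. This serves for orbit spaces of group actions as well as for
  contractions of curves: for a contraction \<open>c : X \<rightarrow> Y\<close> onto a normal space, the structure sheaf of
  \<open>Y\<close> is the direct image \<open>c\<^sub>* O\<^sub>X\<close>.\<close>

definition quot_topology :: "'a topology \<Rightarrow> ('a \<times> 'a) set \<Rightarrow> 'a set topology" where
  "quot_topology T R =
     topology (\<lambda>V. V \<subseteq> topspace T // R \<and> openin T {x \<in> topspace T. R `` {x} \<in> V})"

lemma openin_quot_topology:
  "openin (quot_topology T R) V \<longleftrightarrow>
     V \<subseteq> topspace T // R \<and> openin T {x \<in> topspace T. R `` {x} \<in> V}"
proof -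
  have "istopology (\<lambda>V. V \<subseteq> topspace T // R \<and> openin T {x \<in> topspace T. R `` {x} \<in> V})"
    unfolding istopology_def
  proof (intro conjI allI impI)
    fix A B
    assume "A \<subseteq> topspace T // R \<and> openin T {x \<in> topspace T. R `` {x} \<in> A}"
       and "B \<subseteq> topspace T // R \<and> openin T {x \<in> topspace T. R `` {x} \<in> B}"
    moreover have "{x \<in> topspace T. R `` {x} \<in> A \<inter> B} =
       {x \<in> topspace T. R `` {x} \<in> A} \<inter> {x \<in> topspace T. R `` {x} \<in> B}" by auto
    ultimately show "A \<inter> B \<subseteq> topspace T // R"
      and "openin T {x \<in> topspace T. R `` {x} \<in> A \<inter> B}" by auto
  next
    fix K
    assume K: "\<forall>A\<in>K. A \<subseteq> topspace T // R \<and> openin T {x \<in> topspace T. R `` {x} \<in> A}"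
    then show "\<Union>K \<subseteq> topspace T // R" by auto
    have "{x \<in> topspace T. R `` {x} \<in> \<Union>K} =
       \<Union>((\<lambda>A. {x \<in> topspace T. R `` {x} \<in> A}) ` K)" by auto
    with K show "openin T {x \<in> topspace T. R `` {x} \<in> \<Union>K}" by auto
  qed
  then show ?thesis
    unfolding quot_topology_def by (simp add: topology_inverse')
qed

definition quotient_by :: "'a fspace \<Rightarrow> ('a \<times> 'a) set \<Rightarrow> 'a set fspace" where
  "quotient_by X R = \<lparr> Top = quot_topology (Top X) R,
     Hol = (\<lambda>U. {f. (\<lambda>x. f (R `` {x})) \<in> Hol X {x \<in> pts X. R `` {x} \<in> U}}) \<rparr>"

definition hol_map :: "'a fspace \<Rightarrow> 'b fspace \<Rightarrow> ('a \<Rightarrow> 'b) \<Rightarrow> bool" where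
  "hol_map X Y f \<longleftrightarrow> continuous_map (Top X) (Top Y) f \<and>
     (\<forall>V g. openin (Top Y) V \<and> g \<in> Hol Y V \<longrightarrow> g \<circ> f \<in> Hol X {x \<in> pts X. f x \<in> V})"

definition biholomorphic :: "'a fspace \<Rightarrow> 'b fspace \<Rightarrow> ('a \<Rightarrow> 'b) \<Rightarrow> bool" where
  "biholomorphic X Y f \<longleftrightarrow> homeomorphic_map (Top X) (Top Y) f \<and>
     (\<forall>V g. openin (Top Y) V \<longrightarrow>
        (g \<in> Hol Y V \<longleftrightarrow> g \<circ> f \<in> Hol X {x \<in> pts X. f x \<in> V}))"

text \<open>Anti-holomorphic involutions.\<close>

definition real_structure :: "'a fspace \<Rightarrow> ('a \<Rightarrow> 'a) \<Rightarrow> bool" where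
  "real_structure X \<tau> \<longleftrightarrow> continuous_map (Top X) (Top X) \<tau> \<and>
     (\<forall>x\<in>pts X. \<tau> (\<tau> x) = x) \<and>
     (\<forall>U f. openin (Top X) U \<and> f \<in> Hol X U \<longrightarrow>
        (\<lambda>x. cnj (f (\<tau> x))) \<in> Hol X {x \<in> pts X. \<tau> x \<in> U})"

text \<open>Reduced complex spaces: Hausdorff spaces with a sheaf of functions, locally isomorphic to the zero
  set of finitely many holomorphic functions on an open subset of some \<open>\<complex>\<^sup>N\<close>.\<close>

definition is_sheaf :: "'a fspace \<Rightarrow> bool" where
  "is_sheaf X \<longleftrightarrow> (\<forall>U f. openin (Top X) U \<longrightarrow>
     (f \<in> Hol X U \<longleftrightarrow>
       (\<forall>p\<in>U. \<exists>V g. openin (Top X) V \<and> p \<in> V \<and> g \<in> Hol X V \<and> (\<forall>q\<in>V \<inter> U. f q = g q))))"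

definition analytic_model :: "nat \<Rightarrow> (nat \<Rightarrow> complex) set \<Rightarrow> bool" where
  "analytic_model N A \<longleftrightarrow> (\<exists>W F. openin (top_of_set (cspace N)) W \<and> finite F \<and>
     F \<subseteq> Hol (affine_space N) W \<and> A = {p \<in> W. \<forall>f\<in>F. f p = 0})"

definition complex_space :: "'a fspace \<Rightarrow> bool" where
  "complex_space X \<longleftrightarrow> Hausdorff_space (Top X) \<and> is_sheaf X \<and>
     (\<forall>x\<in>pts X. \<exists>U N A \<phi>. openin (Top X) U \<and> x \<in> U \<and> analytic_model N A \<and>
        biholomorphic (subspace_on X U) (subspace_on (affine_space N) A) \<phi>)"


section \<open>Deformations\<close>

text \<open>Let \<open>\<pi>\<close> map \<open>X\<close> to \<open>\<complex>\<^sup>k\<close> and let \<open>x\<close> be a point of \<open>X\<close>. The predicate says that the germ at \<open>x\<close> of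
  \<open>f\<close> lies in the ideal of the local ring \<open>O\<^sub>X\<^sub>,\<^sub>x\<close> generated by the first \<open>j\<close> of the functions
  \<open>t\<^sub>i = \<pi>\<^sub>i - \<pi>\<^sub>i(x)\<close>. For \<open>j = k\<close> this ideal is \<open>m O\<^sub>X\<^sub>,\<^sub>x\<close> with \<open>m\<close> the maximal ideal of the base at
  \<open>\<pi>(x)\<close>.\<close>

definition in_base_ideal ::
  "'a fspace \<Rightarrow> ('a \<Rightarrow> nat \<Rightarrow> complex) \<Rightarrow> nat \<Rightarrow> 'a \<Rightarrow> ('a \<Rightarrow> complex) \<Rightarrow> bool" where
  "in_base_ideal X \<pi> j x f \<longleftrightarrow> (\<exists>U h. openin (Top X) U \<and> x \<in> U \<and> (\<forall>i<j. h i \<in> Hol X U) \<and>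
     (\<forall>y\<in>U. f y = (\<Sum>i<j. (\<pi> y i - \<pi> x i) * h i y)))"

text \<open>Flatness of \<open>\<pi>\<close> at \<open>x\<close>. The base is a manifold, so its local ring at \<open>\<pi>(x)\<close> is regular with parameters
  \<open>t\<^sub>0, \<dots>, t\<^sub>k\<^sub>-\<^sub>1\<close>, and by the local criterion \<open>O\<^sub>X\<^sub>,\<^sub>x\<close> is flat over it iff these form a regular sequence
  in \<open>O\<^sub>X\<^sub>,\<^sub>x\<close>, i.e. each \<open>t\<^sub>j\<close> is a non-zero-divisor modulo \<open>t\<^sub>0, \<dots>, t\<^sub>j\<^sub>-\<^sub>1\<close>.\<close>

definition flat_at :: "'a fspace \<Rightarrow> ('a \<Rightarrow> nat \<Rightarrow> complex) \<Rightarrow> nat \<Rightarrow> 'a \<Rightarrow> bool" where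
  "flat_at X \<pi> k x \<longleftrightarrow> (\<forall>j<k. \<forall>U g. openin (Top X) U \<and> x \<in> U \<and> g \<in> Hol X U \<and>
     in_base_ideal X \<pi> j x (\<lambda>y. (\<pi> y j - \<pi> x j) * g y) \<longrightarrow> in_base_ideal X \<pi> j x g)"

definition flat_family ::
  "'a fspace \<Rightarrow> nat \<Rightarrow> (nat \<Rightarrow> complex) set \<Rightarrow> ('a \<Rightarrow> nat \<Rightarrow> complex) \<Rightarrow> bool" where
  "flat_family X k B \<pi> \<longleftrightarrow> complex_space X \<and> openin (top_of_set (cspace k)) B \<and>
     hol_map X (subspace_on (affine_space k) B) \<pi> \<and>
     proper_map (Top X) (top_of_set B) \<pi> \<and>
     (\<forall>x\<in>pts X. flat_at X \<pi> k x)"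

definition fibre :: "'a fspace \<Rightarrow> ('a \<Rightarrow> nat \<Rightarrow> complex) \<Rightarrow> (nat \<Rightarrow> complex) \<Rightarrow> 'a fspace" where
  "fibre X \<pi> b = subspace_on X {x \<in> pts X. \<pi> x = b}"

text \<open>\<open>fibre X \<pi> b\<close> carries the reduced structure. It is the fibre in the sense of complex spaces iff every
  function vanishing on it lies in \<open>m O\<^sub>X\<close>; this excludes multiple fibres.\<close>

definition reduced_fibre ::
  "'a fspace \<Rightarrow> nat \<Rightarrow> ('a \<Rightarrow> nat \<Rightarrow> complex) \<Rightarrow> (nat \<Rightarrow> complex) \<Rightarrow> bool" where
  "reduced_fibre X k \<pi> b \<longleftrightarrow> (\<forall>x\<in>pts X. \<pi> x = b \<longrightarrow>
     (\<forall>U f. openin (Top X) U \<and> x \<in> U \<and> f \<in> Hol X U \<and> (\<forall>y\<in>U. \<pi> y = b \<longrightarrow> f y = 0) \<longrightarrow>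
        in_base_ideal X \<pi> k x f))"

text \<open>The fibre over \<open>b\<close> is isomorphic to \<open>Y\<close>, by an isomorphism taking the real structure \<open>\<tau>\<close> of the
  family to \<open>\<sigma>\<close>.\<close>

definition has_fibre ::
  "'a fspace \<Rightarrow> nat \<Rightarrow> ('a \<Rightarrow> nat \<Rightarrow> complex) \<Rightarrow> ('a \<Rightarrow> 'a) \<Rightarrow> (nat \<Rightarrow> complex) \<Rightarrow>
     'b fspace \<Rightarrow> ('b \<Rightarrow> 'b) \<Rightarrow> bool" where
  "has_fibre X k \<pi> \<tau> b Y \<sigma> \<longleftrightarrow> reduced_fibre X k \<pi> b \<and>
     (\<exists>\<phi>. biholomorphic (fibre X \<pi> b) Y \<phi> \<and> (\<forall>x\<in>pts X. \<pi> x = b \<longrightarrow> \<phi> (\<tau> x) = \<sigma> (\<phi> x)))"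


section \<open>The minitwistor space \<open>\<T>\<close>\<close>

text \<open>The bundle \<open>\<P>(O(n) \<oplus> O(n) \<oplus> O) \<rightarrow> \<P>\<^sup>1\<close> is the quotient of \<open>(\<complex>\<^sup>2 - 0) \<times> (\<complex>\<^sup>3 - 0)\<close> by
  \<open>(l,m) (u\<^sub>0,u\<^sub>1; x,y,t) = (l u\<^sub>0, l u\<^sub>1; m l\<^sup>n x, m l\<^sup>n y, m t)\<close>. Its points are orbits, in the
  coordinates \<open>p 0, \<dots>, p 4 = u\<^sub>0, u\<^sub>1, x, y, t\<close>; the affine coordinates are \<open>z = u\<^sub>0/u\<^sub>1\<close> on the base and
  \<open>x, y\<close> (for \<open>u\<^sub>1 = t = 1\<close>) on the fibres.\<close>

definition bundle_dom :: "(nat \<Rightarrow> complex) set" where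
  "bundle_dom = {p \<in> cspace 5. (p 0, p 1) \<noteq> (0, 0) \<and> (p 2, p 3, p 4) \<noteq> (0, 0, 0)}"

definition bundle_rel :: "nat \<Rightarrow> ((nat \<Rightarrow> complex) \<times> (nat \<Rightarrow> complex)) set" where
  "bundle_rel n = {(p, q). p \<in> bundle_dom \<and> q \<in> bundle_dom \<and> (\<exists>l m. l \<noteq> 0 \<and> m \<noteq> 0 \<and>
     q = vec [l * p 0, l * p 1, m * l ^ n * p 2, m * l ^ n * p 3, m * p 4])}"

definition P2_bundle :: "nat \<Rightarrow> (nat \<Rightarrow> complex) set fspace" where
  "P2_bundle n = quotient_by (subspace_on (affine_space 5) bundle_dom) (bundle_rel n)"

definition affine_surface :: "nat \<Rightarrow> (nat \<Rightarrow> real) \<Rightarrow> (nat \<Rightarrow> complex) set set" where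
  "affine_surface n a = {bundle_rel n `` {vec [z, 1, x, y, 1]} | x y z.
     x * y = (-1) ^ n * (\<Prod>i = 1..2 * n. z - complex_of_real (a i))}"

definition compact_surface :: "nat \<Rightarrow> (nat \<Rightarrow> real) \<Rightarrow> (nat \<Rightarrow> complex) set fspace" where
  "compact_surface n a =
     subspace_on (P2_bundle n) (Top (P2_bundle n) closure_of affine_surface n a)"

text \<open>The part of the surface at infinity (\<open>t = 0\<close>) consists of the two sections \<open>x = t = 0\<close> and
  \<open>y = t = 0\<close>.\<close>

definition section_at_infinity ::
  "nat \<Rightarrow> (nat \<Rightarrow> real) \<Rightarrow> nat \<Rightarrow> (nat \<Rightarrow> complex) set set" where
  "section_at_infinity n a c = {P \<in> pts (compact_surface n a). \<exists>p\<in>P. p 4 = 0 \<and> p c = 0}"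

definition contract_rel ::
  "nat \<Rightarrow> (nat \<Rightarrow> real) \<Rightarrow> ((nat \<Rightarrow> complex) set \<times> (nat \<Rightarrow> complex) set) set" where
  "contract_rel n a = {(P, P'). P \<in> pts (compact_surface n a) \<and> P' \<in> pts (compact_surface n a) \<and>
     (P = P' \<or>
      (P \<in> section_at_infinity n a 2 \<and> P' \<in> section_at_infinity n a 2) \<or>
      (P \<in> section_at_infinity n a 3 \<and> P' \<in> section_at_infinity n a 3))}"

definition minitwistor :: "nat \<Rightarrow> (nat \<Rightarrow> real) \<Rightarrow> (nat \<Rightarrow> complex) set set fspace" where
  "minitwistor n a = quotient_by (compact_surface n a) (contract_rel n a)"

text \<open>The real structure \<open>(x,y,z) \<mapsto> (cnj y, cnj x, cnj z)\<close>. A point of \<open>minitwistor n a\<close> is a set of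
  orbits, hence the iterated image.\<close>

definition minitwistor_real :: "(nat \<Rightarrow> complex) set set \<Rightarrow> (nat \<Rightarrow> complex) set set" where
  "minitwistor_real =
     image (image (\<lambda>p. vec [cnj (p 0), cnj (p 1), cnj (p 3), cnj (p 2), cnj (p 4)]))"


section \<open>The quotient \<open>Q/\<int>\<^sub>n\<close>\<close>

text \<open>\<open>Q = \<P>\<^sup>1 \<times> \<P>\<^sup>1\<close> with homogeneous coordinates \<open>([p 0 : p 1], [p 2 : p 3])\<close>, \<open>\<zeta> = p 0 / p 1\<close> and
  \<open>\<eta> = p 2 / p 3\<close>.\<close>

definition Q_dom :: "(nat \<Rightarrow> complex) set" where
  "Q_dom = {p \<in> cspace 4. (p 0, p 1) \<noteq> (0, 0) \<and> (p 2, p 3) \<noteq> (0, 0)}"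

definition Q_rel :: "((nat \<Rightarrow> complex) \<times> (nat \<Rightarrow> complex)) set" where
  "Q_rel = {(p, q). p \<in> Q_dom \<and> q \<in> Q_dom \<and> (\<exists>l m. l \<noteq> 0 \<and> m \<noteq> 0 \<and>
     q = vec [l * p 0, l * p 1, m * p 2, m * p 3])}"

definition Q_space :: "(nat \<Rightarrow> complex) set fspace" where
  "Q_space = quotient_by (subspace_on (affine_space 4) Q_dom) Q_rel"

definition Zn_gen :: "nat \<Rightarrow> (nat \<Rightarrow> complex) set \<Rightarrow> (nat \<Rightarrow> complex) set" where
  "Zn_gen n = image (\<lambda>p. vec [cis (2 * pi / n) * p 0, p 1, cis (- 2 * pi / n) * p 2, p 3])"

definition Zn_rel :: "nat \<Rightarrow> ((nat \<Rightarrow> complex) set \<times> (nat \<Rightarrow> complex) set) set" where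
  "Zn_rel n = {(P, P'). P \<in> pts Q_space \<and> P' \<in> pts Q_space \<and> (\<exists>j. P' = (Zn_gen n ^^ j) P)}"

definition Q_mod_Zn :: "nat \<Rightarrow> (nat \<Rightarrow> complex) set set fspace" where
  "Q_mod_Zn n = quotient_by Q_space (Zn_rel n)"

text \<open>Induced by \<open>(\<zeta>,\<eta>) \<mapsto> (cnj \<eta>, cnj \<zeta>)\<close>.\<close>

definition Q_mod_Zn_real :: "(nat \<Rightarrow> complex) set set \<Rightarrow> (nat \<Rightarrow> complex) set set" where
  "Q_mod_Zn_real = image (image (\<lambda>p. vec [cnj (p 2), cnj (p 3), cnj (p 0), cnj (p 1)]))"


section \<open>The limit\<close>

text \<open>Coordinates on the parameter space in which the limit \<open>a\<^sub>1,\<dots>,a\<^sub>n \<rightarrow> 0\<close>, \<open>a\<^sub>n\<^sub>+\<^sub>1,\<dots>,a\<^sub>2\<^sub>n \<rightarrow> \<infinity>\<close> is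
  the origin of \<open>\<complex>\<^sup>2\<^sup>n\<close>. Used only for \<open>a\<^sub>n\<^sub>+\<^sub>1 > 0\<close>, so that no division by zero occurs.\<close>

definition param :: "nat \<Rightarrow> (nat \<Rightarrow> real) \<Rightarrow> nat \<Rightarrow> complex" where
  "param n a i = (if i < n then complex_of_real (a (i + 1))
                  else if i < 2 * n then complex_of_real (1 / a (i + 1)) else 0)"

end

theory Submission
  imports Defs "HOL-Complex_Analysis.Complex_Analysis"
begin

text \<open>
  Put \<open>s\<^sub>k = a\<^sub>k\<close> and \<open>t\<^sub>k = 1 / a\<^sub>n\<^sub>+\<^sub>k\<close>. In homogeneous coordinates \<open>(u\<^sub>0 : u\<^sub>1)\<close> of the base curve, and
  after rescaling \<open>x\<close> and \<open>y\<close> by a constant, the minitwistor surface is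
  \<open>x y = t\<^sup>2 \<Prod> (u\<^sub>0 - s\<^sub>k u\<^sub>1) \<Prod> (u\<^sub>1 - t\<^sub>k u\<^sub>0)\<close>, which makes sense for vanishing \<open>s\<^sub>k\<close>, \<open>t\<^sub>k\<close>: there it is
  \<open>x y = t\<^sup>2 (u\<^sub>0 u\<^sub>1)\<^sup>n\<close>, solved by the invariants \<open>x = \<zeta>\<^sup>n\<close>, \<open>y = \<eta>\<^sup>n\<close>, \<open>z = \<zeta> \<eta>\<close> of the cyclic group.
  Replacing \<open>t, u\<^sub>0, u\<^sub>1\<close> by the coordinates \<open>w\<^sub>i = t u\<^sub>0\<^sup>i u\<^sub>1\<^sup>n\<^sup>-\<^sup>i\<close> of the cone over the rational normal curve
  contracts the two sections at infinity, so that all these surfaces are the fibres of one family of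
  projective surfaces over the space of the parameters \<open>s\<^sub>k\<close>, \<open>t\<^sub>k\<close>.

  Where \<open>x \<noteq> 0\<close> or \<open>y \<noteq> 0\<close> the family is locally a product with the base. Near \<open>x = y = 0\<close> it is the
  hypersurface \<open>x y = P\<close>, and division by \<open>x y - P\<close> shows that the base coordinates form a regular
  sequence. The fibres are identified by quotient maps from the surfaces in question; these induce
  biholomorphic maps because the fibres are normal at their singular points, which is seen there by
  expanding functions into monomials invariant under a cyclic group.
\<close>

text \<open>Sheaves of functions speak of vanishing, whereas flatness and reduced fibres are
  statements about ideals. The bridge is \<open>vanishing_in_base_ideal\<close>: a function that
  vanishes where the first \<open>j\<close> base coordinates are constant lies in the ideal they
  generate. For \<open>j = 2 * n\<close> this is reducedness of the fibres. Flatness follows because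
  the next base coordinate is nonconstant near every point of such a slice
  (\<open>base_curve\<close>): a function killed by it on the slice vanishes there by continuity.

  The spaces to be compared are iterated quotients whose points are nested sets. Each is presented
  by a single map from a subset of some C^m (\<open>uniformized\<close>), so continuity and
  holomorphy are tested upstairs, on subsets of affine spaces. Compactness makes the comparison maps
  homeomorphisms. What remains is that a continuous function on a fibre is holomorphic as soon as
  its pullback is. Local sections settle this away from the two vertices, where all
  \<open>w_i\<close> vanish, and, in the limit fibre, the two points of type x y = z^n with x = y =
  0.\<close>

abbreviation ahol :: "nat \<Rightarrow> (nat \<Rightarrow> complex) set \<Rightarrow> ((nat \<Rightarrow> complex) \<Rightarrow> complex) set" where
  "ahol N \<equiv> Hol (affine_space N)"

lemma ahol_iff:
  "f \<in> ahol N U \<longleftrightarrow> continuous_on U f \<and>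
     (\<forall>p\<in>U. \<forall>i<N. (\<lambda>w. f (p(i := w))) field_differentiable (at (p i)))"
  by (simp add: affine_space_def)

lemma ahol_lineD:
  "f \<in> ahol N U \<Longrightarrow> p \<in> U \<Longrightarrow> i < N \<Longrightarrow> (\<lambda>w. f (p(i := w))) field_differentiable (at (p i))"
  by (simp add: ahol_iff)

lemma ahol_continuous: "f \<in> ahol N U \<Longrightarrow> continuous_on U f"
  by (simp add: ahol_iff)

lemma Top_affine_space [simp]: "Top (affine_space N) = top_of_set (cspace N)"
  by (simp add: affine_space_def)

lemma ahol_subset: "f \<in> ahol N U \<Longrightarrow> V \<subseteq> U \<Longrightarrow> f \<in> ahol N V"
  unfolding ahol_iff by (meson continuous_on_subset subsetD)

subsection \<open>Polydiscs\<close>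

text \<open>The radii may vary with the coordinate, since division by a power of one coordinate
  changes the radius in that coordinate alone.\<close>

definition polydisc :: "nat \<Rightarrow> (nat \<Rightarrow> complex) \<Rightarrow> (nat \<Rightarrow> real) \<Rightarrow> (nat \<Rightarrow> complex) set" where
  "polydisc N b r = {q \<in> cspace N. \<forall>i<N. cmod (q i - b i) < r i}"

lemma continuous_on_coord:
  fixes f :: "'a::topological_space \<Rightarrow> nat \<Rightarrow> complex"
  shows "continuous_on S f \<Longrightarrow> continuous_on S (\<lambda>x. f x i)"
  by (rule continuous_on_compose2[OF continuous_on_product_coordinates[where i = i]]) auto

lemma continuous_on_coord_id [continuous_intros]:
  "continuous_on S (\<lambda>p::nat \<Rightarrow> complex. p i)"
  using continuous_on_coord[OF continuous_on_id, of S i] by simp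

lemma continuous_on_funupd [continuous_intros]:
  fixes f :: "'a::topological_space \<Rightarrow> nat \<Rightarrow> complex"
  assumes "continuous_on S f" "continuous_on S g"
  shows "continuous_on S (\<lambda>x. (f x)(i := g x))"
proof (rule continuous_on_coordinatewise_then_product)
  fix j show "continuous_on S (\<lambda>x. ((f x)(i := g x)) j)"
    using assms by (cases "j = i") (auto intro!: continuous_on_coord)
qed

lemma polydisc_openin: "openin (top_of_set (cspace N)) (polydisc N b r)"
proof -
  have o: "open {q::nat \<Rightarrow> complex. cmod (q i - b i) < r i}" for i
    by (intro open_Collect_less continuous_intros)
  have "open (\<Inter>i<N. {q::nat \<Rightarrow> complex. cmod (q i - b i) < r i})"
    using o by auto
  moreover have "polydisc N b r = cspace N \<inter> (\<Inter>i<N. {q. cmod (q i - b i) < r i})"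
    by (auto simp: polydisc_def)
  ultimately show ?thesis unfolding openin_open by blast
qed

lemma polydisc_in:
  assumes V: "openin (top_of_set (cspace N)) V" and p: "p \<in> V"
  obtains r where "r > 0" "polydisc N p (\<lambda>_. r) \<subseteq> V"
proof -
  obtain T where T: "open T" "V = cspace N \<inter> T" using V by (auto simp: openin_open)
  have "openin (product_topology (\<lambda>_::nat. euclidean) UNIV) T"
    using T(1) by (simp add: euclidean_product_topology)
  from product_topology_open_contains_basis[OF this, of p]
  obtain X where X: "p \<in> (\<Pi>\<^sub>E i\<in>UNIV. X i)" "\<And>i. open (X i :: complex set)"
      "(\<Pi>\<^sub>E i\<in>UNIV. X i) \<subseteq> T"
    using p T(2) by auto
  have "\<exists>e>0. ball (p i) e \<subseteq> X i" for i
    using X(1,2) open_contains_ball by blast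
  then obtain e where e: "\<And>i. e i > 0" "\<And>i. ball (p i) (e i) \<subseteq> X i" by metis
  \<comment> \<open>Coordinates from \<open>N\<close> on are 0 on \<open>cspace N\<close>, so a
    minimum over finitely many radii is enough; the inserted 1 covers \<open>N = 0\<close>.\<close>
  define r where "r = Min (insert 1 (e ` {..<N}))"
  have r: "r > 0" "\<And>i. i < N \<Longrightarrow> r \<le> e i"
    using e(1) by (auto simp: r_def)
  have "polydisc N p (\<lambda>_. r) \<subseteq> V"
  proof
    fix q assume q: "q \<in> polydisc N p (\<lambda>_. r)"
    have "q i \<in> X i" for i
    proof (cases "i < N")
      case True
      then have "q i \<in> ball (p i) (e i)"
        using q r(2)[OF True] by (auto simp: polydisc_def dist_norm norm_minus_commute)
      then show ?thesis using e(2) by blast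
    next
      case False
      then have "q i = p i" using q p T(2) by (auto simp: polydisc_def cspace_def)
      then show ?thesis using X(1) by auto
    qed
    then show "q \<in> V" using X(3) q T(2) by (auto simp: polydisc_def)
  qed
  with r(1) show ?thesis using that by blast
qed

lemma funupd_cspace: "p \<in> cspace N \<Longrightarrow> i < N \<Longrightarrow> p(i := w) \<in> cspace N"
  by (auto simp: cspace_def)

lemma openin_cspace_sub: "openin (top_of_set (cspace N)) V \<Longrightarrow> V \<subseteq> cspace N"
  by (auto simp: openin_open)

lemma coord_line_ball:
  assumes V: "openin (top_of_set (cspace N)) V" and p: "p \<in> V" and i: "i < N"
  obtains s where "s > 0" "\<And>w. w \<in> ball (p i) s \<Longrightarrow> p(i := w) \<in> V"
proof -
  obtain r where r: "r > 0" "polydisc N p (\<lambda>_. r) \<subseteq> V" using polydisc_in[OF V p] .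
  have "p(i := w) \<in> V" if "w \<in> ball (p i) r" for w
  proof -
    have "p(i := w) \<in> polydisc N p (\<lambda>_. r)"
      using that i r p openin_cspace_sub[OF V] funupd_cspace
      by (auto simp: polydisc_def dist_norm norm_minus_commute)
    then show ?thesis using r by auto
  qed
  with r that show ?thesis by blast
qed

subsection \<open>Circle integrals depending on parameters\<close>

lemma circle_integral_continuous:
  fixes K :: "complex \<Rightarrow> 'a::topological_space \<Rightarrow> complex"
  assumes K: "continuous_on (sphere c r \<times> W) (\<lambda>(z, q). K z q)" and r: "0 \<le> r"
  shows "continuous_on W (\<lambda>q. contour_integral (circlepath c r) (\<lambda>z. K z q))"
proof -
  have "continuous_on (W \<times> cbox 0 1) (\<lambda>(q, t). K (circlepath c r t) q * vector_derivative (circlepath c r) (at t))"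
    unfolding split_def vector_derivative_circlepath
  proof (intro continuous_intros)
    have "continuous_on UNIV (circlepath c r)"
      unfolding circlepath by (intro continuous_intros)
    then have "continuous_on (W \<times> cbox 0 1) (\<lambda>x. (circlepath c r (snd x), fst x))"
      by (intro continuous_on_Pair continuous_on_compose2[of UNIV "circlepath c r", OF _ continuous_on_snd]
          continuous_on_fst continuous_on_id) auto
    moreover have "(\<lambda>x. (circlepath c r (snd x), fst x)) ` (W \<times> cbox 0 1) \<subseteq> sphere c r \<times> W"
      using r by (auto simp: circlepath dist_norm norm_mult)
    ultimately have "continuous_on (W \<times> cbox 0 1)
        (\<lambda>x. (\<lambda>(z, q). K z q) (circlepath c r (snd x), fst x))"
      by (rule continuous_on_compose2[OF K])
    then show "continuous_on (W \<times> cbox 0 1) (\<lambda>p. K (circlepath c r (snd p)) (fst p))"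
      by simp
  qed
  then show ?thesis
    unfolding contour_integral_integral
    using integral_continuous_on_param[of W 0 1 "\<lambda>q t. K (circlepath c r t) q * vector_derivative (circlepath c r) (at t)"]
    by (simp add: box_real)
qed

text \<open>Differentiation under the integral sign asks for a jointly continuous derivative of the
  kernel in \<open>w\<close>. Writing this derivative as a Cauchy integral \<open>D\<close> derives
  its joint continuity from that of \<open>K\<close>.\<close>

lemma circle_integral_differentiable:
  fixes K :: "complex \<Rightarrow> complex \<Rightarrow> complex"
  assumes K: "continuous_on (sphere c r \<times> ball w0 s) (\<lambda>(z, w). K z w)" and r: "0 \<le> r" and s: "0 < s"
    and h: "\<And>z. z \<in> sphere c r \<Longrightarrow> K z holomorphic_on ball w0 s"
  shows "(\<lambda>w. contour_integral (circlepath c r) (\<lambda>z. K z w)) field_differentiable at w0"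
proof -
  define D where "D = (\<lambda>z w. 1 / (2 * of_real pi * \<i>) *
      contour_integral (circlepath w0 (s/2)) (\<lambda>u. K z u / (u - w)^2))"
  have sub: "cball w0 (s/2) \<subseteq> ball w0 s" using s by auto
  have Dd: "(K z has_field_derivative D z w) (at w)" if "z \<in> sphere c r" "w \<in> ball w0 (s/2)" for z w
    unfolding D_def
    by (rule Cauchy_derivative_integral_circlepath(2)[OF _ _ that(2)])
       (use h[OF that(1)] sub in \<open>auto intro!: holomorphic_on_imp_continuous_on elim!: holomorphic_on_subset\<close>)
  have Dc: "continuous_on (sphere c r \<times> ball w0 (s/2)) (\<lambda>q. D (fst q) (snd q))"
    unfolding D_def
  proof (intro continuous_intros circle_integral_continuous)
    have "continuous_on (sphere w0 (s/2) \<times> sphere c r \<times> ball w0 (s/2)) (\<lambda>x. (\<lambda>(z, w). K z w) (fst (snd x), fst x))"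
      by (rule continuous_on_compose2[OF K]) (use s in \<open>auto intro!: continuous_intros\<close>)
    then have "continuous_on (sphere w0 (s/2) \<times> sphere c r \<times> ball w0 (s/2))
       (\<lambda>x. K (fst (snd x)) (fst x) / (fst x - snd (snd x))\<^sup>2)"
      by (intro continuous_intros) auto
    then show "continuous_on (sphere w0 (s/2) \<times> sphere c r \<times> ball w0 (s/2))
       (\<lambda>(z, q). K (fst q) z / (z - snd q)\<^sup>2)"
      by (simp add: split_def)
  qed (use s in auto)
  have circ: "circlepath c r t \<in> sphere c r" for t
    using r by (auto simp: circlepath dist_norm norm_mult)
  have cc: "continuous_on UNIV (circlepath c r)"
    unfolding circlepath by (intro continuous_intros)
  have "(\<lambda>w. integral (cbox 0 1) (\<lambda>t. K (circlepath c r t) w * vector_derivative (circlepath c r) (at t)))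
      field_differentiable at w0 within ball w0 (s/2)"
  proof (rule leibniz_rule_field_differentiable[where fx =
       "\<lambda>w t. D (circlepath c r t) w * vector_derivative (circlepath c r) (at t)"])
    fix w t assume "w \<in> ball w0 (s/2)"
    then show "((\<lambda>w. K (circlepath c r t) w * vector_derivative (circlepath c r) (at t))
        has_field_derivative D (circlepath c r t) w * vector_derivative (circlepath c r) (at t))
        (at w within ball w0 (s/2))"
      by (intro DERIV_cmult_right has_field_derivative_at_within[OF Dd] circ)
  next
    fix w assume "w \<in> ball w0 (s/2)"
    then have w: "w \<in> ball w0 s" using subsetD[OF subset_ball[of "s/2" s w0]] s by auto
    have "continuous_on (cbox 0 1) (\<lambda>t. (\<lambda>(z, w). K z w) (circlepath c r t, w))"
      by (rule continuous_on_compose2[OF K])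
         (use w circ in \<open>auto intro!: continuous_on_Pair continuous_on_const continuous_on_subset[OF cc]\<close>)
    then show "(\<lambda>t. K (circlepath c r t) w * vector_derivative (circlepath c r) (at t)) integrable_on cbox 0 1"
      unfolding vector_derivative_circlepath
      by (intro integrable_continuous continuous_intros) auto
  next
    have cp: "continuous_on (ball w0 (s/2) \<times> cbox 0 1) (\<lambda>x. (circlepath c r (snd x), fst x))"
      by (intro continuous_on_Pair continuous_on_compose2[OF cc continuous_on_snd]
          continuous_on_fst continuous_on_id) auto
    have "continuous_on (ball w0 (s/2) \<times> cbox 0 1) (\<lambda>x. D (circlepath c r (snd x)) (fst x))"
      using continuous_on_compose2[OF Dc cp] circ by (simp add: image_subset_iff)
    then show "continuous_on (ball w0 (s/2) \<times> cbox 0 1)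
       (\<lambda>(w, t). D (circlepath c r t) w * vector_derivative (circlepath c r) (at t))"
      unfolding split_def vector_derivative_circlepath
      by (rule continuous_on_mult) (intro continuous_intros)
  qed (use s in auto)
  then show ?thesis
    unfolding contour_integral_integral using s at_within_open[of w0 "ball w0 (s/2)"]
    by (simp add: box_real)
qed

text \<open>All the division lemmas below obtain their quotients as integrals of this kind.\<close>

lemma ahol_circle_integral:
  assumes W: "openin (top_of_set (cspace N)) W" and r: "0 \<le> r"
    and K: "continuous_on (sphere c r \<times> W) (\<lambda>(z, q). K z q)"
    and h: "\<And>z q i. z \<in> sphere c r \<Longrightarrow> q \<in> W \<Longrightarrow> i < N \<Longrightarrow>
        (\<lambda>w. K z (q(i := w))) field_differentiable at (q i)"
  shows "(\<lambda>q. contour_integral (circlepath c r) (\<lambda>z. K z q)) \<in> ahol N W"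
  unfolding ahol_iff
proof (intro conjI ballI allI impI)
  show "continuous_on W (\<lambda>q. contour_integral (circlepath c r) (\<lambda>z. K z q))"
    by (rule circle_integral_continuous[OF K r])
next
  fix q i assume q: "q \<in> W" and i: "i < N"
  obtain s where s: "s > 0" "\<And>w. w \<in> ball (q i) s \<Longrightarrow> q(i := w) \<in> W"
    using coord_line_ball[OF W q i] by blast
  show "(\<lambda>w. contour_integral (circlepath c r) (\<lambda>z. K z (q(i := w)))) field_differentiable at (q i)"
  proof (rule circle_integral_differentiable[OF _ r s(1)])
    have "continuous_on (sphere c r \<times> ball (q i) s) (\<lambda>x. (\<lambda>(z, q). K z q) (fst x, q(i := snd x)))"
      by (rule continuous_on_compose2[OF K])
        (use s in \<open>auto intro!: continuous_on_Pair continuous_on_funupd continuous_on_fst continuous_on_snd\<close>)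
    then show "continuous_on (sphere c r \<times> ball (q i) s) (\<lambda>(z, w). K z (q(i := w)))"
      by (simp add: split_def)
  next
    fix z assume z: "z \<in> sphere c r"
    have "(\<lambda>w. K z (q(i := w))) field_differentiable at w" if "w \<in> ball (q i) s" for w
      using h[OF z s(2)[OF that] i] by simp
    then show "(\<lambda>w. K z (q(i := w))) holomorphic_on ball (q i) s"
      by (simp add: holomorphic_on_def field_differentiable_at_within)
  qed
qed

subsection \<open>Hadamard's lemma\<close>

text \<open>The base parameters are the first coordinates of the family, so this is the retraction
  onto a slice over which the first \<open>j\<close> of them are constant.\<close>

definition reset :: "nat \<Rightarrow> (nat \<Rightarrow> complex) \<Rightarrow> (nat \<Rightarrow> complex) \<Rightarrow> nat \<Rightarrow> complex" where
  "reset j b p = (\<lambda>i. if i < j then b i else p i)"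

lemma ahol_coord_line:
  assumes "f \<in> ahol N V" "openin (top_of_set (cspace N)) V" "i < N" "\<And>w. w \<in> S \<Longrightarrow> p(i := w) \<in> V"
  shows "(\<lambda>w. f (p(i := w))) holomorphic_on S"
  unfolding holomorphic_on_def
proof
  fix w assume "w \<in> S"
  then have "p(i := w) \<in> V" using assms by blast
  then have "(\<lambda>v. f ((p(i := w))(i := v))) field_differentiable at ((p(i := w)) i)"
    using assms(1,3) unfolding ahol_iff by blast
  then show "(\<lambda>w. f (p(i := w))) field_differentiable at w within S"
    by (simp add: field_differentiable_at_within)
qed

text \<open>The difference quotient in the \<open>i\<close>-th coordinate is a Cauchy integral with
  the two poles \<open>p i\<close> and \<open>b i\<close>, and this integral makes sense and stays
  holomorphic when the poles coincide. Halving the radius keeps both poles inside a circle contained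
  in the domain of \<open>f\<close>.\<close>

lemma hadamard1:
  assumes f: "f \<in> ahol N (polydisc N b (\<lambda>_. r))" and r: "r > 0" and i: "i < N"
  obtains h where "h \<in> ahol N (polydisc N b (\<lambda>_. r/2))"
    "\<And>p. p \<in> polydisc N b (\<lambda>_. r/2) \<Longrightarrow> f p = f (p(i := b i)) + (p i - b i) * h p"
proof -
  let ?V = "polydisc N b (\<lambda>_. r)" and ?W = "polydisc N b (\<lambda>_. r/2)"
  define K where "K = (\<lambda>z p. f (p(i := z)) / ((z - p i) * (z - b i)))"
  define h where "h = (\<lambda>p. contour_integral (circlepath (b i) (r/2)) (\<lambda>z. 1 / (2 * of_real pi * \<i>) * K z p))"
  have V: "p(i := z) \<in> ?V" if "p \<in> ?W" "cmod (z - b i) < r" for p z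
    using that i r by (auto simp: polydisc_def cspace_def intro: less_trans)
  have ne: "z \<noteq> p i" "z \<noteq> b i" if "p \<in> ?W" "z \<in> sphere (b i) (r/2)" for p z
    using that i r by (auto simp: polydisc_def dist_norm norm_minus_commute)
  have fc: "continuous_on ?V f" using f by (auto simp: ahol_iff)
  have "h \<in> ahol N ?W"
    unfolding h_def
  proof (rule ahol_circle_integral[OF polydisc_openin])
    have "continuous_on (sphere (b i) (r/2) \<times> ?W) (\<lambda>x. f ((snd x)(i := fst x)))"
      by (rule continuous_on_compose2[OF fc])
         (use r in \<open>auto intro!: continuous_on_funupd continuous_on_fst continuous_on_snd V simp: dist_norm norm_minus_commute\<close>)
    then have "continuous_on (sphere (b i) (r/2) \<times> ?W)
        (\<lambda>x. 1 / (2 * of_real pi * \<i>) * K (fst x) (snd x))"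
      unfolding K_def
      by (intro continuous_intros continuous_on_coord[OF continuous_on_snd]) (use ne r in auto)
    then show "continuous_on (sphere (b i) (r/2) \<times> ?W) (\<lambda>(z, q). 1 / (2 * of_real pi * \<i>) * K z q)"
      by (simp add: split_def)
  next
    fix z q k assume z: "z \<in> sphere (b i) (r/2)" and q: "q \<in> ?W" and k: "k < N"
    have qz: "q(i := z) \<in> ?V" using V[OF q] z r by (auto simp: dist_norm norm_minus_commute)
    show "(\<lambda>w. 1 / (2 * of_real pi * \<i>) * K z (q(k := w))) field_differentiable at (q k)"
    proof (cases "k = i")
      case True
      then show ?thesis
        unfolding K_def using ne[OF q z] by (auto intro!: derivative_intros)
    next
      case False
      have "(\<lambda>w. f ((q(i := z))(k := w))) field_differentiable at ((q(i := z)) k)"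
        by (rule ahol_lineD[OF f qz k])
      then show ?thesis
        unfolding K_def using ne[OF q z] False by (auto intro!: derivative_intros simp: fun_upd_twist)
    qed
  qed (use r in auto)
  moreover have "f p = f (p(i := b i)) + (p i - b i) * h p" if p: "p \<in> ?W" for p
  proof (cases "p i = b i")
    case True
    then show ?thesis by (metis add.right_neutral diff_self fun_upd_triv mult_zero_left)
  next
    case False
    define F where "F = (\<lambda>z. f (p(i := z)))"
    have F: "F holomorphic_on cball (b i) (r/2)"
      unfolding F_def by (rule ahol_coord_line[OF f polydisc_openin i])
        (use V[OF p] r in \<open>auto simp: dist_norm norm_minus_commute\<close>)
    have pi: "norm (p i - b i) < r/2" using p i by (auto simp: polydisc_def)
    have 1: "((\<lambda>z. F z / (z - p i)) has_contour_integral 2 * of_real pi * \<i> * F (p i)) (circlepath (b i) (r/2))"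
      by (rule Cauchy_integral_circlepath_simple[OF F pi])
    have 2: "((\<lambda>z. F z / (z - b i)) has_contour_integral 2 * of_real pi * \<i> * F (b i)) (circlepath (b i) (r/2))"
      by (rule Cauchy_integral_circlepath_simple[OF F]) (use r in auto)
    have "((\<lambda>z. (F z / (z - p i) - F z / (z - b i)) / ((p i - b i) * (2 * of_real pi * \<i>))) has_contour_integral
        (2 * of_real pi * \<i> * F (p i) - 2 * of_real pi * \<i> * F (b i)) / ((p i - b i) * (2 * of_real pi * \<i>)))
        (circlepath (b i) (r/2))"
      by (intro has_contour_integral_div has_contour_integral_diff 1 2)
    then have "contour_integral (circlepath (b i) (r/2))
       (\<lambda>z. (F z / (z - p i) - F z / (z - b i)) / ((p i - b i) * (2 * of_real pi * \<i>))) =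
       (2 * of_real pi * \<i> * F (p i) - 2 * of_real pi * \<i> * F (b i)) / ((p i - b i) * (2 * of_real pi * \<i>))"
      by (rule contour_integral_unique)
    also have "\<dots> = (F (p i) - F (b i)) / (p i - b i)"
      by (simp add: right_diff_distrib[symmetric])
    finally have "contour_integral (circlepath (b i) (r/2))
       (\<lambda>z. (F z / (z - p i) - F z / (z - b i)) / ((p i - b i) * (2 * of_real pi * \<i>))) =
       (F (p i) - F (b i)) / (p i - b i)" .
    moreover have "contour_integral (circlepath (b i) (r/2))
       (\<lambda>z. (F z / (z - p i) - F z / (z - b i)) / ((p i - b i) * (2 * of_real pi * \<i>))) = h p"
      unfolding h_def
    proof (rule contour_integral_cong[OF refl])
      fix z assume "z \<in> path_image (circlepath (b i) (r/2))"
      then have "z \<in> sphere (b i) (r/2)" using r by auto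
      from ne[OF p this] show "(F z / (z - p i) - F z / (z - b i)) / ((p i - b i) * (2 * of_real pi * \<i>)) =
         1 / (2 * of_real pi * \<i>) * K z p"
        using False by (simp add: K_def F_def divide_simps) (simp add: algebra_simps)
    qed
    ultimately have "h p = (F (p i) - F (b i)) / (p i - b i)" by simp
    then have "(p i - b i) * h p = F (p i) - F (b i)" using False by simp
    then show ?thesis by (simp add: F_def)
  qed
  ultimately show ?thesis using that by blast
qed

text \<open>The coordinates are replaced one after the other and the differences telescope; hence
  the \<open>i\<close>-th quotient is evaluated at a point whose first \<open>i\<close> coordinates
  are already reset.\<close>

lemma hadamard:
  assumes f: "f \<in> ahol N (polydisc N b (\<lambda>_. r))" and r: "r > 0" and j: "j \<le> N"
  obtains h where "\<And>i. i < j \<Longrightarrow> h i \<in> ahol N (polydisc N b (\<lambda>_. r/2))"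
    "\<And>p. p \<in> polydisc N b (\<lambda>_. r/2) \<Longrightarrow> f p = f (reset j b p) + (\<Sum>i<j. (p i - b i) * h i p)"
proof -
  let ?W = "polydisc N b (\<lambda>_. r/2)"
  have "\<exists>h. h \<in> ahol N ?W \<and> (\<forall>p\<in>?W. f p = f (p(i := b i)) + (p i - b i) * h p)" if "i < N" for i
    using hadamard1[OF f r that] by metis
  then obtain h where h: "\<And>i. i < N \<Longrightarrow> h i \<in> ahol N ?W"
     "\<And>i p. i < N \<Longrightarrow> p \<in> ?W \<Longrightarrow> f p = f (p(i := b i)) + (p i - b i) * h i p" by metis
  have rW: "reset i b p \<in> ?W" if "p \<in> ?W" "i \<le> N" for i p
    using that r by (auto simp: polydisc_def reset_def cspace_def)
  define H where "H = (\<lambda>i p. h i (reset i b p))"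
  have "H i \<in> ahol N ?W" if i: "i < j" for i
    unfolding ahol_iff
  proof (intro conjI ballI allI impI)
    have iN: "i < N" using i j by simp
    have "continuous_on ?W (reset i b)"
    proof (rule continuous_on_coordinatewise_then_product)
      fix k show "continuous_on ?W (\<lambda>x. reset i b x k)"
          by (cases "k < i") (auto simp: reset_def intro!: continuous_intros)
    qed
    then show "continuous_on ?W (H i)"
      unfolding H_def
      by (rule continuous_on_compose2[OF ahol_continuous[OF h(1)[OF iN]]]) (use rW iN in auto)
    fix p k assume p: "p \<in> ?W" and k: "k < N"
    show "(\<lambda>w. H i (p(k := w))) field_differentiable at (p k)"
    proof (cases "k < i")
      case True
      then have "H i (p(k := w)) = H i p" for w
        by (auto simp: H_def reset_def intro!: arg_cong[of _ _ "h i"])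
      then show ?thesis by simp
    next
      case False
      then have "reset i b (p(k := w)) = (reset i b p)(k := w)" for w
        by (auto simp: reset_def)
      moreover have "(\<lambda>w. h i ((reset i b p)(k := w))) field_differentiable at (reset i b p k)"
        using ahol_lineD[OF h(1)[OF iN] rW[OF p, of i] k] iN by simp
      ultimately show ?thesis using False by (simp add: H_def reset_def)
    qed
  qed
  moreover have "f p = f (reset j b p) + (\<Sum>i<j. (p i - b i) * H i p)" if p: "p \<in> ?W" for p
    using j
  proof (induction j)
    case 0
    then show ?case by (simp add: reset_def)
  next
    case (Suc j)
    have "(reset j b p)(j := b j) = reset (Suc j) b p" by (auto simp: reset_def less_Suc_eq)
    moreover have "reset j b p j = p j" by (simp add: reset_def)
    ultimately have "f (reset j b p) = f (reset (Suc j) b p) + (p j - b j) * H j p"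
      using h(2)[of j "reset j b p"] rW[OF p, of j] Suc.prems by (simp add: H_def)
    then show ?case using Suc by simp
  qed
  ultimately show ?thesis using that by blast
qed

subsection \<open>Composition\<close>

text \<open>The factor \<open>g w - g w0\<close> vanishes at \<open>w0\<close>, so the difference
  quotient is that of \<open>g\<close> times \<open>c w\<close>, and continuity of \<open>c\<close>
  suffices.\<close>

lemma has_derivative_factor:
  fixes g c :: "complex \<Rightarrow> complex"
  assumes "(g has_field_derivative d) (at w0)" "isCont c w0"
  shows "((\<lambda>w. (g w - g w0) * c w) has_field_derivative d * c w0) (at w0)"
proof -
  have "((\<lambda>w. (g w - g w0) / (w - w0) * c w) \<longlongrightarrow> d * c w0) (at w0)"
    using tendsto_mult[OF assms(1)[unfolded has_field_derivative_iff] assms(2)[unfolded isCont_def]] .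
  then show ?thesis unfolding has_field_derivative_iff by simp
qed

text \<open>The chain rule, although \<open>f\<close> is only known to be continuous and separately
  differentiable: Hadamard's lemma in all \<open>N\<close> coordinates writes \<open>f\<close> near
  \<open>\<gamma> w0\<close> as a constant plus products of coordinate differences with continuous
  functions, and each product is differentiated by the preceding lemma.\<close>

lemma ahol_compose_curve:
  assumes V: "openin (top_of_set (cspace N)) V" and f: "f \<in> ahol N V"
    and g: "\<And>i. i < N \<Longrightarrow> (\<lambda>w. \<gamma> w i) field_differentiable at w0"
    and c: "isCont \<gamma> w0" and gV: "\<gamma> w0 \<in> V" and ev: "\<forall>\<^sub>F w in at w0. \<gamma> w \<in> cspace N"
  shows "(\<lambda>w. f (\<gamma> w)) field_differentiable at w0"
proof -
  define b where "b = \<gamma> w0"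
  obtain r where r: "r > 0" "polydisc N b (\<lambda>_. r) \<subseteq> V" using polydisc_in[OF V gV] unfolding b_def by blast
  let ?W = "polydisc N b (\<lambda>_. r/2)"
  obtain h where h: "\<And>i. i < N \<Longrightarrow> h i \<in> ahol N ?W"
    "\<And>p. p \<in> ?W \<Longrightarrow> f p = f (reset N b p) + (\<Sum>i<N. (p i - b i) * h i p)"
    using hadamard[OF ahol_subset[OF f r(2)] r(1) order_refl] by metis
  have bN: "b \<in> cspace N" using gV openin_cspace_sub[OF V] b_def by auto
  have bW: "b \<in> ?W" using bN r by (auto simp: polydisc_def)
  obtain T where T: "open T" "?W = cspace N \<inter> T" using polydisc_openin[of N b] unfolding openin_open by blast
  have "\<forall>\<^sub>F w in at w0. \<gamma> w \<in> T"
    using c T bW by (auto simp: isCont_def b_def dest: topological_tendstoD)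
  with ev have evW: "\<forall>\<^sub>F w in at w0. \<gamma> w \<in> ?W" using T by (auto elim: eventually_elim2)
  have evn: "\<forall>\<^sub>F w in nhds w0. \<gamma> w \<in> ?W"
    using evW bW b_def unfolding eventually_at_filter by (auto elim!: eventually_mono)
  have ic: "isCont (\<lambda>w. h i (\<gamma> w)) w0" if "i < N" for i
    unfolding isCont_def
    by (rule continuous_on_tendsto_compose[OF ahol_continuous[OF h(1)[OF that]]])
      (use c bW evW in \<open>auto simp: isCont_def b_def\<close>)
  have fe: "f (\<gamma> w) = f b + (\<Sum>i<N. (\<gamma> w i - \<gamma> w0 i) * h i (\<gamma> w))" if "\<gamma> w \<in> ?W" for w
  proof -
    have "reset N b (\<gamma> w) = b" using that bN by (auto simp: reset_def polydisc_def cspace_def)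
    then show ?thesis using h(2)[OF that] by (simp add: b_def)
  qed
  obtain d where d: "\<And>i. i < N \<Longrightarrow> ((\<lambda>w. \<gamma> w i) has_field_derivative d i) (at w0)"
    using g unfolding field_differentiable_def by metis
  have "((\<lambda>w. f b + (\<Sum>i<N. (\<gamma> w i - \<gamma> w0 i) * h i (\<gamma> w))) has_field_derivative
      (\<Sum>i<N. d i * h i (\<gamma> w0))) (at w0)"
    using DERIV_add[OF DERIV_const[of "f b"] DERIV_sum[of "{..<N}", OF has_derivative_factor[OF d ic]]]
    by simp
  then have "((\<lambda>w. f (\<gamma> w)) has_field_derivative (\<Sum>i<N. d i * h i (\<gamma> w0))) (at w0)"
    by (subst DERIV_cong_ev[OF refl _ refl]) (use evn fe in \<open>auto elim!: eventually_mono\<close>)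
  then show ?thesis by (auto simp: field_differentiable_def)
qed

section \<open>Arithmetic and substitution for holomorphic functions\<close>

lemma ahol_const: "(\<lambda>_. c) \<in> ahol N U"
  by (simp add: ahol_iff)

lemma ahol_coord: "(\<lambda>p. p i) \<in> ahol N U"
  unfolding ahol_iff
proof (intro conjI ballI allI impI)
  fix p k show "(\<lambda>w. (p(k := w)) i) field_differentiable at (p k)"
    by (cases "i = k") simp_all
qed (intro continuous_intros)

lemma ahol_add: "f \<in> ahol N U \<Longrightarrow> g \<in> ahol N U \<Longrightarrow> (\<lambda>p. f p + g p) \<in> ahol N U"
  by (auto simp: ahol_iff intro!: continuous_intros derivative_intros)

lemma ahol_diff: "f \<in> ahol N U \<Longrightarrow> g \<in> ahol N U \<Longrightarrow> (\<lambda>p. f p - g p) \<in> ahol N U"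
  by (auto simp: ahol_iff intro!: continuous_intros derivative_intros)

lemma ahol_mult: "f \<in> ahol N U \<Longrightarrow> g \<in> ahol N U \<Longrightarrow> (\<lambda>p. f p * g p) \<in> ahol N U"
  by (auto simp: ahol_iff intro!: continuous_intros derivative_intros)

lemma ahol_divide:
  "f \<in> ahol N U \<Longrightarrow> g \<in> ahol N U \<Longrightarrow> (\<And>p. p \<in> U \<Longrightarrow> g p \<noteq> 0) \<Longrightarrow> (\<lambda>p. f p / g p) \<in> ahol N U"
  by (auto simp: ahol_iff intro!: continuous_intros derivative_intros)

lemma ahol_compose:
  assumes V: "openin (top_of_set (cspace N)) V" and f: "f \<in> ahol N V"
    and W: "openin (top_of_set (cspace M)) W"
    and G: "\<And>i. i < N \<Longrightarrow> (\<lambda>p. G p i) \<in> ahol M W" and GV: "\<And>p. p \<in> W \<Longrightarrow> G p \<in> V"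
  shows "(\<lambda>p. f (G p)) \<in> ahol M W"
  unfolding ahol_iff
proof (intro conjI ballI allI impI)
  have GN: "G p \<in> cspace N" if "p \<in> W" for p using GV[OF that] openin_cspace_sub[OF V] by blast
  have Gc: "continuous_on W G"
  proof (rule continuous_on_coordinatewise_then_product)
    fix i show "continuous_on W (\<lambda>p. G p i)"
    proof (cases "i < N")
      case True then show ?thesis using G ahol_continuous by blast
    next
      case False
      then have "continuous_on W (\<lambda>p. G p i) = continuous_on W (\<lambda>p. 0 :: complex)"
        using GN by (intro continuous_on_cong) (auto simp: cspace_def)
      then show ?thesis by simp
    qed
  qed
  show "continuous_on W (\<lambda>p. f (G p))"
    by (rule continuous_on_compose2[OF ahol_continuous[OF f] Gc]) (use GV in auto)
  fix p i assume p: "p \<in> W" and i: "i < M"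
  obtain s where s: "s > 0" "\<And>w. w \<in> ball (p i) s \<Longrightarrow> p(i := w) \<in> W"
    using coord_line_ball[OF W p i] by blast
  have pc: "continuous_on (ball (p i) s) (\<lambda>w. G (p(i := w)))"
    by (rule continuous_on_compose2[OF Gc])
      (use s in \<open>auto intro!: continuous_on_funupd continuous_on_const continuous_on_id\<close>)
  show "(\<lambda>w. f (G (p(i := w)))) field_differentiable at (p i)"
  proof (rule ahol_compose_curve[OF V f])
    fix k assume k: "k < N"
    show "(\<lambda>w. G (p(i := w)) k) field_differentiable at (p i)"
      by (rule ahol_lineD[OF G[OF k] p i])
  next
    show "isCont (\<lambda>w. G (p(i := w))) (p i)"
      using pc s(1) by (simp add: continuous_on_eq_continuous_at)
  next
    have "\<forall>\<^sub>F w in at (p i). w \<in> ball (p i) s"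
      using s(1) by (intro eventually_at_in_open') auto
    then show "\<forall>\<^sub>F w in at (p i). G (p(i := w)) \<in> cspace N"
      by eventually_elim (use s GN in blast)
  qed (use p GV in auto)
qed

subsection \<open>Functions that extend locally\<close>

text \<open>The induced reduced structure on an arbitrary subset, as a predicate. All sheaves below
  are computed by pulling functions back to a subset of affine space and applying it there.\<close>

definition lhol :: "nat \<Rightarrow> (nat \<Rightarrow> complex) set \<Rightarrow> ((nat \<Rightarrow> complex) \<Rightarrow> complex) \<Rightarrow> bool" where
  "lhol N S f \<longleftrightarrow> (\<forall>p\<in>S. \<exists>V g. openin (top_of_set (cspace N)) V \<and> p \<in> V \<and> g \<in> ahol N V \<and>
     (\<forall>q\<in>V \<inter> S. f q = g q))"

lemma Hol_subspace_affine: "Hol (subspace_on (affine_space N) T) U = {f. lhol N U f}"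
  by (simp add: subspace_on_def lhol_def)

lemma lholE:
  assumes "lhol N S f" "p \<in> S"
  obtains V g where "openin (top_of_set (cspace N)) V" "p \<in> V" "g \<in> ahol N V" "\<And>q. q \<in> V \<Longrightarrow> q \<in> S \<Longrightarrow> f q = g q"
proof -
  from assms obtain V g where "openin (top_of_set (cspace N)) V \<and> p \<in> V \<and> g \<in> ahol N V \<and> (\<forall>q\<in>V \<inter> S. f q = g q)"
    unfolding lhol_def by blast
  then show ?thesis by (intro that[of V g]) auto
qed

lemma lhol_sub_cspace: "lhol N S f \<Longrightarrow> S \<subseteq> cspace N"
  unfolding lhol_def using openin_cspace_sub by blast

lemma lhol_subset:
  assumes "lhol N S f" "T \<subseteq> S"
  shows "lhol N T f"
  unfolding lhol_def
proof
  fix p assume "p \<in> T"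
  then obtain V g where "openin (top_of_set (cspace N)) V" "p \<in> V" "g \<in> ahol N V" "\<And>q. q \<in> V \<Longrightarrow> q \<in> S \<Longrightarrow> f q = g q"
    using lholE[OF assms(1)] assms(2) by blast
  then show "\<exists>V g. openin (top_of_set (cspace N)) V \<and> p \<in> V \<and> g \<in> ahol N V \<and> (\<forall>q\<in>V \<inter> T. f q = g q)"
    using assms(2) by blast
qed

lemma lhol_cong:
  assumes "\<And>p. p \<in> S \<Longrightarrow> f p = g p"
  shows "lhol N S f \<longleftrightarrow> lhol N S g"
proof -
  have "(\<forall>q\<in>V \<inter> S. f q = h q) \<longleftrightarrow> (\<forall>q\<in>V \<inter> S. g q = h q)" for V h
    using assms by auto
  then show ?thesis unfolding lhol_def by simp
qed

lemma ahol_imp_lhol: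
  assumes "openin (top_of_set (cspace N)) V" "f \<in> ahol N V" "S \<subseteq> V"
  shows "lhol N S f"
  unfolding lhol_def using assms by blast

lemma lhol_local:
  assumes "\<And>p. p \<in> S \<Longrightarrow> \<exists>V. openin (top_of_set (cspace N)) V \<and> p \<in> V \<and> lhol N (V \<inter> S) f"
  shows "lhol N S f"
  unfolding lhol_def
proof
  fix p assume p: "p \<in> S"
  then obtain V where V: "openin (top_of_set (cspace N)) V" "p \<in> V" "lhol N (V \<inter> S) f" using assms by blast
  obtain U g where U: "openin (top_of_set (cspace N)) U" "p \<in> U" "g \<in> ahol N U"
      "\<And>q. q \<in> U \<Longrightarrow> q \<in> V \<inter> S \<Longrightarrow> f q = g q"
    using lholE[OF V(3), of p] p V(2) by blast
  show "\<exists>V g. openin (top_of_set (cspace N)) V \<and> p \<in> V \<and> g \<in> ahol N V \<and> (\<forall>q\<in>V \<inter> S. f q = g q)"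
    by (rule exI[of _ "U \<inter> V"], rule exI[of _ g]) (use U V ahol_subset[OF U(3)] in auto)
qed

lemma lhol_local':
  assumes "\<And>p. p \<in> S \<Longrightarrow> \<exists>T. openin (top_of_set S) T \<and> p \<in> T \<and> lhol N T f" and S: "S \<subseteq> cspace N"
  shows "lhol N S f"
proof (rule lhol_local)
  fix p assume "p \<in> S"
  then obtain T where T: "openin (top_of_set S) T" "p \<in> T" "lhol N T f" using assms by blast
  then obtain U where "open U" "T = S \<inter> U" by (auto simp: openin_open)
  then show "\<exists>V. openin (top_of_set (cspace N)) V \<and> p \<in> V \<and> lhol N (V \<inter> S) f"
    using T S by (intro exI[of _ "cspace N \<inter> U"]) (auto simp: openin_open elim!: lhol_subset)
qed

lemma lhol_continuous: assumes f: "lhol N S f" shows "continuous_on S f"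
  unfolding continuous_on_def
proof
  fix p assume p: "p \<in> S"
  obtain V g where V: "openin (top_of_set (cspace N)) V" "p \<in> V" "g \<in> ahol N V"
      "\<And>q. q \<in> V \<Longrightarrow> q \<in> S \<Longrightarrow> f q = g q"
    using lholE[OF f p] by blast
  obtain T where T: "open T" "V = cspace N \<inter> T" using V(1) by (auto simp: openin_open)
  have sub: "S \<subseteq> cspace N" by (rule lhol_sub_cspace[OF f])
  have VS: "V \<inter> S = S \<inter> T" using T sub by auto
  have "continuous_on (V \<inter> S) g" using ahol_continuous[OF V(3)] continuous_on_subset by blast
  then have "(g \<longlongrightarrow> g p) (at p within (V \<inter> S))" using p V(2) by (auto simp: continuous_on_def)
  moreover have "(f \<longlongrightarrow> f p) (at p within (V \<inter> S)) \<longleftrightarrow> (g \<longlongrightarrow> g p) (at p within (V \<inter> S))"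
    by (intro Lim_cong_within) (use V p in auto)
  moreover have "at p within (V \<inter> S) = at p within S"
    by (rule at_within_nhd[of _ T]) (use T V VS in auto)
  ultimately show "(f \<longlongrightarrow> f p) (at p within S)" by simp
qed

lemma lhol_open_imp_ahol:
  assumes S: "openin (top_of_set (cspace N)) S" and f: "lhol N S f"
  shows "f \<in> ahol N S"
  unfolding ahol_iff
proof (intro conjI ballI allI impI)
  show "continuous_on S f" by (rule lhol_continuous[OF f])
  fix p i assume p: "p \<in> S" and i: "i < N"
  obtain V g where V: "openin (top_of_set (cspace N)) V" "p \<in> V" "g \<in> ahol N V"
      "\<And>q. q \<in> V \<Longrightarrow> q \<in> S \<Longrightarrow> f q = g q"
    using lholE[OF f p] by blast
  obtain s where s: "s > 0" "\<And>w. w \<in> ball (p i) s \<Longrightarrow> p(i := w) \<in> V \<inter> S"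
    using coord_line_ball[OF openin_Int[OF V(1) S], of p i] p V(2) i by blast
  have "(\<lambda>w. g (p(i := w))) field_differentiable at (p i)" by (rule ahol_lineD[OF V(3,2) i])
  then obtain d where d: "((\<lambda>w. g (p(i := w))) has_field_derivative d) (at (p i))"
    by (auto simp: field_differentiable_def)
  have "((\<lambda>w. f (p(i := w))) has_field_derivative d) (at (p i))"
    by (rule has_field_derivative_transform_within_open[OF d, of "ball (p i) s"]) (use s V in auto)
  then show "(\<lambda>w. f (p(i := w))) field_differentiable at (p i)" by (auto simp: field_differentiable_def)
qed

lemma lhol_lift2:
  assumes f: "lhol N S f" and g: "lhol N S g"
    and op: "\<And>V f g. f \<in> ahol N V \<Longrightarrow> g \<in> ahol N V \<Longrightarrow> (\<lambda>p. F (f p) (g p)) \<in> ahol N V"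
  shows "lhol N S (\<lambda>p. F (f p) (g p))"
  unfolding lhol_def
proof
  fix p assume p: "p \<in> S"
  obtain V f' where V: "openin (top_of_set (cspace N)) V" "p \<in> V" "f' \<in> ahol N V"
      "\<And>q. q \<in> V \<Longrightarrow> q \<in> S \<Longrightarrow> f q = f' q"
    using lholE[OF f p] by blast
  obtain U g' where U: "openin (top_of_set (cspace N)) U" "p \<in> U" "g' \<in> ahol N U"
      "\<And>q. q \<in> U \<Longrightarrow> q \<in> S \<Longrightarrow> g q = g' q"
    using lholE[OF g p] by blast
  have "(\<lambda>p. F (f' p) (g' p)) \<in> ahol N (V \<inter> U)"
    by (rule op) (use ahol_subset[OF V(3)] ahol_subset[OF U(3)] in auto)
  then show "\<exists>W h. openin (top_of_set (cspace N)) W \<and> p \<in> W \<and> h \<in> ahol N W \<and>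
      (\<forall>q\<in>W \<inter> S. F (f q) (g q) = h q)"
    by (intro exI[of _ "V \<inter> U"] exI[of _ "\<lambda>p. F (f' p) (g' p)"]) (use U V in auto)
qed

lemma openin_cspace: "openin (top_of_set (cspace N)) (cspace N)"
  by simp

lemma lhol_const: "S \<subseteq> cspace N \<Longrightarrow> lhol N S (\<lambda>_. c)"
  by (rule ahol_imp_lhol[OF openin_cspace ahol_const])

lemma lhol_coord: "S \<subseteq> cspace N \<Longrightarrow> lhol N S (\<lambda>p. p i)"
  by (rule ahol_imp_lhol[OF openin_cspace ahol_coord])

lemma lhol_add: "lhol N S f \<Longrightarrow> lhol N S g \<Longrightarrow> lhol N S (\<lambda>p. f p + g p)"
  by (rule lhol_lift2[OF _ _ ahol_add])

lemma lhol_diff: "lhol N S f \<Longrightarrow> lhol N S g \<Longrightarrow> lhol N S (\<lambda>p. f p - g p)"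
  by (rule lhol_lift2[OF _ _ ahol_diff])

lemma lhol_mult: "lhol N S f \<Longrightarrow> lhol N S g \<Longrightarrow> lhol N S (\<lambda>p. f p * g p)"
  by (rule lhol_lift2[OF _ _ ahol_mult])

lemma lhol_minus:
  assumes "lhol N S f" shows "lhol N S (\<lambda>p. - f p)"
  using lhol_diff[OF lhol_const[OF lhol_sub_cspace[OF assms], of 0] assms] by simp

lemma lhol_divide:
  assumes f: "lhol N S f" and g: "lhol N S g" and nz: "\<And>p. p \<in> S \<Longrightarrow> g p \<noteq> 0"
  shows "lhol N S (\<lambda>p. f p / g p)"
  unfolding lhol_def
proof
  fix p assume p: "p \<in> S"
  obtain V f' where V: "openin (top_of_set (cspace N)) V" "p \<in> V" "f' \<in> ahol N V"
      "\<And>q. q \<in> V \<Longrightarrow> q \<in> S \<Longrightarrow> f q = f' q"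
    using lholE[OF f p] by blast
  obtain U g' where U: "openin (top_of_set (cspace N)) U" "p \<in> U" "g' \<in> ahol N U"
      "\<And>q. q \<in> U \<Longrightarrow> q \<in> S \<Longrightarrow> g q = g' q"
    using lholE[OF g p] by blast
  define W where "W = V \<inter> {q \<in> U. g' q \<in> - {0}}"
  have "openin (top_of_set U) (U \<inter> g' -` (- {0}))"
    by (rule continuous_openin_preimage_gen[OF ahol_continuous[OF U(3)]]) auto
  then have "openin (top_of_set (cspace N)) (U \<inter> g' -` (- {0}))"
    by (rule openin_trans[OF _ U(1)])
  moreover have "W = V \<inter> (U \<inter> g' -` (- {0}))" by (auto simp: W_def)
  ultimately have "openin (top_of_set (cspace N)) W" using V(1) by auto
  moreover have "(\<lambda>p. f' p / g' p) \<in> ahol N W"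
    by (rule ahol_divide) (use ahol_subset[OF V(3), of W] ahol_subset[OF U(3), of W] in \<open>auto simp: W_def\<close>)
  moreover have "p \<in> W" using V U p nz[OF p] by (auto simp: W_def)
  moreover have "f q / g q = f' q / g' q" if "q \<in> W \<inter> S" for q
    using that V(4) U(4) by (auto simp: W_def)
  ultimately show "\<exists>W h. openin (top_of_set (cspace N)) W \<and> p \<in> W \<and> h \<in> ahol N W \<and>
      (\<forall>q\<in>W \<inter> S. f q / g q = h q)" by blast
qed

lemma lhol_power: "lhol N S f \<Longrightarrow> lhol N S (\<lambda>p. f p ^ k)"
  by (induction k) (auto intro!: lhol_mult lhol_const dest: lhol_sub_cspace)

lemma lhol_sum: "S \<subseteq> cspace N \<Longrightarrow> (\<And>i. i \<in> I \<Longrightarrow> lhol N S (f i)) \<Longrightarrow> lhol N S (\<lambda>p. \<Sum>i\<in>I. f i p)"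
  by (induction I rule: infinite_finite_induct) (auto intro!: lhol_add lhol_const)

lemma lhol_prod: "S \<subseteq> cspace N \<Longrightarrow> (\<And>i. i \<in> I \<Longrightarrow> lhol N S (f i)) \<Longrightarrow> lhol N S (\<lambda>p. \<Prod>i\<in>I. f i p)"
  by (induction I rule: infinite_finite_induct) (auto intro!: lhol_mult lhol_const)

lemmas lhol_intros = lhol_const lhol_coord lhol_add lhol_diff lhol_mult lhol_minus lhol_divide lhol_power lhol_sum lhol_prod

lemma lhol_compose:
  assumes f: "lhol N S f" and G: "\<And>i. i < N \<Longrightarrow> lhol M T (\<lambda>p. G p i)" and GS: "\<And>p. p \<in> T \<Longrightarrow> G p \<in> S"
    and T: "T \<subseteq> cspace M"
  shows "lhol M T (\<lambda>p. f (G p))"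
  unfolding lhol_def
proof
  fix p assume p: "p \<in> T"
  obtain V f' where V: "openin (top_of_set (cspace N)) V" "G p \<in> V" "f' \<in> ahol N V"
      "\<And>q. q \<in> V \<Longrightarrow> q \<in> S \<Longrightarrow> f q = f' q"
    using lholE[OF f GS[OF p]] by blast
  have "\<exists>U g. openin (top_of_set (cspace M)) U \<and> p \<in> U \<and> g \<in> ahol M U \<and> (\<forall>q\<in>U \<inter> T. G q i = g q)"
    if "i < N" for i
    using G[OF that] p unfolding lhol_def by blast
  then obtain U g where U: "\<And>i. i < N \<Longrightarrow> openin (top_of_set (cspace M)) (U i)" "\<And>i. i < N \<Longrightarrow> p \<in> U i"
      "\<And>i. i < N \<Longrightarrow> g i \<in> ahol M (U i)" "\<And>i q. i < N \<Longrightarrow> q \<in> U i \<inter> T \<Longrightarrow> G q i = g i q" by metis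
  \<comment> \<open>The empty intersection is the whole function space, which is not contained in
    \<open>cspace M\<close>; hence the separate value for \<open>N = 0\<close>.\<close>
  define W where "W = (if N = 0 then cspace M else (\<Inter>i<N. U i))"
  have W: "openin (top_of_set (cspace M)) W"
    unfolding W_def using U(1) openin_cspace by (auto intro!: openin_INT2)
  have WU: "W \<subseteq> U i" if "i < N" for i using that by (auto simp: W_def)
  have pW: "p \<in> W" using U(2) p T by (auto simp: W_def)
  \<comment> \<open>An extension of \<open>G\<close> to a neighbourhood, agreeing with it only on
    \<open>T\<close>; the padding by 0 keeps it in \<open>cspace N\<close> elsewhere.\<close>
  define H where "H = (\<lambda>q i. if i < N then g i q else 0)"
  have Hc: "continuous_on W H"
  proof (rule continuous_on_coordinatewise_then_product)
    fix i show "continuous_on W (\<lambda>q. H q i)"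
      using continuous_on_subset[OF ahol_continuous[OF U(3)] WU, of i] by (cases "i < N") (auto simp: H_def)
  qed
  have HG: "H q = G q" if "q \<in> W" "q \<in> T" for q
  proof
    fix i show "H q i = G q i"
    proof (cases "i < N")
      case True
      then show ?thesis using U(4)[OF True, of q] WU[OF True] that by (auto simp: H_def)
    next
      case False
      then show ?thesis using GS[OF that(2)] lhol_sub_cspace[OF f] by (auto simp: H_def cspace_def)
    qed
  qed
  define X where "X = W \<inter> H -` V"
  have HN: "H ` W \<subseteq> cspace N" by (auto simp: H_def cspace_def)
  have X: "openin (top_of_set (cspace M)) X"
    unfolding X_def
    by (rule openin_trans[OF continuous_openin_preimage[OF Hc _ V(1)] W]) (use HN in auto)
  have "(\<lambda>q. f' (H q)) \<in> ahol M X"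
  proof (rule ahol_compose[OF V(1,3) X])
    fix i assume i: "i < N"
    have "(\<lambda>p. H p i) = g i" using i by (auto simp: H_def)
    then show "(\<lambda>p. H p i) \<in> ahol M X"
      using ahol_subset[OF U(3)[OF i], of X] WU[OF i] by (auto simp: X_def)
  qed (auto simp: X_def)
  moreover have "p \<in> X" using pW HG[OF pW p] V(2) by (auto simp: X_def)
  moreover have "f (G q) = f' (H q)" if "q \<in> X \<inter> T" for q
    using that HG[of q] V(4)[of "G q"] GS[of q] by (auto simp: X_def)
  ultimately show "\<exists>V g. openin (top_of_set (cspace M)) V \<and> p \<in> V \<and> g \<in> ahol M V \<and> (\<forall>q\<in>V \<inter> T. f (G q) = g q)"
    using X by blast
qed

lemma lhol_map_continuous:
  assumes G: "\<And>i. i < N \<Longrightarrow> lhol M T (\<lambda>p. G p i)" and "\<And>p. p \<in> T \<Longrightarrow> G p \<in> cspace N"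
  shows "continuous_on T G"
proof (rule continuous_on_coordinatewise_then_product)
  fix i show "continuous_on T (\<lambda>p. G p i)"
  proof (cases "i < N")
    case True then show ?thesis using G lhol_continuous by blast
  next
    case False
    then have "continuous_on T (\<lambda>p. G p i) = continuous_on T (\<lambda>p. 0 :: complex)"
      using assms(2) by (intro continuous_on_cong) (auto simp: cspace_def)
    then show ?thesis by simp
  qed
qed

section \<open>Conjugation and removable singularities\<close>

lemma ahol_cnj:
  assumes V: "openin (top_of_set (cspace N)) V" and f: "f \<in> ahol N V"
  shows "(\<lambda>p. cnj (f (\<lambda>i. cnj (p i)))) \<in> ahol N {p. (\<lambda>i. cnj (p i)) \<in> V}"
  unfolding ahol_iff
proof (intro conjI ballI allI impI)
  have cc: "continuous_on S (\<lambda>p i. cnj (p i))" for S :: "(nat \<Rightarrow> complex) set"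
    by (intro continuous_on_coordinatewise_then_product continuous_on_cnj continuous_on_coord_id)
  show "continuous_on {p. (\<lambda>i. cnj (p i)) \<in> V} (\<lambda>p. cnj (f (\<lambda>i. cnj (p i))))"
    by (intro continuous_intros continuous_on_compose2[OF ahol_continuous[OF f] cc]) auto
  fix p i assume p: "p \<in> {p. (\<lambda>i. cnj (p i)) \<in> V}" and i: "i < N"
  let ?q = "\<lambda>i. cnj (p i)"
  have "(\<lambda>w. f (?q(i := w))) field_differentiable at (cnj (p i))"
    using ahol_lineD[OF f _ i, of ?q] p by simp
  then have "(cnj \<circ> (\<lambda>w. f (?q(i := w))) \<circ> cnj) field_differentiable at (p i)"
    by (rule field_differentiable_cnj_cnj)
  moreover have "(\<lambda>k. cnj ((p(i := w)) k)) = ?q(i := cnj w)" for w by auto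
  ultimately show "(\<lambda>w. cnj (f (\<lambda>k. cnj ((p(i := w)) k)))) field_differentiable at (p i)"
    by (simp add: o_def)
qed

lemma lhol_cnj:
  assumes f: "lhol N S f"
  shows "lhol N {p. (\<lambda>i. cnj (p i)) \<in> S} (\<lambda>p. cnj (f (\<lambda>i. cnj (p i))))"
  unfolding lhol_def
proof
  fix p assume "p \<in> {p. (\<lambda>i. cnj (p i)) \<in> S}"
  then have p: "(\<lambda>i. cnj (p i)) \<in> S" by simp
  obtain V g where V: "openin (top_of_set (cspace N)) V" "(\<lambda>i. cnj (p i)) \<in> V" "g \<in> ahol N V"
      "\<And>q. q \<in> V \<Longrightarrow> q \<in> S \<Longrightarrow> f q = g q"
    using lholE[OF f p] by blast
  obtain T where T: "open T" "V = cspace N \<inter> T" using V(1) by (auto simp: openin_open)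
  have cc: "continuous_on UNIV (\<lambda>(p :: nat \<Rightarrow> complex) i. cnj (p i))"
    by (intro continuous_on_coordinatewise_then_product continuous_on_cnj continuous_on_coord_id)
  have "open ((\<lambda>p i. cnj (p i)) -` T)" using cc T by (simp add: continuous_on_open_vimage)
  moreover have "{p. (\<lambda>i. cnj (p i)) \<in> V} = cspace N \<inter> (\<lambda>p i. cnj (p i)) -` T"
    using T by (auto simp: cspace_def)
  ultimately have "openin (top_of_set (cspace N)) {p. (\<lambda>i. cnj (p i)) \<in> V}" by auto
  then show "\<exists>V g. openin (top_of_set (cspace N)) V \<and> p \<in> V \<and> g \<in> ahol N V \<and>
     (\<forall>q\<in>V \<inter> {p. (\<lambda>i. cnj (p i)) \<in> S}. cnj (f (\<lambda>i. cnj (q i))) = g q)"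
    using V by (intro exI[of _ "{p. (\<lambda>i. cnj (p i)) \<in> V}"] exI[of _ "\<lambda>p. cnj (g (\<lambda>i. cnj (p i)))"])
      (auto intro: ahol_cnj)
qed

text \<open>Since \<open>k\<close> is continuous at \<open>q0\<close>, the one-variable theorem on
  removable singularities applies on each coordinate line through \<open>q0\<close>.\<close>

lemma ahol_puncture:
  assumes V: "openin (top_of_set (cspace N)) V" and q0: "q0 \<in> V"
    and c: "continuous_on V k" and h: "k \<in> ahol N (V - {q0})"
  shows "k \<in> ahol N V"
  unfolding ahol_iff
proof (intro conjI ballI allI impI)
  fix q i assume q: "q \<in> V" and i: "i < N"
  show "(\<lambda>w. k (q(i := w))) field_differentiable at (q i)"
  proof (cases "q = q0")
    case False then show ?thesis using ahol_lineD[OF h _ i, of q] q by simp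
  next
    case True
    obtain s where s: "s > 0" "\<And>w. w \<in> ball (q i) s \<Longrightarrow> q(i := w) \<in> V"
      using coord_line_ball[OF V q i] by blast
    have "(\<lambda>w. k (q(i := w))) holomorphic_on ball (q i) s"
    proof (rule no_isolated_singularity[where K = "{q i}"])
      show "continuous_on (ball (q i) s) (\<lambda>w. k (q(i := w)))"
        by (rule continuous_on_compose2[OF c])
          (use s in \<open>auto intro!: continuous_on_funupd continuous_on_const continuous_on_id\<close>)
      show "(\<lambda>w. k (q(i := w))) holomorphic_on ball (q i) s - {q i}"
        unfolding holomorphic_on_def
      proof
        fix w assume w: "w \<in> ball (q i) s - {q i}"
        have "(q(i := w)) i \<noteq> q0 i" using w True by simp
        then have "q(i := w) \<in> V - {q0}" using s(2)[of w] w by auto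
        from ahol_lineD[OF h this i]
        show "(\<lambda>w. k (q(i := w))) field_differentiable at w within ball (q i) s - {q i}"
          by (simp add: field_differentiable_at_within)
      qed
    qed auto
    then show ?thesis using s(1) by (auto simp: holomorphic_on_open field_differentiable_def)
  qed
qed (rule c)

subsection \<open>Weierstrass division by a power of a coordinate\<close>

text \<open>Splits the Cauchy kernel into powers of \<open>w\<close> with coefficients that depend
  on \<open>w\<close> only through \<open>w ^ n\<close>.\<close>

lemma geometric_division:
  fixes z w :: complex
  assumes "z ^ n \<noteq> w ^ n"
  shows "1 / (z - w) = (\<Sum>r<n. w ^ r * z ^ (n - Suc r) / (z ^ n - w ^ n))"
proof -
  have "z \<noteq> w" using assms by auto
  have "z ^ n - w ^ n = (z - w) * (\<Sum>r<n. w ^ (n - Suc r) * z ^ r)"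
    by (rule power_diff_sumr2)
  also have "(\<Sum>r<n. w ^ (n - Suc r) * z ^ r) = (\<Sum>r<n. w ^ r * z ^ (n - Suc r))"
    by (rule sum.reindex_bij_witness[of _ "\<lambda>r. n - Suc r" "\<lambda>r. n - Suc r"]) auto
  finally have "(\<Sum>r<n. w ^ r * z ^ (n - Suc r)) = (z ^ n - w ^ n) / (z - w)"
    using \<open>z \<noteq> w\<close> by simp
  then show ?thesis using assms by (simp add: sum_divide_distrib[symmetric])
qed

text \<open>Sorts the power series of \<open>f\<close> in the \<open>i\<close>-th coordinate by the
  residue of the exponent modulo \<open>n\<close>. Inserting the split kernel into Cauchy's formula
  yields the \<open>g r\<close> as integrals in which \<open>q i ^ n\<close> has become an
  independent variable, of modulus below \<open>s ^ n\<close>.\<close>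

lemma power_division:
  assumes f: "f \<in> ahol N (polydisc N (\<lambda>_. 0) \<rho>)" and i: "i < N" and s: "0 < s" "s < \<rho> i" and n: "n \<ge> 1"
  obtains g where "\<And>r. r < n \<Longrightarrow> g r \<in> ahol N (polydisc N (\<lambda>_. 0) (\<rho>(i := s ^ n)))"
    "\<And>q. q \<in> polydisc N (\<lambda>_. 0) (\<rho>(i := s)) \<Longrightarrow> f q = (\<Sum>r<n. q i ^ r * g r (q(i := q i ^ n)))"
proof -
  let ?V = "polydisc N (\<lambda>_. 0) \<rho>" and ?W = "polydisc N (\<lambda>_. 0) (\<rho>(i := s ^ n))"
  define K where "K = (\<lambda>r (z::complex) q. 1 / (2 * of_real pi * \<i>) * (f (q(i := z)) * z ^ (n - Suc r) / (z ^ n - q i)))"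
  define g where "g = (\<lambda>r q. contour_integral (circlepath 0 s) (\<lambda>z. K r z q))"
  have V: "q(i := z) \<in> ?V" if "q \<in> polydisc N (\<lambda>_. 0) (\<rho>(i := t))" "cmod z < \<rho> i" for q and z :: complex and t
    using that i by (auto simp: polydisc_def cspace_def split: if_splits)
  have ne: "z ^ n \<noteq> q i" if "q \<in> ?W" "cmod z = s" for q and z :: complex
  proof
    assume "z ^ n = q i"
    then have "cmod (q i) = s ^ n" using that(2) by (metis norm_power)
    then show False using that(1) i by (auto simp: polydisc_def)
  qed
  have "g r \<in> ahol N ?W" for r
    unfolding g_def
  proof (rule ahol_circle_integral[OF polydisc_openin])
    have "continuous_on (sphere 0 s \<times> ?W) (\<lambda>x. f ((snd x)(i := fst x)))"
      by (rule continuous_on_compose2[OF ahol_continuous[OF f]])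
         (use s V in \<open>auto intro!: continuous_on_funupd continuous_on_fst continuous_on_snd continuous_on_id\<close>)
    then have "continuous_on (sphere 0 s \<times> ?W) (\<lambda>x. K r (fst x) (snd x))"
      unfolding K_def
      by (intro continuous_intros continuous_on_coord[OF continuous_on_snd]) (use ne in auto)
    then show "continuous_on (sphere 0 s \<times> ?W) (\<lambda>(z, q). K r z q)"
      by (simp add: split_def)
  next
    fix z :: complex and q k assume z: "z \<in> sphere 0 s" and q: "q \<in> ?W" and k: "k < N"
    have qz: "q(i := z) \<in> ?V" using V[OF q] z s by auto
    have nz: "z ^ n \<noteq> q i" using ne[OF q] z by simp
    show "(\<lambda>w. K r z (q(k := w))) field_differentiable at (q k)"
    proof (cases "k = i")
      case True
      then show ?thesis
        unfolding K_def using nz by (auto intro!: derivative_intros)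
    next
      case False
      have "(\<lambda>w. f ((q(i := z))(k := w))) field_differentiable at ((q(i := z)) k)"
        by (rule ahol_lineD[OF f qz k])
      then show ?thesis
        unfolding K_def using nz False by (auto intro!: derivative_intros simp: fun_upd_twist)
    qed
  qed (use s in auto)
  moreover have "f q = (\<Sum>r<n. q i ^ r * g r (q(i := q i ^ n)))" if q: "q \<in> polydisc N (\<lambda>_. 0) (\<rho>(i := s))" for q
  proof -
    define F where "F = (\<lambda>z::complex. f (q(i := z)))"
    have qi: "cmod (q i) < s" using q i by (auto simp: polydisc_def)
    have qW: "q(i := q i ^ n) \<in> ?W"
      using q i qi n by (auto simp: polydisc_def cspace_def norm_power power_strict_mono split: if_splits)
    have F: "F holomorphic_on cball 0 s"
      unfolding F_def by (rule ahol_coord_line[OF f polydisc_openin i]) (use V[OF q] s in auto)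
    have 1: "((\<lambda>z. F z / (z - q i)) has_contour_integral 2 * of_real pi * \<i> * F (q i)) (circlepath 0 s)"
      by (rule Cauchy_integral_circlepath_simple[OF F]) (use qi in auto)
    have ne': "z ^ n \<noteq> q i ^ n" if "cmod z = s" for z :: complex
      using ne[OF qW that] by simp
    have eq: "1 / (2 * of_real pi * \<i>) * (F z / (z - q i)) = (\<Sum>r<n. q i ^ r * K r z (q(i := q i ^ n)))"
      if "cmod z = s" for z :: complex
    proof -
      have "1 / (2 * of_real pi * \<i>) * (F z / (z - q i)) = 1 / (2 * of_real pi * \<i>) * (F z * (1 / (z - q i)))" by simp
      also have "\<dots> = (\<Sum>r<n. q i ^ r * K r z (q(i := q i ^ n)))"
        unfolding geometric_division[OF ne'[OF that]]
        by (simp add: K_def F_def sum_distrib_left algebra_simps)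
      finally show ?thesis .
    qed
    have int: "(\<lambda>z. K r z (q(i := q i ^ n))) contour_integrable_on circlepath 0 s" for r
    proof (rule contour_integrable_continuous_circlepath)
      have "continuous_on (sphere 0 s) F"
        using F holomorphic_on_imp_continuous_on continuous_on_subset sphere_cball by blast
      then show "continuous_on (path_image (circlepath 0 s)) (\<lambda>z. K r z (q(i := q i ^ n)))"
        unfolding K_def F_def using s ne' by (auto intro!: continuous_intros)
    qed
    have "F (q i) = contour_integral (circlepath 0 s) (\<lambda>z. 1 / (2 * of_real pi * \<i>) * (F z / (z - q i)))"
      using contour_integral_unique[OF has_contour_integral_lmul[OF 1, of "1 / (2 * of_real pi * \<i>)"]] by simp
    also have "\<dots> = contour_integral (circlepath 0 s) (\<lambda>z. \<Sum>r<n. q i ^ r * K r z (q(i := q i ^ n)))"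
      by (rule contour_integral_cong) (use eq s in auto)
    also have "\<dots> = (\<Sum>r<n. contour_integral (circlepath 0 s) (\<lambda>z. q i ^ r * K r z (q(i := q i ^ n))))"
      by (rule contour_integral_sum) (auto intro!: contour_integrable_lmul int)
    also have "\<dots> = (\<Sum>r<n. q i ^ r * g r (q(i := q i ^ n)))"
      unfolding g_def by (intro sum.cong refl contour_integral_lmul int)
    finally show ?thesis by (simp add: F_def)
  qed
  ultimately show ?thesis using that by blast
qed

subsection \<open>Division by the equation of a conic bundle\<close>

text \<open>Weierstrass division with remainder 0. The equation x y = P is not regular in x or y
  alone, since it vanishes on the coordinate axes where P = 0. In the direction (1, -1) it is a
  quadratic polynomial in the parameter \<open>z\<close>, with two small roots at which the
  translate of \<open>g\<close> vanishes by \<open>van\<close>; here \<open>indep\<close> makes P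
  constant along the direction. The quotient is the Cauchy integral of \<open>g\<close> over the
  equation, taken at \<open>z = 0\<close>.\<close>

lemma conic_division:
  assumes V: "openin (top_of_set (cspace N)) V" and e0: "e0 \<in> V" "e0 a = 0" "e0 b = 0" "P e0 = 0"
    and g: "g \<in> ahol N V" and P: "P \<in> ahol N V" and ab: "a < N" "b < N" "a \<noteq> b"
    and indep: "\<And>e x y. P (e(a := x, b := y)) = P e"
    and van: "\<And>e. e \<in> V \<Longrightarrow> e a * e b = P e \<Longrightarrow> g e = 0"
  obtains V' k where "openin (top_of_set (cspace N)) V'" "e0 \<in> V'" "V' \<subseteq> V" "k \<in> ahol N V'"
    "\<And>e. e \<in> V' \<Longrightarrow> g e = (e a * e b - P e) * k e"
proof -
  obtain r0 where r0: "r0 > 0" "polydisc N e0 (\<lambda>_. r0) \<subseteq> V" using polydisc_in[OF V e0(1)] by blast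
  define r where "r = r0 / 2"
  have r: "r > 0" using r0 by (simp add: r_def)
  define D where "D = polydisc N e0 (\<lambda>_. r / 4)"
  have DV: "D \<subseteq> V" using r0 by (force simp: D_def polydisc_def r_def)
  \<comment> \<open>These bounds keep the roots in \<open>z\<close> inside the circle of radius
    \<open>r\<close>: for \<open>cmod z \<ge> r\<close> both factors have modulus at least
    \<open>3 * r / 4\<close>, so their product exceeds the bound on \<open>P\<close>, because 9/16 >
    1/4.\<close>
  define V' where "V' = D \<inter> P -` ball 0 (r\<^sup>2 / 4)"
  have oD: "openin (top_of_set (cspace N)) D" unfolding D_def by (rule polydisc_openin)
  have "openin (top_of_set D) V'"
    unfolding V'_def
    by (rule continuous_openin_preimage_gen[OF ahol_continuous[OF ahol_subset[OF P DV]]]) auto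
  then have oV': "openin (top_of_set (cspace N)) V'" using oD by (rule openin_trans)
  have e0V: "e0 \<in> V'"
    using e0 r openin_cspace_sub[OF V] by (auto simp: V'_def D_def polydisc_def)
  have V'V: "V' \<subseteq> V" using DV by (auto simp: V'_def)
  \<comment> \<open>The translation along (1, -1); after it the equation is \<open>Q e z\<close>, a
    quadratic polynomial in \<open>z\<close> with leading coefficient -1 for every
    \<open>e\<close>.\<close>
  define sh :: "(nat \<Rightarrow> complex) \<Rightarrow> complex \<Rightarrow> nat \<Rightarrow> complex"
    where "sh = (\<lambda>e z. e(a := e a + z, b := e b - z))"
  have bd: "cmod (e a) < r / 4" "cmod (e b) < r / 4" "cmod (P e) < r\<^sup>2 / 4" if "e \<in> V'" for e
    using that e0 ab by (auto simp: V'_def D_def polydisc_def)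
  have shV: "sh e z \<in> V" if e: "e \<in> V'" and z: "cmod z \<le> r" for e z
  proof -
    have "cmod (e a + z) < r0" "cmod (e b - z) < r0"
      using bd[OF e] z r norm_triangle_ineq[of "e a" z] norm_triangle_ineq4[of "e b" z] by (auto simp: r_def)
    then have "sh e z \<in> polydisc N e0 (\<lambda>_. r0)"
      using e e0 ab r0(1) by (auto simp: V'_def D_def polydisc_def sh_def cspace_def r_def)
    then show ?thesis using r0 by auto
  qed
  define Q where "Q = (\<lambda>e z. (e a + z) * (e b - z) - P e)"
  have Qnz: "Q e z \<noteq> 0" if e: "e \<in> V'" and z: "r \<le> cmod z" for e z
  proof
    assume "Q e z = 0"
    then have eq: "cmod (e a + z) * cmod (e b - z) = cmod (P e)"
      by (metis Q_def eq_iff_diff_eq_0 norm_mult)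
    have "3 * r / 4 \<le> cmod (e a + z)" "3 * r / 4 \<le> cmod (e b - z)"
      using bd[OF e] z norm_triangle_ineq2[of z "- e a"] norm_triangle_ineq2[of z "e b"]
      by (auto simp: add.commute norm_minus_commute)
    then have "(3 * r / 4) * (3 * r / 4) \<le> cmod (e a + z) * cmod (e b - z)"
      using r by (intro mult_mono) auto
    moreover have "r\<^sup>2 / 4 < (3 * r / 4) * (3 * r / 4)" using r by (simp add: power2_eq_square)
    ultimately show False using eq bd(3)[OF e] by linarith
  qed
  define K where "K = (\<lambda>(z::complex) e. 1 / (2 * of_real pi * \<i>) * (g (sh e z) / (Q e z * z)))"
  define k where "k = (\<lambda>e. contour_integral (circlepath 0 r) (\<lambda>z. K z e))"
  have Kh: "K z \<in> ahol N V'" if z: "cmod z = r" for z :: complex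
  proof -
    have "(\<lambda>e. g (sh e z)) \<in> ahol N V'"
    proof (rule ahol_compose[OF V g oV'])
      fix i assume "i < N"
      show "(\<lambda>e. sh e z i) \<in> ahol N V'"
        by (cases "i = a"; cases "i = b")
          (auto simp: sh_def intro!: ahol_add ahol_diff ahol_coord ahol_const)
    qed (use shV z in auto)
    then show ?thesis
      unfolding K_def Q_def
      by (intro ahol_mult ahol_divide ahol_diff ahol_add ahol_coord ahol_const ahol_subset[OF P V'V])
        (use Qnz[unfolded Q_def] z r in auto)
  qed
  have kh: "k \<in> ahol N V'"
    unfolding k_def
  proof (rule ahol_circle_integral[OF oV'])
    have cs: "continuous_on (sphere 0 r \<times> V') (\<lambda>x. snd x i)" for i
      by (intro continuous_on_coord[OF continuous_on_snd] continuous_on_id)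
    have "continuous_on (sphere 0 r \<times> V') (\<lambda>x. g (sh (snd x) (fst x)))"
      by (rule continuous_on_compose2[OF ahol_continuous[OF g]])
        (use shV in \<open>auto simp: sh_def intro!: continuous_on_funupd continuous_on_add continuous_on_diff cs
           continuous_on_fst continuous_on_snd continuous_on_id\<close>)
    moreover have "continuous_on (sphere 0 r \<times> V') (\<lambda>x. P (snd x))"
      by (rule continuous_on_compose2[OF ahol_continuous[OF ahol_subset[OF P V'V]]])
        (auto intro!: continuous_on_snd continuous_on_id)
    ultimately have "continuous_on (sphere 0 r \<times> V') (\<lambda>x. K (fst x) (snd x))"
      unfolding K_def Q_def
      by (intro continuous_on_mult continuous_on_divide continuous_on_diff continuous_on_add cs
            continuous_on_const continuous_on_fst continuous_on_id)
        (use Qnz[unfolded Q_def] r in auto)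
    then show "continuous_on (sphere 0 r \<times> V') (\<lambda>(z, e). K z e)" by (simp add: split_def)
  qed (use r Kh in \<open>auto intro: ahol_lineD\<close>)
  have generic: "g e = (e a * e b - P e) * k e"
    if e: "e \<in> V'" and disc: "(e a + e b)\<^sup>2 \<noteq> 4 * P e" for e
  proof (cases "e a * e b = P e")
    case True
    then show ?thesis using van[of e] e V'V by auto
  next
    case False
    define s where "s = csqrt ((e a + e b)\<^sup>2 - 4 * P e)"
    have s: "s \<noteq> 0" "s\<^sup>2 = (e a + e b)\<^sup>2 - 4 * P e" using disc by (auto simp: s_def)
    define \<alpha> where "\<alpha> = ((e b - e a) + s) / 2"
    define \<beta> where "\<beta> = ((e b - e a) - s) / 2"
    have Qf: "Q e z = - ((z - \<alpha>) * (z - \<beta>))" for z :: complex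
    proof -
      have "4 * ((z - \<alpha>) * (z - \<beta>)) = (2 * z - (e b - e a))\<^sup>2 - s\<^sup>2"
        by (simp add: \<alpha>_def \<beta>_def field_simps power2_eq_square)
      also have "\<dots> = - 4 * Q e z" unfolding s(2) Q_def by (simp add: algebra_simps power2_eq_square)
      finally show ?thesis by simp
    qed
    have small: "cmod \<alpha> < r" "cmod \<beta> < r"
      using Qnz[OF e, of \<alpha>] Qnz[OF e, of \<beta>] Qf by (auto simp: not_le[symmetric])
    have ab_ne: "\<alpha> \<noteq> \<beta>" using s by (simp add: \<alpha>_def \<beta>_def)
    have Q0: "e a * e b - P e = - (\<alpha> * \<beta>)" using Qf[of 0] by (simp add: Q_def)
    then have nz: "\<alpha> \<noteq> 0" "\<beta> \<noteq> 0" using False by auto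
    define G where "G = (\<lambda>z::complex. g (sh e z))"
    have Gz: "G z = 0" if "cmod z < r" "Q e z = 0" for z :: complex
      unfolding G_def
    proof (rule van)
      show "sh e z \<in> V" using shV[OF e] that by simp
      show "sh e z a * sh e z b = P (sh e z)"
        using that(2) ab(3) indep by (simp add: sh_def Q_def)
    qed
    have Gh: "G holomorphic_on cball 0 r"
      unfolding holomorphic_on_def
    proof
      fix z :: complex assume z: "z \<in> cball 0 r"
      have "(\<lambda>z. g (sh e z)) field_differentiable at z"
      proof (rule ahol_compose_curve[OF V g])
        show "(\<lambda>w. sh e w i) field_differentiable at z" for i
          by (cases "i = a"; cases "i = b") (auto simp: sh_def intro!: derivative_intros)
        have "continuous_on UNIV (sh e)"
          unfolding sh_def by (intro continuous_on_funupd continuous_intros)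
        then show "isCont (sh e) z" by (simp add: continuous_on_eq_continuous_at)
        show "sh e z \<in> V" using shV[OF e] z by simp
        have "sh e w \<in> cspace N" for w
          using e V'V openin_cspace_sub[OF V] ab by (auto simp: sh_def cspace_def)
        then show "\<forall>\<^sub>F w in at z. sh e w \<in> cspace N" by simp
      qed
      then show "G field_differentiable at z within cball 0 r"
        by (simp add: G_def field_differentiable_at_within)
    qed
    have I: "((\<lambda>z. G z / (z - w)) has_contour_integral 2 * of_real pi * \<i> * G w) (circlepath 0 r)"
      if "cmod w < r" for w :: complex
      by (rule Cauchy_integral_circlepath_simple[OF Gh]) (use that in auto)
    \<comment> \<open>Partial fractions of the kernel \<open>1 / (z * Q e z)\<close>: the residues
      at the two roots contain values of \<open>g\<close> on the hypersurface and drop out, the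
      residue at 0 contains \<open>g e\<close>. The minus sign is that of
      \<open>Q e z = - ((z - \<alpha>) * (z - \<beta>))\<close>.\<close>
    define c where "c = - 1 / (2 * of_real pi * \<i>)"
    have "((\<lambda>z. c * (1 / (\<alpha> * \<beta>) * (G z / (z - 0)) + 1 / (\<alpha> * (\<alpha> - \<beta>)) * (G z / (z - \<alpha>))
         + 1 / (\<beta> * (\<beta> - \<alpha>)) * (G z / (z - \<beta>)))) has_contour_integral
         c * (1 / (\<alpha> * \<beta>) * (2 * of_real pi * \<i> * G 0) + 1 / (\<alpha> * (\<alpha> - \<beta>)) * (2 * of_real pi * \<i> * G \<alpha>)
         + 1 / (\<beta> * (\<beta> - \<alpha>)) * (2 * of_real pi * \<i> * G \<beta>))) (circlepath 0 r)"
      by (intro has_contour_integral_lmul has_contour_integral_add I small) (use r in auto)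
    moreover have "G \<alpha> = 0" "G \<beta> = 0" using Gz small Qf by auto
    ultimately have "contour_integral (circlepath 0 r)
         (\<lambda>z. c * (1 / (\<alpha> * \<beta>) * (G z / (z - 0)) + 1 / (\<alpha> * (\<alpha> - \<beta>)) * (G z / (z - \<alpha>))
         + 1 / (\<beta> * (\<beta> - \<alpha>)) * (G z / (z - \<beta>)))) = - G 0 / (\<alpha> * \<beta>)"
      by (auto dest!: contour_integral_unique simp: c_def)
    moreover have "contour_integral (circlepath 0 r)
         (\<lambda>z. c * (1 / (\<alpha> * \<beta>) * (G z / (z - 0)) + 1 / (\<alpha> * (\<alpha> - \<beta>)) * (G z / (z - \<alpha>))
         + 1 / (\<beta> * (\<beta> - \<alpha>)) * (G z / (z - \<beta>)))) = k e"
      unfolding k_def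
    proof (rule contour_integral_cong[OF refl])
      fix z :: complex assume "z \<in> path_image (circlepath 0 r)"
      then have z: "cmod z = r" using r by auto
      then have zn: "z \<noteq> 0" "z - \<alpha> \<noteq> 0" "z - \<beta> \<noteq> 0" using r small by auto
      have d: "\<alpha> - \<beta> \<noteq> 0" "\<beta> - \<alpha> \<noteq> 0" using ab_ne by auto
      have pf: "1 / (\<alpha> * \<beta>) * (1 / z) + 1 / (\<alpha> * (\<alpha> - \<beta>)) * (1 / (z - \<alpha>)) + 1 / (\<beta> * (\<beta> - \<alpha>)) * (1 / (z - \<beta>))
          = 1 / (z * ((z - \<alpha>) * (z - \<beta>)))"
        using zn nz d by (simp add: divide_simps) (simp add: algebra_simps)
      have "1 / (\<alpha> * \<beta>) * (G z / (z - 0)) + 1 / (\<alpha> * (\<alpha> - \<beta>)) * (G z / (z - \<alpha>))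
         + 1 / (\<beta> * (\<beta> - \<alpha>)) * (G z / (z - \<beta>)) = G z * (1 / (\<alpha> * \<beta>) * (1 / z) + 1 / (\<alpha> * (\<alpha> - \<beta>)) * (1 / (z - \<alpha>)) + 1 / (\<beta> * (\<beta> - \<alpha>)) * (1 / (z - \<beta>)))"
        by (simp add: distrib_left)
      also have "\<dots> = G z / (z * ((z - \<alpha>) * (z - \<beta>)))" unfolding pf by simp
      finally show "c * (1 / (\<alpha> * \<beta>) * (G z / (z - 0)) + 1 / (\<alpha> * (\<alpha> - \<beta>)) * (G z / (z - \<alpha>))
         + 1 / (\<beta> * (\<beta> - \<alpha>)) * (G z / (z - \<beta>))) = K z e"
        by (simp add: K_def c_def Qf G_def mult.commute)
    qed
    ultimately have "k e = - G 0 / (\<alpha> * \<beta>)" by simp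
    then show ?thesis using Q0 nz by (simp add: G_def sh_def)
  qed
  have "g e = (e a * e b - P e) * k e" if e: "e \<in> V'" for e
  proof (cases "(e a + e b)\<^sup>2 = 4 * P e")
    case False then show ?thesis using generic e by blast
  next
    case True
    obtain s where s: "s > 0" "\<And>w. w \<in> ball (e a) s \<Longrightarrow> e(a := w) \<in> V'"
      using coord_line_ball[OF oV' e ab(1)] by blast
    \<comment> \<open>A double root is reached by continuity: with \<open>e b\<close> fixed, the
      discriminant as a function of the other coordinate has only the zeros \<open>e a\<close> and
      \<open>- e a - 2 * e b\<close>.\<close>
    define \<Phi> where "\<Phi> = (\<lambda>w. g (e(a := w)) - (w * e b - P e) * k (e(a := w)))"
    have PP: "P (e(a := w)) = P e" for w :: complex
    proof -
      have "e(a := w) = e(a := w, b := e b)" using ab(3) by auto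
      then show ?thesis using indep[of e w "e b"] by simp
    qed
    have co: "continuous_on (ball (e a) s) (\<lambda>w. h (e(a := w)))" if "h \<in> ahol N V'" for h
      by (rule continuous_on_compose2[OF ahol_continuous[OF that]])
        (use s in \<open>auto intro!: continuous_on_funupd continuous_on_const continuous_on_id\<close>)
    have "continuous_on (ball (e a) s) \<Phi>"
      unfolding \<Phi>_def by (intro continuous_intros co kh ahol_subset[OF g V'V])
    then have "isCont \<Phi> (e a)" using s(1) by (simp add: continuous_on_eq_continuous_at)
    then have lim: "(\<Phi> \<longlongrightarrow> \<Phi> (e a)) (at (e a))" by (simp add: isCont_def)
    have "\<forall>\<^sub>F w in at (e a). w \<in> ball (e a) s" using s(1) by (intro eventually_at_in_open') auto
    moreover have "\<forall>\<^sub>F w in at (e a). w \<noteq> e a" "\<forall>\<^sub>F w in at (e a). w \<noteq> - e a - 2 * e b"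
      by (rule eventually_neq_at_within)+
    ultimately have "\<forall>\<^sub>F w in at (e a). \<Phi> w = 0"
    proof eventually_elim
      case (elim w)
      have "(w + e b)\<^sup>2 - 4 * P e = (w + e b)\<^sup>2 - (e a + e b)\<^sup>2" using True by simp
      also have "\<dots> = (w - e a) * (w - (- e a - 2 * e b))" by (simp add: power2_eq_square algebra_simps)
      finally have "(w + e b)\<^sup>2 \<noteq> 4 * P e" using elim by auto
      then have "g (e(a := w)) = (w * e b - P e) * k (e(a := w))"
        using generic[OF s(2)[OF elim(1)]] ab PP by simp
      then show ?case by (simp add: \<Phi>_def)
    qed
    then have "(\<Phi> \<longlongrightarrow> 0) (at (e a))" by (rule tendsto_eventually)
    then have "\<Phi> (e a) = 0" using lim tendsto_unique trivial_limit_at by blast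
    then show ?thesis by (simp add: \<Phi>_def)
  qed
  then show ?thesis using that oV' e0V V'V kh by blast
qed

subsection \<open>Spaces uniformized by subsets of affine space\<close>

text \<open>A presentation of a space as a quotient of a subset of affine space in which holomorphy
  is tested on pullbacks. It passes to further quotients and, given local retractions, to open or
  closed subspaces, so an iterated construction keeps a single map \<open>c\<close>.\<close>

definition uniformized :: "nat \<Rightarrow> (nat \<Rightarrow> complex) set \<Rightarrow> ((nat \<Rightarrow> complex) \<Rightarrow> 'a) \<Rightarrow> 'a fspace \<Rightarrow> bool" where
  "uniformized m D c Y \<longleftrightarrow> D \<subseteq> cspace m \<and> quotient_map (top_of_set D) (Top Y) c \<and>
     (\<forall>U\<subseteq>pts Y. Hol Y U = {f. lhol m {d \<in> D. c d \<in> U} (\<lambda>d. f (c d))})"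

text \<open>On a saturated open set \<open>W\<close>, \<open>r\<close> is a holomorphic choice of
  one representative in each fibre of \<open>c\<close>, in other words a local slice for the
  equivalence relation. It turns functions upstairs into functions that are constant on the fibres
  of \<open>c\<close>.\<close>

definition local_retractions :: "nat \<Rightarrow> (nat \<Rightarrow> complex) set \<Rightarrow> ((nat \<Rightarrow> complex) \<Rightarrow> 'a) \<Rightarrow> bool" where
  "local_retractions m D c \<longleftrightarrow> (\<forall>d\<in>D. \<exists>W r. openin (top_of_set D) W \<and> d \<in> W \<and>
     (\<forall>x\<in>W. \<forall>y\<in>D. c y = c x \<longrightarrow> y \<in> W \<and> r y = r x) \<and>
     (\<forall>x\<in>W. r x \<in> D \<and> c (r x) = c x) \<and> (\<forall>i<m. lhol m W (\<lambda>x. r x i)))"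

lemma local_retractionsE:
  assumes "local_retractions m D c" "d \<in> D"
  obtains W r where "openin (top_of_set D) W" "d \<in> W"
     "\<And>x y. x \<in> W \<Longrightarrow> y \<in> D \<Longrightarrow> c y = c x \<Longrightarrow> y \<in> W \<and> r y = r x"
     "\<And>x. x \<in> W \<Longrightarrow> r x \<in> D \<and> c (r x) = c x" "\<And>i. i < m \<Longrightarrow> lhol m W (\<lambda>x. r x i)"
proof -
  from bspec[OF assms(1)[unfolded local_retractions_def] assms(2)]
  obtain W r where *: "openin (top_of_set D) W \<and> d \<in> W \<and>
     (\<forall>x\<in>W. \<forall>y\<in>D. c y = c x \<longrightarrow> y \<in> W \<and> r y = r x) \<and>
     (\<forall>x\<in>W. r x \<in> D \<and> c (r x) = c x) \<and> (\<forall>i<m. lhol m W (\<lambda>x. r x i))" by (elim exE)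
  show ?thesis by (rule that[of W r]) (use * in simp_all)
qed

lemma uniformizedD:
  assumes "uniformized m D c Y"
  shows "D \<subseteq> cspace m" "quotient_map (top_of_set D) (Top Y) c" "c ` D = pts Y"
    "\<And>U. U \<subseteq> pts Y \<Longrightarrow> openin (Top Y) U \<longleftrightarrow> openin (top_of_set D) {d \<in> D. c d \<in> U}"
    "\<And>U f. U \<subseteq> pts Y \<Longrightarrow> f \<in> Hol Y U \<longleftrightarrow> lhol m {d \<in> D. c d \<in> U} (\<lambda>d. f (c d))"
    "continuous_map (top_of_set D) (Top Y) c"
proof -
  show q: "quotient_map (top_of_set D) (Top Y) c" using assms by (simp add: uniformized_def)
  show "continuous_map (top_of_set D) (Top Y) c" by (rule quotient_imp_continuous_map[OF q])
qed (use assms in \<open>auto simp: uniformized_def quotient_map_def\<close>)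

section \<open>Affine subsets, quotients and subspaces as uniformized spaces\<close>

lemma quotient_map_quot: "quotient_map T (quot_topology T R) (\<lambda>x. R `` {x})"
proof -
  have "openin (quot_topology T R) (topspace T // R)"
    unfolding openin_quot_topology
    by (auto simp: quotient_def intro!: arg_cong[of _ _ "openin T", THEN iffD1, OF _ openin_topspace])
  moreover have "topspace (quot_topology T R) \<subseteq> topspace T // R"
    using openin_topspace[of "quot_topology T R"] unfolding openin_quot_topology by blast
  ultimately have top: "topspace (quot_topology T R) = topspace T // R"
    using openin_subset by blast
  then show ?thesis
    unfolding quotient_map_def openin_quot_topology by (auto simp: quotient_def)
qed

lemma uniformized_affine:
  assumes "D \<subseteq> cspace N" shows "uniformized N D (\<lambda>d. d) (subspace_on (affine_space N) D)"
proof -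
  have "Top (subspace_on (affine_space N) D) = top_of_set D"
    using assms by (simp add: subspace_on_def subtopology_subtopology Int_absorb1)
  moreover have "quotient_map (top_of_set D) (top_of_set D) (\<lambda>d. d)"
    unfolding quotient_map_def by (auto simp: Int_absorb1 subset_eq[symmetric] Collect_conj_eq)
  moreover have "{d \<in> D. d \<in> U} = U" if "U \<subseteq> D" for U using that by auto
  ultimately show ?thesis using assms
    unfolding uniformized_def by (simp add: Hol_subspace_affine)
qed

lemma uniformized_quotient:
  assumes u: "uniformized m D c Y"
  shows "uniformized m D (\<lambda>d. R `` {c d}) (quotient_by Y R)"
proof -
  note uD = uniformizedD[OF u]
  have q: "quotient_map (top_of_set D) (Top (quotient_by Y R)) (\<lambda>d. R `` {c d})"
    using quotient_map_compose[OF uD(2) quotient_map_quot[of "Top Y" R]]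
    by (simp add: quotient_by_def o_def)
  have "Hol (quotient_by Y R) U = {f. lhol m {d \<in> D. R `` {c d} \<in> U} (\<lambda>d. f (R `` {c d}))}" for U
  proof -
    have *: "{d \<in> D. c d \<in> {x \<in> pts Y. R `` {x} \<in> U}} = {d \<in> D. R `` {c d} \<in> U}" using uD(3) by auto
    have "(\<lambda>x. f (R `` {x})) \<in> Hol Y {x \<in> pts Y. R `` {x} \<in> U} \<longleftrightarrow>
        lhol m {d \<in> D. R `` {c d} \<in> U} (\<lambda>d. f (R `` {c d}))" for f
      using uD(5)[of "{x \<in> pts Y. R `` {x} \<in> U}" "\<lambda>x. f (R `` {x})"] unfolding * by auto
    then show ?thesis by (simp add: quotient_by_def)
  qed
  then show ?thesis using q uD(1) by (simp add: uniformized_def)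
qed

text \<open>Taking subspaces commutes with taking quotients. The point is that a function on the
  subspace whose pullback extends locally upstairs extends locally on \<open>Y\<close>: the
  extension near \<open>r d\<close> need not be constant on the fibres of \<open>c\<close>, but its
  composition with \<open>r\<close> is, and so it descends.\<close>

lemma uniformized_subspace:
  assumes u: "uniformized m D c Y" and l: "local_retractions m D c"
    and S: "openin (Top Y) S \<or> closedin (Top Y) S"
  shows "uniformized m {d \<in> D. c d \<in> S} c (subspace_on Y S)"
  unfolding uniformized_def
proof (intro conjI allI impI)
  note uD = uniformizedD[OF u]
  show sub: "{d \<in> D. c d \<in> S} \<subseteq> cspace m" using uD(1) by auto
  have SY: "S \<subseteq> pts Y" using S by (auto dest: openin_subset closedin_subset)
  have "quotient_map (subtopology (top_of_set D) {d \<in> D. c d \<in> S}) (subtopology (Top Y) S) c"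
    by (rule quotient_map_restriction[OF uD(2) _ S]) auto
  then show "quotient_map (top_of_set {d \<in> D. c d \<in> S}) (Top (subspace_on Y S)) c"
    by (simp add: subspace_on_def subtopology_subtopology Int_absorb1)
  fix U assume "U \<subseteq> pts (subspace_on Y S)"
  then have U: "U \<subseteq> S" by (auto simp: subspace_on_def)
  have eq: "{d \<in> {d \<in> D. c d \<in> S}. c d \<in> U} = {d \<in> D. c d \<in> U}" using U by auto
  let ?A = "{d \<in> D. c d \<in> U}"
  have AN: "?A \<subseteq> cspace m" using uD(1) by auto
  show "Hol (subspace_on Y S) U = {f. lhol m {d \<in> {d \<in> D. c d \<in> S}. c d \<in> U} (\<lambda>d. f (c d))}"
    unfolding eq
  proof (intro set_eqI iffI; simp only: mem_Collect_eq)
    fix f assume "f \<in> Hol (subspace_on Y S) U"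
    then have f: "\<forall>p\<in>U. \<exists>V g. openin (Top Y) V \<and> p \<in> V \<and> g \<in> Hol Y V \<and> (\<forall>q\<in>V \<inter> U. f q = g q)"
      by (simp add: subspace_on_def)
    show "lhol m ?A (\<lambda>d. f (c d))"
    proof (rule lhol_local'[OF _ AN])
      fix d assume d: "d \<in> ?A"
      then obtain V g where V: "openin (Top Y) V" "c d \<in> V" "g \<in> Hol Y V" "\<forall>q\<in>V \<inter> U. f q = g q"
        using f by blast
      have VY: "V \<subseteq> pts Y" using V(1) openin_subset by blast
      have "lhol m {d \<in> D. c d \<in> V} (\<lambda>d. g (c d))" using uD(5)[OF VY] V(3) by blast
      then have "lhol m {d \<in> D. c d \<in> V \<inter> U} (\<lambda>d. g (c d))" by (rule lhol_subset) auto
      then have 1: "lhol m {d \<in> D. c d \<in> V \<inter> U} (\<lambda>d. f (c d))"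
        by (subst lhol_cong[where g = "\<lambda>d. g (c d)"]) (use V(4) in auto)
      have "openin (top_of_set D) {d \<in> D. c d \<in> V}" using uD(4)[OF VY] V(1) by blast
      then have "openin (top_of_set ?A) {d \<in> D. c d \<in> V \<inter> U}" by (auto simp: openin_open)
      with 1 d V(2) show "\<exists>T. openin (top_of_set ?A) T \<and> d \<in> T \<and> lhol m T (\<lambda>d. f (c d))" by blast
    qed
  next
    fix f assume f: "lhol m ?A (\<lambda>d. f (c d))"
    have "\<exists>V g. openin (Top Y) V \<and> p \<in> V \<and> g \<in> Hol Y V \<and> (\<forall>q\<in>V \<inter> U. f q = g q)" if p: "p \<in> U" for p
    proof -
      have "p \<in> c ` D" unfolding uD(3) using p U SY by auto
      then obtain d where d: "d \<in> D" "c d = p" by auto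
      obtain W r where W: "openin (top_of_set D) W" "d \<in> W"
        "\<And>x y. x \<in> W \<Longrightarrow> y \<in> D \<Longrightarrow> c y = c x \<Longrightarrow> y \<in> W \<and> r y = r x"
        "\<And>x. x \<in> W \<Longrightarrow> r x \<in> D \<and> c (r x) = c x" "\<And>i. i < m \<Longrightarrow> lhol m W (\<lambda>x. r x i)"
        using local_retractionsE[OF l d(1)] by auto
      have WD: "W \<subseteq> D" using W(1) by (auto simp: openin_open)
      have rd: "r d \<in> ?A" using W(4)[OF W(2)] d p by auto
      obtain V1 g where V1: "openin (top_of_set (cspace m)) V1" "r d \<in> V1" "g \<in> ahol m V1"
          "\<And>q. q \<in> V1 \<Longrightarrow> q \<in> ?A \<Longrightarrow> f (c q) = g q"
        using lholE[OF f rd] by blast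
      define V2 where "V2 = W \<inter> r -` V1"
      have rc: "continuous_on W r"
        by (rule lhol_map_continuous[OF W(5)]) (use W(4) uD(1) in auto)
      have "openin (top_of_set W) V2"
        unfolding V2_def by (rule continuous_openin_preimage[OF rc _ V1(1)]) (use W(4) uD(1) in auto)
      then have oV2: "openin (top_of_set D) V2" using W(1) by (rule openin_trans)
      define V where "V = c ` V2"
      have V2D: "V2 \<subseteq> D" using WD by (auto simp: V2_def)
      have sat: "{d \<in> D. c d \<in> V} = V2"
      proof
        show "{d \<in> D. c d \<in> V} \<subseteq> V2"
          unfolding V_def V2_def using W(3) by fastforce
        show "V2 \<subseteq> {d \<in> D. c d \<in> V}" using V2D by (auto simp: V_def)
      qed
      have VY: "V \<subseteq> pts Y" using uD(3) V2D by (auto simp: V_def)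
      have oV: "openin (Top Y) V" using uD(4)[OF VY] sat oV2 by simp
      \<comment> \<open>Any representative in \<open>V2\<close> serves, since \<open>r\<close> has
        the same value on all of them.\<close>
      define G where "G = (\<lambda>P. g (r (SOME x. x \<in> V2 \<and> c x = P)))"
      have Gc: "G (c x) = g (r x)" if "x \<in> V2" for x
      proof -
        have "\<exists>y. y \<in> V2 \<and> c y = c x" using that by blast
        from someI_ex[OF this] have "(SOME y. y \<in> V2 \<and> c y = c x) \<in> V2" "c (SOME y. y \<in> V2 \<and> c y = c x) = c x" by auto
        then have "r (SOME y. y \<in> V2 \<and> c y = c x) = r x" using W(3)[of x] that V2D by (auto simp: V2_def)
        then show ?thesis by (simp add: G_def)
      qed
      have "lhol m V2 (\<lambda>x. g (r x))"
        by (rule lhol_compose[OF ahol_imp_lhol[OF V1(1,3) order_refl]])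
          (use W(5) WD uD(1) in \<open>auto simp: V2_def intro: lhol_subset\<close>)
      then have "lhol m V2 (\<lambda>x. G (c x))" using Gc by (subst lhol_cong[where g = "\<lambda>x. g (r x)"]) auto
      then have GH: "G \<in> Hol Y V" using uD(5)[OF VY, of G] sat by simp
      have "f q = G q" if q: "q \<in> V \<inter> U" for q
      proof -
        obtain x where x: "x \<in> V2" "c x = q" using q by (auto simp: V_def)
        have "r x \<in> V1" "r x \<in> ?A" using x q W(4)[of x] by (auto simp: V2_def)
        then have "f (c (r x)) = g (r x)" using V1(4) by blast
        then show ?thesis using Gc[OF x(1)] x W(4)[of x] by (auto simp: V2_def)
      qed
      moreover have "p \<in> V" using W(2) V1(2) d by (auto simp: V_def V2_def)
      ultimately show ?thesis using oV GH by blast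
    qed
    then show "f \<in> Hol (subspace_on Y S) U" by (auto simp: subspace_on_def)
  qed
qed

lemma uniformized_is_sheaf:
  assumes u: "uniformized m D c Y" shows "is_sheaf Y"
  unfolding is_sheaf_def
proof (intro allI impI iffI)
  note uD = uniformizedD[OF u]
  fix U f assume U: "openin (Top Y) U" and "f \<in> Hol Y U"
  then show "\<forall>p\<in>U. \<exists>V g. openin (Top Y) V \<and> p \<in> V \<and> g \<in> Hol Y V \<and> (\<forall>q\<in>V \<inter> U. f q = g q)" by blast
next
  note uD = uniformizedD[OF u]
  fix U f assume U: "openin (Top Y) U"
    and f: "\<forall>p\<in>U. \<exists>V g. openin (Top Y) V \<and> p \<in> V \<and> g \<in> Hol Y V \<and> (\<forall>q\<in>V \<inter> U. f q = g q)"
  have UY: "U \<subseteq> pts Y" using U openin_subset by blast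
  have "lhol m {d \<in> D. c d \<in> U} (\<lambda>d. f (c d))"
  proof (rule lhol_local')
    fix d assume d: "d \<in> {d \<in> D. c d \<in> U}"
    then obtain V g where V: "openin (Top Y) V" "c d \<in> V" "g \<in> Hol Y V" "\<forall>q\<in>V \<inter> U. f q = g q"
      using f by blast
    have VY: "V \<subseteq> pts Y" using V(1) openin_subset by blast
    have "lhol m {d \<in> D. c d \<in> V} (\<lambda>d. g (c d))" using uD(5)[OF VY] V(3) by blast
    then have "lhol m {d \<in> D. c d \<in> V \<inter> U} (\<lambda>d. g (c d))" by (rule lhol_subset) auto
    then have 1: "lhol m {d \<in> D. c d \<in> V \<inter> U} (\<lambda>d. f (c d))"
      by (subst lhol_cong[where g = "\<lambda>d. g (c d)"]) (use V(4) in auto)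
    have "openin (top_of_set D) {d \<in> D. c d \<in> V}" using uD(4)[OF VY] V(1) by blast
    then have "openin (top_of_set {d \<in> D. c d \<in> U}) {d \<in> D. c d \<in> V \<inter> U}" by (auto simp: openin_open)
    with 1 d V(2) show "\<exists>T. openin (top_of_set {d \<in> D. c d \<in> U}) T \<and> d \<in> T \<and> lhol m T (\<lambda>d. f (c d))" by blast
  qed (use uD(1) in auto)
  then show "f \<in> Hol Y U" using uD(5)[OF UY] by blast
qed

text \<open>The map \<open>\<Psi>\<close> lifts the inverse of \<open>\<phi>\<close>, so holomorphy
  passes from \<open>Z\<close> to \<open>Y\<close> by composition. For the other direction no lift
  is available at singular points; it is isolated as the hypothesis \<open>desc\<close>.\<close>

lemma uniformized_biholomorphic:
  assumes u: "uniformized m D c Y" and v: "uniformized N E e Z"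
    and h: "homeomorphic_map (Top Z) (Top Y) \<phi>"
    and \<Psi>: "\<And>i. i < N \<Longrightarrow> lhol m D (\<lambda>d. \<Psi> d i)" "\<And>d. d \<in> D \<Longrightarrow> \<Psi> d \<in> E" "\<And>d. d \<in> D \<Longrightarrow> \<phi> (e (\<Psi> d)) = c d"
    and desc: "\<And>V g. openin (Top Y) V \<Longrightarrow> lhol m {d \<in> D. c d \<in> V} (\<lambda>d. g (c d)) \<Longrightarrow>
       lhol N {x \<in> E. \<phi> (e x) \<in> V} (\<lambda>x. g (\<phi> (e x)))"
  shows "biholomorphic Z Y \<phi>"
  unfolding biholomorphic_def
proof (intro conjI allI impI h)
  note uD = uniformizedD[OF u] and vD = uniformizedD[OF v]
  fix V g assume V: "openin (Top Y) V"
  have VY: "V \<subseteq> pts Y" using V openin_subset by blast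
  have eq: "{x \<in> E. e x \<in> {z \<in> pts Z. \<phi> z \<in> V}} = {x \<in> E. \<phi> (e x) \<in> V}" using vD(3) by auto
  have Z: "g \<circ> \<phi> \<in> Hol Z {z \<in> pts Z. \<phi> z \<in> V} \<longleftrightarrow> lhol N {x \<in> E. \<phi> (e x) \<in> V} (\<lambda>x. g (\<phi> (e x)))"
    using vD(5)[of "{z \<in> pts Z. \<phi> z \<in> V}" "g \<circ> \<phi>"] unfolding eq by (auto simp: o_def)
  have Y: "g \<in> Hol Y V \<longleftrightarrow> lhol m {d \<in> D. c d \<in> V} (\<lambda>d. g (c d))" by (rule uD(5)[OF VY])
  have "lhol m {d \<in> D. c d \<in> V} (\<lambda>d. g (c d))" if "lhol N {x \<in> E. \<phi> (e x) \<in> V} (\<lambda>x. g (\<phi> (e x)))"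
  proof -
    have "lhol m {d \<in> D. c d \<in> V} (\<lambda>d. g (\<phi> (e (\<Psi> d))))"
      by (rule lhol_compose[OF that]) (use \<Psi> uD(1) in \<open>auto intro: lhol_subset\<close>)
    then show ?thesis using \<Psi>(3) by (subst lhol_cong[where g = "\<lambda>d. g (\<phi> (e (\<Psi> d)))"]) auto
  qed
  then show "(g \<in> Hol Y V) = (g \<circ> \<phi> \<in> Hol Z {x \<in> pts Z. \<phi> x \<in> V})"
    using Z Y desc[OF V] by blast
qed

lemma continuous_map_uniformized:
  assumes u: "uniformized m D c Y" and f: "continuous_map (top_of_set D) T (\<lambda>d. f (c d))"
  shows "continuous_map (Top Y) T f"
  by (rule continuous_compose_quotient_map[OF uniformizedD(2)[OF u]]) (use f in \<open>simp add: o_def\<close>)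

text \<open>Supplies the continuity from which the extension over singular points starts.\<close>

lemma uniformized_function_continuous:
  assumes u: "uniformized m D c Y" and U: "openin (Top Y) U" and f: "lhol m {d \<in> D. c d \<in> U} (\<lambda>d. f (c d))"
  shows "continuous_map (subtopology (Top Y) U) euclidean f"
proof -
  have "quotient_map (subtopology (top_of_set D) {d \<in> D. c d \<in> U}) (subtopology (Top Y) U) c"
    by (rule quotient_map_restriction[OF uniformizedD(2)[OF u]]) (use U in auto)
  then have "quotient_map (top_of_set {d \<in> D. c d \<in> U}) (subtopology (Top Y) U) c"
    by (simp add: subtopology_subtopology Int_absorb1)
  moreover have "continuous_map (top_of_set {d \<in> D. c d \<in> U}) euclidean (f \<circ> c)"
    using lhol_continuous[OF f] by (simp add: o_def continuous_map_iff_continuous2)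
  ultimately show ?thesis by (rule continuous_compose_quotient_map)
qed

subsection \<open>Linear forms on the cone over the rational normal curve\<close>

text \<open>On the curve \<open>w\<^sub>i = t u\<^sub>0\<^sup>i u\<^sub>1\<^sup>n\<^sup>-\<^sup>i\<close> the following recursion multiplies out a product of \<open>m\<close> linear factors
  \<open>\<alpha>\<^sub>k u\<^sub>0 + \<beta>\<^sub>k u\<^sub>1\<close> without ever dividing by a power of \<open>u\<^sub>0\<close> or \<open>u\<^sub>1\<close>.\<close>

fun contraction :: "(nat \<Rightarrow> complex) \<Rightarrow> (nat \<Rightarrow> complex) \<Rightarrow> (nat \<Rightarrow> complex) \<Rightarrow> nat \<Rightarrow> nat \<Rightarrow> complex" where
  "contraction \<alpha> \<beta> w 0 i = w i"
| "contraction \<alpha> \<beta> w (Suc m) i = \<alpha> m * contraction \<alpha> \<beta> w m (Suc i) + \<beta> m * contraction \<alpha> \<beta> w m i"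

lemma contraction_scale: "contraction \<alpha> \<beta> (\<lambda>i. l * w i) m i = l * contraction \<alpha> \<beta> w m i"
  by (induction m arbitrary: i) (simp_all add: algebra_simps)

lemma contraction_cnj:
  "cnj (contraction \<alpha> \<beta> w m i) = contraction (\<lambda>k. cnj (\<alpha> k)) (\<lambda>k. cnj (\<beta> k)) (\<lambda>k. cnj (w k)) m i"
  by (induction m arbitrary: i) simp_all

lemma contraction_cong:
  "(\<And>k. k < m \<Longrightarrow> \<alpha> k = \<alpha>' k \<and> \<beta> k = \<beta>' k) \<Longrightarrow> (\<And>k. k \<le> i + m \<Longrightarrow> w k = w' k) \<Longrightarrow>
     contraction \<alpha> \<beta> w m i = contraction \<alpha>' \<beta>' w' m i"
  by (induction m arbitrary: i) auto

text \<open>Each contraction uses up one linear factor: it lowers the degree of the remaining curve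
  by one and multiplies by that factor. With \<open>m = n\<close> and \<open>i = 0\<close> only
  \<open>t\<close> times the full product is left.\<close>

lemma contraction_curve:
  assumes "\<And>k. k \<le> n \<Longrightarrow> w k = t * u0 ^ k * u1 ^ (n - k)" "i + m \<le> n"
  shows "contraction \<alpha> \<beta> w m i = t * u0 ^ i * u1 ^ (n - i - m) * (\<Prod>k<m. \<alpha> k * u0 + \<beta> k * u1)"
  using assms(2)
proof (induction m arbitrary: i)
  case 0
  then show ?case using assms(1) by simp
next
  case (Suc m)
  have 1: "n - i - m = Suc (n - i - Suc m)" using Suc.prems by simp
  have 2: "n - Suc i - m = n - i - Suc m" by simp
  show ?case
    using Suc.IH[of i] Suc.IH[of "Suc i"] Suc.prems unfolding 1 2
    by (simp add: algebra_simps)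
qed

lemma lhol_contraction:
  assumes "S \<subseteq> cspace N" "\<And>k. lhol N S (\<lambda>p. \<alpha> p k)" "\<And>k. lhol N S (\<lambda>p. \<beta> p k)" "\<And>k. lhol N S (\<lambda>p. w p k)"
  shows "lhol N S (\<lambda>p. contraction (\<alpha> p) (\<beta> p) (w p) m i)"
  by (induction m arbitrary: i) (auto intro!: lhol_add lhol_mult assms)

lemma curve_first:
  assumes m: "\<And>i j. i < n \<Longrightarrow> j < n \<Longrightarrow> w i * w (Suc j) = w (Suc i) * (w j :: complex)"
    and "w 0 \<noteq> 0" "i \<le> n"
  shows "w i = w 0 * (w 1 / w 0) ^ i"
  using assms(3)
proof (induction i)
  case (Suc i)
  then have "w 0 * w (Suc i) = w 1 * w i" using m[of 0 i] by simp
  then have "w (Suc i) = w 1 * w i / w 0" using assms(2) by (simp add: field_simps)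
  then show ?case using Suc by simp
qed simp

lemma curve_last:
  assumes m: "\<And>i j. i < n \<Longrightarrow> j < n \<Longrightarrow> w i * w (Suc j) = w (Suc i) * (w j :: complex)"
    and "w n \<noteq> 0" "i \<le> n"
  shows "w (n - i) = w n * (w (n - 1) / w n) ^ i"
  using assms(3)
proof (induction i)
  case (Suc i)
  have "w (n - 1) * w (n - i) = w n * w (n - Suc i)"
    using m[of "n - 1" "n - Suc i"] Suc.prems by (simp add: Suc_diff_Suc)
  then have "w (n - Suc i) = w (n - 1) * w (n - i) / w n" using assms(2) by (simp add: field_simps)
  then show ?case using Suc by simp
qed simp

text \<open>The minor of two neighbouring columns reads
  \<open>w (i + 1) ^ 2 = w i * w (i + 2)\<close>, so zeros spread upwards from \<open>w 0\<close>;
  only the last coordinate escapes this.\<close>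

lemma curve_zero:
  assumes m: "\<And>i j. i < n \<Longrightarrow> j < n \<Longrightarrow> w i * w (Suc j) = w (Suc i) * (w j :: complex)"
    and "w 0 = 0" "w n = 0" "i \<le> n"
  shows "w i = 0"
  using assms(4)
proof (induction i)
  case (Suc i)
  show ?case
  proof (cases "Suc i = n")
    case False
    then have "w i * w (Suc (Suc i)) = w (Suc i) * w (Suc i)" using m[of i "Suc i"] Suc.prems by simp
    then show ?thesis using Suc by simp
  qed (use assms in simp)
qed (use assms in simp)

subsection \<open>The family\<close>

text \<open>Coordinates on \<open>\<complex>\<^sup>3\<^sup>n\<^sup>+\<^sup>3\<close>: the base coordinates \<open>s\<^sub>k\<close>, \<open>t\<^sub>k\<close> at \<open>k\<close> and \<open>n + k\<close> (\<open>k < n\<close>), then \<open>x\<close>, \<open>y\<close> at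
  \<open>2n\<close>, \<open>2n + 1\<close>, then \<open>w\<^sub>0, \<dots>, w\<^sub>n\<close>. The equation is \<open>x y = t\<^sup>2 \<Prod> (u\<^sub>0 - s\<^sub>k u\<^sub>1) \<Prod> (u\<^sub>1 - t\<^sub>k u\<^sub>0)\<close> on
  \<open>w\<^sub>i = t u\<^sub>0\<^sup>i u\<^sub>1\<^sup>n\<^sup>-\<^sup>i\<close>.\<close>

definition curve_coord :: "nat \<Rightarrow> (nat \<Rightarrow> complex) \<Rightarrow> nat \<Rightarrow> complex" where
  "curve_coord n e i = e (2 * n + 2 + i)"

text \<open>This form collects the roots that tend to 0, \<open>infinity_form\<close> those that
  tend to infinity. Each has degree \<open>n\<close> in u0, u1 and is therefore linear in the
  \<open>w_i\<close>, which makes the equation of the family quadratic.\<close>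

definition zero_form :: "nat \<Rightarrow> (nat \<Rightarrow> complex) \<Rightarrow> complex" where
  "zero_form n e = contraction (\<lambda>_. 1) (\<lambda>k. - e k) (curve_coord n e) n 0"

definition infinity_form :: "nat \<Rightarrow> (nat \<Rightarrow> complex) \<Rightarrow> complex" where
  "infinity_form n e = contraction (\<lambda>k. - e (n + k)) (\<lambda>_. 1) (curve_coord n e) n 0"

definition branch_form :: "nat \<Rightarrow> (nat \<Rightarrow> complex) \<Rightarrow> complex" where
  "branch_form n e = zero_form n e * infinity_form n e"

definition on_curve :: "nat \<Rightarrow> (nat \<Rightarrow> complex) \<Rightarrow> bool" where
  "on_curve n w \<longleftrightarrow> (\<forall>i<n. \<forall>j<n. w i * w (Suc j) = w (Suc i) * w j)"

definition family_cone :: "nat \<Rightarrow> (nat \<Rightarrow> complex) set" where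
  "family_cone n = {e \<in> cspace (3 * n + 3). (\<exists>c\<in>{2 * n..<3 * n + 3}. e c \<noteq> 0) \<and>
     on_curve n (curve_coord n e) \<and> e (2 * n) * e (2 * n + 1) = branch_form n e}"

text \<open>The base coordinates are fixed and x, y and the \<open>w_i\<close> all have weight 1, so
  the family lies in the product of the base with a projective space of dimension n + 2.\<close>

definition scale :: "nat \<Rightarrow> complex \<Rightarrow> (nat \<Rightarrow> complex) \<Rightarrow> nat \<Rightarrow> complex" where
  "scale n l e = (\<lambda>i. if i < 2 * n then e i else l * e i)"

definition family_rel :: "nat \<Rightarrow> ((nat \<Rightarrow> complex) \<times> (nat \<Rightarrow> complex)) set" where
  "family_rel n = {(e, f). e \<in> family_cone n \<and> f \<in> family_cone n \<and> (\<exists>l. l \<noteq> 0 \<and> f = scale n l e)}"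

definition family :: "nat \<Rightarrow> (nat \<Rightarrow> complex) set fspace" where
  "family n = quotient_by (subspace_on (affine_space (3 * n + 3)) (family_cone n)) (family_rel n)"

definition family_class :: "nat \<Rightarrow> (nat \<Rightarrow> complex) \<Rightarrow> (nat \<Rightarrow> complex) set" where
  "family_class n e = family_rel n `` {e}"

definition base_part :: "nat \<Rightarrow> (nat \<Rightarrow> complex) \<Rightarrow> nat \<Rightarrow> complex" where
  "base_part n e i = (if i < 2 * n then e i else 0)"

definition base_map :: "nat \<Rightarrow> (nat \<Rightarrow> complex) set \<Rightarrow> nat \<Rightarrow> complex" where
  "base_map n x = base_part n (SOME e. e \<in> x)"

lemma family_cone_cspace: "family_cone n \<subseteq> cspace (3 * n + 3)"
  by (auto simp: family_cone_def)

lemma scale_scale: "scale n l (scale n m e) = scale n (l * m) e"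
  by (auto simp: scale_def)

lemma scale_1 [simp]: "scale n 1 e = e"
  by (auto simp: scale_def)

lemma curve_coord_scale: "curve_coord n (scale n l e) = (\<lambda>i. l * curve_coord n e i)"
  by (auto simp: curve_coord_def scale_def)

lemma contraction_base_cong:
  assumes "\<And>k. k < 2 * n \<Longrightarrow> e k = f k" "\<And>k. k \<le> n \<Longrightarrow> curve_coord n e k = l * curve_coord n f k"
  shows "zero_form n e = l * zero_form n f" "infinity_form n e = l * infinity_form n f"
    "branch_form n e = l\<^sup>2 * branch_form n f"
proof -
  show 1: "zero_form n e = l * zero_form n f"
    unfolding zero_form_def contraction_scale[symmetric] by (rule contraction_cong) (use assms in auto)
  show 2: "infinity_form n e = l * infinity_form n f"
    unfolding infinity_form_def contraction_scale[symmetric] by (rule contraction_cong) (use assms in auto)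
  show "branch_form n e = l\<^sup>2 * branch_form n f"
    unfolding branch_form_def 1 2 by (simp add: power2_eq_square)
qed

lemma branch_form_scale: "branch_form n (scale n l e) = l\<^sup>2 * branch_form n e"
  by (rule contraction_base_cong) (auto simp: scale_def curve_coord_def)

lemma branch_form_curve:
  assumes "\<And>k. k \<le> n \<Longrightarrow> curve_coord n e k = t * u0 ^ k * u1 ^ (n - k)"
  shows "branch_form n e = t\<^sup>2 * (\<Prod>k<n. u0 - e k * u1) * (\<Prod>k<n. u1 - e (n + k) * u0)"
  unfolding branch_form_def zero_form_def infinity_form_def
  by (subst (1 2) contraction_curve[where t = t and ?u0.0 = u0 and ?u1.0 = u1 and n = n, OF assms])
    (auto simp: power2_eq_square algebra_simps)

lemma scale_family_cone:
  assumes "e \<in> family_cone n" "l \<noteq> 0" shows "scale n l e \<in> family_cone n"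
proof -
  obtain c where c: "c \<in> {2 * n..<3 * n + 3}" "e c \<noteq> 0" using assms by (auto simp: family_cone_def)
  have "scale n l e \<in> cspace (3 * n + 3)" using assms by (auto simp: family_cone_def scale_def cspace_def)
  moreover have "scale n l e c \<noteq> 0" using c assms by (auto simp: scale_def)
  moreover have "on_curve n (curve_coord n (scale n l e))"
    using assms by (auto simp: family_cone_def on_curve_def curve_coord_scale)
  moreover have "scale n l e (2 * n) * scale n l e (2 * n + 1) = branch_form n (scale n l e)"
    using assms unfolding branch_form_scale by (auto simp: family_cone_def scale_def power2_eq_square)
  ultimately show ?thesis using c by (auto simp: family_cone_def)
qed

lemma equiv_family_rel: "equiv (family_cone n) (family_rel n)"
proof (rule equivI)
  show "refl_on (family_cone n) (family_rel n)"
    by (auto simp: refl_on_def family_rel_def intro!: exI[of _ 1])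
  show "sym (family_rel n)"
  proof (rule symI)
    fix e f assume "(e, f) \<in> family_rel n"
    then obtain l where "e \<in> family_cone n" "f \<in> family_cone n" "l \<noteq> 0" "f = scale n l e" by (auto simp: family_rel_def)
    then show "(f, e) \<in> family_rel n"
      by (auto simp: family_rel_def scale_scale intro!: exI[of _ "1 / l"])
  qed
  show "trans (family_rel n)"
  proof (rule transI)
    fix e f g assume "(e, f) \<in> family_rel n" "(f, g) \<in> family_rel n"
    then obtain l m where "l \<noteq> 0" "m \<noteq> 0" "f = scale n l e" "g = scale n m f" "e \<in> family_cone n" "g \<in> family_cone n"
      by (auto simp: family_rel_def)
    then show "(e, g) \<in> family_rel n"
      by (auto simp: family_rel_def scale_scale intro!: exI[of _ "m * l"])
  qed
qed (auto simp: family_rel_def)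

lemma family_class_eq_iff:
  assumes "e \<in> family_cone n" "f \<in> family_cone n"
  shows "family_class n e = family_class n f \<longleftrightarrow> (\<exists>l. l \<noteq> 0 \<and> f = scale n l e)"
  using eq_equiv_class_iff[OF equiv_family_rel assms] assms
  by (simp add: family_class_def family_rel_def)

lemma family_class_scale:
  "e \<in> family_cone n \<Longrightarrow> l \<noteq> 0 \<Longrightarrow> family_class n (scale n l e) = family_class n e"
  using family_class_eq_iff[of e n "scale n l e"] scale_family_cone by auto

lemma some_in_family_class:
  assumes "e \<in> family_cone n"
  obtains l where "l \<noteq> 0" "(SOME f. f \<in> family_class n e) = scale n l e"
proof -
  have "e \<in> family_class n e"
    using equiv_class_self[OF equiv_family_rel assms] by (simp add: family_class_def)
  then have "(SOME f. f \<in> family_class n e) \<in> family_class n e"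
    by (rule someI[where P = "\<lambda>f. f \<in> family_class n e"])
  then show ?thesis using that by (auto simp: family_class_def family_rel_def)
qed

lemma base_map_class [simp]:
  assumes "e \<in> family_cone n" shows "base_map n (family_class n e) = base_part n e"
proof -
  obtain l where "(SOME f. f \<in> family_class n e) = scale n l e"
    using some_in_family_class[OF assms] by blast
  then show ?thesis by (auto simp: base_map_def base_part_def scale_def)
qed

lemma uniformized_family: "uniformized (3 * n + 3) (family_cone n) (family_class n) (family n)"
  using uniformized_quotient[OF uniformized_affine[OF family_cone_cspace], of n "family_rel n"]
  by (simp add: family_def family_class_def[abs_def])

lemma pts_family: "pts (family n) = family_class n ` family_cone n"
  using uniformizedD(3)[OF uniformized_family] by auto

text \<open>For \<open>e c = 0\<close> this is a junk value, since \<open>1 / 0 = 0\<close>.\<close>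

definition normal_form :: "nat \<Rightarrow> nat \<Rightarrow> (nat \<Rightarrow> complex) \<Rightarrow> nat \<Rightarrow> complex" where
  "normal_form n c e = scale n (1 / e c) e"

lemma normal_form_cone: "e \<in> family_cone n \<Longrightarrow> e c \<noteq> 0 \<Longrightarrow> normal_form n c e \<in> family_cone n"
  by (simp add: normal_form_def scale_family_cone)

lemma normal_form_class: "e \<in> family_cone n \<Longrightarrow> e c \<noteq> 0 \<Longrightarrow> family_class n (normal_form n c e) = family_class n e"
  by (simp add: normal_form_def family_class_scale)

lemma normal_form_coord: "e c \<noteq> 0 \<Longrightarrow> c \<ge> 2 * n \<Longrightarrow> normal_form n c e c = 1"
  by (simp add: normal_form_def scale_def)

lemma normal_form_id: "e c = 1 \<Longrightarrow> normal_form n c e = e"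
  by (simp add: normal_form_def)

lemma normal_form_scale: "l \<noteq> 0 \<Longrightarrow> c \<ge> 2 * n \<Longrightarrow> normal_form n c (scale n l e) = normal_form n c e"
  by (auto simp: normal_form_def scale_def)

lemma class_coord_nonzero:
  assumes "e \<in> family_cone n" "f \<in> family_cone n" "family_class n e = family_class n f" "c \<ge> 2 * n"
  shows "e c \<noteq> 0 \<longleftrightarrow> f c \<noteq> 0" "normal_form n c e = normal_form n c f"
proof -
  obtain l where l: "l \<noteq> 0" "f = scale n l e" using family_class_eq_iff[of e n f] assms by auto
  then show "e c \<noteq> 0 \<longleftrightarrow> f c \<noteq> 0" using assms(4) by (auto simp: scale_def)
  show "normal_form n c e = normal_form n c f" unfolding l(2) normal_form_scale[OF l(1) assms(4)] ..
qed

lemma lhol_normal_form: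
  assumes "S \<subseteq> cspace (3 * n + 3)" "\<And>e. e \<in> S \<Longrightarrow> e c \<noteq> 0"
  shows "lhol (3 * n + 3) S (\<lambda>e. normal_form n c e i)"
proof (cases "i < 2 * n")
  case True then show ?thesis using assms by (auto simp: normal_form_def scale_def intro!: lhol_coord)
next
  case False
  then have "(\<lambda>e. normal_form n c e i) = (\<lambda>e. 1 / e c * e i)" by (auto simp: normal_form_def scale_def)
  then show ?thesis using assms by (simp only:) (intro lhol_mult lhol_divide lhol_const lhol_coord; auto)
qed

lemma openin_coord_nonzero:
  fixes S :: "(nat \<Rightarrow> complex) set"
  shows "openin (top_of_set S) {e \<in> S. e c \<noteq> 0}"
proof -
  have "open {e :: nat \<Rightarrow> complex. e c \<noteq> 0}"
    by (intro open_Collect_neq continuous_intros)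
  moreover have "{e \<in> S. e c \<noteq> 0} = S \<inter> {e. e c \<noteq> 0}" by auto
  ultimately show ?thesis by auto
qed

text \<open>The retractions dehomogenize by a coordinate that is nonzero at the given point.\<close>

lemma local_retractions_family: "local_retractions (3 * n + 3) (family_cone n) (family_class n)"
  unfolding local_retractions_def
proof
  fix d assume d: "d \<in> family_cone n"
  then obtain c where c: "c \<ge> 2 * n" "d c \<noteq> 0" by (auto simp: family_cone_def)
  let ?W = "{e \<in> family_cone n. e c \<noteq> 0}"
  have 1: "\<forall>x\<in>?W. \<forall>y\<in>family_cone n. family_class n y = family_class n x \<longrightarrow> y \<in> ?W \<and> normal_form n c y = normal_form n c x"
    using class_coord_nonzero[OF _ _ _ c(1)] by blast
  have 2: "\<forall>i<3 * n + 3. lhol (3 * n + 3) ?W (\<lambda>x. normal_form n c x i)"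
    using family_cone_cspace by (auto intro!: lhol_normal_form)
  have 3: "\<forall>x\<in>?W. normal_form n c x \<in> family_cone n \<and> family_class n (normal_form n c x) = family_class n x"
    by (simp add: normal_form_cone normal_form_class)
  have 4: "openin (top_of_set (family_cone n)) ?W" by (rule openin_coord_nonzero)
  have 5: "d \<in> ?W" using d c by simp
  show "\<exists>W r. openin (top_of_set (family_cone n)) W \<and> d \<in> W \<and>
     (\<forall>x\<in>W. \<forall>y\<in>family_cone n. family_class n y = family_class n x \<longrightarrow> y \<in> W \<and> r y = r x) \<and>
     (\<forall>x\<in>W. r x \<in> family_cone n \<and> family_class n (r x) = family_class n x) \<and>
     (\<forall>i<3 * n + 3. lhol (3 * n + 3) W (\<lambda>x. r x i))"
    by (intro exI[of _ ?W] exI[of _ "normal_form n c"] conjI 1 2 3 4 5)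
qed

subsection \<open>The family is a complex space\<close>

text \<open>A continuous injection into a Hausdorff space: a line in the fibre coordinates is sent
  to the matrix \<open>e i * cnj (e j) / S e\<close> of the orthogonal projection onto it, and the
  base coordinates are recorded alongside.\<close>

lemma Hausdorff_family: "Hausdorff_space (Top (family n))"
proof -
  define S where "S = (\<lambda>e::nat \<Rightarrow> complex. \<Sum>k\<in>{2*n..<3*n+3}. e k * cnj (e k))"
  have S: "S e \<noteq> 0" if "e \<in> family_cone n" for e
  proof
    obtain c where c: "c \<in> {2 * n..<3 * n + 3}" "e c \<noteq> 0"
      using \<open>e \<in> family_cone n\<close> unfolding family_cone_def by blast
    assume "S e = 0"
    moreover have "S e = of_real (\<Sum>k\<in>{2*n..<3*n+3}. (cmod (e k))\<^sup>2)"
      by (simp add: S_def complex_norm_square[symmetric] del: of_real_power)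
    ultimately have "(\<Sum>k\<in>{2*n..<3*n+3}. (cmod (e k))\<^sup>2) = 0" using of_real_eq_0_iff by metis
    then have "cmod (e c) ^ 2 = 0" using c by (subst (asm) sum_nonneg_eq_0_iff) auto
    then show False using c by simp
  qed
  define F where "F = (\<lambda>e i j. if i < 2 * n then e i else if j < 2 * n then 0 else e i * cnj (e j) / S e)"
  have Fs: "F (scale n l e) = F e" if "l \<noteq> 0" for l e
  proof -
    have "S (scale n l e) = l * cnj l * S e"
      by (auto simp: S_def scale_def sum_distrib_left intro!: sum.cong)
    then show ?thesis using that by (auto simp: F_def scale_def fun_eq_iff)
  qed
  define G where "G = (\<lambda>x. F (SOME e. e \<in> x))"
  have G: "G (family_class n e) = F e" if e: "e \<in> family_cone n" for e
  proof -
    obtain l where "l \<noteq> 0" "(SOME f. f \<in> family_class n e) = scale n l e"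
      using some_in_family_class[OF e] by blast
    then show ?thesis using Fs by (simp add: G_def)
  qed
  have "continuous_on (family_cone n) F"
  proof (intro continuous_on_coordinatewise_then_product)
    fix i j
    show "continuous_on (family_cone n) (\<lambda>e. F e i j)"
      unfolding F_def S_def
      by (cases "i < 2 * n"; cases "j < 2 * n") (use S in \<open>auto simp: S_def intro!: continuous_intros\<close>)
  qed
  then have "continuous_on (family_cone n) (\<lambda>e. G (family_class n e))"
    using G by (simp cong: continuous_on_cong)
  then have "continuous_map (Top (family n)) euclidean G"
    by (intro continuous_map_uniformized[OF uniformized_family]) (simp add: continuous_map_iff_continuous2)
  moreover have "inj_on G (pts (family n))"
  proof (rule inj_onI)
    fix x y assume "x \<in> pts (family n)" "y \<in> pts (family n)" and eq: "G x = G y"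
    then obtain e f where e: "e \<in> family_cone n" "x = family_class n e" and f: "f \<in> family_cone n" "y = family_class n f"
      by (auto simp: pts_family)
    have FF: "F e i j = F f i j" for i j using eq e f G by simp
    obtain c where c: "c \<ge> 2 * n" "e c \<noteq> 0" using e by (auto simp: family_cone_def)
    have "f c \<noteq> 0" using FF[of c c] c S e f by (auto simp: F_def)
    \<comment> \<open>Equality of the columns \<open>c\<close> of the two projection matrices makes
      the vectors proportional with this factor.\<close>
    define l where "l = cnj (e c) * S f / (S e * cnj (f c))"
    have "f = scale n l e"
    proof
      fix i
      have "f i * (cnj (f c) / S f) = e i * (cnj (e c) / S e)" if "i \<ge> 2 * n"
        using FF[of i c] c that by (simp add: F_def)
      then have "f i = l * e i" if "i \<ge> 2 * n"
        using that \<open>f c \<noteq> 0\<close> S[OF f(1)] S[OF e(1)] by (simp add: l_def field_simps)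
      then show "f i = scale n l e i" using FF[of i i] by (auto simp: scale_def F_def)
    qed
    moreover have "l \<noteq> 0" using c \<open>f c \<noteq> 0\<close> S e f by (simp add: l_def)
    ultimately show "x = y" using family_class_eq_iff e f by blast
  qed
  ultimately show ?thesis
    using Hausdorff_space_injective_preimage[of euclidean "Top (family n)" G] by auto
qed

lemma lhol_branch_form:
  assumes "S \<subseteq> cspace N" shows "lhol N S (branch_form n)"
proof -
  have "lhol N S (\<lambda>e. branch_form n e)"
    unfolding branch_form_def zero_form_def infinity_form_def
    by (intro lhol_mult lhol_contraction lhol_const lhol_minus lhol_coord assms)
      (auto simp: curve_coord_def intro!: lhol_coord assms)
  then show ?thesis by simp
qed

text \<open>The chart at a point with \<open>e c \<noteq> 0\<close> is the part
  \<open>e c = 1\<close> of the cone, with \<open>normal_form\<close> as chart map. It is an affine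
  variety, because \<open>e c = 1\<close> already implies the open condition that some fibre
  coordinate is nonzero.\<close>

lemma complex_space_family: "complex_space (family n)"
  unfolding complex_space_def
proof (intro conjI ballI)
  let ?N = "3 * n + 3"
  fix x assume "x \<in> pts (family n)"
  then obtain e where e: "e \<in> family_cone n" "x = family_class n e" by (auto simp: pts_family)
  then obtain c where c: "c \<in> {2 * n..<3 * n + 3}" "e c \<noteq> 0" by (auto simp: family_cone_def)
  then have cn: "c \<ge> 2 * n" by simp
  define E1 where "E1 = {e \<in> family_cone n. e c \<noteq> 0}"
  define A where "A = {e \<in> family_cone n. e c = 1}"
  define U where "U = family_class n ` E1"
  have UX: "U \<subseteq> pts (family n)" by (auto simp: U_def E1_def pts_family)
  have sat: "{e \<in> family_cone n. family_class n e \<in> U} = E1"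
    using class_coord_nonzero(1)[OF _ _ _ cn] by (auto simp: U_def E1_def)
  have oU: "openin (Top (family n)) U"
    using uniformizedD(4)[OF uniformized_family UX] openin_coord_nonzero unfolding sat E1_def by simp
  have AN: "A \<subseteq> cspace ?N" using family_cone_cspace by (auto simp: A_def)
  have "analytic_model ?N A"
    unfolding analytic_model_def
  proof (intro exI conjI)
    let ?F = "(\<lambda>(i, j) e. curve_coord n e i * curve_coord n e (Suc j) - curve_coord n e (Suc i) * curve_coord n e j)
        ` ({..<n} \<times> {..<n}) \<union> {\<lambda>e. e (2 * n) * e (2 * n + 1) - branch_form n e, \<lambda>e. e c - 1}"
    show "openin (top_of_set (cspace ?N)) (cspace ?N)" by simp
    show "finite ?F" by auto
    show "?F \<subseteq> ahol ?N (cspace ?N)"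
    proof
      fix f assume f: "f \<in> ?F"
      have "lhol ?N (cspace ?N) f"
      proof -
        have "lhol ?N (cspace ?N) (\<lambda>e. curve_coord n e i * curve_coord n e (Suc j) - curve_coord n e (Suc i) * curve_coord n e j)" for i j
          unfolding curve_coord_def by (intro lhol_intros) auto
        moreover have "lhol ?N (cspace ?N) (\<lambda>e. e (2 * n) * e (2 * n + 1) - branch_form n e)"
          by (intro lhol_diff lhol_mult lhol_coord lhol_branch_form) auto
        moreover have "lhol ?N (cspace ?N) (\<lambda>e. e c - 1)" by (intro lhol_intros) auto
        ultimately show ?thesis using f by auto
      qed
      then show "f \<in> ahol ?N (cspace ?N)" by (rule lhol_open_imp_ahol[OF openin_cspace])
    qed
    show "A = {p \<in> cspace ?N. \<forall>f\<in>?F. f p = 0}"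
    proof (intro set_eqI iffI)
      fix e assume "e \<in> A"
      then show "e \<in> {p \<in> cspace ?N. \<forall>f\<in>?F. f p = 0}" by (auto simp: A_def family_cone_def on_curve_def)
    next
      fix e assume e: "e \<in> {p \<in> cspace ?N. \<forall>f\<in>?F. f p = 0}"
      then have "on_curve n (curve_coord n e)" by (force simp: on_curve_def)
      moreover have "e c = 1" "e (2 * n) * e (2 * n + 1) = branch_form n e" using e by auto
      moreover have "\<exists>k\<in>{2 * n..<3 * n + 3}. e k \<noteq> 0" using c(1) \<open>e c = 1\<close> by (intro bexI[of _ c]) auto
      ultimately show "e \<in> A" using e unfolding A_def family_cone_def by blast
    qed
  qed
  define \<phi> where "\<phi> = (\<lambda>x. normal_form n c (SOME e. e \<in> E1 \<and> family_class n e = x))"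
  have \<phi>: "\<phi> (family_class n e) = normal_form n c e" if e: "e \<in> E1" for e
  proof -
    have "\<exists>f. f \<in> E1 \<and> family_class n f = family_class n e" using e by blast
    from someI_ex[OF this]
    have "(SOME f. f \<in> E1 \<and> family_class n f = family_class n e) \<in> family_cone n"
      "family_class n (SOME f. f \<in> E1 \<and> family_class n f = family_class n e) = family_class n e"
      by (auto simp: E1_def)
    from class_coord_nonzero(2)[OF this(1) _ this(2) cn] show ?thesis
      unfolding \<phi>_def using e by (auto simp: E1_def)
  qed
  have uU: "uniformized ?N E1 (family_class n) (subspace_on (family n) U)"
    using uniformized_subspace[OF uniformized_family local_retractions_family, of n U] oU sat by simp
  have uA: "uniformized ?N A (\<lambda>d. d) (subspace_on (affine_space ?N) A)"
    by (rule uniformized_affine[OF AN])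
  have TA: "Top (subspace_on (affine_space ?N) A) = top_of_set A"
    using AN by (simp add: subspace_on_def subtopology_subtopology Int_absorb1)
  have nA: "normal_form n c e \<in> A" if "e \<in> E1" for e
    using that normal_form_cone normal_form_coord[of e c n] cn by (auto simp: A_def E1_def)
  have AE: "A \<subseteq> E1" by (auto simp: A_def E1_def)
  have nh: "lhol ?N E1 (\<lambda>e. normal_form n c e i)" for i
    by (rule lhol_normal_form) (use family_cone_cspace in \<open>auto simp: E1_def\<close>)
  have "homeomorphic_maps (Top (subspace_on (family n) U)) (top_of_set A) \<phi> (family_class n)"
    unfolding homeomorphic_maps_def
  proof (intro conjI ballI)
    have "continuous_on E1 (\<lambda>e. normal_form n c e)"
      by (rule lhol_map_continuous[OF nh]) (use nA AN in blast)
    then have "continuous_map (top_of_set E1) (top_of_set A) (\<lambda>e. normal_form n c e)"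
      using nA by (auto simp: continuous_map_in_subtopology)
    then have "continuous_map (top_of_set E1) (top_of_set A) (\<lambda>e. \<phi> (family_class n e))"
      by (rule continuous_map_eq) (simp add: \<phi>)
    then show "continuous_map (Top (subspace_on (family n) U)) (top_of_set A) \<phi>"
      by (rule continuous_map_uniformized[OF uU])
    have "continuous_map (top_of_set E1) (Top (subspace_on (family n) U)) (family_class n)"
      by (rule uniformizedD(6)[OF uU])
    then have "continuous_map (subtopology (top_of_set E1) A) (Top (subspace_on (family n) U)) (family_class n)"
      by (rule continuous_map_from_subtopology)
    then show "continuous_map (top_of_set A) (Top (subspace_on (family n) U)) (family_class n)"
      using AE by (simp add: subtopology_subtopology Int_absorb1)
    fix x assume "x \<in> pts (subspace_on (family n) U)"
    then have "x \<in> family_class n ` E1" using uniformizedD(3)[OF uU] by simp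
    then obtain e where e: "e \<in> E1" "x = family_class n e" by blast
    then show "family_class n (\<phi> x) = x"
      using normal_form_class by (simp add: \<phi> E1_def)
  next
    fix y assume "y \<in> topspace (top_of_set A)"
    then have y: "y \<in> A" by simp
    then show "\<phi> (family_class n y) = y"
      using AE by (auto simp: \<phi> A_def normal_form_id)
  qed
  then have "homeomorphic_map (Top (subspace_on (family n) U)) (top_of_set A) \<phi>"
    using homeomorphic_map_maps by blast
  then have h: "homeomorphic_map (Top (subspace_on (family n) U)) (Top (subspace_on (affine_space ?N) A)) \<phi>"
    unfolding TA .
  have "biholomorphic (subspace_on (family n) U) (subspace_on (affine_space ?N) A) \<phi>"
  proof (rule uniformized_biholomorphic[OF uA uU h, where \<Psi> = "\<lambda>d. d"])
    show "lhol ?N A (\<lambda>d. d i)" for i by (rule lhol_coord[OF AN])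
    show "d \<in> E1" if "d \<in> A" for d using that AE by blast
    show "\<phi> (family_class n d) = d" if "d \<in> A" for d
      using that AE by (auto simp: \<phi> A_def normal_form_id)
    fix V g assume g: "lhol ?N {d \<in> A. d \<in> V} (\<lambda>d. g d)"
    have "lhol ?N {e \<in> E1. normal_form n c e \<in> V} (\<lambda>e. g (normal_form n c e))"
      by (rule lhol_compose[OF g]) (use nA nh family_cone_cspace in \<open>auto simp: E1_def intro: lhol_subset\<close>)
    moreover have "{x \<in> E1. \<phi> (family_class n x) \<in> V} = {e \<in> E1. normal_form n c e \<in> V}" by (auto simp: \<phi>)
    ultimately show "lhol ?N {x \<in> E1. \<phi> (family_class n x) \<in> V} (\<lambda>x. g (\<phi> (family_class n x)))"
      by (subst lhol_cong[where g = "\<lambda>e. g (normal_form n c e)"]) (auto simp: \<phi>)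
  qed
  moreover have "x \<in> U" using e c by (auto simp: U_def E1_def)
  ultimately show "\<exists>U N A \<phi>. openin (Top (family n)) U \<and> x \<in> U \<and> analytic_model N A \<and>
        biholomorphic (subspace_on (family n) U) (subspace_on (affine_space N) A) \<phi>"
    using oU \<open>analytic_model ?N A\<close> by blast
next
  show "Hausdorff_space (Top (family n))" by (rule Hausdorff_family)
  show "is_sheaf (family n)" by (rule uniformized_is_sheaf[OF uniformized_family])
qed

subsection \<open>The base map is proper\<close>

lemma base_part_cspace: "base_part n e \<in> cspace (2 * n)"
  by (simp add: base_part_def cspace_def)

lemma continuous_on_base_part: "continuous_on S (base_part n)"
proof (rule continuous_on_coordinatewise_then_product)
  fix i show "continuous_on S (\<lambda>e. base_part n e i)"
    by (cases "i < 2 * n") (auto simp: base_part_def intro!: continuous_intros)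
qed

lemma continuous_map_base_map: "continuous_map (Top (family n)) (top_of_set (cspace (2 * n))) (base_map n)"
proof (rule continuous_map_uniformized[OF uniformized_family])
  have "continuous_map (top_of_set (family_cone n)) (top_of_set (cspace (2 * n))) (base_part n)"
    using base_part_cspace continuous_on_base_part by (auto simp: continuous_map_in_subtopology continuous_map_iff_continuous2)
  then show "continuous_map (top_of_set (family_cone n)) (top_of_set (cspace (2 * n))) (\<lambda>d. base_map n (family_class n d))"
    by (rule continuous_map_eq) simp
qed

lemma hol_map_base_map:
  "hol_map (family n) (subspace_on (affine_space (2 * n)) (cspace (2 * n))) (base_map n)"
  unfolding hol_map_def
proof (intro conjI allI impI)
  have T: "Top (subspace_on (affine_space (2 * n)) (cspace (2 * n))) = top_of_set (cspace (2 * n))"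
    by (simp add: subspace_on_def subtopology_subtopology)
  show "continuous_map (Top (family n)) (Top (subspace_on (affine_space (2 * n)) (cspace (2 * n)))) (base_map n)"
    unfolding T by (rule continuous_map_base_map)
  fix V g assume "openin (Top (subspace_on (affine_space (2 * n)) (cspace (2 * n)))) V \<and>
       g \<in> Hol (subspace_on (affine_space (2 * n)) (cspace (2 * n))) V"
  then have g: "lhol (2 * n) V g" by (simp add: Hol_subspace_affine)
  let ?U = "{x \<in> pts (family n). base_map n x \<in> V}"
  have eq: "{e \<in> family_cone n. family_class n e \<in> ?U} = {e \<in> family_cone n. base_part n e \<in> V}"
    by (auto simp: pts_family)
  have "lhol (3 * n + 3) {e \<in> family_cone n. base_part n e \<in> V} (\<lambda>e. g (base_part n e))"
  proof (rule lhol_compose[OF g])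
    fix i assume "i < 2 * n"
    then show "lhol (3 * n + 3) {e \<in> family_cone n. base_part n e \<in> V} (\<lambda>p. base_part n p i)"
      using family_cone_cspace by (auto simp: base_part_def intro!: lhol_coord)
  qed (use family_cone_cspace in auto)
  then have "lhol (3 * n + 3) {e \<in> family_cone n. base_part n e \<in> V} (\<lambda>e. (g \<circ> base_map n) (family_class n e))"
    by (subst lhol_cong[where g = "\<lambda>e. g (base_part n e)"]) auto
  then show "g \<circ> base_map n \<in> Hol (family n) ?U"
    using uniformizedD(5)[OF uniformized_family, of ?U n "g \<circ> base_map n"] unfolding eq by auto
qed

lemma continuous_on_contraction:
  assumes "\<And>k. continuous_on S (\<lambda>p. \<alpha> p k)" "\<And>k. continuous_on S (\<lambda>p. \<beta> p k)" "\<And>k. continuous_on S (\<lambda>p. w p k)"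
  shows "continuous_on S (\<lambda>p. contraction (\<alpha> p) (\<beta> p) (w p) m i)"
  by (induction m arbitrary: i) (auto intro!: continuous_on_add continuous_on_mult assms)

lemma continuous_on_branch_form: "continuous_on S (branch_form n)"
proof -
  have "continuous_on S (\<lambda>e. branch_form n e)"
    unfolding branch_form_def zero_form_def infinity_form_def curve_coord_def
    by (intro continuous_on_mult continuous_on_contraction continuous_on_const continuous_on_minus continuous_on_coord_id)
  then show ?thesis by simp
qed

lemma compact_Pi_UNIV:
  assumes "\<And>i. compact (K i :: complex set)"
  shows "compact (Pi\<^sub>E UNIV K :: (nat \<Rightarrow> complex) set)"
  using assms compactin_PiE[of "\<lambda>_. euclidean" UNIV K] by (simp add: euclidean_product_topology)

lemma closed_cspace: "closed (cspace N)"
proof -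
  have "cspace N = (\<Inter>i\<in>{N..}. {p. p i = 0})" by (auto simp: cspace_def)
  then show ?thesis by (auto intro!: closed_INT closed_Collect_eq continuous_intros)
qed

text \<open>Every class has a representative in which a fibre coordinate of largest modulus equals
  1. Over a compact set of parameters such representatives lie in a closed subset of a product of
  compact sets, whose image is the preimage in question.\<close>

lemma compact_preimage_base:
  assumes K: "compact K" "K \<subseteq> cspace (2 * n)"
  shows "compactin (Top (family n)) {x \<in> pts (family n). base_map n x \<in> K}"
proof -
  let ?I = "{2 * n..<3 * n + 3}"
  define C where "C = {e. \<exists>c\<in>?I. cmod (e c) = 1} \<inter> {e. on_curve n (curve_coord n e)} \<inter>
     {e. e (2 * n) * e (2 * n + 1) = branch_form n e} \<inter> cspace (3 * n + 3) \<inter> base_part n -` K"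
  define L where "L = (\<lambda>i. if i < 2 * n then (\<lambda>e. e i) ` K else cball (0::complex) 1)"
  have "closed C"
    unfolding C_def
  proof (intro closed_Int closed_cspace)
    have "{e. \<exists>c\<in>?I. cmod (e c) = 1} = (\<Union>c\<in>?I. {e. cmod (e c) = 1})" by auto
    also have "closed \<dots>" by (intro closed_UN) (auto intro!: closed_Collect_eq continuous_intros)
    finally show "closed {e. \<exists>c\<in>?I. cmod (e c) = 1}" .
    have "{e. on_curve n (curve_coord n e)} =
        (\<Inter>i\<in>{..<n}. \<Inter>j\<in>{..<n}. {e. e (2*n+2+i) * e (2*n+2+Suc j) = e (2*n+2+Suc i) * e (2*n+2+j)})"
      by (auto simp: on_curve_def curve_coord_def)
    also have "closed \<dots>" by (intro closed_INT ballI closed_Collect_eq continuous_intros)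
    finally show "closed {e. on_curve n (curve_coord n e)}" .
    show "closed {e. e (2 * n) * e (2 * n + 1) = branch_form n e}"
      by (intro closed_Collect_eq continuous_intros continuous_on_branch_form)
    show "closed (base_part n -` K)"
      using continuous_on_base_part[of UNIV n] compact_imp_closed[OF K(1)] by (simp add: continuous_on_closed_vimage)
  qed
  moreover have "compact (Pi\<^sub>E UNIV L)"
  proof (rule compact_Pi_UNIV)
    fix i show "compact (L i)"
      unfolding L_def using K(1) by (auto intro!: compact_continuous_image continuous_intros)
  qed
  ultimately have cC: "compact (C \<inter> Pi\<^sub>E UNIV L)" by (rule closed_Int_compact)
  have sub: "C \<inter> Pi\<^sub>E UNIV L \<subseteq> family_cone n"
    by (force simp: C_def family_cone_def)
  have "compactin (top_of_set (family_cone n)) (C \<inter> Pi\<^sub>E UNIV L)"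
    using cC sub by (simp add: compactin_subtopology)
  then have "compactin (Top (family n)) (family_class n ` (C \<inter> Pi\<^sub>E UNIV L))"
    by (rule image_compactin) (rule uniformizedD(6)[OF uniformized_family])
  moreover have "family_class n ` (C \<inter> Pi\<^sub>E UNIV L) = {x \<in> pts (family n). base_map n x \<in> K}"
  proof (intro set_eqI iffI)
    fix x assume "x \<in> family_class n ` (C \<inter> Pi\<^sub>E UNIV L)"
    then obtain e where "e \<in> C" "e \<in> family_cone n" "x = family_class n e" using sub by blast
    then show "x \<in> {x \<in> pts (family n). base_map n x \<in> K}" by (auto simp: pts_family C_def)
  next
    fix x assume x: "x \<in> {x \<in> pts (family n). base_map n x \<in> K}"
    then obtain e where e: "e \<in> family_cone n" "x = family_class n e" by (auto simp: pts_family)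
    define M where "M = Max ((\<lambda>c. cmod (e c)) ` ?I)"
    have "M \<in> (\<lambda>c. cmod (e c)) ` ?I" unfolding M_def by (rule Max_in) auto
    then obtain c where c: "c \<in> ?I" "M = cmod (e c)" by blast
    have le: "cmod (e k) \<le> cmod (e c)" if "k \<in> ?I" for k
      unfolding c(2)[symmetric] M_def by (rule Max_ge) (use that in auto)
    obtain c' where "c' \<in> ?I" "e c' \<noteq> 0" using e by (auto simp: family_cone_def)
    then have ec: "e c \<noteq> 0" using le[of c'] by auto
    let ?f = "normal_form n c e"
    have f: "?f \<in> family_cone n" "family_class n ?f = x" using normal_form_cone normal_form_class e ec by auto
    have bf: "base_part n ?f \<in> K" using x f base_map_class[OF f(1)] by auto
    have "?f c = 1" using normal_form_coord ec c by auto
    then have "?f \<in> C" using f(1) bf c(1) by (auto simp: C_def family_cone_def intro!: bexI[of _ c])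
    moreover have "?f i \<in> L i" for i
    proof (cases "i < 2 * n")
      case True
      then show ?thesis using bf by (auto simp: L_def base_part_def image_iff intro!: bexI[OF _ bf])
    next
      case False
      show ?thesis
      proof (cases "i < 3 * n + 3")
        case True
        then have "cmod (e i) \<le> cmod (e c)" using False le[of i] by simp
        then show ?thesis using False ec by (simp add: L_def normal_form_def scale_def norm_divide divide_simps)
      next
        case F2: False
        then have "?f i = 0" using f(1) by (auto simp: family_cone_def cspace_def)
        then show ?thesis using False by (simp add: L_def)
      qed
    qed
    ultimately show "x \<in> family_class n ` (C \<inter> Pi\<^sub>E UNIV L)" using f(2) by blast
  qed
  ultimately show ?thesis by simp
qed

text \<open>The base is metrizable, hence compactly generated and Hausdorff, so properness reduces
  to compactness of the preimages of compact sets.\<close>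

lemma proper_base_map: "proper_map (Top (family n)) (top_of_set (cspace (2 * n))) (base_map n)"
proof (rule compact_imp_proper_map)
  have m: "metrizable_space (top_of_set (cspace (2 * n)))"
    by (simp add: metrizable_space_subtopology metrizable_space_euclidean)
  show "k_space (top_of_set (cspace (2 * n)))" using m by (simp add: metrizable_imp_k_space)
  show "kc_space (top_of_set (cspace (2 * n)))" using m by (simp add: Hausdorff_imp_kc_space metrizable_imp_Hausdorff_space)
  show "base_map n \<in> pts (family n) \<rightarrow> topspace (top_of_set (cspace (2 * n)))"
    by (auto simp: base_map_def base_part_cspace)
  show "continuous_map (Top (family n)) (top_of_set (cspace (2 * n))) (base_map n) \<or> kc_space (Top (family n))"
    using continuous_map_base_map by blast
  fix K assume "compactin (top_of_set (cspace (2 * n))) K"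
  then show "compactin (Top (family n)) {x \<in> pts (family n). base_map n x \<in> K}"
    using compact_preimage_base by (simp add: compactin_subtopology)
qed

subsection \<open>The real structure of the family\<close>

text \<open>The base coordinates are conjugated as well, so the resulting real structure covers
  conjugation on the base and preserves the fibres over real parameters.\<close>

definition conj_swap :: "nat \<Rightarrow> (nat \<Rightarrow> complex) \<Rightarrow> nat \<Rightarrow> complex" where
  "conj_swap n e i = cnj (e (if i = 2 * n then 2 * n + 1 else if i = 2 * n + 1 then 2 * n else i))"

definition family_real :: "nat \<Rightarrow> (nat \<Rightarrow> complex) set \<Rightarrow> (nat \<Rightarrow> complex) set" where
  "family_real n = image (conj_swap n)"

lemma conj_swap_invol [simp]: "conj_swap n (conj_swap n e) = e"
  by (auto simp: conj_swap_def fun_eq_iff)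

lemma conj_swap_cspace: "N > 2 * n + 1 \<Longrightarrow> e \<in> cspace N \<Longrightarrow> conj_swap n e \<in> cspace N"
  by (auto simp: conj_swap_def cspace_def)

lemma conj_swap_branch_form: "branch_form n (conj_swap n e) = cnj (branch_form n e)"
  unfolding branch_form_def zero_form_def infinity_form_def complex_cnj_mult contraction_cnj
  by (intro arg_cong2[where f = "(*)"] contraction_cong) (auto simp: conj_swap_def curve_coord_def)

lemma conj_swap_cone:
  assumes "e \<in> family_cone n" shows "conj_swap n e \<in> family_cone n"
proof -
  obtain c where c: "c \<in> {2 * n..<3 * n + 3}" "e c \<noteq> 0" using assms unfolding family_cone_def by blast
  have "\<exists>c\<in>{2 * n..<3 * n + 3}. conj_swap n e c \<noteq> 0"
  proof -
    have "conj_swap n e (if c = 2 * n then 2 * n + 1 else if c = 2 * n + 1 then 2 * n else c) \<noteq> 0"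
      using c by (auto simp: conj_swap_def)
    moreover have "(if c = 2 * n then 2 * n + 1 else if c = 2 * n + 1 then 2 * n else c) \<in> {2 * n..<3 * n + 3}"
      using c by auto
    ultimately show ?thesis by blast
  qed
  moreover have "on_curve n (curve_coord n (conj_swap n e))"
    using assms by (auto simp: family_cone_def on_curve_def curve_coord_def conj_swap_def simp flip: complex_cnj_mult)
  moreover have "cnj (e (2 * n)) * cnj (e (2 * n + 1)) = cnj (branch_form n e)"
    using assms by (auto simp: family_cone_def simp flip: complex_cnj_mult)
  then have "conj_swap n e (2 * n) * conj_swap n e (2 * n + 1) = branch_form n (conj_swap n e)"
    unfolding conj_swap_branch_form by (simp add: conj_swap_def mult.commute)
  ultimately show ?thesis using assms conj_swap_cspace[of n "3 * n + 3" e] by (auto simp: family_cone_def)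
qed

lemma conj_swap_scale: "conj_swap n (scale n l e) = scale n (cnj l) (conj_swap n e)"
  by (auto simp: conj_swap_def scale_def)

lemma family_real_class:
  assumes "e \<in> family_cone n" shows "family_real n (family_class n e) = family_class n (conj_swap n e)"
proof (intro set_eqI iffI)
  fix f assume "f \<in> family_real n (family_class n e)"
  then obtain l where "l \<noteq> 0" "f = conj_swap n (scale n l e)" by (auto simp: family_real_def family_class_def family_rel_def)
  then show "f \<in> family_class n (conj_swap n e)"
    using assms by (auto simp: family_class_def family_rel_def conj_swap_scale scale_family_cone conj_swap_cone)
next
  fix f assume "f \<in> family_class n (conj_swap n e)"
  then obtain l where "l \<noteq> 0" "f = scale n l (conj_swap n e)" by (auto simp: family_class_def family_rel_def)
  then have "f = conj_swap n (scale n (cnj l) e)" "scale n (cnj l) e \<in> family_class n e"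
    using assms by (auto simp: family_class_def family_rel_def conj_swap_scale scale_family_cone)
  then show "f \<in> family_real n (family_class n e)" by (auto simp: family_real_def)
qed

lemma base_part_conj_swap: "base_part n (conj_swap n e) i = cnj (base_part n e i)"
  by (auto simp: base_part_def conj_swap_def)

lemma base_map_real: "x \<in> pts (family n) \<Longrightarrow> base_map n (family_real n x) i = cnj (base_map n x i)"
  by (auto simp: pts_family family_real_class conj_swap_cone base_part_conj_swap)

text \<open>Conjugating arguments and values together preserves holomorphy, and the exchange of x
  and y is a permutation of the coordinates.\<close>

lemma lhol_conj_swap:
  assumes f: "lhol (3 * n + 3) S f"
  shows "lhol (3 * n + 3) {e. conj_swap n e \<in> S} (\<lambda>e. cnj (f (conj_swap n e)))"
proof -
  let ?s = "\<lambda>i. if i = 2 * n then 2 * n + 1 else if i = 2 * n + 1 then 2 * n else i"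
  have eq: "conj_swap n e = (\<lambda>i. cnj (e (?s i)))" for e by (auto simp: conj_swap_def)
  have sub: "{e. conj_swap n e \<in> S} \<subseteq> cspace (3 * n + 3)"
  proof
    fix e assume "e \<in> {e. conj_swap n e \<in> S}"
    then have "conj_swap n e \<in> cspace (3 * n + 3)" using lhol_sub_cspace[OF f] by auto
    from conj_swap_cspace[OF _ this, of n] show "e \<in> cspace (3 * n + 3)" by simp
  qed
  have "lhol (3 * n + 3) {e. conj_swap n e \<in> S} (\<lambda>e. cnj (f (\<lambda>i. cnj ((\<lambda>i. e (?s i)) i))))"
    by (rule lhol_compose[OF lhol_cnj[OF f]]) (use sub in \<open>auto simp: eq intro: lhol_coord\<close>)
  then show ?thesis by (simp add: eq)
qed

lemma real_structure_family: "real_structure (family n) (family_real n)"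
  unfolding real_structure_def
proof (intro conjI ballI allI impI)
  have "continuous_on (family_cone n) (conj_swap n)"
  proof (rule continuous_on_coordinatewise_then_product)
    show "continuous_on (family_cone n) (\<lambda>e. conj_swap n e i)" for i
      unfolding conj_swap_def by (intro continuous_on_cnj continuous_on_coord_id)
  qed
  then have "continuous_map (top_of_set (family_cone n)) (top_of_set (family_cone n)) (conj_swap n)"
    using conj_swap_cone by (auto simp: continuous_map_in_subtopology continuous_map_iff_continuous2)
  then have "continuous_map (top_of_set (family_cone n)) (Top (family n)) (family_class n \<circ> conj_swap n)"
    by (rule continuous_map_compose) (rule uniformizedD(6)[OF uniformized_family])
  then have "continuous_map (top_of_set (family_cone n)) (Top (family n)) (\<lambda>e. family_real n (family_class n e))"
    by (rule continuous_map_eq) (simp add: family_real_class)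
  then show "continuous_map (Top (family n)) (Top (family n)) (family_real n)"
    by (rule continuous_map_uniformized[OF uniformized_family])
  show "family_real n (family_real n x) = x" if "x \<in> pts (family n)" for x
    using that by (auto simp: pts_family family_real_class conj_swap_cone)
  fix U f assume "openin (Top (family n)) U \<and> f \<in> Hol (family n) U"
  then have UX: "U \<subseteq> pts (family n)" and f: "f \<in> Hol (family n) U" using openin_subset by auto
  let ?V = "{x \<in> pts (family n). family_real n x \<in> U}"
  have "lhol (3 * n + 3) {e \<in> family_cone n. family_class n e \<in> U} (\<lambda>e. f (family_class n e))"
    using uniformizedD(5)[OF uniformized_family UX] f by blast
  then have "lhol (3 * n + 3) {e. conj_swap n e \<in> {e \<in> family_cone n. family_class n e \<in> U}}
      (\<lambda>e. cnj (f (family_class n (conj_swap n e))))"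
    by (rule lhol_conj_swap)
  moreover have eq: "{e. conj_swap n e \<in> {e \<in> family_cone n. family_class n e \<in> U}} =
      {e \<in> family_cone n. family_class n e \<in> ?V}"
  proof (intro set_eqI iffI)
    fix e assume e: "e \<in> {e. conj_swap n e \<in> {e \<in> family_cone n. family_class n e \<in> U}}"
    then have "conj_swap n (conj_swap n e) \<in> family_cone n" using conj_swap_cone by blast
    then show "e \<in> {e \<in> family_cone n. family_class n e \<in> ?V}" using e by (auto simp: pts_family family_real_class)
  next
    fix e assume "e \<in> {e \<in> family_cone n. family_class n e \<in> ?V}"
    then show "e \<in> {e. conj_swap n e \<in> {e \<in> family_cone n. family_class n e \<in> U}}"
      by (auto simp: family_real_class conj_swap_cone)
  qed
  ultimately have "lhol (3 * n + 3) {e \<in> family_cone n. family_class n e \<in> ?V} (\<lambda>e. cnj (f (family_class n (conj_swap n e))))"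
    by simp
  then have "lhol (3 * n + 3) {e \<in> family_cone n. family_class n e \<in> ?V} (\<lambda>e. cnj (f (family_real n (family_class n e))))"
    by (subst lhol_cong[where g = "\<lambda>e. cnj (f (family_class n (conj_swap n e)))"]) (auto simp: family_real_class)
  then show "(\<lambda>x. cnj (f (family_real n x))) \<in> Hol (family n) ?V"
    using uniformizedD(5)[OF uniformized_family, of ?V n "\<lambda>x. cnj (f (family_real n x))"] by auto
qed

subsection \<open>Functions vanishing over coordinate subspaces of the base\<close>

lemma polydisc_mono: "s \<le> r \<Longrightarrow> polydisc N b (\<lambda>_. s) \<subseteq> polydisc N b (\<lambda>_. r)"
  unfolding polydisc_def by force

lemma reset_polydisc: "p \<in> polydisc N b (\<lambda>_. r) \<Longrightarrow> 0 < r \<Longrightarrow> b \<in> cspace N \<Longrightarrow> reset j b p \<in> polydisc N b (\<lambda>_. r)"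
  by (auto simp: polydisc_def reset_def cspace_def)

lemma preimage_polydisc:
  assumes V: "openin (top_of_set (cspace N)) V" and e0: "e0 \<in> cspace N" "\<rho> e0 \<in> V"
    and \<rho>: "continuous_on (cspace N) \<rho>" "\<rho> ` cspace N \<subseteq> cspace N"
  obtains r where "r > 0" "\<And>e. e \<in> polydisc N e0 (\<lambda>_. r) \<Longrightarrow> \<rho> e \<in> V"
proof -
  have "openin (top_of_set (cspace N)) (cspace N \<inter> \<rho> -` V)"
    by (rule continuous_openin_preimage[OF \<rho>(1) _ V]) (use \<rho>(2) in auto)
  then obtain r where "r > 0" "polydisc N e0 (\<lambda>_. r) \<subseteq> cspace N \<inter> \<rho> -` V"
    using polydisc_in[of N "cspace N \<inter> \<rho> -` V" e0] e0 by auto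
  then show ?thesis using that by blast
qed

lemma local_representative:
  assumes Z: "openin (top_of_set (family_cone n)) Z" and e0: "e0 \<in> Z" and F: "lhol (3 * n + 3) Z F"
  obtains V g where "openin (top_of_set (cspace (3 * n + 3))) V" "e0 \<in> V" "g \<in> ahol (3 * n + 3) V"
    "\<And>e. e \<in> V \<Longrightarrow> e \<in> family_cone n \<Longrightarrow> e \<in> Z \<and> F e = g e"
proof -
  obtain T where T: "open T" "Z = family_cone n \<inter> T" using Z by (auto simp: openin_open)
  obtain V g where V: "openin (top_of_set (cspace (3 * n + 3))) V" "e0 \<in> V" "g \<in> ahol (3 * n + 3) V"
    "\<And>q. q \<in> V \<Longrightarrow> q \<in> Z \<Longrightarrow> F q = g q" using lholE[OF F e0] by blast
  show ?thesis
  proof (rule that[of "V \<inter> T" g])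
    show "openin (top_of_set (cspace (3 * n + 3))) (V \<inter> T)" using V(1) T(1) by (auto simp: openin_open)
    show "e0 \<in> V \<inter> T" using V(2) e0 T(2) by auto
    show "g \<in> ahol (3 * n + 3) (V \<inter> T)" by (rule ahol_subset[OF V(3)]) auto
  qed (use V(4) T(2) in auto)
qed

lemma ahol_compose_cspace:
  assumes V: "openin (top_of_set (cspace N)) V" and f: "f \<in> ahol N V"
    and W: "openin (top_of_set (cspace N)) W"
    and \<rho>: "\<And>i. lhol N (cspace N) (\<lambda>e. \<rho> e i)" and WV: "\<And>e. e \<in> W \<Longrightarrow> \<rho> e \<in> V"
  shows "(\<lambda>e. f (\<rho> e)) \<in> ahol N W"
  by (rule ahol_compose[OF V f W ahol_subset[OF lhol_open_imp_ahol[OF openin_cspace \<rho>] openin_cspace_sub[OF W]] WV])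

text \<open>Where \<open>x \<noteq> 0\<close> or \<open>y \<noteq> 0\<close>, the family is locally the product of a cone with the base.\<close>

lemma slice_ideal_vertex:
  assumes Z: "openin (top_of_set (family_cone n)) Z" and e0: "e0 \<in> Z" and F: "lhol (3 * n + 3) Z F"
    and van: "\<And>e. e \<in> Z \<Longrightarrow> (\<And>i. i < j \<Longrightarrow> e i = e0 i) \<Longrightarrow> F e = 0" and j: "j \<le> 2 * n"
    and c: "{c, c'} = {2 * n, 2 * n + 1}" "e0 c = 1"
  obtains V h where "openin (top_of_set (cspace (3 * n + 3))) V" "e0 \<in> V"
    "\<And>i. i < j \<Longrightarrow> h i \<in> ahol (3 * n + 3) V"
    "\<And>e. e \<in> V \<Longrightarrow> e \<in> family_cone n \<Longrightarrow> e c = 1 \<Longrightarrow> F e = (\<Sum>i<j. (e i - e0 i) * h i e)"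
proof -
  let ?N = "3 * n + 3"
  have O_cone: "Z \<subseteq> family_cone n" using Z by (auto simp: openin_open)
  have e0c: "e0 \<in> family_cone n" "e0 \<in> cspace ?N" using O_cone e0 family_cone_cspace by auto
  have cc: "c \<noteq> c'" "c \<ge> 2 * n" "c' \<ge> 2 * n" "c < 2 * n + 2" "c' < 2 * n + 2"
    using c(1) by (auto simp: doubleton_eq_iff)
  have prod: "e c * e c' = e (2 * n) * e (2 * n + 1)" for e :: "nat \<Rightarrow> complex"
    using c(1) by (auto simp: doubleton_eq_iff)
  obtain V0 g where V0: "openin (top_of_set (cspace ?N)) V0" "e0 \<in> V0" "g \<in> ahol ?N V0"
    "\<And>e. e \<in> V0 \<Longrightarrow> e \<in> family_cone n \<Longrightarrow> e \<in> Z \<and> F e = g e"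
    using local_representative[OF Z e0 F] by metis
  \<comment> \<open>For \<open>e c = 1\<close> the equation of the family reads
    \<open>e c' = branch_form n e\<close>, so \<open>\<rho>\<close> solves it. It leaves the base
    and the curve coordinates alone; hence it carries every point over the curve into the family,
    whatever the values of the base parameters.\<close>
  define \<rho> where "\<rho> = (\<lambda>e. e(c := 1, c' := branch_form n e))"
  have bf: "branch_form n (\<rho> e) = branch_form n e" for e
    using contraction_base_cong(3)[of n "\<rho> e" e 1] cc by (auto simp: \<rho>_def curve_coord_def)
  have \<rho>_id: "\<rho> e = e" if "e \<in> family_cone n" "e c = 1" for e
  proof -
    have "e c' = branch_form n e" using that prod[of e] by (simp add: family_cone_def)
    then show ?thesis using that by (auto simp: \<rho>_def)
  qed
  have \<rho>N: "\<rho> ` cspace ?N \<subseteq> cspace ?N" using cc by (auto simp: \<rho>_def cspace_def)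
  have \<rho>l: "lhol ?N (cspace ?N) (\<lambda>e. \<rho> e i)" for i
    by (cases "i = c"; cases "i = c'") (auto simp: \<rho>_def intro!: lhol_const lhol_coord lhol_branch_form)
  have \<rho>c: "continuous_on (cspace ?N) \<rho>"
    by (rule lhol_map_continuous[OF \<rho>l]) (use \<rho>N in auto)
  have \<rho>_cone: "\<rho> (reset j e0 e) \<in> family_cone n" if "e \<in> cspace ?N" "on_curve n (curve_coord n e)" for e
  proof -
    have "reset j e0 e \<in> cspace ?N" using that e0c by (auto simp: reset_def cspace_def)
    then have "\<rho> (reset j e0 e) \<in> cspace ?N" using \<rho>N by blast
    moreover have "curve_coord n (\<rho> (reset j e0 e)) = curve_coord n e"
      using cc j by (auto simp: curve_coord_def \<rho>_def reset_def)
    moreover have "\<rho> (reset j e0 e) c = 1" using cc by (simp add: \<rho>_def)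
    moreover have "\<rho> (reset j e0 e) c' = branch_form n (\<rho> (reset j e0 e))" unfolding bf using cc by (simp add: \<rho>_def)
    ultimately show ?thesis using that cc prod[of "\<rho> (reset j e0 e)"]
      by (auto simp: family_cone_def intro!: bexI[of _ c])
  qed
  have "\<rho> e0 \<in> V0" using \<rho>_id[OF e0c(1) c(2)] V0(2) by simp
  then obtain r where r: "r > 0" "\<And>e. e \<in> polydisc ?N e0 (\<lambda>_. r) \<Longrightarrow> \<rho> e \<in> V0"
    using preimage_polydisc[OF V0(1) e0c(2) _ \<rho>c \<rho>N] by blast
  have g1: "(\<lambda>e. g (\<rho> e)) \<in> ahol ?N (polydisc ?N e0 (\<lambda>_. r))"
    by (rule ahol_compose_cspace[OF V0(1,3) polydisc_openin \<rho>l r(2)])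
  have jN: "j \<le> ?N" using j by simp
  obtain h where h: "\<And>i. i < j \<Longrightarrow> h i \<in> ahol ?N (polydisc ?N e0 (\<lambda>_. r/2))"
    "\<And>p. p \<in> polydisc ?N e0 (\<lambda>_. r/2) \<Longrightarrow> g (\<rho> p) = g (\<rho> (reset j e0 p)) + (\<Sum>i<j. (p i - e0 i) * h i p)"
    using hadamard[OF g1 r(1) jN] by blast
  show ?thesis
  proof (rule that[OF polydisc_openin _ h(1)])
    show "e0 \<in> polydisc ?N e0 (\<lambda>_. r/2)" using e0c r by (auto simp: polydisc_def)
    fix e assume e: "e \<in> polydisc ?N e0 (\<lambda>_. r/2)" "e \<in> family_cone n" "e c = 1"
    have er: "e \<in> polydisc ?N e0 (\<lambda>_. r)" using e(1) polydisc_mono[of "r/2" r] r by auto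
    have "F e = g (\<rho> e)" using V0(4) r(2)[OF er] e \<rho>_id by auto
    moreover have "g (\<rho> (reset j e0 e)) = 0"
    proof -
      let ?f = "\<rho> (reset j e0 e)"
      have fc: "?f \<in> family_cone n" using e(2) by (intro \<rho>_cone) (auto simp: family_cone_def)
      have "?f \<in> V0" by (rule r(2)[OF reset_polydisc[OF er r(1) e0c(2)]])
      then have "?f \<in> Z" "F ?f = g ?f" using V0(4) fc by auto
      moreover have "F ?f = 0"
        by (rule van[OF \<open>?f \<in> Z\<close>]) (use j cc in \<open>auto simp: \<rho>_def reset_def\<close>)
      ultimately show ?thesis by simp
    qed
    ultimately show "F e = (\<Sum>i<j. (e i - e0 i) * h i e)" using h(2)[OF e(1)] by simp
  qed auto
qed

text \<open>Near \<open>x = y = 0\<close> the family is the hypersurface \<open>x y = P\<close>, with \<open>P\<close> a function of the base and of the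
  affine coordinate of the curve; \<open>\<rho>\<close> is the retraction onto the affine curve.\<close>

lemma slice_ideal_hypersurface:
  assumes Z: "openin (top_of_set (family_cone n)) Z" and e0: "e0 \<in> Z" and F: "lhol (3 * n + 3) Z F"
    and van: "\<And>e. e \<in> Z \<Longrightarrow> (\<And>i. i < j \<Longrightarrow> e i = e0 i) \<Longrightarrow> F e = 0" and j: "j \<le> 2 * n"
    and c: "c \<in> {2 * n + 2..<3 * n + 3}" "e0 c = 1" and e00: "e0 (2 * n) = 0" "e0 (2 * n + 1) = 0"
    and \<rho>l: "\<And>i. lhol (3 * n + 3) (cspace (3 * n + 3)) (\<lambda>e. \<rho> e i)"
    and \<rho>N: "\<rho> ` cspace (3 * n + 3) \<subseteq> cspace (3 * n + 3)"
    and \<rho>_base: "\<And>e i. i < 2 * n + 2 \<Longrightarrow> \<rho> e i = e i"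
    and \<rho>_curve: "\<And>e. on_curve n (curve_coord n (\<rho> e)) \<and> \<rho> e c = 1"
    and \<rho>_id: "\<And>e. e \<in> family_cone n \<Longrightarrow> e c = 1 \<Longrightarrow> \<rho> e = e"
    and \<rho>_cong: "\<And>e f. (\<And>i. i \<ge> 2 * n + 2 \<Longrightarrow> e i = f i) \<Longrightarrow> curve_coord n (\<rho> e) = curve_coord n (\<rho> f)"
  obtains V h where "openin (top_of_set (cspace (3 * n + 3))) V" "e0 \<in> V"
    "\<And>i. i < j \<Longrightarrow> h i \<in> ahol (3 * n + 3) V"
    "\<And>e. e \<in> V \<Longrightarrow> e \<in> family_cone n \<Longrightarrow> e c = 1 \<Longrightarrow> F e = (\<Sum>i<j. (e i - e0 i) * h i e)"
proof -
  let ?N = "3 * n + 3"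
  have O_cone: "Z \<subseteq> family_cone n" using Z by (auto simp: openin_open)
  have e0c: "e0 \<in> family_cone n" "e0 \<in> cspace ?N" using O_cone e0 family_cone_cspace by auto
  obtain V0 g where V0: "openin (top_of_set (cspace ?N)) V0" "e0 \<in> V0" "g \<in> ahol ?N V0"
    "\<And>e. e \<in> V0 \<Longrightarrow> e \<in> family_cone n \<Longrightarrow> e \<in> Z \<and> F e = g e"
    using local_representative[OF Z e0 F] by metis
  have \<rho>c: "continuous_on (cspace ?N) \<rho>"
    by (rule lhol_map_continuous[OF \<rho>l]) (use \<rho>N in auto)
  have "\<rho> e0 \<in> V0" using \<rho>_id[OF e0c(1) c(2)] V0(2) by simp
  then obtain r where r: "r > 0" "\<And>e. e \<in> polydisc ?N e0 (\<lambda>_. r) \<Longrightarrow> \<rho> e \<in> V0"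
    using preimage_polydisc[OF V0(1) e0c(2) _ \<rho>c \<rho>N] by blast
  let ?D = "polydisc ?N e0 (\<lambda>_. r)" and ?D2 = "polydisc ?N e0 (\<lambda>_. r/2)"
  define P where "P = (\<lambda>e. branch_form n (\<rho> e))"
  \<comment> \<open>The right-hand side of the equation with the first \<open>j\<close> parameters
    frozen. The likewise frozen function \<open>g0\<close> vanishes on x y = Q, so conic division
    gives \<open>g0 = (x y - Q) k\<close>. On the family x y = P, and there
    \<open>x y - Q = P - Q\<close> lies in the ideal by Hadamard's lemma applied to P.\<close>
  define Q where "Q = (\<lambda>e. P (reset j e0 e))"
  define g0 where "g0 = (\<lambda>e. g (\<rho> (reset j e0 e)))"
  have jN: "j \<le> ?N" using j by simp
  have DN: "?D \<subseteq> cspace ?N" by (auto simp: polydisc_def)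
  have rl: "lhol ?N (cspace ?N) (\<lambda>e. reset j e0 e i)" for i
    by (cases "i < j") (auto simp: reset_def intro!: lhol_const lhol_coord)
  have g1: "(\<lambda>e. g (\<rho> e)) \<in> ahol ?N ?D"
    by (rule ahol_compose_cspace[OF V0(1,3) polydisc_openin \<rho>l r(2)])
  have Pl: "P \<in> ahol ?N (cspace ?N)"
    unfolding P_def
    by (rule ahol_compose_cspace[OF openin_cspace lhol_open_imp_ahol[OF openin_cspace lhol_branch_form] openin_cspace \<rho>l])
      (use \<rho>N in auto)
  have Ql: "Q \<in> ahol ?N ?D"
    unfolding Q_def
    by (rule ahol_compose_cspace[OF openin_cspace Pl polydisc_openin rl])
      (use reset_polydisc[OF _ r(1) e0c(2)] DN in blast)
  have g0l: "g0 \<in> ahol ?N ?D"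
    unfolding g0_def
    by (rule ahol_compose_cspace[OF polydisc_openin g1 polydisc_openin rl])
      (rule reset_polydisc[OF _ r(1) e0c(2)])
  obtain h1 where h1: "\<And>i. i < j \<Longrightarrow> h1 i \<in> ahol ?N ?D2"
    "\<And>p. p \<in> ?D2 \<Longrightarrow> g (\<rho> p) = g (\<rho> (reset j e0 p)) + (\<Sum>i<j. (p i - e0 i) * h1 i p)"
    using hadamard[OF g1 r(1) jN] by blast
  obtain q where q: "\<And>i. i < j \<Longrightarrow> q i \<in> ahol ?N ?D2"
    "\<And>p. p \<in> ?D2 \<Longrightarrow> P p = P (reset j e0 p) + (\<Sum>i<j. (p i - e0 i) * q i p)"
    using hadamard[OF ahol_subset[OF Pl DN] r(1) jN] by blast
  have r0: "reset j e0 e0 = e0" by (simp add: reset_def)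
  have Q0: "Q e0 = 0"
    using e0c(1) e00 \<rho>_id[OF e0c(1) c(2)] by (simp add: Q_def P_def r0 family_cone_def)
  have indep: "Q (e(2 * n := x, 2 * n + 1 := y)) = Q e" for e x y
  proof -
    let ?f = "\<rho> (reset j e0 (e(2 * n := x, 2 * n + 1 := y)))" and ?g = "\<rho> (reset j e0 e)"
    have "curve_coord n ?f = curve_coord n ?g" by (rule \<rho>_cong) (auto simp: reset_def)
    then have "branch_form n ?f = 1\<^sup>2 * branch_form n ?g"
      by (intro contraction_base_cong(3)) (simp_all add: \<rho>_base reset_def)
    then show ?thesis by (simp add: Q_def P_def)
  qed
  have van0: "g0 e = 0" if e: "e \<in> ?D" and eq: "e (2 * n) * e (2 * n + 1) = Q e" for e
  proof -
    let ?f = "\<rho> (reset j e0 e)"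
    have rD: "reset j e0 e \<in> ?D" by (rule reset_polydisc[OF e r(1) e0c(2)])
    then have fN: "?f \<in> cspace ?N" using \<rho>N DN by blast
    have "?f (2 * n) * ?f (2 * n + 1) = branch_form n ?f"
      using eq j by (simp add: \<rho>_base Q_def P_def reset_def)
    then have fc: "?f \<in> family_cone n"
      using fN \<rho>_curve[of "reset j e0 e"] c(1) by (auto simp: family_cone_def intro!: bexI[of _ c])
    have "?f \<in> V0" by (rule r(2)[OF rD])
    then have "?f \<in> Z" "F ?f = g ?f" using V0(4) fc by auto
    moreover have "F ?f = 0"
      by (rule van[OF \<open>?f \<in> Z\<close>]) (use j in \<open>auto simp: \<rho>_base reset_def\<close>)
    ultimately show ?thesis by (simp add: g0_def)
  qed
  have e0D: "e0 \<in> ?D" "e0 \<in> ?D2" using e0c r by (auto simp: polydisc_def)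
  have lt: "2 * n < ?N" "2 * n + 1 < ?N" "2 * n \<noteq> 2 * n + 1" by auto
  obtain V' k where V': "openin (top_of_set (cspace ?N)) V'" "e0 \<in> V'" "V' \<subseteq> ?D" "k \<in> ahol ?N V'"
    "\<And>e. e \<in> V' \<Longrightarrow> g0 e = (e (2 * n) * e (2 * n + 1) - Q e) * k e"
    using conic_division[OF polydisc_openin e0D(1) e00 Q0 g0l Ql lt indep van0] by metis
  show ?thesis
  proof (rule that[of "V' \<inter> ?D2" "\<lambda>i e. q i e * k e + h1 i e"])
    show "openin (top_of_set (cspace ?N)) (V' \<inter> ?D2)" using V'(1) polydisc_openin by blast
    show "e0 \<in> V' \<inter> ?D2" using V'(2) e0D by blast
    show "(\<lambda>e. q i e * k e + h1 i e) \<in> ahol ?N (V' \<inter> ?D2)" if "i < j" for i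
      using ahol_subset[OF q(1)[OF that]] ahol_subset[OF h1(1)[OF that]] ahol_subset[OF V'(4)]
      by (intro ahol_add ahol_mult) auto
    fix e assume e: "e \<in> V' \<inter> ?D2" "e \<in> family_cone n" "e c = 1"
    have eD: "e \<in> ?D" using e V'(3) by blast
    have "e (2 * n) * e (2 * n + 1) = P e" using e \<rho>_id[OF e(2,3)] by (simp add: P_def family_cone_def)
    then have 1: "e (2 * n) * e (2 * n + 1) - Q e = (\<Sum>i<j. (e i - e0 i) * q i e)"
      using q(2)[of e] e by (simp add: Q_def)
    have "F e = g (\<rho> e)" using V0(4) r(2)[OF eD] e \<rho>_id by auto
    also have "\<dots> = g0 e + (\<Sum>i<j. (e i - e0 i) * h1 i e)" using h1(2)[of e] e by (simp add: g0_def)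
    also have "\<dots> = (\<Sum>i<j. (e i - e0 i) * q i e) * k e + (\<Sum>i<j. (e i - e0 i) * h1 i e)"
      using V'(5)[of e] e 1 by simp
    also have "\<dots> = (\<Sum>i<j. (e i - e0 i) * (q i e * k e + h1 i e))"
      unfolding sum_distrib_right sum.distrib[symmetric] by (intro sum.cong refl) (simp add: algebra_simps)
    finally show "F e = (\<Sum>i<j. (e i - e0 i) * (q i e * k e + h1 i e))" .
  qed
qed

text \<open>The affine curve in the chart \<open>w\<^sub>0 = 1\<close> (\<open>\<epsilon> i = i\<close>) or \<open>w\<^sub>n = 1\<close> (\<open>\<epsilon> i = n - i\<close>).\<close>

definition affine_curve :: "nat \<Rightarrow> (nat \<Rightarrow> nat) \<Rightarrow> (nat \<Rightarrow> complex) \<Rightarrow> nat \<Rightarrow> complex" where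
  "affine_curve n \<epsilon> e i = (if i < 2 * n + 2 then e i else if i < 3 * n + 3
     then e (2 * n + 2 + \<epsilon> 1) ^ \<epsilon> (i - (2 * n + 2)) else 0)"

lemma affine_curve_coord: "i \<le> n \<Longrightarrow> curve_coord n (affine_curve n \<epsilon> e) i = e (2 * n + 2 + \<epsilon> 1) ^ \<epsilon> i"
  by (simp add: affine_curve_def curve_coord_def)

lemma affine_curve_on_curve:
  assumes "\<epsilon> = (\<lambda>i. i) \<or> \<epsilon> = (\<lambda>i. n - i)"
  shows "on_curve n (curve_coord n (affine_curve n \<epsilon> e))"
  unfolding on_curve_def
proof (intro allI impI)
  fix i j assume "i < n" "j < n"
  moreover from this have "\<epsilon> i + \<epsilon> (Suc j) = \<epsilon> (Suc i) + \<epsilon> j" using assms by auto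
  ultimately show "curve_coord n (affine_curve n \<epsilon> e) i * curve_coord n (affine_curve n \<epsilon> e) (Suc j) =
      curve_coord n (affine_curve n \<epsilon> e) (Suc i) * curve_coord n (affine_curve n \<epsilon> e) j"
    by (simp add: affine_curve_coord power_add[symmetric])
qed

lemma affine_curve_id:
  assumes \<epsilon>: "\<epsilon> = (\<lambda>i. i) \<or> \<epsilon> = (\<lambda>i. n - i)" and n: "n \<ge> 1" and e: "e \<in> family_cone n" "e (2 * n + 2 + \<epsilon> 0) = 1"
  shows "affine_curve n \<epsilon> e = e"
proof
  fix i
  have m: "\<And>i j. i < n \<Longrightarrow> j < n \<Longrightarrow> curve_coord n e i * curve_coord n e (Suc j) = curve_coord n e (Suc i) * curve_coord n e j"
    using e by (auto simp: family_cone_def on_curve_def)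
  have *: "curve_coord n e k = e (2 * n + 2 + \<epsilon> 1) ^ \<epsilon> k" if "k \<le> n" for k
    using \<epsilon>
  proof
    assume "\<epsilon> = (\<lambda>i. i)"
    then show ?thesis using curve_first[of n "curve_coord n e", OF m] e that by (simp add: curve_coord_def)
  next
    assume "\<epsilon> = (\<lambda>i. n - i)"
    then show ?thesis using curve_last[of n "curve_coord n e" "n - k", OF m] e that by (simp add: curve_coord_def)
  qed
  show "affine_curve n \<epsilon> e i = e i"
  proof (cases "i < 2 * n + 2 \<or> i \<ge> 3 * n + 3")
    case True
    then show ?thesis using e family_cone_cspace by (auto simp: affine_curve_def cspace_def)
  next
    case False
    then have "2 * n + 2 + (i - (2 * n + 2)) = i" "i - (2 * n + 2) \<le> n" by auto
    then have "e i = e (2 * n + 2 + \<epsilon> 1) ^ \<epsilon> (i - (2 * n + 2))"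
      using *[of "i - (2 * n + 2)"] by (simp only: curve_coord_def)
    then show ?thesis using False by (simp add: affine_curve_def)
  qed
qed

text \<open>By \<open>curve_zero\<close> all curve coordinates vanish together with the first and
  the last one, so four charts cover the family.\<close>

lemma family_cone_chart:
  assumes "e \<in> family_cone n"
  shows "e (2 * n) \<noteq> 0 \<or> e (2 * n + 1) \<noteq> 0 \<or> e (2 * n + 2) \<noteq> 0 \<or> e (2 * n + 2 + n) \<noteq> 0"
proof (rule ccontr)
  assume not: "\<not> ?thesis"
  obtain c where c: "c \<in> {2 * n..<3 * n + 3}" "e c \<noteq> 0" using assms unfolding family_cone_def by blast
  have m: "\<And>i j. i < n \<Longrightarrow> j < n \<Longrightarrow> curve_coord n e i * curve_coord n e (Suc j) = curve_coord n e (Suc i) * curve_coord n e j"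
    using assms by (auto simp: family_cone_def on_curve_def)
  have z: "curve_coord n e i = 0" if "i \<le> n" for i
    by (rule curve_zero[of n "curve_coord n e", OF m]) (use not that in \<open>auto simp: curve_coord_def\<close>)
  have "c \<noteq> 2 * n" "c \<noteq> 2 * n + 1" using c not by auto
  then have "2 * n + 2 + (c - (2 * n + 2)) = c" "c - (2 * n + 2) \<le> n" using c by auto
  then have "e c = 0" using z[of "c - (2 * n + 2)"] by (simp only: curve_coord_def)
  then show False using c by simp
qed

text \<open>Combines the two local situations: normalization to \<open>e c = 1\<close> with c one of
  x, y, or, at x = y = 0, with c the first or last curve coordinate. Since \<open>Z\<close> is
  closed under scaling, the given point can be normalized without leaving it.\<close>

lemma slice_ideal:
  assumes n: "n \<ge> 1" and Z: "openin (top_of_set (family_cone n)) Z" and e1: "e1 \<in> Z"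
    and sat: "\<And>e l. e \<in> Z \<Longrightarrow> l \<noteq> 0 \<Longrightarrow> scale n l e \<in> Z"
    and F: "lhol (3 * n + 3) Z F"
    and van: "\<And>e. e \<in> Z \<Longrightarrow> (\<And>i. i < j \<Longrightarrow> e i = e1 i) \<Longrightarrow> F e = 0" and j: "j \<le> 2 * n"
  obtains c V h where "c \<in> {2 * n..<3 * n + 3}" "e1 c \<noteq> 0" "openin (top_of_set (cspace (3 * n + 3))) V"
    "normal_form n c e1 \<in> V" "\<And>i. i < j \<Longrightarrow> h i \<in> ahol (3 * n + 3) V"
    "\<And>e. e \<in> V \<Longrightarrow> e \<in> family_cone n \<Longrightarrow> e c = 1 \<Longrightarrow> F e = (\<Sum>i<j. (e i - e1 i) * h i e)"
proof -
  note goal = that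
  have e1c: "e1 \<in> family_cone n" using Z e1 by (auto simp: openin_open)
  have base: "normal_form n c e1 i = e1 i" if "i < j" for c i
    using that j by (simp add: normal_form_def scale_def)
  have van': "F e = 0" if "e \<in> Z" "\<And>i. i < j \<Longrightarrow> e i = normal_form n c e1 i" for c e
    using van[OF that(1)] that(2) base by simp
  have nf: "normal_form n c e1 \<in> Z" if "e1 c \<noteq> 0" for c
    unfolding normal_form_def by (rule sat[OF e1]) (use that in auto)
  have vertex: ?thesis if c: "{c, c'} = {2 * n, 2 * n + 1}" "e1 c \<noteq> 0" for c c'
  proof -
    have c2: "c \<in> {2 * n..<3 * n + 3}" using c(1) by (auto simp: doubleton_eq_iff)
    then have nc: "normal_form n c e1 c = 1" using normal_form_coord c(2) by auto
    show ?thesis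
    proof (rule slice_ideal_vertex[OF Z nf[OF c(2)] F van' j c(1) nc])
      fix V h assume a: "openin (top_of_set (cspace (3 * n + 3))) V" "normal_form n c e1 \<in> V"
        "\<And>i. i < j \<Longrightarrow> h i \<in> ahol (3 * n + 3) V"
        "\<And>e. e \<in> V \<Longrightarrow> e \<in> family_cone n \<Longrightarrow> e c = 1 \<Longrightarrow> F e = (\<Sum>i<j. (e i - normal_form n c e1 i) * h i e)"
      show ?thesis by (rule goal[OF c2 c(2) a(1,2,3)]) (use a(4) base in simp_all)
    qed
  qed
  have hyp: ?thesis if \<epsilon>: "\<epsilon> = (\<lambda>i. i) \<or> \<epsilon> = (\<lambda>i. n - i)" and c: "e1 (2 * n + 2 + \<epsilon> 0) \<noteq> 0"
    and z: "e1 (2 * n) = 0" "e1 (2 * n + 1) = 0" for \<epsilon>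
  proof -
    let ?c = "2 * n + 2 + \<epsilon> 0" and ?\<rho> = "affine_curve n \<epsilon>"
    have c2: "?c \<in> {2 * n + 2..<3 * n + 3}" "?c \<in> {2 * n..<3 * n + 3}" using \<epsilon> by auto
    have 1: "normal_form n ?c e1 ?c = 1" using normal_form_coord c by auto
    have z': "normal_form n ?c e1 (2 * n) = 0" "normal_form n ?c e1 (2 * n + 1) = 0"
      using z by (auto simp: normal_form_def scale_def)
    have "\<epsilon> (?c - (2 * n + 2)) = 0" using \<epsilon> by auto
    then have r1: "on_curve n (curve_coord n (?\<rho> e)) \<and> ?\<rho> e ?c = 1" for e
      using affine_curve_on_curve[OF \<epsilon>] c2 by (auto simp: affine_curve_def)
    have r2: "lhol (3 * n + 3) (cspace (3 * n + 3)) (\<lambda>e. ?\<rho> e i)" for i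
      unfolding affine_curve_def
      by (cases "i < 2 * n + 2"; cases "i < 3 * n + 3") (auto intro!: lhol_coord lhol_power lhol_const)
    have r3: "?\<rho> ` cspace (3 * n + 3) \<subseteq> cspace (3 * n + 3)" by (auto simp: affine_curve_def cspace_def)
    have r4: "?\<rho> e i = e i" if "i < 2 * n + 2" for e i using that by (simp add: affine_curve_def)
    have r5: "curve_coord n (?\<rho> e) = curve_coord n (?\<rho> f)" if "\<And>i. i \<ge> 2 * n + 2 \<Longrightarrow> e i = f i" for e f
      using that by (auto simp: affine_curve_def curve_coord_def)
    show ?thesis
    proof (rule slice_ideal_hypersurface[OF Z nf[OF c] F van' j c2(1) 1 z' r2 r3 r4 r1 affine_curve_id[OF \<epsilon> n] r5])
      fix V h assume a: "openin (top_of_set (cspace (3 * n + 3))) V" "normal_form n ?c e1 \<in> V"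
        "\<And>i. i < j \<Longrightarrow> h i \<in> ahol (3 * n + 3) V"
        "\<And>e. e \<in> V \<Longrightarrow> e \<in> family_cone n \<Longrightarrow> e ?c = 1 \<Longrightarrow> F e = (\<Sum>i<j. (e i - normal_form n ?c e1 i) * h i e)"
      show ?thesis by (rule goal[OF c2(2) c a(1,2,3)]) (use a(4) base in simp_all)
    qed
  qed
  show ?thesis
    using family_cone_chart[OF e1c] vertex[of "2 * n" "2 * n + 1"] vertex[of "2 * n + 1" "2 * n"]
      hyp[of "\<lambda>i. i"] hyp[of "\<lambda>i. n - i"] by (auto simp: insert_commute)
qed

text \<open>Composition with \<open>normal_form\<close> makes a function given near the slice
  \<open>e c = 1\<close> homogeneous of degree 0, so that it descends to the family.\<close>

lemma extend_from_slice:
  assumes c: "c \<ge> 2 * n" and V: "openin (top_of_set (cspace (3 * n + 3))) V"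
  defines "U \<equiv> family_class n ` {e \<in> family_cone n. e c \<noteq> 0 \<and> normal_form n c e \<in> V}"
    and "H \<equiv> \<lambda>h x. h (normal_form n c (SOME e. e \<in> x)) :: complex"
  shows "openin (Top (family n)) U"
    and "\<And>h. h \<in> ahol (3 * n + 3) V \<Longrightarrow> H h \<in> Hol (family n) U"
    and "\<And>h e. e \<in> family_cone n \<Longrightarrow> H h (family_class n e) = h (normal_form n c e)"
proof -
  let ?N = "3 * n + 3" and ?E = "{e \<in> family_cone n. e c \<noteq> 0}"
  let ?A = "{e \<in> family_cone n. e c \<noteq> 0 \<and> normal_form n c e \<in> V}"
  have UX: "U \<subseteq> pts (family n)" by (auto simp: U_def pts_family)
  have sat: "{e \<in> family_cone n. family_class n e \<in> U} = ?A"
  proof (intro set_eqI iffI)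
    fix e assume "e \<in> {e \<in> family_cone n. family_class n e \<in> U}"
    then obtain f where e: "e \<in> family_cone n" and f: "f \<in> ?A" "family_class n e = family_class n f" by (auto simp: U_def)
    then show "e \<in> ?A" using class_coord_nonzero[OF e _ f(2) c] by simp
  qed (auto simp: U_def)
  have nl: "lhol ?N ?E (\<lambda>e. normal_form n c e i)" for i
    using family_cone_cspace by (auto intro!: lhol_normal_form)
  have nN: "normal_form n c e \<in> cspace ?N" if "e \<in> ?E" for e
    using that normal_form_cone family_cone_cspace by blast
  have "continuous_on ?E (normal_form n c)"
    by (rule lhol_map_continuous[OF nl]) (use nN in auto)
  then have "openin (top_of_set ?E) (?E \<inter> normal_form n c -` V)"
    by (rule continuous_openin_preimage[OF _ _ V]) (use nN in auto)
  moreover have "openin (top_of_set (family_cone n)) ?E" by (rule openin_coord_nonzero)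
  moreover have "?E \<inter> normal_form n c -` V = ?A" by auto
  ultimately have "openin (top_of_set (family_cone n)) ?A" using openin_trans by simp
  then show "openin (Top (family n)) U"
    using uniformizedD(4)[OF uniformized_family UX] sat by simp
  show Hc: "H h (family_class n e) = h (normal_form n c e)" if e: "e \<in> family_cone n" for h e
  proof -
    obtain l where "l \<noteq> 0" "(SOME f. f \<in> family_class n e) = scale n l e"
      using some_in_family_class[OF e] by blast
    then show ?thesis using c by (simp add: H_def normal_form_scale)
  qed
  fix h assume h: "h \<in> ahol ?N V"
  have "lhol ?N ?A (\<lambda>e. h (normal_form n c e))"
  proof (rule lhol_compose[OF ahol_imp_lhol[OF V h order_refl]])
    show "lhol ?N ?A (\<lambda>e. normal_form n c e i)" for i by (rule lhol_subset[OF nl]) auto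
  qed (use family_cone_cspace in auto)
  then have "lhol ?N ?A (\<lambda>e. H h (family_class n e))"
    by (subst lhol_cong[where g = "\<lambda>e. h (normal_form n c e)"]) (auto simp: Hc)
  then show "H h \<in> Hol (family n) U"
    using uniformizedD(5)[OF uniformized_family UX, of "H h"] sat by simp
qed

text \<open>The slices over coordinate subspaces of the base are reduced. For
  \<open>j = 2 * n\<close> the slice is a fibre; for smaller \<open>j\<close> this converts the
  ideal membership demanded by flatness into a statement about vanishing.\<close>

lemma vanishing_in_base_ideal:
  assumes n: "n \<ge> 1" and U: "openin (Top (family n)) U" "x \<in> U" and f: "f \<in> Hol (family n) U" and j: "j \<le> 2 * n"
    and van: "\<And>y. y \<in> U \<Longrightarrow> (\<And>i. i < j \<Longrightarrow> base_map n y i = base_map n x i) \<Longrightarrow> f y = 0"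
  shows "in_base_ideal (family n) (base_map n) j x f"
proof -
  let ?N = "3 * n + 3"
  have UX: "U \<subseteq> pts (family n)" using U openin_subset by blast
  obtain e1 where e1: "e1 \<in> family_cone n" "x = family_class n e1" using U UX by (auto simp: pts_family)
  let ?Z = "{e \<in> family_cone n. family_class n e \<in> U}"
  have Z: "openin (top_of_set (family_cone n)) ?Z" using uniformizedD(4)[OF uniformized_family UX] U(1) by simp
  have F: "lhol ?N ?Z (\<lambda>e. f (family_class n e))" using uniformizedD(5)[OF uniformized_family UX] f by simp
  have e1O: "e1 \<in> ?Z" using e1 U by simp
  have sat: "scale n l e \<in> ?Z" if "e \<in> ?Z" "l \<noteq> 0" for e l
    using that by (simp add: scale_family_cone family_class_scale)
  have van': "f (family_class n e) = 0" if "e \<in> ?Z" "\<And>i. i < j \<Longrightarrow> e i = e1 i" for e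
    using van[of "family_class n e"] that e1 j by (simp add: base_part_def)
  show ?thesis
  proof (rule slice_ideal[OF n Z e1O sat F van' j])
  fix c V h assume c: "c \<in> {2 * n..<3 * n + 3}" "e1 c \<noteq> 0" and V: "openin (top_of_set (cspace ?N)) V"
    "normal_form n c e1 \<in> V" and h: "\<And>i. i < j \<Longrightarrow> h i \<in> ahol ?N V"
    and eq: "\<And>e. e \<in> V \<Longrightarrow> e \<in> family_cone n \<Longrightarrow> e c = 1 \<Longrightarrow> f (family_class n e) = (\<Sum>i<j. (e i - e1 i) * h i e)"
  have cn: "c \<ge> 2 * n" using c by simp
  define U' where "U' = family_class n ` {e \<in> family_cone n. e c \<noteq> 0 \<and> normal_form n c e \<in> V}"
  define H where "H = (\<lambda>h x. h (normal_form n c (SOME e. e \<in> x)) :: complex)"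
  note ext = extend_from_slice[OF cn V(1), folded U'_def H_def]
  show ?thesis
    unfolding in_base_ideal_def
  proof (intro exI conjI)
    show "openin (Top (family n)) U'" by (rule ext(1))
    show "x \<in> U'" using e1 c V by (auto simp: U'_def)
    show "\<forall>i<j. H (h i) \<in> Hol (family n) U'" using ext(2)[OF h] by (simp add: H_def)
    show "\<forall>y\<in>U'. f y = (\<Sum>i<j. (base_map n y i - base_map n x i) * H (h i) y)"
    proof
      fix y assume "y \<in> U'"
      then obtain e where e: "e \<in> family_cone n" "e c \<noteq> 0" "normal_form n c e \<in> V" "y = family_class n e"
        by (auto simp: U'_def)
      let ?e = "normal_form n c e"
      have ee: "?e \<in> family_cone n" "?e c = 1" "family_class n ?e = y"
        using e cn by (simp_all add: normal_form_cone normal_form_coord normal_form_class)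
      have "f y = (\<Sum>i<j. (?e i - e1 i) * h i ?e)" using eq[OF e(3) ee(1,2)] ee(3) by simp
      also have "\<dots> = (\<Sum>i<j. (base_map n y i - base_map n x i) * H (h i) y)"
      proof (intro sum.cong refl)
        fix i assume "i \<in> {..<j}"
        then have "?e i = base_map n y i" "e1 i = base_map n x i"
          using j e e1 by (auto simp: base_part_def normal_form_def scale_def)
        moreover have "H (h i) y = h i ?e" using ext(3)[OF e(1)] e(4) by (simp add: H_def)
        ultimately show "(?e i - e1 i) * h i ?e = (base_map n y i - base_map n x i) * H (h i) y" by simp
      qed
      finally show "f y = (\<Sum>i<j. (base_map n y i - base_map n x i) * H (h i) y)" .
    qed
  qed
qed
qed

lemma reduced_fibre_family: "n \<ge> 1 \<Longrightarrow> reduced_fibre (family n) (2 * n) (base_map n) b"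
  unfolding reduced_fibre_def
proof (intro ballI allI impI)
  fix x U f assume n: "n \<ge> 1" and x: "x \<in> pts (family n)" "base_map n x = b"
    and *: "openin (Top (family n)) U \<and> x \<in> U \<and> f \<in> Hol (family n) U \<and> (\<forall>y\<in>U. base_map n y = b \<longrightarrow> f y = 0)"
  show "in_base_ideal (family n) (base_map n) (2 * n) x f"
  proof (rule vanishing_in_base_ideal[OF n, of U])
    fix y assume y: "y \<in> U" "\<And>i. i < 2 * n \<Longrightarrow> base_map n y i = base_map n x i"
    have "base_map n y = b"
    proof
      fix i show "base_map n y i = b i"
        using y(2)[of i] x(2) by (cases "i < 2 * n") (auto simp: base_map_def base_part_def)
    qed
    then show "f y = 0" using * y by blast
  qed (use * in auto)
qed

subsection \<open>Flatness\<close>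

lemma tendsto_coordinatewise:
  fixes f :: "'a \<Rightarrow> nat \<Rightarrow> complex"
  assumes "\<And>i. ((\<lambda>x. f x i) \<longlongrightarrow> l i) F"
  shows "(f \<longlongrightarrow> l) F"
proof -
  have "limitin (product_topology (\<lambda>_. euclidean) UNIV) f l F"
    unfolding limitin_componentwise using assms by simp
  then show ?thesis by (simp add: euclidean_product_topology)
qed

text \<open>Shows that the part of a slice where the \<open>j\<close>-th parameter differs from its
  value at the point is dense. Shifting that parameter by \<delta> changes the right-hand side of
  the equation to \<open>b \<delta>\<close>; the curve coordinates stay fixed and x, y follow. If x
  or y is nonzero the other one is solved for, otherwise both become a square root of
  \<open>b \<delta>\<close>.\<close>

lemma base_curve:
  assumes e: "e \<in> family_cone n" and j: "j < 2 * n"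
  obtains \<gamma> :: "complex \<Rightarrow> nat \<Rightarrow> complex" where "(\<gamma> \<longlongrightarrow> e) (at 0)" "\<And>\<delta>. \<gamma> \<delta> \<in> family_cone n"
    "\<And>\<delta> i. i < 2 * n \<Longrightarrow> \<gamma> \<delta> i = (if i = j then e i + \<delta> else e i)"
proof -
  note goal = that
  define m where "m = (\<lambda>\<delta>. e(j := e j + \<delta>))"
  define b where "b = (\<lambda>\<delta>. branch_form n (m \<delta>))"
  have mc: "continuous_on UNIV m" unfolding m_def by (intro continuous_on_funupd continuous_intros)
  have bc: "continuous_on UNIV b"
    unfolding b_def by (rule continuous_on_compose2[OF continuous_on_branch_form[of UNIV] mc]) auto
  have m0: "m 0 = e" by (simp add: m_def)
  have b0: "b 0 = e (2 * n) * e (2 * n + 1)" using e by (simp add: b_def m0 family_cone_def)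
  have tm: "((\<lambda>\<delta>. m \<delta> i) \<longlongrightarrow> e i) (at 0)" for i
    by (cases "i = j") (auto simp: m_def intro!: tendsto_eq_intros)
  have tb: "(b \<longlongrightarrow> b 0) (at 0)" using bc by (simp add: continuous_on_eq_continuous_at isCont_def)
  have cone: "(m \<delta>)(2 * n := x, 2 * n + 1 := y) \<in> family_cone n"
    if "x * y = b \<delta>" "\<exists>c\<in>{2 * n..<3 * n + 3}. ((m \<delta>)(2 * n := x, 2 * n + 1 := y)) c \<noteq> 0" for \<delta> x y
  proof -
    let ?f = "(m \<delta>)(2 * n := x, 2 * n + 1 := y)"
    have "branch_form n ?f = b \<delta>"
      unfolding b_def using contraction_base_cong(3)[of n ?f "m \<delta>" 1] by (auto simp: curve_coord_def)
    moreover have "curve_coord n ?f = curve_coord n e" using j by (auto simp: curve_coord_def m_def)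
    moreover have "?f \<in> cspace (3 * n + 3)" using e j by (auto simp: family_cone_def cspace_def m_def)
    ultimately show ?thesis using e that by (auto simp: family_cone_def)
  qed
  have main: ?thesis if X: "(X \<longlongrightarrow> e (2 * n)) (at 0)" "(Y \<longlongrightarrow> e (2 * n + 1)) (at 0)" and XY: "\<And>\<delta>. X \<delta> * Y \<delta> = b \<delta>"
    and nz: "\<And>\<delta>. \<exists>c\<in>{2 * n..<3 * n + 3}. ((m \<delta>)(2 * n := X \<delta>, 2 * n + 1 := Y \<delta>)) c \<noteq> 0" for X Y
  proof (rule goal[of "\<lambda>\<delta>. (m \<delta>)(2 * n := X \<delta>, 2 * n + 1 := Y \<delta>)"])
    show "((\<lambda>\<delta>. (m \<delta>)(2 * n := X \<delta>, 2 * n + 1 := Y \<delta>)) \<longlongrightarrow> e) (at 0)"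
    proof (rule tendsto_coordinatewise)
      fix i show "((\<lambda>\<delta>. ((m \<delta>)(2 * n := X \<delta>, 2 * n + 1 := Y \<delta>)) i) \<longlongrightarrow> e i) (at 0)"
        using X tm[of i] by (cases "i = 2 * n"; cases "i = 2 * n + 1") auto
    qed
    show "(m \<delta>)(2 * n := X \<delta>, 2 * n + 1 := Y \<delta>) \<in> family_cone n" for \<delta> by (rule cone[OF XY nz])
    show "((m \<delta>)(2 * n := X \<delta>, 2 * n + 1 := Y \<delta>)) i = (if i = j then e i + \<delta> else e i)" if "i < 2 * n" for \<delta> i
      using that by (auto simp: m_def)
  qed
  consider "e (2 * n) \<noteq> 0" | "e (2 * n + 1) \<noteq> 0" | "e (2 * n) = 0" "e (2 * n + 1) = 0" by blast
  then show ?thesis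
  proof cases
    case 1
    show ?thesis
    proof (rule main[of "\<lambda>_. e (2 * n)" "\<lambda>\<delta>. b \<delta> / e (2 * n)"])
      show "((\<lambda>\<delta>. b \<delta> / e (2 * n)) \<longlongrightarrow> e (2 * n + 1)) (at 0)"
        using tendsto_divide[OF tb tendsto_const 1] 1 by (simp add: b0)
    qed (use 1 in \<open>auto intro!: bexI[of _ "2 * n"]\<close>)
  next
    case 2
    show ?thesis
    proof (rule main[of "\<lambda>\<delta>. b \<delta> / e (2 * n + 1)" "\<lambda>_. e (2 * n + 1)"])
      show "((\<lambda>\<delta>. b \<delta> / e (2 * n + 1)) \<longlongrightarrow> e (2 * n)) (at 0)"
        using tendsto_divide[OF tb tendsto_const 2] 2 by (simp add: b0)
    qed (use 2 in \<open>auto intro!: bexI[of _ "2 * n + 1"]\<close>)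
  next
    case 3
    \<comment> \<open>The branch \<open>csqrt\<close> jumps, but only its limit as \<delta> tends to
      0 is used, and there the modulus decides.\<close>
    have "((\<lambda>\<delta>. sqrt (cmod (b \<delta>))) \<longlongrightarrow> sqrt (cmod (b 0))) (at 0)"
      by (intro tendsto_real_sqrt tendsto_norm tb)
    then have "((\<lambda>\<delta>. cmod (csqrt (b \<delta>))) \<longlongrightarrow> 0) (at 0)" using 3 by (simp add: b0)
    then have s: "((\<lambda>\<delta>. csqrt (b \<delta>)) \<longlongrightarrow> 0) (at 0)" by (rule tendsto_norm_zero_cancel)
    obtain c where c: "c \<in> {2 * n..<3 * n + 3}" "e c \<noteq> 0" using e unfolding family_cone_def by blast
    show ?thesis
    proof (rule main[of "\<lambda>\<delta>. csqrt (b \<delta>)" "\<lambda>\<delta>. csqrt (b \<delta>)"])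
      show "csqrt (b \<delta>) * csqrt (b \<delta>) = b \<delta>" for \<delta> using power2_csqrt[of "b \<delta>"] by (simp add: power2_eq_square)
      have "c \<noteq> 2 * n" "c \<noteq> 2 * n + 1" "c \<noteq> j" using c 3 j by auto
      then show "\<exists>c\<in>{2 * n..<3 * n + 3}. ((m \<delta>)(2 * n := csqrt (b \<delta>), 2 * n + 1 := csqrt (b \<delta>))) c \<noteq> 0" for \<delta>
        using c by (intro bexI[of _ c]) (auto simp: m_def)
    qed (use s 3 in auto)
  qed
qed

text \<open>On the slice over the first \<open>j\<close> parameters the assumed relation says that g
  times the difference in the \<open>j\<close>-th parameter is 0. Hence \<open>g\<close> vanishes
  where that difference is nonzero, by density and continuity on the whole slice near x, and so lies
  in the ideal.\<close>

lemma flat_at_family: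
  assumes n: "n \<ge> 1" and x: "x \<in> pts (family n)"
  shows "flat_at (family n) (base_map n) (2 * n) x"
  unfolding flat_at_def
proof (intro allI impI)
  let ?N = "3 * n + 3" and ?\<pi> = "base_map n"
  fix j U g assume j: "j < 2 * n"
    and *: "openin (Top (family n)) U \<and> x \<in> U \<and> g \<in> Hol (family n) U \<and>
       in_base_ideal (family n) ?\<pi> j x (\<lambda>y. (?\<pi> y j - ?\<pi> x j) * g y)"
  then obtain U1 h where U1: "openin (Top (family n)) U1" "x \<in> U1"
    "\<And>y. y \<in> U1 \<Longrightarrow> (?\<pi> y j - ?\<pi> x j) * g y = (\<Sum>i<j. (?\<pi> y i - ?\<pi> x i) * h i y)"
    unfolding in_base_ideal_def by blast
  define U2 where "U2 = U \<inter> U1"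
  have U2: "openin (Top (family n)) U2" "x \<in> U2" using * U1 by (auto simp: U2_def)
  have U2X: "U2 \<subseteq> pts (family n)" using U2 openin_subset by blast
  have UX: "U \<subseteq> pts (family n)" using * openin_subset by blast
  have gl: "lhol ?N {e \<in> family_cone n. family_class n e \<in> U2} (\<lambda>e. g (family_class n e))"
    using uniformizedD(5)[OF uniformized_family UX, of g] * by (auto simp: U2_def elim: lhol_subset)
  then have g2: "g \<in> Hol (family n) U2" using uniformizedD(5)[OF uniformized_family U2X, of g] by simp
  have off: "g y = 0" if "y \<in> U2" "\<And>i. i < j \<Longrightarrow> ?\<pi> y i = ?\<pi> x i" "?\<pi> y j \<noteq> ?\<pi> x j" for y
    using U1(3)[of y] that by (simp add: U2_def)
  let ?Z = "{e \<in> family_cone n. family_class n e \<in> U2}"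
  have oO: "openin (top_of_set (family_cone n)) ?Z" using uniformizedD(4)[OF uniformized_family U2X] U2(1) by simp
  then obtain T where T: "open T" "?Z = family_cone n \<inter> T" by (auto simp: openin_open)
  show "in_base_ideal (family n) ?\<pi> j x g"
  proof (rule vanishing_in_base_ideal[OF n U2 g2])
    fix y assume y: "y \<in> U2" "\<And>i. i < j \<Longrightarrow> ?\<pi> y i = ?\<pi> x i"
    show "g y = 0"
    proof (cases "?\<pi> y j = ?\<pi> x j")
      case False then show ?thesis using off y by blast
    next
      case True
      obtain e where e: "e \<in> family_cone n" "y = family_class n e" using y(1) U2X by (auto simp: pts_family)
      obtain \<gamma> where \<gamma>: "(\<gamma> \<longlongrightarrow> e) (at 0)" "\<And>\<delta>. \<gamma> \<delta> \<in> family_cone n"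
        "\<And>\<delta> i. i < 2 * n \<Longrightarrow> \<gamma> \<delta> i = (if i = j then e i + \<delta> else e i)"
        using base_curve[OF e(1) j] by metis
      have eO: "e \<in> ?Z" using e y by simp
      have "\<forall>\<^sub>F \<delta> in at 0. \<gamma> \<delta> \<in> T" using \<gamma>(1) T eO by (auto dest: topological_tendstoD)
      then have ev: "\<forall>\<^sub>F \<delta> in at 0. \<gamma> \<delta> \<in> ?Z" using \<gamma>(2) T(2) by (auto elim: eventually_mono)
      have lim: "((\<lambda>\<delta>. g (family_class n (\<gamma> \<delta>))) \<longlongrightarrow> g (family_class n e)) (at 0)"
        by (rule continuous_on_tendsto_compose[OF lhol_continuous[OF gl] \<gamma>(1) eO ev])
      have "\<forall>\<^sub>F \<delta> in at (0::complex). \<delta> \<noteq> 0" by (rule eventually_neq_at_within)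
      with ev have "\<forall>\<^sub>F \<delta> in at 0. g (family_class n (\<gamma> \<delta>)) = 0"
      proof eventually_elim
        case (elim \<delta>)
        have pi: "?\<pi> (family_class n (\<gamma> \<delta>)) i = (if i = j then ?\<pi> y i + \<delta> else ?\<pi> y i)" if "i < 2 * n" for i
          using that \<gamma> e by (simp add: base_part_def)
        show ?case
        proof (rule off)
          show "family_class n (\<gamma> \<delta>) \<in> U2" using elim by simp
          show "?\<pi> (family_class n (\<gamma> \<delta>)) i = ?\<pi> x i" if "i < j" for i using pi[of i] that j y by simp
          show "?\<pi> (family_class n (\<gamma> \<delta>)) j \<noteq> ?\<pi> x j" using pi[OF j] True elim by simp
        qed
      qed
      then have "((\<lambda>\<delta>. g (family_class n (\<gamma> \<delta>))) \<longlongrightarrow> 0) (at 0)" by (rule tendsto_eventually)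
      then show ?thesis using lim e tendsto_unique trivial_limit_at by blast
    qed
  qed (use j in auto)
qed

lemma flat_family_family:
  assumes "n \<ge> 1" shows "flat_family (family n) (2 * n) (cspace (2 * n)) (base_map n)"
  unfolding flat_family_def
  using complex_space_family hol_map_base_map proper_base_map flat_at_family[OF assms] by auto

subsection \<open>Comparing a fibre with a uniformized space\<close>

definition fibre_cone :: "nat \<Rightarrow> (nat \<Rightarrow> complex) \<Rightarrow> (nat \<Rightarrow> complex) set" where
  "fibre_cone n b = {e \<in> family_cone n. base_part n e = b}"

lemma fibre_cone_scale: "e \<in> fibre_cone n b \<Longrightarrow> l \<noteq> 0 \<Longrightarrow> scale n l e \<in> fibre_cone n b"
  by (auto simp: fibre_cone_def scale_family_cone) (auto simp: base_part_def scale_def)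

lemma fibre_cone_family_cone: "e \<in> fibre_cone n b \<Longrightarrow> e \<in> family_cone n"
  by (simp add: fibre_cone_def)

lemma fibre_cone_cspace: "fibre_cone n b \<subseteq> cspace (3 * n + 3)"
  using family_cone_cspace by (auto simp: fibre_cone_def)

lemma uniformized_fibre:
  assumes b: "b \<in> cspace (2 * n)"
  shows "uniformized (3 * n + 3) (fibre_cone n b) (family_class n) (fibre (family n) (base_map n) b)"
proof -
  let ?S = "{x \<in> pts (family n). base_map n x = b}"
  have "closedin (top_of_set (cspace (2 * n))) {b}" using b by (auto intro: closed_subset)
  then have "closedin (Top (family n)) {x \<in> pts (family n). base_map n x \<in> {b}}"
    by (rule closedin_continuous_map_preimage[OF continuous_map_base_map])
  then have "closedin (Top (family n)) ?S" by simp
  moreover have "{d \<in> family_cone n. family_class n d \<in> ?S} = fibre_cone n b"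
    by (auto simp: fibre_cone_def pts_family)
  ultimately show ?thesis
    using uniformized_subspace[OF uniformized_family local_retractions_family, of n ?S] by (simp add: fibre_def)
qed

text \<open>The map induced by \<open>\<Psi>\<close> is a continuous bijection from a compact space
  to a Hausdorff space, hence a homeomorphism. This is established before holomorphy is discussed,
  which is why \<open>desc\<close> may assume that \<open>h\<close> is continuous. The real
  structures are compared through the lift \<open>g\<close> to \<open>D\<close>.\<close>

lemma has_fibreI:
  assumes n: "n \<ge> 1" and b: "b \<in> cspace (2 * n)"
    and u: "uniformized m D c Y" and comp: "compact_space (Top Y)"
    and \<Psi>: "\<And>i. i < 3 * n + 3 \<Longrightarrow> lhol m D (\<lambda>d. \<Psi> d i)" "\<And>d. d \<in> D \<Longrightarrow> \<Psi> d \<in> fibre_cone n b"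
    and inj: "\<And>d d'. d \<in> D \<Longrightarrow> d' \<in> D \<Longrightarrow> c d = c d' \<longleftrightarrow> family_class n (\<Psi> d) = family_class n (\<Psi> d')"
    and surj: "\<And>e. e \<in> fibre_cone n b \<Longrightarrow> \<exists>d\<in>D. family_class n (\<Psi> d) = family_class n e"
    and desc: "\<And>Z h. openin (top_of_set (fibre_cone n b)) Z \<Longrightarrow>
       (\<And>e l. e \<in> Z \<Longrightarrow> l \<noteq> 0 \<Longrightarrow> scale n l e \<in> Z \<and> h (scale n l e) = h e) \<Longrightarrow> continuous_on Z h \<Longrightarrow>
       lhol m {d \<in> D. \<Psi> d \<in> Z} (\<lambda>d. h (\<Psi> d)) \<Longrightarrow> lhol (3 * n + 3) Z h"
    and real: "\<And>d. d \<in> D \<Longrightarrow> g d \<in> D" "\<And>d. d \<in> D \<Longrightarrow> \<sigma> (c d) = c (g d)"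
       "\<And>d. d \<in> D \<Longrightarrow> \<Psi> (g d) = conj_swap n (\<Psi> d)"
  shows "has_fibre (family n) (2 * n) (base_map n) (family_real n) b Y \<sigma>"
proof -
  let ?N = "3 * n + 3" and ?X = "fibre (family n) (base_map n) b"
  note uF = uniformized_fibre[OF b]
  note uD = uniformizedD[OF u] and fD = uniformizedD[OF uF]
  define \<psi> where "\<psi> = (\<lambda>y. family_class n (\<Psi> (SOME d. d \<in> D \<and> c d = y)))"
  have \<psi>: "\<psi> (c d) = family_class n (\<Psi> d)" if d: "d \<in> D" for d
  proof -
    have "\<exists>d'. d' \<in> D \<and> c d' = c d" using d by blast
    from someI_ex[OF this] have "(SOME d'. d' \<in> D \<and> c d' = c d) \<in> D" "c (SOME d'. d' \<in> D \<and> c d' = c d) = c d" by auto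
    then show ?thesis unfolding \<psi>_def using inj d by blast
  qed
  have \<Psi>c: "continuous_on D \<Psi>"
    by (rule lhol_map_continuous[OF \<Psi>(1)]) (use \<Psi>(2) fibre_cone_cspace in auto)
  have "continuous_map (top_of_set D) (top_of_set (fibre_cone n b)) \<Psi>"
    using \<Psi>c \<Psi>(2) by (auto simp: continuous_map_in_subtopology continuous_map_iff_continuous2)
  then have "continuous_map (top_of_set D) (Top ?X) (family_class n \<circ> \<Psi>)"
    by (rule continuous_map_compose) (rule fD(6))
  then have "continuous_map (top_of_set D) (Top ?X) (\<lambda>d. \<psi> (c d))"
    by (rule continuous_map_eq) (simp add: \<psi>)
  then have \<psi>c: "continuous_map (Top Y) (Top ?X) \<psi>" by (rule continuous_map_uniformized[OF u])
  have "Hausdorff_space (Top ?X)"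
    by (simp add: fibre_def subspace_on_def Hausdorff_space_subtopology Hausdorff_family)
  moreover have "\<psi> ` pts Y = pts ?X"
  proof -
    have "\<psi> ` pts Y = (\<lambda>d. family_class n (\<Psi> d)) ` D"
      unfolding uD(3)[symmetric] image_image using \<psi> by (intro image_cong) auto
    also have "\<dots> = family_class n ` fibre_cone n b"
    proof
      show "(\<lambda>d. family_class n (\<Psi> d)) ` D \<subseteq> family_class n ` fibre_cone n b" using \<Psi>(2) by auto
      show "family_class n ` fibre_cone n b \<subseteq> (\<lambda>d. family_class n (\<Psi> d)) ` D"
      proof
        fix x assume "x \<in> family_class n ` fibre_cone n b"
        then obtain e where e: "e \<in> fibre_cone n b" "x = family_class n e" by blast
        then show "x \<in> (\<lambda>d. family_class n (\<Psi> d)) ` D" using surj[OF e(1)] by force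
      qed
    qed
    finally show ?thesis using fD(3) by simp
  qed
  moreover have "inj_on \<psi> (pts Y)"
    unfolding uD(3)[symmetric] using inj \<psi> by (auto simp: inj_on_def)
  ultimately have "homeomorphic_map (Top Y) (Top ?X) \<psi>"
    using continuous_imp_homeomorphic_map[OF \<psi>c comp] by blast
  then obtain \<phi> where \<phi>h: "homeomorphic_maps (Top Y) (Top ?X) \<psi> \<phi>" by (auto simp: homeomorphic_map_maps)
  then have \<phi>H: "homeomorphic_map (Top ?X) (Top Y) \<phi>"
    using homeomorphic_maps_sym homeomorphic_map_maps by blast
  have \<phi>: "\<phi> (family_class n (\<Psi> d)) = c d" if "d \<in> D" for d
  proof -
    have "\<phi> (\<psi> (c d)) = c d" using \<phi>h that uD(3) by (auto simp: homeomorphic_maps_def)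
    then show ?thesis using \<psi> that by simp
  qed
  have "biholomorphic ?X Y \<phi>"
  proof (rule uniformized_biholomorphic[OF u uF \<phi>H \<Psi> \<phi>])
    fix V f assume V: "openin (Top Y) V" and f: "lhol m {d \<in> D. c d \<in> V} (\<lambda>d. f (c d))"
    let ?Z = "{x \<in> fibre_cone n b. \<phi> (family_class n x) \<in> V}"
    have "continuous_map (Top ?X) (Top Y) \<phi>" using \<phi>h by (simp add: homeomorphic_maps_def)
    then have "continuous_map (top_of_set (fibre_cone n b)) (Top Y) (\<phi> \<circ> family_class n)"
      using continuous_map_compose[OF fD(6)] by blast
    then have pc: "continuous_map (top_of_set (fibre_cone n b)) (Top Y) (\<lambda>x. \<phi> (family_class n x))" by (simp add: o_def)
    show "lhol ?N ?Z (\<lambda>x. f (\<phi> (family_class n x)))"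
    proof (rule desc)
      show "openin (top_of_set (fibre_cone n b)) ?Z"
        using openin_continuous_map_preimage[OF pc V] by simp
      show "scale n l e \<in> ?Z \<and> f (\<phi> (family_class n (scale n l e))) = f (\<phi> (family_class n e))" if "e \<in> ?Z" "l \<noteq> 0" for e l
        using that fibre_cone_scale[of e n b l] family_class_scale[OF fibre_cone_family_cone[of e n b], of l] by simp
      have "continuous_map (subtopology (top_of_set (fibre_cone n b)) ?Z) (Top Y) (\<lambda>x. \<phi> (family_class n x))"
        by (rule continuous_map_from_subtopology[OF pc])
      then have "continuous_map (top_of_set ?Z) (Top Y) (\<lambda>x. \<phi> (family_class n x))"
        by (simp add: subtopology_subtopology Int_absorb1)
      then have "continuous_map (top_of_set ?Z) (subtopology (Top Y) V) (\<lambda>x. \<phi> (family_class n x))"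
        by (auto simp: continuous_map_in_subtopology)
      then have "continuous_map (top_of_set ?Z) euclidean (f \<circ> (\<lambda>x. \<phi> (family_class n x)))"
        by (rule continuous_map_compose[OF _ uniformized_function_continuous[OF u V f]])
      then show "continuous_on ?Z (\<lambda>x. f (\<phi> (family_class n x)))"
        by (simp add: o_def)
      have "{d \<in> D. \<Psi> d \<in> ?Z} = {d \<in> D. c d \<in> V}" using \<Psi>(2) \<phi> by auto
      then show "lhol m {d \<in> D. \<Psi> d \<in> ?Z} (\<lambda>d. f (\<phi> (family_class n (\<Psi> d))))"
        using f \<phi> by (subst lhol_cong[where g = "\<lambda>d. f (c d)"]) auto
    qed
  qed
  moreover have "\<phi> (family_real n x) = \<sigma> (\<phi> x)" if "x \<in> pts (family n)" "base_map n x = b" for x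
  proof -
    obtain e where "e \<in> family_cone n" "x = family_class n e"
      using \<open>x \<in> pts (family n)\<close> by (auto simp: pts_family)
    then have e: "e \<in> fibre_cone n b" "x = family_class n e"
      using \<open>base_map n x = b\<close> by (simp_all add: fibre_cone_def)
    then obtain d where d: "d \<in> D" "x = family_class n (\<Psi> d)" using surj[OF e(1)] by auto
    have "family_real n x = family_class n (\<Psi> (g d))"
      using family_real_class[OF fibre_cone_family_cone[OF \<Psi>(2)[OF d(1)]]] d real(3) by simp
    then show ?thesis using \<phi>[OF real(1)[OF d(1)]] \<phi>[OF d(1)] real(2)[OF d(1)] d(2) by simp
  qed
  ultimately show ?thesis
    unfolding has_fibre_def using reduced_fibre_family[OF n] by blast
qed

subsection \<open>Functions invariant under a cyclic group\<close>

text \<open>The action of weights (1, a) of the roots of unity on C^2. Weight \<open>a = 1\<close>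
  has the cone over the rational normal curve as quotient, \<open>a = n - 1\<close> the surface x y
  = z^n.\<close>

definition twist :: "complex \<Rightarrow> nat \<Rightarrow> (nat \<Rightarrow> complex) \<Rightarrow> nat \<Rightarrow> complex" where
  "twist \<omega> a q = q(0 := \<omega> * q 0, 1 := \<omega> ^ a * q 1)"

lemma cis_root_power: "n \<ge> 1 \<Longrightarrow> cis (2 * pi / real n) ^ n = 1"
proof -
  assume "n \<ge> 1"
  then have *: "real n * (2 * pi / real n) = 2 * pi" by simp
  show ?thesis using Complex.DeMoivre[of "2 * pi / real n" n] * by (simp only: cis_2pi)
qed

lemma sum_roots_unity:
  assumes n: "n \<ge> 1"
  defines "\<omega> \<equiv> cis (2 * pi / n)"
  shows "(\<Sum>k<n. (\<omega> ^ k) ^ m) = (if n dvd m then of_nat n else 0)"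
proof -
  have \<omega>n: "\<omega> ^ n = 1" unfolding \<omega>_def by (rule cis_root_power[OF n])
  show ?thesis
  proof (cases "n dvd m")
    case True
    then obtain r where "m = n * r" by blast
    then have "\<omega> ^ m = 1" using \<omega>n by (simp add: power_mult)
    then have "(\<omega> ^ k) ^ m = 1" for k by (metis power_mult mult.commute power_one)
    then show ?thesis using True by simp
  next
    case False
    have "\<omega> ^ m \<noteq> 1"
    proof
      assume "\<omega> ^ m = 1"
      then have "cis (real m * (2 * pi / n)) = 1"
        using Complex.DeMoivre[of "2 * pi / real n" m] by (simp only: \<omega>_def)
      then have "cos (real m * (2 * pi / n)) = 1" by (metis cis.simps(1) one_complex.simps(1))
      then obtain j :: int where "real m * (2 * pi / n) = of_int j * 2 * pi" by (auto simp: cos_one_2pi_int)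
      then have "real m = of_int j * real n" using n by (simp add: field_simps)
      then have "int m = j * int n" by (metis of_int_eq_iff of_int_mult of_int_of_nat_eq)
      then have "int n dvd int m" by simp
      then show False using False by simp
    qed
    have "(\<Sum>k<n. (\<omega> ^ k) ^ m) = (\<Sum>k<n. (\<omega> ^ m) ^ k)" by (simp add: power_mult[symmetric] mult.commute)
    also have "\<dots> = ((\<omega> ^ m) ^ n - 1) / (\<omega> ^ m - 1)" using \<open>\<omega> ^ m \<noteq> 1\<close> by (rule geometric_sum)
    also have "(\<omega> ^ m) ^ n = 1" by (metis \<omega>n mult.commute power_mult power_one)
    finally show ?thesis using False by simp
  qed
qed

text \<open>Power division in both variables in turn leaves coefficients depending on
  \<open>q 0 ^ n\<close> and \<open>q 1 ^ n\<close>, which the group fixes. Averaging over the group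
  then removes every monomial whose weight \<open>r + a * t\<close> is not divisible by
  \<open>n\<close>.\<close>

lemma invariant_division:
  assumes k: "k \<in> ahol 2 (polydisc 2 (\<lambda>_. 0) (\<lambda>_. \<rho>))" and s: "0 < s" "s < \<rho>" and n: "n \<ge> 1"
    and inv: "\<And>\<omega> q. \<omega> ^ n = 1 \<Longrightarrow> q \<in> cspace 2 \<Longrightarrow> k (twist \<omega> a q) = k q"
  obtains g where "\<And>r t. r < n \<Longrightarrow> t < n \<Longrightarrow> g r t \<in> ahol 2 (polydisc 2 (\<lambda>_. 0) (\<lambda>_. s ^ n))"
    "\<And>q. q \<in> polydisc 2 (\<lambda>_. 0) (\<lambda>_. s) \<Longrightarrow> k q = (\<Sum>r<n. \<Sum>t<n.
        if n dvd r + a * t then q 0 ^ r * q 1 ^ t * g r t (q(0 := q 0 ^ n, 1 := q 1 ^ n)) else 0)"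
proof -
  have lt: "(0::nat) < 2" "(1::nat) < 2" by auto
  let ?P = "polydisc 2 (\<lambda>_. 0)"
  obtain f where f: "\<And>r. r < n \<Longrightarrow> f r \<in> ahol 2 (?P ((\<lambda>_. \<rho>)(0 := s ^ n)))"
    "\<And>q. q \<in> ?P ((\<lambda>_. \<rho>)(0 := s)) \<Longrightarrow> k q = (\<Sum>r<n. q 0 ^ r * f r (q(0 := q 0 ^ n)))"
    using power_division[OF k lt(1) s(1) _ n] s(2) by metis
  have s2: "s < ((\<lambda>_. \<rho>)(0 := s ^ n)) (1::nat)" using s by simp
  have "\<exists>g. (\<forall>t<n. g t \<in> ahol 2 (?P ((\<lambda>_. \<rho>)(0 := s ^ n, 1 := s ^ n)))) \<and>
     (\<forall>q\<in>?P ((\<lambda>_. \<rho>)(0 := s ^ n, 1 := s)). f r q = (\<Sum>t<n. q 1 ^ t * g t (q(1 := q 1 ^ n))))" if "r < n" for r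
    by (rule power_division[OF f(1)[OF that] lt(2) s(1) s2 n]) blast
  then have "\<forall>r. \<exists>g. r < n \<longrightarrow> (\<forall>t<n. g t \<in> ahol 2 (?P ((\<lambda>_. \<rho>)(0 := s ^ n, 1 := s ^ n)))) \<and>
     (\<forall>q\<in>?P ((\<lambda>_. \<rho>)(0 := s ^ n, 1 := s)). f r q = (\<Sum>t<n. q 1 ^ t * g t (q(1 := q 1 ^ n))))" by blast
  from choice[OF this] obtain g where g: "\<And>r t. r < n \<Longrightarrow> t < n \<Longrightarrow> g r t \<in> ahol 2 (?P ((\<lambda>_. \<rho>)(0 := s ^ n, 1 := s ^ n)))"
    "\<And>r q. r < n \<Longrightarrow> q \<in> ?P ((\<lambda>_. \<rho>)(0 := s ^ n, 1 := s)) \<Longrightarrow> f r q = (\<Sum>t<n. q 1 ^ t * g r t (q(1 := q 1 ^ n)))"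
    by auto
  have two: "i < 2 \<longleftrightarrow> i = 0 \<or> i = 1" for i :: nat by auto
  have pe: "?P ((\<lambda>_. \<rho>)(0 := s ^ n, 1 := s ^ n)) = ?P (\<lambda>_. s ^ n)"
    by (auto simp: polydisc_def two)
  define G where "G = (\<lambda>r t q. g r t (q(0 := q 0 ^ n, 1 := q 1 ^ n)))"
  have full: "k q = (\<Sum>r<n. \<Sum>t<n. q 0 ^ r * q 1 ^ t * G r t q)" if q: "q \<in> ?P (\<lambda>_. s)" for q
  proof -
    have q1: "q \<in> ?P ((\<lambda>_. \<rho>)(0 := s))" using q s by (auto simp: polydisc_def two intro: less_trans)
    have q2: "q(0 := q 0 ^ n) \<in> ?P ((\<lambda>_. \<rho>)(0 := s ^ n, 1 := s))"
      using q n by (auto simp: polydisc_def two cspace_def norm_power power_strict_mono)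
    have "k q = (\<Sum>r<n. q 0 ^ r * f r (q(0 := q 0 ^ n)))" by (rule f(2)[OF q1])
    also have "\<dots> = (\<Sum>r<n. \<Sum>t<n. q 0 ^ r * q 1 ^ t * G r t q)"
    proof (rule sum.cong[OF refl])
      fix r assume "r \<in> {..<n}"
      then show "q 0 ^ r * f r (q(0 := q 0 ^ n)) = (\<Sum>t<n. q 0 ^ r * q 1 ^ t * G r t q)"
        using g(2)[OF _ q2, of r] by (simp add: sum_distrib_left G_def mult.assoc)
    qed
    finally show ?thesis .
  qed
  define \<omega> where "\<omega> = cis (2 * pi / n)"
  have \<omega>: "(\<omega> ^ j) ^ n = 1" for j
  proof -
    have "\<omega> ^ n = 1" unfolding \<omega>_def by (rule cis_root_power[OF n])
    then show ?thesis by (metis mult.commute power_mult power_one)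
  qed
  have n\<omega>: "cmod (\<omega> ^ j) = 1" for j by (simp add: \<omega>_def norm_power)
  have avg: "k q = (\<Sum>r<n. \<Sum>t<n. if n dvd r + a * t then q 0 ^ r * q 1 ^ t * G r t q else 0)"
    if q: "q \<in> ?P (\<lambda>_. s)" for q
  proof -
    have qN: "q \<in> cspace 2" using q by (auto simp: polydisc_def)
    have tw: "twist (\<omega> ^ j) a q \<in> ?P (\<lambda>_. s)" for j
      using q n\<omega>[of j] by (auto simp: polydisc_def two twist_def cspace_def norm_mult norm_power)
    have GT: "G r t (twist (\<omega> ^ j) a q) = G r t q" for r t j
    proof -
      have "((\<omega> ^ j) ^ a) ^ n = 1" using \<omega>[of j] by (metis mult.commute power_mult power_one)
      then have "(twist (\<omega> ^ j) a q)(0 := (twist (\<omega> ^ j) a q) 0 ^ n, 1 := (twist (\<omega> ^ j) a q) 1 ^ n)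
          = q(0 := q 0 ^ n, 1 := q 1 ^ n)"
        using \<omega>[of j] by (auto simp: twist_def power_mult_distrib fun_eq_iff)
      then show ?thesis by (simp add: G_def)
    qed
    have "of_nat n * k q = (\<Sum>j<n. k (twist (\<omega> ^ j) a q))" using inv[OF \<omega> qN] by simp
    also have "\<dots> = (\<Sum>j<n. \<Sum>r<n. \<Sum>t<n. (\<omega> ^ j) ^ (r + a * t) * (q 0 ^ r * q 1 ^ t * G r t q))"
    proof (rule sum.cong[OF refl])
      fix j
      have t01: "twist (\<omega> ^ j) a q 0 = \<omega> ^ j * q 0" "twist (\<omega> ^ j) a q 1 = (\<omega> ^ j) ^ a * q 1" by (auto simp: twist_def)
      show "k (twist (\<omega> ^ j) a q) = (\<Sum>r<n. \<Sum>t<n. (\<omega> ^ j) ^ (r + a * t) * (q 0 ^ r * q 1 ^ t * G r t q))"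
        unfolding full[OF tw] GT t01
      proof (intro sum.cong refl)
        fix r t
        have "(\<omega> ^ j) ^ (r + a * t) = (\<omega> ^ j) ^ r * ((\<omega> ^ j) ^ a) ^ t" by (simp only: power_add power_mult)
        then show "(\<omega> ^ j * q 0) ^ r * ((\<omega> ^ j) ^ a * q 1) ^ t * G r t q =
            (\<omega> ^ j) ^ (r + a * t) * (q 0 ^ r * q 1 ^ t * G r t q)"
          by (simp only: power_mult_distrib mult_ac)
      qed
    qed
    also have "\<dots> = (\<Sum>r<n. \<Sum>t<n. \<Sum>j<n. (\<omega> ^ j) ^ (r + a * t) * (q 0 ^ r * q 1 ^ t * G r t q))"
      by (subst sum.swap, rule sum.cong[OF refl], subst sum.swap, rule refl)
    also have "\<dots> = (\<Sum>r<n. \<Sum>t<n. (if n dvd r + a * t then of_nat n else 0) * (q 0 ^ r * q 1 ^ t * G r t q))"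
      unfolding sum_distrib_right[symmetric] \<omega>_def sum_roots_unity[OF n] ..
    also have "\<dots> = of_nat n * (\<Sum>r<n. \<Sum>t<n. if n dvd r + a * t then q 0 ^ r * q 1 ^ t * G r t q else 0)"
      unfolding sum_distrib_left by (intro sum.cong refl) auto
    finally show ?thesis using n by simp
  qed
  show ?thesis using that[of g] g(1)[unfolded pe] avg[unfolded G_def] by blast
qed

text \<open>Normality of a cyclic quotient singularity, stated so as to cover both types that occur.
  The map \<open>\<mu>\<close> uniformizes the chart \<open>e c = 1\<close> by C^2. The pullback of
  \<open>h\<close> is holomorphic off the origin and continuous, hence holomorphic; its expansion
  contains only invariant monomials. Each of these is a holomorphic function \<open>M r t\<close> of
  the ambient coordinates, and the n-th powers of the variables are the coordinates
  \<open>ia\<close> and \<open>ib\<close>, so the expansion itself is the required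
  extension.\<close>

lemma cyclic_extension:
  assumes n: "n \<ge> 1" and Z: "openin (top_of_set (fibre_cone n b)) Z" and e0: "e0 \<in> Z"
    and hom: "\<And>e l. e \<in> Z \<Longrightarrow> l \<noteq> 0 \<Longrightarrow> scale n l e \<in> Z \<and> h (scale n l e) = h e"
    and hc: "continuous_on Z h" and reg: "lhol (3 * n + 3) {e \<in> Z. Reg e} h"
    and c: "2 * n \<le> c" "c < 3 * n + 3" "e0 c \<noteq> 0"
    and \<mu>: "\<And>i. lhol 2 (cspace 2) (\<lambda>q. \<mu> q i)" "\<And>q. q \<in> cspace 2 \<Longrightarrow> \<mu> q \<in> fibre_cone n b"
      "\<And>\<omega> q. \<omega> ^ n = 1 \<Longrightarrow> q \<in> cspace 2 \<Longrightarrow> \<mu> (twist \<omega> a q) = \<mu> q" "\<mu> (\<lambda>_. 0) = normal_form n c e0"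
      "\<And>q. q \<in> cspace 2 \<Longrightarrow> q \<noteq> (\<lambda>_. 0) \<Longrightarrow> Reg (\<mu> q)"
      "\<And>e. e \<in> fibre_cone n b \<Longrightarrow> e c \<noteq> 0 \<Longrightarrow> \<exists>q\<in>cspace 2. normal_form n c e = \<mu> q"
    and ia: "\<And>q. q \<in> cspace 2 \<Longrightarrow> \<mu> q ia = q 0 ^ n" "\<And>q. q \<in> cspace 2 \<Longrightarrow> \<mu> q ib = q 1 ^ n"
    and M: "\<And>r t. lhol (3 * n + 3) (cspace (3 * n + 3)) (M r t)"
      "\<And>q r t. q \<in> cspace 2 \<Longrightarrow> r < n \<Longrightarrow> t < n \<Longrightarrow> n dvd r + a * t \<Longrightarrow> q 0 ^ r * q 1 ^ t = M r t (\<mu> q)"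
  shows "\<exists>V. openin (top_of_set (cspace (3 * n + 3))) V \<and> e0 \<in> V \<and> lhol (3 * n + 3) (V \<inter> Z) h"
proof -
  let ?N = "3 * n + 3" and ?P = "polydisc 2 (\<lambda>_. 0)"
  have two: "i < 2 \<longleftrightarrow> i = 0 \<or> i = 1" for i :: nat by auto
  have ZF: "Z \<subseteq> fibre_cone n b" using Z by (auto simp: openin_open)
  have ZN: "Z \<subseteq> cspace ?N" using ZF fibre_cone_cspace by blast
  have \<mu>c: "continuous_on (cspace 2) \<mu>"
    by (rule lhol_map_continuous[OF \<mu>(1)]) (use \<mu>(2) fibre_cone_cspace in blast)
  have nf0: "normal_form n c e0 \<in> Z" unfolding normal_form_def using hom[OF e0, of "1 / e0 c"] c by simp
  have "openin (top_of_set (cspace 2)) (cspace 2 \<inter> \<mu> -` Z)"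
    by (rule continuous_openin_preimage[OF \<mu>c _ Z]) (use \<mu>(2) in auto)
  moreover have "(\<lambda>_. 0) \<in> cspace 2 \<inter> \<mu> -` Z" using \<mu>(4) nf0 by (simp add: cspace_def)
  ultimately obtain \<rho> where \<rho>: "\<rho> > 0" "?P (\<lambda>_. \<rho>) \<subseteq> cspace 2 \<inter> \<mu> -` Z" by (rule polydisc_in)
  let ?D = "?P (\<lambda>_. \<rho>)"
  have DZ: "\<mu> q \<in> Z" "q \<in> cspace 2" if "q \<in> ?D" for q using \<rho> that by auto
  define k where "k = (\<lambda>q. h (\<mu> q))"
  have kc: "continuous_on ?D k"
    unfolding k_def
    by (rule continuous_on_compose2[OF hc continuous_on_subset[OF \<mu>c]]) (use DZ in auto)
  have "openin (top_of_set (cspace 2)) (?D - {\<lambda>_. 0})"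
    by (rule openin_diff[OF polydisc_openin]) (auto simp: cspace_def intro: closed_subset)
  moreover have "lhol 2 (?D - {\<lambda>_. 0}) k"
    unfolding k_def
  proof (rule lhol_compose[OF reg])
    show "lhol 2 (?D - {\<lambda>_. 0}) (\<lambda>q. \<mu> q i)" for i by (rule lhol_subset[OF \<mu>(1)]) (use DZ in auto)
    show "\<mu> q \<in> {e \<in> Z. Reg e}" if "q \<in> ?D - {\<lambda>_. 0}" for q using that DZ[of q] \<mu>(5)[of q] by auto
  qed (use DZ in auto)
  ultimately have "k \<in> ahol 2 (?D - {\<lambda>_. 0})" by (rule lhol_open_imp_ahol)
  then have kh: "k \<in> ahol 2 ?D"
    by (intro ahol_puncture[OF polydisc_openin _ kc]) (use \<rho>(1) in \<open>auto simp: polydisc_def cspace_def\<close>)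
  define s where "s = \<rho> / 2"
  have s: "0 < s" "s < \<rho>" using \<rho>(1) by (auto simp: s_def)
  have inv: "k (twist \<omega> a q) = k q" if "\<omega> ^ n = 1" "q \<in> cspace 2" for \<omega> q
    using \<mu>(3)[OF that] by (simp add: k_def)
  show ?thesis
  proof (rule invariant_division[OF kh s n inv])
    fix g assume g: "\<And>r t. r < n \<Longrightarrow> t < n \<Longrightarrow> g r t \<in> ahol 2 (?P (\<lambda>_. s ^ n))"
    and gk: "\<And>q. q \<in> ?P (\<lambda>_. s) \<Longrightarrow> k q = (\<Sum>r<n. \<Sum>t<n.
        if n dvd r + a * t then q 0 ^ r * q 1 ^ t * g r t (q(0 := q 0 ^ n, 1 := q 1 ^ n)) else 0)"
    define A where "A = (\<lambda>y::nat \<Rightarrow> complex. (\<lambda>i::nat. if i = 0 then y ia else if i = 1 then y ib else 0))"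
    define G where "G = (\<lambda>y. \<Sum>r<n. \<Sum>t<n. if n dvd r + a * t then M r t y * g r t (A y) else 0)"
    \<comment> \<open>The inequalities bound \<open>normal_form n c e\<close> at \<open>ia\<close>
      and \<open>ib\<close> by \<open>s ^ n\<close>; they are multiplied out so that openness is
      immediate.\<close>
    define V where "V = cspace ?N \<inter> {e. e c \<noteq> 0 \<and> cmod (e ia) < s ^ n * cmod (e c) \<and> cmod (e ib) < s ^ n * cmod (e c)}"
    have oV: "openin (top_of_set (cspace ?N)) V"
      unfolding V_def
      by (intro openin_open_Int open_Collect_conj open_Collect_neq open_Collect_less continuous_intros)
    have nfV: "cmod (normal_form n c e ia) < s ^ n" "cmod (normal_form n c e ib) < s ^ n" "e c \<noteq> 0"
      if "e \<in> V" "ia \<ge> 2 * n" "ib \<ge> 2 * n" for e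
      using that by (auto simp: V_def normal_form_def scale_def norm_divide field_simps)
    \<comment> \<open>Base coordinates are constant on the fibre, whereas an n-th power of a
      variable takes the values 0 and 1.\<close>
    have iN: "ia \<ge> 2 * n" "ib \<ge> 2 * n"
    proof -
      have bp: "i \<ge> 2 * n" if *: "\<And>q. q \<in> cspace 2 \<Longrightarrow> \<mu> q i = q k ^ n" "k < 2" for i k
      proof (rule ccontr)
        assume "\<not> i \<ge> 2 * n"
        then have "\<mu> q i = b i" if "q \<in> cspace 2" for q
          using \<mu>(2)[OF that] by (auto simp: fibre_cone_def base_part_def fun_eq_iff split: if_splits)
        then have "q k ^ n = b i" if "q \<in> cspace 2" for q using *(1) that by simp
        from this[of "\<lambda>_. 0"] this[of "(\<lambda>_. 0)(k := 1)"] show False using n *(2) by (auto simp: cspace_def power_0_left)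
      qed
      show "ia \<ge> 2 * n" "ib \<ge> 2 * n" using bp[of ia 0] bp[of ib 1] ia by auto
    qed
    have "e0 \<in> V"
    proof -
      have z: "(\<lambda>_. 0) \<in> cspace 2" by (simp add: cspace_def)
      have "normal_form n c e0 ia = 0" "normal_form n c e0 ib = 0"
        using ia(1)[OF z] ia(2)[OF z] n by (simp_all add: \<mu>(4))
      then have "e0 ia = 0" "e0 ib = 0" using iN c by (auto simp: normal_form_def scale_def)
      then show ?thesis using c s e0 ZN by (auto simp: V_def)
    qed
    moreover have "lhol ?N (V \<inter> Z) h"
    proof -
      have nl: "lhol ?N (V \<inter> Z) (\<lambda>e. normal_form n c e i)" for i
        by (rule lhol_normal_form) (auto simp: V_def)
      have VN: "V \<inter> Z \<subseteq> cspace ?N" using ZN by auto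
      have nN: "normal_form n c e \<in> cspace ?N" if "e \<in> V \<inter> Z" for e
      proof -
        have "e \<in> family_cone n" "e c \<noteq> 0" using that ZF fibre_cone_family_cone by (auto simp: V_def)
        then show ?thesis using normal_form_cone family_cone_cspace by blast
      qed
      have "lhol ?N (V \<inter> Z) (\<lambda>e. G (normal_form n c e))"
        unfolding G_def
      proof (intro lhol_sum VN)
        fix r t assume rt: "r \<in> {..<n}" "t \<in> {..<n}"
        have "lhol ?N (V \<inter> Z) (\<lambda>e. M r t (normal_form n c e))"
          by (rule lhol_compose[OF M(1) nl nN VN])
        moreover have grt: "g r t \<in> ahol 2 (?P (\<lambda>_. s ^ n))" using g rt by simp
        have "lhol ?N (V \<inter> Z) (\<lambda>e. g r t (A (normal_form n c e)))"
        proof (rule lhol_compose[OF ahol_imp_lhol[OF polydisc_openin grt order_refl] _ _ VN])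
          show "lhol ?N (V \<inter> Z) (\<lambda>e. A (normal_form n c e) i)" if "i < 2" for i
            using that nl by (auto simp: A_def two)
          show "A (normal_form n c e) \<in> ?P (\<lambda>_. s ^ n)" if "e \<in> V \<inter> Z" for e
            using nfV[of e] iN that by (auto simp: polydisc_def A_def cspace_def two)
        qed
        ultimately show "lhol ?N (V \<inter> Z) (\<lambda>e. if n dvd r + a * t
            then M r t (normal_form n c e) * g r t (A (normal_form n c e)) else 0)"
          by (cases "n dvd r + a * t") (auto intro!: lhol_mult lhol_const VN)
      qed
      moreover have "h e = G (normal_form n c e)" if e: "e \<in> V \<inter> Z" for e
      proof -
        have ec: "e c \<noteq> 0" using e by (auto simp: V_def)
        obtain q where q: "q \<in> cspace 2" "normal_form n c e = \<mu> q" using \<mu>(6)[of e] e ec ZF by auto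
        have "cmod (q 0) ^ n < s ^ n" "cmod (q 1) ^ n < s ^ n"
          using nfV[of e] e iN q ia by (auto simp: norm_power)
        then have "cmod (q 0) < s" "cmod (q 1) < s" using power_less_imp_less_base[of _ n s] s(1) by simp_all
        then have qP: "q \<in> ?P (\<lambda>_. s)" using q(1) by (auto simp: polydisc_def two)
        have "h e = h (normal_form n c e)" using hom[of e "1 / e c"] e ec by (simp add: normal_form_def)
        also have "\<dots> = k q" by (simp add: k_def q)
        also have "\<dots> = G (\<mu> q)"
        proof -
          have "A (\<mu> q) = q(0 := q 0 ^ n, 1 := q 1 ^ n)"
            using q(1) ia by (auto simp: A_def cspace_def fun_eq_iff)
          then show ?thesis
            unfolding gk[OF qP] G_def
            by (intro sum.cong refl if_cong) (simp_all only: M(2)[OF q(1)] lessThan_iff)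
        qed
        finally show ?thesis by (simp add: q)
      qed
      ultimately show ?thesis by (subst lhol_cong[where g = "\<lambda>e. G (normal_form n c e)"]) auto
    qed
    ultimately show ?thesis using oV by blast
  qed
qed

subsection \<open>Points over the rational normal curve\<close>

definition cone_point :: "nat \<Rightarrow> (nat \<Rightarrow> complex) \<Rightarrow> complex \<Rightarrow> complex \<Rightarrow> complex \<Rightarrow> complex \<Rightarrow> complex \<Rightarrow> nat \<Rightarrow> complex" where
  "cone_point n b x y t u0 u1 i = (if i < 2 * n then b i else if i = 2 * n then x else if i = 2 * n + 1 then y
     else if i < 3 * n + 3 then t * u0 ^ (i - (2 * n + 2)) * u1 ^ (n - (i - (2 * n + 2))) else 0)"

definition binary_form :: "nat \<Rightarrow> (nat \<Rightarrow> complex) \<Rightarrow> complex \<Rightarrow> complex \<Rightarrow> complex" where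
  "binary_form n b u0 u1 = (\<Prod>k<n. u0 - b k * u1) * (\<Prod>k<n. u1 - b (n + k) * u0)"

lemma cone_point_coords:
  "i < 2 * n \<Longrightarrow> cone_point n b x y t u0 u1 i = b i"
  "cone_point n b x y t u0 u1 (2 * n) = x" "cone_point n b x y t u0 u1 (2 * n + 1) = y"
  "i \<le> n \<Longrightarrow> cone_point n b x y t u0 u1 (2 * n + 2 + i) = t * u0 ^ i * u1 ^ (n - i)"
  "i \<le> n \<Longrightarrow> curve_coord n (cone_point n b x y t u0 u1) i = t * u0 ^ i * u1 ^ (n - i)"
  by (simp_all add: cone_point_def curve_coord_def)

lemma branch_form_binary:
  assumes "\<And>i. i \<le> n \<Longrightarrow> curve_coord n e i = t * u0 ^ i * u1 ^ (n - i)" "\<And>k. k < 2 * n \<Longrightarrow> e k = b k"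
  shows "branch_form n e = t\<^sup>2 * binary_form n b u0 u1"
proof -
  have "branch_form n e = t\<^sup>2 * (\<Prod>k<n. u0 - e k * u1) * (\<Prod>k<n. u1 - e (n + k) * u0)"
    by (rule branch_form_curve) (rule assms(1))
  then show ?thesis using assms(2) by (simp add: binary_form_def mult.assoc)
qed

lemma on_curveD:
  "on_curve n w \<Longrightarrow> i < n \<Longrightarrow> j < n \<Longrightarrow> w i * w (Suc j) = w (Suc i) * w j"
  by (simp add: on_curve_def)

lemma on_curve_param: "(\<And>i. i \<le> n \<Longrightarrow> w i = t * u0 ^ i * u1 ^ (n - i)) \<Longrightarrow> on_curve n w"
  unfolding on_curve_def
proof (intro allI impI)
  fix i j assume w: "\<And>i. i \<le> n \<Longrightarrow> w i = t * u0 ^ i * u1 ^ (n - i)" and ij: "i < n" "j < n"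
  have "n - i = Suc (n - Suc i)" "n - j = Suc (n - Suc j)" using ij by auto
  then show "w i * w (Suc j) = w (Suc i) * w j" using ij by (simp add: w)
qed

lemma cone_point_fibre:
  assumes "b \<in> cspace (2 * n)" "x * y = t\<^sup>2 * binary_form n b u0 u1" "x \<noteq> 0 \<or> y \<noteq> 0 \<or> t \<noteq> 0 \<and> (u0 \<noteq> 0 \<or> u1 \<noteq> 0)"
  shows "cone_point n b x y t u0 u1 \<in> fibre_cone n b"
proof -
  let ?e = "cone_point n b x y t u0 u1"
  have "?e \<in> cspace (3 * n + 3)" by (auto simp: cone_point_def cspace_def)
  moreover have "\<exists>c\<in>{2 * n..<3 * n + 3}. ?e c \<noteq> 0"
  proof -
    consider "x \<noteq> 0" | "y \<noteq> 0" | "t \<noteq> 0" "u0 \<noteq> 0" | "t \<noteq> 0" "u1 \<noteq> 0" using assms(3) by blast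
    then show ?thesis
    proof cases
      case 1 then show ?thesis by (intro bexI[of _ "2 * n"]) (auto simp: cone_point_coords)
    next
      case 2 then show ?thesis by (intro bexI[of _ "2 * n + 1"]) (auto simp: cone_point_coords(3)[simplified])
    next
      case 3
      have "?e (2 * n + 2 + n) \<noteq> 0" unfolding cone_point_coords(4)[OF order_refl] using 3 by simp
      then show ?thesis by (intro bexI[of _ "2 * n + 2 + n"]) auto
    next
      case 4
      have "?e (2 * n + 2 + 0) \<noteq> 0" unfolding cone_point_coords(4)[OF le0] using 4 by simp
      then show ?thesis by (intro bexI[of _ "2 * n + 2 + 0"]) auto
    qed
  qed
  moreover have "on_curve n (curve_coord n ?e)" by (rule on_curve_param) (rule cone_point_coords(5))
  moreover have "?e (2 * n) * ?e (2 * n + 1) = branch_form n ?e"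
    unfolding cone_point_coords(2,3) assms(2)
    by (rule branch_form_binary[symmetric]) (auto simp: cone_point_coords)
  moreover have "base_part n ?e = b" using assms(1) by (auto simp: base_part_def cone_point_def cspace_def)
  ultimately show ?thesis by (auto simp: fibre_cone_def family_cone_def)
qed

lemma fibre_coneD:
  assumes "e \<in> fibre_cone n b"
  shows "e \<in> cspace (3 * n + 3)" "on_curve n (curve_coord n e)" "e (2 * n) * e (2 * n + 1) = branch_form n e"
    "k < 2 * n \<Longrightarrow> e k = b k"
  using assms by (auto simp: fibre_cone_def family_cone_def base_part_def)

lemma fibre_cone_eq_cone_point:
  assumes e: "e \<in> fibre_cone n b" and w: "\<And>i. i \<le> n \<Longrightarrow> curve_coord n e i = t * u0 ^ i * u1 ^ (n - i)"
  shows "e = cone_point n b (e (2 * n)) (e (2 * n + 1)) t u0 u1"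
    "e (2 * n) * e (2 * n + 1) = t\<^sup>2 * binary_form n b u0 u1"
proof -
  show "e (2 * n) * e (2 * n + 1) = t\<^sup>2 * binary_form n b u0 u1"
    unfolding fibre_coneD(3)[OF e] by (rule branch_form_binary[OF w fibre_coneD(4)[OF e]])
  show "e = cone_point n b (e (2 * n)) (e (2 * n + 1)) t u0 u1"
  proof
    fix i
    consider "i < 2 * n" | "i = 2 * n" | "i = 2 * n + 1" | j where "i = 2 * n + 2 + j" "j \<le> n" | "i \<ge> 3 * n + 3"
    proof -
      have "i < 2 * n \<or> i = 2 * n \<or> i = 2 * n + 1 \<or> (\<exists>j\<le>n. i = 2 * n + 2 + j) \<or> i \<ge> 3 * n + 3" by presburger
      then show ?thesis using that by blast
    qed
    then show "e i = cone_point n b (e (2 * n)) (e (2 * n + 1)) t u0 u1 i"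
    proof cases
      case 1 then show ?thesis using fibre_coneD(4)[OF e] by (simp add: cone_point_def)
    next
      case 4 then show ?thesis using w[of j] cone_point_coords(4)[of j n] by (simp add: curve_coord_def)
    next
      case 5 then show ?thesis using fibre_coneD(1)[OF e] by (simp add: cone_point_def cspace_def)
    qed (simp_all add: cone_point_def)
  qed
qed

lemma scale_cone_point: "scale n l (cone_point n b x y t u0 u1) = cone_point n b (l * x) (l * y) (l * t) u0 u1"
  by (auto simp: scale_def cone_point_def)

lemma lhol_cone_point:
  assumes "S \<subseteq> cspace m" "lhol m S X" "lhol m S Y" "lhol m S T" "lhol m S U0" "lhol m S U1"
  shows "lhol m S (\<lambda>d. cone_point n b (X d) (Y d) (T d) (U0 d) (U1 d) i)"
  unfolding cone_point_def
  by (cases "i < 2 * n"; cases "i = 2 * n"; cases "i = 2 * n + 1"; cases "i < 3 * n + 3")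
    (auto intro!: lhol_const lhol_mult lhol_power assms)

lemma curve_first_coord:
  assumes "on_curve n (curve_coord n e)" "e (2 * n + 2) \<noteq> 0" "i \<le> n" "n \<ge> 1"
  shows "curve_coord n e i = e (2 * n + 2) * (e (2 * n + 3) / e (2 * n + 2)) ^ i * 1 ^ (n - i)"
proof -
  have "curve_coord n e 0 = e (2 * n + 2)" "curve_coord n e 1 = e (2 * n + 3)"
    by (simp_all add: curve_coord_def eval_nat_numeral)
  then show ?thesis
    using curve_first[of n "curve_coord n e" i, OF on_curveD[OF assms(1)]] assms by simp
qed

lemma curve_last_coord:
  assumes "on_curve n (curve_coord n e)" "e (3 * n + 2) \<noteq> 0" "i \<le> n" "n \<ge> 1"
  shows "curve_coord n e i = e (3 * n + 2) * 1 ^ i * (e (3 * n + 1) / e (3 * n + 2)) ^ (n - i)"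
proof -
  have "2 * n + 2 + n = 3 * n + 2" "2 * n + 2 + (n - 1) = 3 * n + 1" using assms(4) by auto
  then have "curve_coord n e n = e (3 * n + 2)" "curve_coord n e (n - 1) = e (3 * n + 1)"
    by (simp_all only: curve_coord_def)
  then show ?thesis
    using curve_last[of n "curve_coord n e" "n - i", OF on_curveD[OF assms(1)]] assms by simp
qed

text \<open>An n-th root of the first or last coordinate absorbs the factor \<open>t\<close>, so
  \<open>t = 1\<close> can be prescribed; the zero vector is then represented by u0 = u1 =
  0.\<close>

lemma curve_param:
  assumes n: "n \<ge> 1" and w: "on_curve n (curve_coord n e)"
  obtains u0 u1 where "\<And>i. i \<le> n \<Longrightarrow> curve_coord n e i = 1 * u0 ^ i * u1 ^ (n - i)"
proof -
  have root: "\<exists>r. v = r ^ n" for v :: complex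
    using exists_complex_root[of n v] n by auto
  consider "e (2 * n + 2) \<noteq> 0" | "e (3 * n + 2) \<noteq> 0" | "e (2 * n + 2) = 0" "e (3 * n + 2) = 0" by blast
  then show ?thesis
  proof cases
    case 1
    obtain r where r: "e (2 * n + 2) = r ^ n" using root by blast
    define z where "z = e (2 * n + 3) / e (2 * n + 2)"
    show ?thesis
    proof (rule that[of "r * z" r])
      fix i assume "i \<le> n"
      then have "r ^ n = r ^ i * r ^ (n - i)" by (simp add: power_add[symmetric])
      then show "curve_coord n e i = 1 * (r * z) ^ i * r ^ (n - i)"
        unfolding curve_first_coord[OF w 1 \<open>i \<le> n\<close> n] z_def[symmetric] unfolding r
        by (simp add: power_mult_distrib)
    qed
  next
    case 2
    obtain r where r: "e (3 * n + 2) = r ^ n" using root by blast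
    define z where "z = e (3 * n + 1) / e (3 * n + 2)"
    show ?thesis
    proof (rule that[of r "r * z"])
      fix i assume "i \<le> n"
      then have "r ^ n = r ^ i * r ^ (n - i)" by (simp add: power_add[symmetric])
      then show "curve_coord n e i = 1 * r ^ i * (r * z) ^ (n - i)"
        unfolding curve_last_coord[OF w 2 \<open>i \<le> n\<close> n] z_def[symmetric] unfolding r
        by (simp add: power_mult_distrib)
    qed
  next
    case 3
    have e': "2 * n + 2 + n = 3 * n + 2" by simp
    have z: "curve_coord n e i = 0" if "i \<le> n" for i
      by (rule curve_zero[of n "curve_coord n e", OF on_curveD[OF w]])
        (use 3 that e' in \<open>simp_all only: curve_coord_def add_0_right\<close>)
    show ?thesis
      by (rule that[of 0 0]) (use z n in \<open>auto simp: power_0_left\<close>)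
  qed
qed

lemma binary_form_scale: "binary_form n b (l * u0) (l * u1) = l ^ n * l ^ n * binary_form n b u0 u1"
proof -
  have "(\<Prod>k<n. l * u0 - b k * (l * u1)) = l ^ n * (\<Prod>k<n. u0 - b k * u1)"
    "(\<Prod>k<n. l * u1 - b (n + k) * (l * u0)) = l ^ n * (\<Prod>k<n. u1 - b (n + k) * u0)"
  proof -
    have *: "(\<Prod>k<n. l * f k) = l ^ n * (\<Prod>k<n. f k)" for f :: "nat \<Rightarrow> complex" by (simp add: prod.distrib)
    show "(\<Prod>k<n. l * u0 - b k * (l * u1)) = l ^ n * (\<Prod>k<n. u0 - b k * u1)"
      unfolding *[symmetric] by (intro prod.cong refl) (simp add: algebra_simps)
    show "(\<Prod>k<n. l * u1 - b (n + k) * (l * u0)) = l ^ n * (\<Prod>k<n. u1 - b (n + k) * u0)"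
      unfolding *[symmetric] by (intro prod.cong refl) (simp add: algebra_simps)
  qed
  then show ?thesis by (simp add: binary_form_def)
qed

lemma binary_form_zero: "binary_form n (\<lambda>_. 0) u0 u1 = u0 ^ n * u1 ^ n"
  by (simp add: binary_form_def)

lemma lhol_binary_form:
  assumes "S \<subseteq> cspace m" "lhol m S U0" "lhol m S U1"
  shows "lhol m S (\<lambda>d. binary_form n b (U0 d) (U1 d))"
  unfolding binary_form_def by (intro lhol_mult lhol_prod lhol_diff lhol_const assms)

definition pair :: "complex \<Rightarrow> complex \<Rightarrow> nat \<Rightarrow> complex" where
  "pair a b i = (if i = 0 then a else if i = 1 then b else 0)"

lemma pair_simps [simp]: "pair a b 0 = a" "pair a b (Suc 0) = b" "pair a b \<in> cspace 2"
  by (auto simp: pair_def cspace_def)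

lemma cspace_2_nonzero: "q \<in> cspace 2 \<Longrightarrow> q \<noteq> (\<lambda>_. 0) \<Longrightarrow> q 0 \<noteq> 0 \<or> q 1 \<noteq> 0"
proof (rule ccontr)
  assume q: "q \<in> cspace 2" "q \<noteq> (\<lambda>_. 0)" and "\<not> (q 0 \<noteq> 0 \<or> q 1 \<noteq> 0)"
  then have "q i = 0" for i by (cases "i = 0"; cases "i = 1") (auto simp: cspace_def)
  then show False using q(2) by auto
qed

lemma twist_simps: "twist \<omega> a q 0 = \<omega> * q 0" "twist \<omega> a q 1 = \<omega> ^ a * q 1"
  by (simp_all add: twist_def)

subsection \<open>Normality\<close>

text \<open>At a vertex all curve coordinates vanish and x or y can be normalized to 1. The other
  one of x, y is then a function of the curve, so the fibre is locally the cone over the rational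
  normal curve, the quotient of C^2 by scalar n-th roots of unity.\<close>

lemma vertex_extension:
  assumes n: "n \<ge> 1" and b: "b \<in> cspace (2 * n)" and Z: "openin (top_of_set (fibre_cone n b)) Z" and e0: "e0 \<in> Z"
    and hom: "\<And>e l. e \<in> Z \<Longrightarrow> l \<noteq> 0 \<Longrightarrow> scale n l e \<in> Z \<and> h (scale n l e) = h e"
    and hc: "continuous_on Z h" and reg: "lhol (3 * n + 3) {e \<in> Z. e (2 * n + 2) \<noteq> 0 \<or> e (3 * n + 2) \<noteq> 0} h"
    and sing: "e0 (2 * n + 2) = 0" "e0 (3 * n + 2) = 0"
  shows "\<exists>V. openin (top_of_set (cspace (3 * n + 3))) V \<and> e0 \<in> V \<and> lhol (3 * n + 3) (V \<inter> Z) h"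
proof -
  have e0F: "e0 \<in> fibre_cone n b" using e0 Z by (auto simp: openin_open)
  have "e0 (2 * n) \<noteq> 0 \<or> e0 (2 * n + 1) \<noteq> 0"
  proof -
    have "2 * n + 2 + n = 3 * n + 2" by simp
    then show ?thesis using family_cone_chart[OF fibre_cone_family_cone[OF e0F]] sing by metis
  qed
  then obtain c where c: "c = 2 * n \<or> c = 2 * n + 1" "e0 c \<noteq> 0" by blast
  have c2: "2 * n \<le> c" "c < 3 * n + 3" using c by auto
  \<comment> \<open>The coordinate \<open>c\<close> is normalized to 1, and the equation with
    \<open>t = 1\<close> forces the other one to be the binary form.\<close>
  define X where "X = (\<lambda>q :: nat \<Rightarrow> complex. if c = 2 * n then 1 else binary_form n b (q 0) (q 1))"
  define Y where "Y = (\<lambda>q :: nat \<Rightarrow> complex. if c = 2 * n then binary_form n b (q 0) (q 1) else 1)"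
  define \<mu> where "\<mu> = (\<lambda>q. cone_point n b (X q) (Y q) 1 (q 0) (q 1))"
  have key: "\<mu> (pair u0 u1) = e"
    if e: "e \<in> fibre_cone n b" "e c = 1" and u: "\<And>i. i \<le> n \<Longrightarrow> curve_coord n e i = 1 * u0 ^ i * u1 ^ (n - i)" for e u0 u1
  proof -
    have "e (2 * n) = X (pair u0 u1) \<and> e (2 * n + 1) = Y (pair u0 u1)"
      using fibre_cone_eq_cone_point(2)[OF e(1) u] e(2) c by (auto simp: X_def Y_def)
    then show ?thesis using fibre_cone_eq_cone_point(1)[OF e(1) u] by (simp add: \<mu>_def)
  qed
  have nf: "normal_form n c e \<in> fibre_cone n b" "normal_form n c e c = 1" if "e \<in> fibre_cone n b" "e c \<noteq> 0" for e
    using that fibre_cone_scale normal_form_coord[of e c n] c2 by (auto simp: normal_form_def)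
  have \<mu>w: "i \<le> n \<Longrightarrow> \<mu> q (2 * n + 2 + i) = q 0 ^ i * q 1 ^ (n - i)" for q i
    using cone_point_coords(4)[of i n] by (simp add: \<mu>_def)
  have \<mu>0: "\<mu> q (2 * n + 2) = q 1 ^ n" "\<mu> q (3 * n + 2) = q 0 ^ n" for q
  proof -
    show "\<mu> q (2 * n + 2) = q 1 ^ n" using \<mu>w[of 0 q] by simp
    have "2 * n + 2 + n = 3 * n + 2" by simp
    then show "\<mu> q (3 * n + 2) = q 0 ^ n" using \<mu>w[of n q] by (metis diff_self_eq_0 mult.right_neutral order_refl power_0)
  qed
  show ?thesis
  proof (rule cyclic_extension[OF n Z e0 hom hc reg c2 c(2), where a = 1 and \<mu> = \<mu> and ia = "3 * n + 2" and ib = "2 * n + 2"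
        and M = "\<lambda>r t e. if r + t = 0 then 1 else e (2 * n + 2 + r)"])
    show "lhol 2 (cspace 2) (\<lambda>q. \<mu> q i)" for i
      unfolding \<mu>_def
      by (intro lhol_cone_point lhol_const lhol_coord order_refl; cases "c = 2 * n")
        (auto simp: X_def Y_def intro!: lhol_const lhol_binary_form lhol_coord)
    show "\<mu> q \<in> fibre_cone n b" for q
      unfolding \<mu>_def by (rule cone_point_fibre[OF b]) (auto simp: X_def Y_def)
    show "\<mu> (twist \<omega> 1 q) = \<mu> q" if "\<omega> ^ n = 1" for \<omega> q
    proof -
      have "cone_point n b x y 1 (\<omega> * u0) (\<omega> * u1) = cone_point n b x y 1 u0 u1" for x y u0 u1
      proof
        fix i
        have w1: "\<omega> ^ j * \<omega> ^ (n - j) = 1" if "j \<le> n" for j using that \<open>\<omega> ^ n = 1\<close> by (simp add: power_add[symmetric])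
        have *: "(\<omega> * u0) ^ j * (\<omega> * u1) ^ (n - j) = u0 ^ j * u1 ^ (n - j)" if "j \<le> n" for j
        proof -
          have "(\<omega> * u0) ^ j * (\<omega> * u1) ^ (n - j) = (\<omega> ^ j * \<omega> ^ (n - j)) * (u0 ^ j * u1 ^ (n - j))"
            by (simp only: power_mult_distrib mult_ac)
          then show ?thesis using w1[OF that] by simp
        qed
        show "cone_point n b x y 1 (\<omega> * u0) (\<omega> * u1) i = cone_point n b x y 1 u0 u1 i"
          using *[of "i - (2 * n + 2)"] by (auto simp: cone_point_def)
      qed
      moreover have "X (twist \<omega> 1 q) = X q" "Y (twist \<omega> 1 q) = Y q"
        using that binary_form_scale[of n b \<omega> "q 0" "q 1"] by (simp_all add: X_def Y_def twist_def)
      ultimately show ?thesis by (simp add: \<mu>_def twist_def)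
    qed
    show "\<mu> (\<lambda>_. 0) = normal_form n c e0"
    proof -
      have "curve_coord n e0 i = 0" if "i \<le> n" for i
      proof (rule curve_zero[of n "curve_coord n e0", OF on_curveD[OF fibre_coneD(2)[OF e0F]]])
        have "2 * n + 2 + n = 3 * n + 2" by simp
        then show "curve_coord n e0 n = 0" using sing by (simp only: curve_coord_def)
      qed (use sing that in \<open>simp_all add: curve_coord_def\<close>)
      then have "curve_coord n (normal_form n c e0) i = 1 * 0 ^ i * 0 ^ (n - i)" if "i \<le> n" for i
        using that n by (cases "i = 0") (auto simp: normal_form_def curve_coord_scale power_0_left)
      then have "\<mu> (pair 0 0) = normal_form n c e0" by (rule key[OF nf[OF e0F c(2)]])
      moreover have "pair 0 0 = (\<lambda>_. 0)" by (auto simp: pair_def)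
      ultimately show ?thesis by simp
    qed
    show "\<mu> q (2 * n + 2) \<noteq> 0 \<or> \<mu> q (3 * n + 2) \<noteq> 0" if "q \<in> cspace 2" "q \<noteq> (\<lambda>_. 0)" for q
      using cspace_2_nonzero[OF that] unfolding \<mu>0 by auto
    show "\<exists>q\<in>cspace 2. normal_form n c e = \<mu> q" if e: "e \<in> fibre_cone n b" "e c \<noteq> 0" for e
    proof -
      obtain u0 u1 where "\<And>i. i \<le> n \<Longrightarrow> curve_coord n (normal_form n c e) i = 1 * u0 ^ i * u1 ^ (n - i)"
        using curve_param[OF n fibre_coneD(2)[OF nf(1)[OF e]]] by blast
      then have "\<mu> (pair u0 u1) = normal_form n c e" by (rule key[OF nf[OF e]])
      then show ?thesis by (intro bexI[of _ "pair u0 u1"]) simp_all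
    qed
    show "\<mu> q (3 * n + 2) = q 0 ^ n" "\<mu> q (2 * n + 2) = q 1 ^ n" for q by (rule \<mu>0)+
    show "lhol (3 * n + 3) (cspace (3 * n + 3)) (\<lambda>e. if r + t = 0 then 1 else e (2 * n + 2 + r))" for r t
      by (cases "r + t = 0") (auto intro: lhol_const lhol_coord)
    \<comment> \<open>With both exponents below \<open>n\<close>, an invariant monomial has
      \<open>r + t = 0\<close> or \<open>r + t = n\<close>; in the second case it is the curve
      coordinate with index \<open>r\<close>.\<close>
    show "q 0 ^ r * q 1 ^ t = (if r + t = 0 then 1 else \<mu> q (2 * n + 2 + r))"
      if rt: "r < n" "t < n" "n dvd r + 1 * t" for q r t
    proof (cases "r + t = 0")
      case False
      obtain k where k: "r + t = n * k" using rt(3) by auto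
      have "n * k < n * 2" using rt(1,2) unfolding k[symmetric] by linarith
      then have "k < 2" using mult_less_cancel1[of n k 2] by blast
      moreover have "k \<noteq> 0" using k False by (intro notI) simp
      ultimately have "k = 1" by simp
      then have "t = n - r" using k by simp
      then show ?thesis using \<mu>w[of r q] rt(1) False by simp
    qed simp
  qed
qed

text \<open>For \<open>b = 0\<close> the chart \<open>w\<^sub>0 = 1\<close> (\<open>s\<close>) or \<open>w\<^sub>n = 1\<close> (\<open>\<not> s\<close>) is the surface \<open>x y = z\<^sup>n\<close>.\<close>

definition node_coord :: "nat \<Rightarrow> bool \<Rightarrow> nat" where
  "node_coord n s = (if s then 2 * n + 2 else 3 * n + 2)"

definition node_z :: "nat \<Rightarrow> bool \<Rightarrow> nat" where
  "node_z n s = (if s then 2 * n + 3 else 3 * n + 1)"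

definition node_point :: "nat \<Rightarrow> bool \<Rightarrow> complex \<Rightarrow> complex \<Rightarrow> nat \<Rightarrow> complex" where
  "node_point n s a b = cone_point n (\<lambda>_. 0) (a ^ n) (b ^ n) 1 (if s then a * b else 1) (if s then 1 else a * b)"

lemma node_curve:
  assumes "n \<ge> 1" "e \<in> fibre_cone n (\<lambda>_. 0)" "e (node_coord n s) = 1" "i \<le> n"
  shows "curve_coord n e i = 1 * (if s then e (node_z n s) else 1) ^ i * (if s then 1 else e (node_z n s)) ^ (n - i)"
  using curve_first_coord[OF fibre_coneD(2)[OF assms(2)] _ assms(4,1)]
    curve_last_coord[OF fibre_coneD(2)[OF assms(2)] _ assms(4,1)] assms(3)
  by (cases s) (simp_all add: node_coord_def node_z_def)

lemma node_product:
  assumes "n \<ge> 1" "e \<in> fibre_cone n (\<lambda>_. 0)" "e (node_coord n s) = 1"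
  shows "e (2 * n) * e (2 * n + 1) = e (node_z n s) ^ n"
  using fibre_cone_eq_cone_point(2)[OF assms(2) node_curve[OF assms]] by (simp add: binary_form_zero)

lemma node_chart:
  assumes "n \<ge> 1" "e \<in> fibre_cone n (\<lambda>_. 0)" "e (node_coord n s) = 1"
    and "a ^ n = e (2 * n)" "b ^ n = e (2 * n + 1)" "a * b = e (node_z n s)"
  shows "node_point n s a b = e"
proof -
  have "node_point n s a b = cone_point n (\<lambda>_. 0) (e (2 * n)) (e (2 * n + 1)) 1
      (if s then e (node_z n s) else 1) (if s then 1 else e (node_z n s))"
    using assms(4-6) by (simp add: node_point_def)
  also have "\<dots> = e" by (rule fibre_cone_eq_cone_point(1)[OF assms(2) node_curve[OF assms(1-3)], symmetric])
  finally show ?thesis .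
qed

text \<open>The surface x y = z^n is the quotient of C^2 by the roots of unity acting with weights
  (1, -1), through x = q0^n, y = q1^n, z = q0 q1. The weight -1 is written \<open>n - 1\<close>
  because \<open>twist\<close> takes natural numbers.\<close>

lemma node_extension:
  assumes n: "n \<ge> 1" and Z: "openin (top_of_set (fibre_cone n (\<lambda>_. 0))) Z" and e0: "e0 \<in> Z"
    and hom: "\<And>e l. e \<in> Z \<Longrightarrow> l \<noteq> 0 \<Longrightarrow> scale n l e \<in> Z \<and> h (scale n l e) = h e"
    and hc: "continuous_on Z h" and reg: "lhol (3 * n + 3) {e \<in> Z. e (2 * n) \<noteq> 0 \<or> e (2 * n + 1) \<noteq> 0} h"
    and sing: "e0 (2 * n) = 0" "e0 (2 * n + 1) = 0"
  shows "\<exists>V. openin (top_of_set (cspace (3 * n + 3))) V \<and> e0 \<in> V \<and> lhol (3 * n + 3) (V \<inter> Z) h"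
proof -
  let ?F = "fibre_cone n (\<lambda>_. 0)"
  have e0F: "e0 \<in> ?F" using e0 Z by (auto simp: openin_open)
  have z0: "(\<lambda>_. 0) \<in> cspace (2 * n)" by (simp add: cspace_def)
  obtain s where s: "e0 (if s then 2 * n + 2 else 3 * n + 2) \<noteq> 0"
  proof -
    have "2 * n + 2 + n = 3 * n + 2" by simp
    then have "e0 (2 * n + 2) \<noteq> 0 \<or> e0 (3 * n + 2) \<noteq> 0"
      using family_cone_chart[OF fibre_cone_family_cone[OF e0F]] sing by metis
    then show ?thesis using that[of True] that[of False] by auto
  qed
  define c where "c = node_coord n s"
  define iz where "iz = node_z n s"
  have c: "2 * n \<le> c" "c < 3 * n + 3" "e0 c \<noteq> 0" using s by (auto simp: c_def node_coord_def)
  define \<mu> where "\<mu> = (\<lambda>q :: nat \<Rightarrow> complex. node_point n s (q 0) (q 1))"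
  have pr: "e (2 * n) * e (2 * n + 1) = e iz ^ n" if "e \<in> ?F" "e c = 1" for e
    using node_product[OF n that(1)] that(2) by (simp add: c_def iz_def)
  have key: "\<mu> (pair q0 q1) = e" if "e \<in> ?F" "e c = 1" "q0 ^ n = e (2 * n)" "q1 ^ n = e (2 * n + 1)" "q0 * q1 = e iz" for e q0 q1
    using node_chart[OF n that(1) that(2)[unfolded c_def] that(3,4) that(5)[unfolded iz_def]] by (simp add: \<mu>_def)
  have nf: "normal_form n c e \<in> ?F" "normal_form n c e c = 1" if "e \<in> ?F" "e c \<noteq> 0" for e
    using that fibre_cone_scale normal_form_coord[of e c n] c by (auto simp: normal_form_def)
  have \<mu>xy: "\<mu> q (2 * n) = q 0 ^ n" "\<mu> q (2 * n + 1) = q 1 ^ n" for q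
    unfolding \<mu>_def node_point_def cone_point_coords by (rule refl)+
  have \<mu>iz: "\<mu> q iz = q 0 * q 1" for q
  proof (cases s)
    case True
    have "\<mu> q (2 * n + 2 + 1) = q 0 * q 1" unfolding \<mu>_def node_point_def using cone_point_coords(4)[of 1 n] n True by simp
    moreover have "2 * n + 2 + 1 = iz" using True by (simp add: iz_def node_z_def)
    ultimately show ?thesis by simp
  next
    case False
    have "\<mu> q (2 * n + 2 + (n - 1)) = q 0 * q 1" unfolding \<mu>_def node_point_def using cone_point_coords(4)[of "n - 1" n] n False by simp
    moreover have "2 * n + 2 + (n - 1) = iz" using False n by (simp add: iz_def node_z_def)
    ultimately show ?thesis by simp
  qed
  show ?thesis
  proof (rule cyclic_extension[OF n Z e0 hom hc reg c, where a = "n - 1" and \<mu> = \<mu> and ia = "2 * n" and ib = "2 * n + 1"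
        and M = "\<lambda>r t e. e iz ^ r"])
    show "lhol 2 (cspace 2) (\<lambda>q. \<mu> q i)" for i
      unfolding \<mu>_def node_point_def
      by (cases s) (auto intro!: lhol_cone_point lhol_const lhol_mult lhol_power lhol_coord)
    show "\<mu> q \<in> ?F" for q
      unfolding \<mu>_def node_point_def by (rule cone_point_fibre[OF z0]) (auto simp: binary_form_zero power_mult_distrib)
    show "\<mu> (twist \<omega> (n - 1) q) = \<mu> q" if \<omega>: "\<omega> ^ n = 1" for \<omega> q
    proof -
      have "(\<omega> * q 0) ^ n = q 0 ^ n" using \<omega> by (simp add: power_mult_distrib)
      moreover have "(\<omega> ^ (n - 1) * q 1) ^ n = q 1 ^ n"
      proof -
        have "(\<omega> ^ (n - 1)) ^ n = 1" using \<omega> by (metis mult.commute power_mult power_one)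
        then show ?thesis by (simp add: power_mult_distrib)
      qed
      moreover have "(\<omega> * q 0) * (\<omega> ^ (n - 1) * q 1) = q 0 * q 1"
      proof -
        have "\<omega> * \<omega> ^ (n - 1) = 1" using \<omega> n by (metis power_eq_if not_one_le_zero)
        moreover have "(\<omega> * q 0) * (\<omega> ^ (n - 1) * q 1) = (\<omega> * \<omega> ^ (n - 1)) * (q 0 * q 1)" by (simp only: mult_ac)
        ultimately show ?thesis by simp
      qed
      ultimately show ?thesis unfolding \<mu>_def node_point_def twist_simps by (simp only:)
    qed
    show "\<mu> (\<lambda>_. 0) = normal_form n c e0"
    proof -
      let ?e = "normal_form n c e0"
      have z: "?e (2 * n) = 0" "?e (2 * n + 1) = 0" using sing by (simp_all add: normal_form_def scale_def)
      then have "?e iz = 0" using pr[OF nf[OF e0F c(3)]] n by simp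
      then have "\<mu> (pair 0 0) = ?e" using z n by (intro key[OF nf[OF e0F c(3)]]) (simp_all add: power_0_left)
      moreover have "pair 0 0 = (\<lambda>_. 0)" by (auto simp: pair_def)
      ultimately show ?thesis by simp
    qed
    show "\<mu> q (2 * n) \<noteq> 0 \<or> \<mu> q (2 * n + 1) \<noteq> 0" if "q \<in> cspace 2" "q \<noteq> (\<lambda>_. 0)" for q
      using cspace_2_nonzero[OF that] unfolding \<mu>xy by auto
    show "\<exists>q\<in>cspace 2. normal_form n c e = \<mu> q" if e: "e \<in> ?F" "e c \<noteq> 0" for e
    proof -
      let ?e = "normal_form n c e"
      have root: "\<exists>r. v = r ^ n" for v :: complex
        using exists_complex_root[of n v] n by auto
      \<comment> \<open>A nonzero x allows any root \<open>q0\<close>, and then \<open>q1\<close> is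
        forced by the product; for x = 0 also z = 0, and any root of y will do.\<close>
      obtain q0 q1 where q: "q0 ^ n = ?e (2 * n)" "q1 ^ n = ?e (2 * n + 1)" "q0 * q1 = ?e iz"
      proof (cases "?e (2 * n) = 0")
        case True
        then have "?e iz = 0" using pr[OF nf[OF e]] n by simp
        moreover obtain q1 where "?e (2 * n + 1) = q1 ^ n" using root by blast
        ultimately show ?thesis using that[of 0 q1] True n by (simp add: power_0_left)
      next
        case False
        obtain q0 where q0: "?e (2 * n) = q0 ^ n" using root by blast
        then have "q0 \<noteq> 0" using False n by auto
        moreover have "(?e iz / q0) ^ n = ?e (2 * n + 1)"
          using pr[OF nf[OF e]] q0 False by (simp add: power_divide) (simp add: field_simps)
        ultimately show ?thesis using that[of q0 "?e iz / q0"] q0 by simp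
      qed
      then have "\<mu> (pair q0 q1) = ?e" by (rule key[OF nf[OF e]])
      then show ?thesis by (intro bexI[of _ "pair q0 q1"]) simp_all
    qed
    show "\<mu> q (2 * n) = q 0 ^ n" "\<mu> q (2 * n + 1) = q 1 ^ n" for q by (rule \<mu>xy)+
    show "lhol (3 * n + 3) (cspace (3 * n + 3)) (\<lambda>e. e iz ^ r)" for r by (intro lhol_power lhol_coord order_refl)
    show "q 0 ^ r * q 1 ^ t = \<mu> q iz ^ r" if "r < n" "t < n" "n dvd r + (n - 1) * t" for q r t
    proof -
      \<comment> \<open>Modulo \<open>n\<close> the weight is \<open>r - t\<close>, and both
        exponents are below \<open>n\<close>, so \<open>r = t\<close>: the relevant invariant
        monomials are powers of \<open>q 0 * q 1\<close>, that is, of z.\<close>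
      have "int n dvd int (r + (n - 1) * t)" using that(3) by (simp only: int_dvd_int_iff)
      moreover have eq: "int (r + (n - 1) * t) = (int r - int t) + int n * int t"
        using n by (cases n) (simp_all add: algebra_simps)
      ultimately have "int n dvd (int r - int t) + int n * int t" by (simp only:)
      then have "int n dvd int r - int t" using dvd_add_left_iff[of "int n" "int n * int t" "int r - int t"] by simp
      moreover have "\<bar>int r - int t\<bar> < int n" using that by auto
      ultimately have "int r - int t = 0" using dvd_imp_le_int[of "int r - int t" "int n"] by fastforce
      then have "r = t" by simp
      then show ?thesis unfolding \<mu>iz by (simp add: power_mult_distrib)
    qed
  qed
qed

subsection \<open>The projective plane bundle\<close>

definition bundle_act :: "nat \<Rightarrow> complex \<Rightarrow> complex \<Rightarrow> (nat \<Rightarrow> complex) \<Rightarrow> nat \<Rightarrow> complex" where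
  "bundle_act n l m p = vec [l * p 0, l * p 1, m * l ^ n * p 2, m * l ^ n * p 3, m * p 4]"

definition bundle_class :: "nat \<Rightarrow> (nat \<Rightarrow> complex) \<Rightarrow> (nat \<Rightarrow> complex) set" where
  "bundle_class n p = bundle_rel n `` {p}"

lemma vec5 [simp]:
  "vec [a, b, c, d, e] 0 = a" "vec [a, b, c, d, e] (Suc 0) = b" "vec [a, b, c, d, e] 2 = c"
  "vec [a, b, c, d, e] 3 = d" "vec [a, b, c, d, e] 4 = e"
  by (simp_all add: vec_def eval_nat_numeral)

lemma vec5_cspace [simp]: "vec [a, b, c, d, e] \<in> cspace 5"
  by (simp add: vec_def cspace_def)

lemma cspace5_eqI:
  assumes "p \<in> cspace 5" "q \<in> cspace 5" "p 0 = q 0" "p 1 = q 1" "p 2 = q 2" "p 3 = q 3" "p 4 = q 4"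
  shows "p = q"
proof
  fix i :: nat
  consider "i = 0" | "i = 1" | "i = 2" | "i = 3" | "i = 4" | "i \<ge> 5" by linarith
  then show "p i = q i" using assms by cases (auto simp: cspace_def)
qed

lemma bundle_act_simps [simp]:
  "bundle_act n l m p 0 = l * p 0" "bundle_act n l m p (Suc 0) = l * p 1" "bundle_act n l m p 2 = m * l ^ n * p 2"
  "bundle_act n l m p 3 = m * l ^ n * p 3" "bundle_act n l m p 4 = m * p 4" "bundle_act n l m p \<in> cspace 5"
  by (simp_all add: bundle_act_def)

lemma bundle_act_dom: "p \<in> bundle_dom \<Longrightarrow> l \<noteq> 0 \<Longrightarrow> m \<noteq> 0 \<Longrightarrow> bundle_act n l m p \<in> bundle_dom"
  by (auto simp: bundle_dom_def)

lemma bundle_act_act: "bundle_act n l m (bundle_act n l' m' p) = bundle_act n (l * l') (m * m') p"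
  by (rule cspace5_eqI) (simp_all add: power_mult_distrib mult_ac)

lemma bundle_act_1: "p \<in> cspace 5 \<Longrightarrow> bundle_act n 1 1 p = p"
  by (rule cspace5_eqI) simp_all

lemma bundle_rel_iff:
  "(p, q) \<in> bundle_rel n \<longleftrightarrow> p \<in> bundle_dom \<and> (\<exists>l m. l \<noteq> 0 \<and> m \<noteq> 0 \<and> q = bundle_act n l m p)"
  unfolding bundle_rel_def bundle_act_def[symmetric] using bundle_act_dom by auto

lemma equiv_bundle_rel: "equiv bundle_dom (bundle_rel n)"
proof (rule equivI)
  show "refl_on bundle_dom (bundle_rel n)"
  proof (rule refl_onI)
    fix p assume p: "p \<in> bundle_dom"
    then have "p = bundle_act n 1 1 p" using bundle_act_1[of p n] by (simp add: bundle_dom_def)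
    then show "(p, p) \<in> bundle_rel n" unfolding bundle_rel_iff using p by (metis one_neq_zero)
  qed
  show "sym (bundle_rel n)"
  proof (rule symI)
    fix p q assume "(p, q) \<in> bundle_rel n"
    then obtain l m where lm: "p \<in> bundle_dom" "l \<noteq> 0" "m \<noteq> 0" "q = bundle_act n l m p" by (auto simp: bundle_rel_iff)
    then have "p = bundle_act n (1 / l) (1 / m) q"
      using bundle_act_1[of p n] by (simp add: bundle_act_act bundle_dom_def)
    then show "(q, p) \<in> bundle_rel n"
      unfolding bundle_rel_iff using lm bundle_act_dom
      by (intro conjI exI[of _ "1 / l"] exI[of _ "1 / m"]) auto
  qed
  show "trans (bundle_rel n)"
  proof (rule transI)
    fix p q r assume "(p, q) \<in> bundle_rel n" "(q, r) \<in> bundle_rel n"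
    then obtain l m l' m' where "p \<in> bundle_dom" "l \<noteq> 0" "m \<noteq> 0" "q = bundle_act n l m p" "l' \<noteq> 0" "m' \<noteq> 0" "r = bundle_act n l' m' q"
      by (auto simp: bundle_rel_iff)
    then show "(p, r) \<in> bundle_rel n"
      unfolding bundle_rel_iff
      by (intro conjI exI[of _ "l' * l"] exI[of _ "m' * m"]) (simp_all add: bundle_act_act)
  qed
  show "bundle_rel n \<subseteq> bundle_dom \<times> bundle_dom" by (auto simp: bundle_rel_def)
qed

lemma bundle_class_eq_iff:
  assumes "p \<in> bundle_dom" "q \<in> bundle_dom"
  shows "bundle_class n p = bundle_class n q \<longleftrightarrow> (\<exists>l m. l \<noteq> 0 \<and> m \<noteq> 0 \<and> q = bundle_act n l m p)"
  using eq_equiv_class_iff[OF equiv_bundle_rel assms] assms by (simp add: bundle_class_def bundle_rel_iff)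

lemma bundle_class_act: "p \<in> bundle_dom \<Longrightarrow> l \<noteq> 0 \<Longrightarrow> m \<noteq> 0 \<Longrightarrow> bundle_class n (bundle_act n l m p) = bundle_class n p"
  using bundle_class_eq_iff[of p "bundle_act n l m p" n] bundle_act_dom by metis

lemma bundle_dom_cspace: "bundle_dom \<subseteq> cspace 5"
  by (auto simp: bundle_dom_def)

lemma uniformized_bundle: "uniformized 5 bundle_dom (bundle_class n) (P2_bundle n)"
  using uniformized_quotient[OF uniformized_affine[OF bundle_dom_cspace], of "bundle_rel n"]
  by (simp add: P2_bundle_def bundle_class_def[abs_def])

text \<open>The retractions normalize one base coordinate \<open>j\<close> and one fibre coordinate \<open>k\<close> to \<open>1\<close>.\<close>

definition bundle_retraction :: "nat \<Rightarrow> nat \<Rightarrow> nat \<Rightarrow> (nat \<Rightarrow> complex) \<Rightarrow> nat \<Rightarrow> complex" where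
  "bundle_retraction n j k p = bundle_act n (1 / p j) (if k = 4 then 1 / p 4 else p j ^ n / p k) p"

lemma bundle_retraction_act:
  assumes "l \<noteq> 0" "m \<noteq> 0" "j = 0 \<or> j = 1" "k = 2 \<or> k = 3 \<or> k = 4" "p j \<noteq> 0" "p k \<noteq> 0"
  shows "bundle_retraction n j k (bundle_act n l m p) = bundle_retraction n j k p"
proof -
  have j: "bundle_act n l m p j = l * p j" using assms(3) by auto
  have k: "bundle_act n l m p k = (if k = 4 then m * p 4 else m * l ^ n * p k)" using assms(4) by auto
  show ?thesis
    unfolding bundle_retraction_def bundle_act_act j
    using assms by (cases "k = 4") (simp_all add: k power_mult_distrib field_simps)
qed

lemma local_retractions_bundle: "local_retractions 5 bundle_dom (bundle_class n)"
  unfolding local_retractions_def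
proof
  fix d assume d: "d \<in> bundle_dom"
  obtain j where j: "j = 0 \<or> j = 1" "d j \<noteq> 0" using d by (auto simp: bundle_dom_def)
  obtain k where k: "k = 2 \<or> k = 3 \<or> k = 4" "d k \<noteq> 0" using d by (auto simp: bundle_dom_def)
  let ?W = "{p \<in> bundle_dom. p j \<noteq> 0} \<inter> {p \<in> bundle_dom. p k \<noteq> 0}" and ?r = "bundle_retraction n j k"
  have oW: "openin (top_of_set bundle_dom) ?W" by (intro openin_Int openin_coord_nonzero)
  have W: "y \<in> ?W \<and> ?r y = ?r x" if x: "x \<in> ?W" and y: "y \<in> bundle_dom" "bundle_class n y = bundle_class n x" for x y
  proof -
    obtain l m where lm: "l \<noteq> 0" "m \<noteq> 0" "y = bundle_act n l m x"
      using bundle_class_eq_iff[of x y n] x y by auto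
    have "y j \<noteq> 0" "y k \<noteq> 0" using lm x j(1) k(1) by auto
    then show ?thesis using bundle_retraction_act[OF lm(1,2) j(1) k(1)] x y lm(3) by auto
  qed
  have r: "?r x \<in> bundle_dom \<and> bundle_class n (?r x) = bundle_class n x" if "x \<in> ?W" for x
    unfolding bundle_retraction_def using that bundle_act_dom bundle_class_act by (cases "k = 4") simp_all
  have l: "lhol 5 ?W (\<lambda>x. ?r x i)" if i5: "i < 5" for i
  proof -
    have sub: "?W \<subseteq> cspace 5" using bundle_dom_cspace by auto
    have lj: "lhol 5 ?W (\<lambda>p. 1 / p j)" by (intro lhol_divide lhol_const lhol_coord sub) auto
    have lm: "lhol 5 ?W (\<lambda>p. if k = 4 then 1 / p 4 else p j ^ n / p k)"
      by (cases "k = 4") (auto intro!: lhol_divide lhol_const lhol_coord lhol_power sub intro: subsetD[OF bundle_dom_cspace])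
    consider "i = 0" | "i = 1" | "i = 2" | "i = 3" | "i = 4" using i5 by linarith
    then show ?thesis
    proof cases
      case 1
      have "lhol 5 ?W (\<lambda>p. 1 / p j * p 0)" by (intro lhol_mult lj lhol_coord sub)
      then show ?thesis by (simp add: bundle_retraction_def 1)
    next
      case 2
      have "lhol 5 ?W (\<lambda>p. 1 / p j * p 1)" by (intro lhol_mult lj lhol_coord sub)
      then show ?thesis by (simp add: bundle_retraction_def 2)
    next
      case 3
      have "lhol 5 ?W (\<lambda>p. (if k = 4 then 1 / p 4 else p j ^ n / p k) * (1 / p j) ^ n * p 2)"
        by (intro lhol_mult lhol_power lj lm lhol_coord sub)
      then show ?thesis unfolding bundle_retraction_def 3 bundle_act_simps .
    next
      case 4
      have "lhol 5 ?W (\<lambda>p. (if k = 4 then 1 / p 4 else p j ^ n / p k) * (1 / p j) ^ n * p 3)"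
        by (intro lhol_mult lhol_power lj lm lhol_coord sub)
      then show ?thesis unfolding bundle_retraction_def 4 bundle_act_simps .
    next
      case 5
      have "lhol 5 ?W (\<lambda>p. (if k = 4 then 1 / p 4 else p j ^ n / p k) * p 4)"
        by (intro lhol_mult lhol_power lj lm lhol_coord sub)
      then show ?thesis unfolding bundle_retraction_def 5 bundle_act_simps .
    qed
  qed
  show "\<exists>W r. openin (top_of_set bundle_dom) W \<and> d \<in> W \<and>
     (\<forall>x\<in>W. \<forall>y\<in>bundle_dom. bundle_class n y = bundle_class n x \<longrightarrow> y \<in> W \<and> r y = r x) \<and>
     (\<forall>x\<in>W. r x \<in> bundle_dom \<and> bundle_class n (r x) = bundle_class n x) \<and> (\<forall>i<5. lhol 5 W (\<lambda>x. r x i))"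
  proof (intro exI[of _ ?W] exI[of _ ?r] conjI)
    show "openin (top_of_set bundle_dom) ?W" by (rule oW)
    show "d \<in> ?W" using d j k by simp
    show "\<forall>x\<in>?W. \<forall>y\<in>bundle_dom. bundle_class n y = bundle_class n x \<longrightarrow> y \<in> ?W \<and> ?r y = ?r x" using W by blast
    show "\<forall>x\<in>?W. ?r x \<in> bundle_dom \<and> bundle_class n (?r x) = bundle_class n x" using r by blast
    show "\<forall>i<5. lhol 5 ?W (\<lambda>x. ?r x i)" using l by blast
  qed
qed

subsection \<open>The compactified surface\<close>

definition surface_form :: "nat \<Rightarrow> (nat \<Rightarrow> real) \<Rightarrow> complex \<Rightarrow> complex \<Rightarrow> complex" where
  "surface_form n a u0 u1 = (-1) ^ n * (\<Prod>i = 1..2 * n. u0 - complex_of_real (a i) * u1)"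

definition surface_cone :: "nat \<Rightarrow> (nat \<Rightarrow> real) \<Rightarrow> (nat \<Rightarrow> complex) set" where
  "surface_cone n a = {d \<in> bundle_dom. d 2 * d 3 = surface_form n a (d 0) (d 1) * d 4 ^ 2}"

lemma surface_form_scale: "surface_form n a (l * u0) (l * u1) = l ^ (2 * n) * surface_form n a u0 u1"
proof -
  have "(\<Prod>i = 1..2 * n. l * u0 - complex_of_real (a i) * (l * u1)) = (\<Prod>i = 1..2 * n. l * (u0 - complex_of_real (a i) * u1))"
    by (intro prod.cong refl) (simp add: algebra_simps)
  then show ?thesis by (simp add: surface_form_def prod.distrib)
qed

lemma surface_cone_act:
  assumes "l \<noteq> 0" "m \<noteq> 0" "d \<in> surface_cone n a"
  shows "bundle_act n l m d \<in> surface_cone n a"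
proof -
  have "m * l ^ n * d 2 * (m * l ^ n * d 3) = (m * l ^ n) ^ 2 * (d 2 * d 3)" by (simp add: power2_eq_square mult_ac)
  also have "\<dots> = (m * l ^ n) ^ 2 * (surface_form n a (d 0) (d 1) * d 4 ^ 2)" using assms by (simp add: surface_cone_def)
  also have "\<dots> = surface_form n a (l * d 0) (l * d 1) * (m * d 4) ^ 2"
    unfolding surface_form_scale by (simp add: power_mult_distrib power_mult mult_ac power2_eq_square power_add mult_2)
  finally show ?thesis using assms bundle_act_dom by (simp add: surface_cone_def)
qed

lemma surface_cone_dom: "surface_cone n a \<subseteq> bundle_dom"
  by (auto simp: surface_cone_def)

lemma surface_cone_saturated: "{d \<in> bundle_dom. bundle_class n d \<in> bundle_class n ` surface_cone n a} = surface_cone n a"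
proof (intro set_eqI iffI)
  fix d assume "d \<in> {d \<in> bundle_dom. bundle_class n d \<in> bundle_class n ` surface_cone n a}"
  then obtain f where f: "d \<in> bundle_dom" "f \<in> surface_cone n a" "bundle_class n f = bundle_class n d" by auto
  then obtain l m where "l \<noteq> 0" "m \<noteq> 0" "d = bundle_act n l m f"
    using bundle_class_eq_iff[of f d n] surface_cone_dom by blast
  then show "d \<in> surface_cone n a" using surface_cone_act f by simp
qed (use surface_cone_dom in auto)

lemma continuous_on_surface_form:
  "continuous_on S f \<Longrightarrow> continuous_on S g \<Longrightarrow> continuous_on S (\<lambda>x. surface_form n a (f x) (g x))"
  unfolding surface_form_def by (intro continuous_intros)

lemma closedin_surface: "closedin (Top (P2_bundle n)) (bundle_class n ` surface_cone n a)"
proof -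
  note uD = uniformizedD[OF uniformized_bundle[of n]]
  let ?C = "bundle_class n ` surface_cone n a"
  have CP: "?C \<subseteq> pts (P2_bundle n)" using uD(3) surface_cone_dom by blast
  have "{d \<in> bundle_dom. bundle_class n d \<in> pts (P2_bundle n) - ?C} = bundle_dom - surface_cone n a"
    using surface_cone_saturated[of n a] uD(3) by blast
  moreover have "closed {d :: nat \<Rightarrow> complex. d 2 * d 3 = surface_form n a (d 0) (d 1) * d 4 ^ 2}"
    by (intro closed_Collect_eq continuous_intros continuous_on_surface_form)
  then have "closedin (top_of_set bundle_dom) (bundle_dom \<inter> {d. d 2 * d 3 = surface_form n a (d 0) (d 1) * d 4 ^ 2})"
    by (rule closedin_closed_Int)
  then have "closedin (top_of_set bundle_dom) (surface_cone n a)" by (simp add: surface_cone_def Int_def)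
  then have "openin (top_of_set bundle_dom) (bundle_dom - surface_cone n a)" using openin_diff by fastforce
  ultimately have "openin (Top (P2_bundle n)) (pts (P2_bundle n) - ?C)"
    using uD(4)[of "pts (P2_bundle n) - ?C"] by auto
  then show ?thesis using CP by (simp add: closedin_def)
qed

lemma affine_surfaceI:
  assumes d: "d \<in> surface_cone n a" "d 1 \<noteq> 0" "d 4 \<noteq> 0"
  shows "bundle_class n d \<in> affine_surface n a"
proof -
  let ?z = "d 0 / d 1" and ?x = "d 2 / (d 4 * d 1 ^ n)" and ?y = "d 3 / (d 4 * d 1 ^ n)"
  have "bundle_act n (1 / d 1) (1 / d 4) d = vec [?z, 1, ?x, ?y, 1]"
    by (rule cspace5_eqI) (use d in \<open>simp_all add: power_divide\<close>)
  moreover have "bundle_class n (bundle_act n (1 / d 1) (1 / d 4) d) = bundle_class n d"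
    by (rule bundle_class_act) (use d surface_cone_dom in auto)
  ultimately have eq: "bundle_class n d = bundle_rel n `` {vec [?z, 1, ?x, ?y, 1]}" by (simp add: bundle_class_def)
  have "?x * ?y = surface_form n a (d 0) (d 1) / d 1 ^ (2 * n)"
    using d by (simp add: surface_cone_def power2_eq_square mult_2 power_add)
  also have "surface_form n a (d 0) (d 1) = d 1 ^ (2 * n) * surface_form n a ?z 1"
    using surface_form_scale[of n a "d 1" ?z 1] d by simp
  finally have "?x * ?y = (-1) ^ n * (\<Prod>i = 1..2 * n. ?z - complex_of_real (a i))"
    using d by (simp add: surface_form_def)
  then show ?thesis unfolding affine_surface_def eq by blast
qed

text \<open>The homogenized equation cuts out a closed set. Conversely its points with u1 = 0 or t =
  0 are limits of affine ones; there x or y is nonzero, which permits perturbing u1 and t and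
  solving for the other coordinate.\<close>

lemma closure_affine_surface:
  "Top (P2_bundle n) closure_of affine_surface n a = bundle_class n ` surface_cone n a"
proof
  note uD = uniformizedD[OF uniformized_bundle[of n]]
  have "affine_surface n a \<subseteq> bundle_class n ` surface_cone n a"
  proof
    fix P assume "P \<in> affine_surface n a"
    then obtain x y z where P: "P = bundle_rel n `` {vec [z, 1, x, y, 1]}"
      "x * y = (-1) ^ n * (\<Prod>i = 1..2 * n. z - complex_of_real (a i))" by (auto simp: affine_surface_def)
    then have "vec [z, 1, x, y, 1] \<in> surface_cone n a" by (simp add: surface_cone_def bundle_dom_def surface_form_def)
    then show "P \<in> bundle_class n ` surface_cone n a" using P(1) by (auto simp: bundle_class_def)
  qed
  then show "Top (P2_bundle n) closure_of affine_surface n a \<subseteq> bundle_class n ` surface_cone n a"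
    by (rule closure_of_minimal[OF _ closedin_surface])
  show "bundle_class n ` surface_cone n a \<subseteq> Top (P2_bundle n) closure_of affine_surface n a"
  proof (rule image_subsetI)
    fix d assume d: "d \<in> surface_cone n a"
    have dD: "d \<in> bundle_dom" using d surface_cone_dom by blast
    have dP: "bundle_class n d \<in> pts (P2_bundle n)" using dD uD(3) by blast
    show "bundle_class n d \<in> Top (P2_bundle n) closure_of affine_surface n a"
    proof (cases "d 2 = 0 \<and> d 3 = 0")
      case True
      then have "d 4 \<noteq> 0" using dD by (auto simp: bundle_dom_def)
      then have z: "surface_form n a (d 0) (d 1) = 0" using d True by (simp add: surface_cone_def)
      \<comment> \<open>At u1 = 0 the form is u0^(2n) up to sign, and u0 cannot vanish as
        well.\<close>
      have "d 1 \<noteq> 0"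
      proof
        assume d1: "d 1 = 0"
        then have "d 0 \<noteq> 0" using dD by (auto simp: bundle_dom_def)
        then show False using z d1 by (simp add: surface_form_def)
      qed
      then have "bundle_class n d \<in> affine_surface n a" using affine_surfaceI d \<open>d 4 \<noteq> 0\<close> by blast
      then show ?thesis using dP by (auto simp: in_closure_of)
    next
      case False
      then obtain k k' where k: "(k = 2 \<and> k' = 3) \<or> (k = 3 \<and> k' = (2::nat))" "d k \<noteq> 0" by auto
      \<comment> \<open>Moves u1 and t by \<delta> and restores the equation by means of
        \<open>k'\<close>, dividing by the nonzero coordinate \<open>d k\<close>.\<close>
      define \<gamma> where "\<gamma> = (\<lambda>\<delta>. d(1 := d 1 + \<delta>, 4 := d 4 + \<delta>, k' := surface_form n a (d 0) (d 1 + \<delta>) * (d 4 + \<delta>) ^ 2 / d k))"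
      have \<gamma>: "\<gamma> \<delta> \<in> surface_cone n a \<and> \<gamma> \<delta> 1 \<noteq> 0 \<and> \<gamma> \<delta> 4 \<noteq> 0" if "d 1 + \<delta> \<noteq> 0" "d 4 + \<delta> \<noteq> 0" for \<delta>
        using that dD k by (auto simp: \<gamma>_def surface_cone_def bundle_dom_def cspace_def)
      have \<gamma>0: "\<gamma> 0 = d"
      proof -
        have "d k * d k' = surface_form n a (d 0) (d 1) * d 4 ^ 2" using d k by (auto simp: surface_cone_def mult.commute)
        then have "d k' = surface_form n a (d 0) (d 1) * d 4 ^ 2 / d k" using k by (simp add: field_simps)
        then show ?thesis by (auto simp: \<gamma>_def)
      qed
      have "continuous_on UNIV \<gamma>"
        unfolding \<gamma>_def
        by (intro continuous_on_funupd continuous_intros continuous_on_surface_form) (use k in auto)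
      then have lim: "(\<gamma> \<longlongrightarrow> d) (at 0)" using \<gamma>0 by (metis UNIV_I continuous_on_def)
      show ?thesis
        unfolding in_closure_of
      proof (intro conjI dP allI impI)
        fix T assume T: "bundle_class n d \<in> T \<and> openin (Top (P2_bundle n)) T"
        then have TP: "T \<subseteq> pts (P2_bundle n)" using openin_subset by blast
        have "openin (top_of_set bundle_dom) {d \<in> bundle_dom. bundle_class n d \<in> T}" using uD(4)[OF TP] T by blast
        then obtain Q where Q: "open Q" "{d \<in> bundle_dom. bundle_class n d \<in> T} = bundle_dom \<inter> Q" by (auto simp: openin_open)
        have "d \<in> Q" using Q(2) dD T by blast
        then have "\<forall>\<^sub>F \<delta> in at 0. \<gamma> \<delta> \<in> Q" using lim Q(1) by (auto dest: topological_tendstoD)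
        moreover have "\<forall>\<^sub>F \<delta> in at (0::complex). \<delta> \<noteq> - d 1" "\<forall>\<^sub>F \<delta> in at (0::complex). \<delta> \<noteq> - d 4"
          by (rule eventually_neq_at_within)+
        ultimately have "\<forall>\<^sub>F \<delta> in at (0::complex). \<gamma> \<delta> \<in> Q \<and> \<delta> \<noteq> - d 1 \<and> \<delta> \<noteq> - d 4"
          by eventually_elim simp
        then obtain \<delta> where \<delta>: "\<gamma> \<delta> \<in> Q" "\<delta> \<noteq> - d 1" "\<delta> \<noteq> - d 4"
          using eventually_happens trivial_limit_at by blast
        then have "d 1 + \<delta> \<noteq> 0" "d 4 + \<delta> \<noteq> 0" by (metis add.commute add_eq_0_iff)+
        then have g: "\<gamma> \<delta> \<in> surface_cone n a \<and> \<gamma> \<delta> 1 \<noteq> 0 \<and> \<gamma> \<delta> 4 \<noteq> 0" by (rule \<gamma>)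
        then have "bundle_class n (\<gamma> \<delta>) \<in> affine_surface n a" using affine_surfaceI by blast
        moreover have "bundle_class n (\<gamma> \<delta>) \<in> T" using Q(2) \<delta>(1) g surface_cone_dom by blast
        ultimately show "\<exists>y. y \<in> affine_surface n a \<and> y \<in> T" by blast
      qed
    qed
  qed
qed

lemma pts_compact_surface: "pts (compact_surface n a) = bundle_class n ` surface_cone n a"
  using closedin_subset[OF closedin_surface[of n a]]
  by (auto simp: compact_surface_def subspace_on_def closure_affine_surface)

lemma uniformized_compact_surface: "uniformized 5 (surface_cone n a) (bundle_class n) (compact_surface n a)"
  using uniformized_subspace[OF uniformized_bundle local_retractions_bundle, of n "bundle_class n ` surface_cone n a"]
    closedin_surface[of n a]
  unfolding compact_surface_def closure_affine_surface surface_cone_saturated by simp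

definition contract_class :: "nat \<Rightarrow> (nat \<Rightarrow> real) \<Rightarrow> (nat \<Rightarrow> complex) \<Rightarrow> (nat \<Rightarrow> complex) set set" where
  "contract_class n a d = contract_rel n a `` {bundle_class n d}"

lemma uniformized_minitwistor: "uniformized 5 (surface_cone n a) (contract_class n a) (minitwistor n a)"
  using uniformized_quotient[OF uniformized_compact_surface, of n a "contract_rel n a"]
  by (simp add: minitwistor_def contract_class_def[abs_def])

text \<open>Scaling first the base and then the fibre coordinates by an entry of largest modulus
  gives representatives in a compact set.\<close>

lemma compact_minitwistor: "compact_space (Top (minitwistor n a))"
proof -
  note uD = uniformizedD[OF uniformized_minitwistor[of n a]]
  let ?K = "{d. \<exists>j\<in>{0, 1}. cmod (d j) = 1} \<inter> {d. \<exists>k\<in>{2, 3, 4}. cmod (d k) = 1} \<inter>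
      {d. d 2 * d 3 = surface_form n a (d 0) (d 1) * d 4 ^ 2} \<inter> cspace 5"
  let ?B = "Pi\<^sub>E UNIV (\<lambda>_. cball (0::complex) 1)"
  have ex: "{d :: nat \<Rightarrow> complex. \<exists>j\<in>I. cmod (d j) = 1} = (\<Union>j\<in>I. {d. cmod (d j) = 1})" for I by auto
  have cl: "closed {d :: nat \<Rightarrow> complex. cmod (d j) = 1}" for j by (intro closed_Collect_eq continuous_intros)
  have "closed ?K"
    unfolding ex
    by (intro closed_Int closed_UN ballI finite.intros cl closed_cspace closed_Collect_eq continuous_intros continuous_on_surface_form)
  then have "compact (?K \<inter> ?B)" by (rule closed_Int_compact) (intro compact_Pi_UNIV compact_cball)
  moreover have sub: "?K \<inter> ?B \<subseteq> surface_cone n a" by (auto simp: surface_cone_def bundle_dom_def)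
  ultimately have "compactin (top_of_set (surface_cone n a)) (?K \<inter> ?B)" by (simp add: compactin_subtopology)
  then have "compactin (Top (minitwistor n a)) (contract_class n a ` (?K \<inter> ?B))"
    by (rule image_compactin) (rule uD(6))
  moreover have "contract_class n a ` (?K \<inter> ?B) = pts (minitwistor n a)"
  proof
    show "contract_class n a ` (?K \<inter> ?B) \<subseteq> pts (minitwistor n a)" using sub uD(3) by blast
    show "pts (minitwistor n a) \<subseteq> contract_class n a ` (?K \<inter> ?B)"
    proof
      fix y assume "y \<in> pts (minitwistor n a)"
      then obtain d where d: "d \<in> surface_cone n a" "y = contract_class n a d" using uD(3) by blast
      have dD: "d \<in> bundle_dom" using d surface_cone_dom by blast
      obtain j where j: "j \<in> {0, 1}" "d j \<noteq> 0" "cmod (d 0) \<le> cmod (d j)" "cmod (d 1) \<le> cmod (d j)"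
      proof (cases "cmod (d 0) \<le> cmod (d 1)")
        case True
        then have "d 1 \<noteq> 0" using dD by (auto simp: bundle_dom_def)
        then show ?thesis using that[of 1] True by simp
      next
        case False
        then have "d 0 \<noteq> 0" by auto
        then show ?thesis using that[of 0] False by simp
      qed
      define f where "f = bundle_act n (1 / d j) 1 d"
      have f: "f \<in> surface_cone n a" unfolding f_def by (rule surface_cone_act) (use j d in auto)
      have fj: "f j = 1" "cmod (f 0) \<le> 1" "cmod (f 1) \<le> 1"
        using j by (auto simp: f_def norm_divide divide_simps)
      obtain k where k: "k \<in> {2, 3, 4}" "f k \<noteq> 0" "cmod (f 2) \<le> cmod (f k)" "cmod (f 3) \<le> cmod (f k)" "cmod (f 4) \<le> cmod (f k)"
      proof -
        define M where "M = Max ((\<lambda>k. cmod (f k)) ` {2, 3, 4})"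
        have "M \<in> (\<lambda>k. cmod (f k)) ` {2, 3, 4}" unfolding M_def by (rule Max_in) auto
        then obtain k where k: "k \<in> {2, 3, 4}" "M = cmod (f k)" by blast
        have le: "cmod (f i) \<le> cmod (f k)" if "i \<in> {2, 3, 4}" for i
          unfolding k(2)[symmetric] M_def by (rule Max_ge) (use that in auto)
        have "f k \<noteq> 0"
        proof
          assume "f k = 0"
          then have "f 2 = 0" "f 3 = 0" "f 4 = 0" using le[of 2] le[of 3] le[of 4] by auto
          then show False using f surface_cone_dom by (auto simp: bundle_dom_def)
        qed
        then show ?thesis using that[OF k(1)] le by simp
      qed
      define h where "h = bundle_act n 1 (1 / f k) f"
      have h: "h \<in> surface_cone n a" unfolding h_def by (rule surface_cone_act) (use k f in auto)
      have h01: "h 0 = f 0" "h 1 = f 1" "h 2 = f 2 / f k" "h 3 = f 3 / f k" "h 4 = f 4 / f k" by (simp_all add: h_def)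
      have "bundle_class n h = bundle_class n d"
        using bundle_class_act[of f 1 "1 / f k" n] bundle_class_act[of d "1 / d j" 1 n] dD j k f surface_cone_dom
        by (auto simp: h_def f_def)
      then have "contract_class n a h = y" using d by (simp add: contract_class_def)
      moreover have "h \<in> ?K"
      proof -
        have "cmod (h j) = 1" using j(1) h01 fj by auto
        moreover have "cmod (h k) = 1" using k h01 by auto
        ultimately show ?thesis using h j(1) k(1) by (auto simp: surface_cone_def bundle_dom_def)
      qed
      moreover have "h \<in> ?B"
      proof -
        have hc: "h \<in> cspace 5" using h surface_cone_dom bundle_dom_cspace by blast
        have "cmod (h i) \<le> 1" for i
        proof -
          consider "i = 0" | "i = 1" | "i = 2" | "i = 3" | "i = 4" | "i \<ge> 5" by linarith
          then show ?thesis
            using fj k hc by cases (auto simp: h01 h01(2)[unfolded One_nat_def] norm_divide divide_simps cspace_def)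
        qed
        then show ?thesis by auto
      qed
      ultimately show "y \<in> contract_class n a ` (?K \<inter> ?B)" by blast
    qed
  qed
  ultimately show ?thesis by (simp add: compact_space_def)
qed

subsection \<open>The minitwistor space as a fibre\<close>

text \<open>The constant in the equation is split evenly: x and y are divided by the same real
  number, so the rescaling commutes with the real structure, which exchanges them.\<close>

definition real_scale :: "nat \<Rightarrow> (nat \<Rightarrow> real) \<Rightarrow> complex" where
  "real_scale n a = complex_of_real (sqrt (\<Prod>k<n. a (n + k + 1)))"

definition surface_map :: "nat \<Rightarrow> (nat \<Rightarrow> real) \<Rightarrow> (nat \<Rightarrow> complex) \<Rightarrow> nat \<Rightarrow> complex" where
  "surface_map n a d = cone_point n (param n a) (d 2 / real_scale n a) (d 3 / real_scale n a) (d 4) (d 0) (d 1)"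

lemma param_cspace: "param n a \<in> cspace (2 * n)"
  by (auto simp: param_def cspace_def)

lemma strict_mono_pos:
  fixes a :: "nat \<Rightarrow> real"
  assumes "strict_mono_on {1..2 * n} a" "a (n + 1) > 0" "k < n"
  shows "a (n + k + 1) > 0"
proof (cases "k = 0")
  case False
  then have "a (n + 1) < a (n + k + 1)" using assms by (intro strict_mono_onD[OF assms(1)]) auto
  then show ?thesis using assms(2) by simp
qed (use assms in simp)

lemma real_scale_power2:
  assumes "\<And>k. k < n \<Longrightarrow> a (n + k + 1) > 0"
  shows "real_scale n a ^ 2 = (\<Prod>k<n. complex_of_real (a (n + k + 1)))" "real_scale n a \<noteq> 0"
proof -
  have p: "(\<Prod>k<n. a (n + k + 1)) > 0" using assms by (intro prod_pos) auto
  then have "(sqrt (\<Prod>k<n. a (n + k + 1)))\<^sup>2 = (\<Prod>k<n. a (n + k + 1))" by simp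
  then have "complex_of_real ((sqrt (\<Prod>k<n. a (n + k + 1)))\<^sup>2) = complex_of_real (\<Prod>k<n. a (n + k + 1))" by (simp only:)
  then show "real_scale n a ^ 2 = (\<Prod>k<n. complex_of_real (a (n + k + 1)))" by (simp add: real_scale_def)
  have "sqrt (\<Prod>k<n. a (n + k + 1)) > 0" using p by (rule real_sqrt_gt_zero)
  then show "real_scale n a \<noteq> 0" unfolding real_scale_def of_real_eq_0_iff by linarith
qed

text \<open>The factor \<open>(-1)\<^sup>n\<close> of the surface turns \<open>\<Prod> (u\<^sub>0 - a\<^sub>n\<^sub>+\<^sub>k u\<^sub>1)\<close> into \<open>\<Prod> a\<^sub>n\<^sub>+\<^sub>k \<Prod> (u\<^sub>1 - u\<^sub>0 / a\<^sub>n\<^sub>+\<^sub>k)\<close>; the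
  constant \<open>\<Prod> a\<^sub>n\<^sub>+\<^sub>k\<close> is absorbed by rescaling \<open>x\<close> and \<open>y\<close>.\<close>

lemma surface_form_binary:
  assumes pos: "\<And>k. k < n \<Longrightarrow> a (n + k + 1) > 0"
  shows "surface_form n a u0 u1 = real_scale n a ^ 2 * binary_form n (param n a) u0 u1"
proof -
  have "(\<Prod>i = 1..2 * n. u0 - complex_of_real (a i) * u1) = (\<Prod>k<2 * n. u0 - complex_of_real (a (k + 1)) * u1)"
    by (rule prod.reindex_bij_witness[of _ "\<lambda>k. k + 1" "\<lambda>i. i - 1"]) auto
  also have "\<dots> = (\<Prod>k<n. u0 - complex_of_real (a (k + 1)) * u1) * (\<Prod>k<n. u0 - complex_of_real (a (n + k + 1)) * u1)"
  proof -
    have "{..<2 * n} = {..<n} \<union> (\<lambda>k. n + k) ` {..<n}"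
    proof (intro set_eqI iffI)
      fix i assume "i \<in> {..<2 * n}"
      then show "i \<in> {..<n} \<union> (\<lambda>k. n + k) ` {..<n}"
        by (cases "i < n") (auto intro!: image_eqI[of _ _ "i - n"])
    qed auto
    then have "(\<Prod>k<2 * n. u0 - complex_of_real (a (k + 1)) * u1) = (\<Prod>k<n. u0 - complex_of_real (a (k + 1)) * u1) *
        (\<Prod>k\<in>(\<lambda>k. n + k) ` {..<n}. u0 - complex_of_real (a (k + 1)) * u1)"
      by (simp only:) (rule prod.union_disjoint; auto)
    also have "(\<Prod>k\<in>(\<lambda>k. n + k) ` {..<n}. u0 - complex_of_real (a (k + 1)) * u1) =
        (\<Prod>k<n. u0 - complex_of_real (a (n + k + 1)) * u1)"
      by (subst prod.reindex) (auto simp: inj_on_def)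
    finally show ?thesis .
  qed
  finally have 1: "(\<Prod>i = 1..2 * n. u0 - complex_of_real (a i) * u1) =
     (\<Prod>k<n. u0 - complex_of_real (a (k + 1)) * u1) * (\<Prod>k<n. u0 - complex_of_real (a (n + k + 1)) * u1)" .
  have 2: "(\<Prod>k<n. u0 - param n a k * u1) = (\<Prod>k<n. u0 - complex_of_real (a (k + 1)) * u1)"
    by (intro prod.cong refl) (simp add: param_def)
  have "(\<Prod>k<n. complex_of_real (a (n + k + 1))) * (\<Prod>k<n. u1 - param n a (n + k) * u0) =
      (\<Prod>k<n. (-1) * (u0 - complex_of_real (a (n + k + 1)) * u1))"
    unfolding prod.distrib[symmetric]
  proof (intro prod.cong refl)
    fix k assume "k \<in> {..<n}"
    then have "complex_of_real (a (n + k + 1)) \<noteq> 0" "param n a (n + k) = 1 / complex_of_real (a (n + k + 1))"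
      using pos[of k] by (auto simp: param_def)
    then show "complex_of_real (a (n + k + 1)) * (u1 - param n a (n + k) * u0) = (-1) * (u0 - complex_of_real (a (n + k + 1)) * u1)"
      by (simp add: algebra_simps)
  qed
  also have "\<dots> = (-1) ^ n * (\<Prod>k<n. u0 - complex_of_real (a (n + k + 1)) * u1)"
    unfolding prod.distrib by simp
  finally have 3: "(\<Prod>k<n. complex_of_real (a (n + k + 1))) * (\<Prod>k<n. u1 - param n a (n + k) * u0) =
      (-1) ^ n * (\<Prod>k<n. u0 - complex_of_real (a (n + k + 1)) * u1)" .
  have "real_scale n a ^ 2 * binary_form n (param n a) u0 u1 =
     (\<Prod>k<n. u0 - param n a k * u1) * ((\<Prod>k<n. complex_of_real (a (n + k + 1))) * (\<Prod>k<n. u1 - param n a (n + k) * u0))"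
  proof -
    have "real_scale n a ^ 2 = (\<Prod>k<n. complex_of_real (a (n + k + 1)))"
      by (rule real_scale_power2(1)) (rule pos)
    then show ?thesis by (simp only: binary_form_def mult_ac)
  qed
  also have "\<dots> = surface_form n a u0 u1"
    unfolding 3 2 surface_form_def 1 by (simp only: mult_ac)
  finally show ?thesis by simp
qed

section \<open>Parameters of a point on the cone over the curve\<close>

lemma cone_point_cong:
  assumes "\<And>i. i \<le> n \<Longrightarrow> t * u0 ^ i * u1 ^ (n - i) = t' * v0 ^ i * v1 ^ (n - i)"
  shows "cone_point n b x y t u0 u1 = cone_point n b x y t' v0 v1"
proof
  fix i show "cone_point n b x y t u0 u1 i = cone_point n b x y t' v0 v1 i"
    using assms[of "i - (2 * n + 2)"] by (auto simp: cone_point_def)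
qed

lemma cone_point_eqD:
  assumes "cone_point n b x y t u0 u1 = cone_point n b' x' y' t' v0 v1"
  shows "x = x'" "y = y'" "i \<le> n \<Longrightarrow> t * u0 ^ i * u1 ^ (n - i) = t' * v0 ^ i * v1 ^ (n - i)"
  using cone_point_coords(2)[of n b x y t u0 u1] cone_point_coords(2)[of n b' x' y' t' v0 v1]
    cone_point_coords(3)[of n b x y t u0 u1] cone_point_coords(3)[of n b' x' y' t' v0 v1]
    cone_point_coords(4)[of i n b x y t u0 u1] cone_point_coords(4)[of i n b' x' y' t' v0 v1]
  unfolding assms by simp_all

text \<open>Two neighbouring coordinates at a nonzero end of the curve recover the ratio of u0 and
  u1; rescaling this pair by \<open>l\<close> is compensated in \<open>t\<close> by
  \<open>l ^ n\<close>, as in the line bundle of degree n.\<close>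

lemma curve_param_unique:
  assumes n: "n \<ge> 1" and u: "u0 \<noteq> 0 \<or> u1 \<noteq> (0::complex)" and v: "v0 \<noteq> 0 \<or> v1 \<noteq> 0" and t: "t \<noteq> 0"
    and eq: "\<And>i. i \<le> n \<Longrightarrow> t' * v0 ^ i * v1 ^ (n - i) = t * u0 ^ i * u1 ^ (n - i)"
  obtains l where "l \<noteq> 0" "v0 = l * u0" "v1 = l * u1" "t' * l ^ n = t"
proof (cases "u1 = 0")
  case False
  have a: "t' * v1 ^ n = t * u1 ^ n" using eq[of 0] by simp
  then have nz: "t' \<noteq> 0" "v1 \<noteq> 0" using t False n by (auto simp: power_0_left)
  define l where "l = v1 / u1"
  have v1: "v1 = l * u1" "l \<noteq> 0" using False nz by (auto simp: l_def)
  have tl: "t' * l ^ n = t" using a False by (simp add: v1(1) power_mult_distrib)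
  have m: "v1 ^ n = v1 * v1 ^ (n - 1)" "u1 ^ n = u1 * u1 ^ (n - 1)" using n by (simp_all add: power_eq_if)
  have 1: "t' * v0 * v1 ^ (n - 1) = t * u0 * u1 ^ (n - 1)" using eq[of 1] n by simp
  have 2: "t' * v1 ^ (n - 1) * v1 = t * u1 ^ (n - 1) * u1" using a unfolding m by (simp only: mult_ac)
  have "(t' * v1 ^ (n - 1)) * (v0 * u1) = (t' * v0 * v1 ^ (n - 1)) * u1" by (simp only: mult_ac)
  also have "\<dots> = (t * u1 ^ (n - 1) * u1) * u0" unfolding 1 by (simp only: mult_ac)
  also have "\<dots> = (t' * v1 ^ (n - 1)) * (v1 * u0)" unfolding 2[symmetric] by (simp only: mult_ac)
  finally have "(t' * v1 ^ (n - 1)) * (v0 * u1) = (t' * v1 ^ (n - 1)) * (v1 * u0)" .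
  then have "v0 * u1 = v1 * u0" using nz by simp
  then have "v0 = l * u0" using False by (simp add: l_def field_simps)
  then show ?thesis using that v1 tl by blast
next
  case True
  then have u0: "u0 \<noteq> 0" using u by simp
  have a: "t' * v0 ^ n = t * u0 ^ n" using eq[of n] by simp
  then have nz: "t' \<noteq> 0" "v0 \<noteq> 0" using t u0 n by (auto simp: power_0_left)
  define l where "l = v0 / u0"
  have v0: "v0 = l * u0" "l \<noteq> 0" using u0 nz by (auto simp: l_def)
  have tl: "t' * l ^ n = t" using a u0 by (simp add: v0(1) power_mult_distrib)
  have "t' * v1 ^ n = 0" using eq[of 0] True n by (simp add: power_0_left)
  then have "v1 = l * u1" using nz True by simp
  then show ?thesis using that v0 tl by blast
qed

lemma curve_param_general:
  assumes n: "n \<ge> 1" and w: "on_curve n (curve_coord n e)"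
  obtains t u0 u1 where "u0 \<noteq> 0 \<or> u1 \<noteq> 0" "\<And>i. i \<le> n \<Longrightarrow> curve_coord n e i = t * u0 ^ i * u1 ^ (n - i)"
proof -
  obtain u0 u1 where u: "\<And>i. i \<le> n \<Longrightarrow> curve_coord n e i = 1 * u0 ^ i * u1 ^ (n - i)"
    using curve_param[OF n w] by blast
  show ?thesis
  proof (cases "u0 = 0 \<and> u1 = 0")
    case True
    show ?thesis by (rule that[of 1 0 0]) (use u True n in \<open>auto simp: power_0_left\<close>)
  next
    case False
    show ?thesis by (rule that[of u0 u1 1]) (use u False in auto)
  qed
qed

context
  fixes n :: nat and a :: "nat \<Rightarrow> real"
  assumes n: "n \<ge> 1" and pos: "\<And>k. k < n \<Longrightarrow> a (n + k + 1) > 0"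
begin

lemma surface_map_fibre:
  assumes "d \<in> surface_cone n a" shows "surface_map n a d \<in> fibre_cone n (param n a)"
  unfolding surface_map_def
proof (rule cone_point_fibre[OF param_cspace])
  have "d 2 * d 3 = real_scale n a ^ 2 * binary_form n (param n a) (d 0) (d 1) * d 4 ^ 2"
    using assms surface_form_binary[of n a, OF pos] by (simp add: surface_cone_def)
  then show "d 2 / real_scale n a * (d 3 / real_scale n a) = (d 4)\<^sup>2 * binary_form n (param n a) (d 0) (d 1)"
    using real_scale_power2(2)[of n a, OF pos] by (simp add: field_simps power2_eq_square)
  show "d 2 / real_scale n a \<noteq> 0 \<or> d 3 / real_scale n a \<noteq> 0 \<or> d 4 \<noteq> 0 \<and> (d 0 \<noteq> 0 \<or> d 1 \<noteq> 0)"
    using assms real_scale_power2(2)[of n a, OF pos] by (auto simp: surface_cone_def bundle_dom_def)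
qed

text \<open>For t \<noteq> 0 the point of the base curve is recovered from the \<open>w_i\<close>.
  For t = 0 all \<open>w_i\<close> vanish and x y = 0, so only the information which of x, y is zero
  survives: exactly the two sections at infinity are collapsed, each to one point.\<close>

lemma surface_map_class_eq_iff:
  assumes d: "d \<in> surface_cone n a" and f: "f \<in> surface_cone n a"
  shows "family_class n (surface_map n a d) = family_class n (surface_map n a f) \<longleftrightarrow>
     bundle_class n d = bundle_class n f \<or> (d 4 = 0 \<and> f 4 = 0 \<and> (d 2 = 0 \<and> f 2 = 0 \<or> d 3 = 0 \<and> f 3 = 0))"
proof -
  let ?k = "real_scale n a" and ?b = "param n a"
  have k: "?k \<noteq> 0" by (rule real_scale_power2(2)[of n a, OF pos])
  have dD: "d \<in> bundle_dom" "f \<in> bundle_dom" using d f surface_cone_dom by blast+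
  have iff: "family_class n (surface_map n a d) = family_class n (surface_map n a f) \<longleftrightarrow>
    (\<exists>l. l \<noteq> 0 \<and> surface_map n a f = scale n l (surface_map n a d))"
    by (rule family_class_eq_iff) (use surface_map_fibre d f fibre_cone_family_cone in blast)+
  show ?thesis
    unfolding iff
  proof
    assume "\<exists>l. l \<noteq> 0 \<and> surface_map n a f = scale n l (surface_map n a d)"
    then obtain l where l: "l \<noteq> 0" and eq: "surface_map n a f = scale n l (surface_map n a d)" by blast
    note D = cone_point_eqD[OF eq[unfolded surface_map_def scale_cone_point]]
    have xy: "f 2 = l * d 2" "f 3 = l * d 3" using D(1,2) k by (auto simp: field_simps)
    have w: "f 4 * f 0 ^ i * f 1 ^ (n - i) = l * d 4 * d 0 ^ i * d 1 ^ (n - i)" if "i \<le> n" for i using D(3)[OF that] .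
    have u: "d 0 \<noteq> 0 \<or> d 1 \<noteq> 0" "f 0 \<noteq> 0 \<or> f 1 \<noteq> 0" using dD by (auto simp: bundle_dom_def)
    show "bundle_class n d = bundle_class n f \<or> (d 4 = 0 \<and> f 4 = 0 \<and> (d 2 = 0 \<and> f 2 = 0 \<or> d 3 = 0 \<and> f 3 = 0))"
    proof (cases "d 4 = 0")
      case True
      have "f 4 = 0" using w[of 0] w[of n] True u(2) by auto
      moreover have "d 2 * d 3 = 0" using d True by (simp add: surface_cone_def)
      ultimately show ?thesis using True xy by auto
    next
      case False
      then have t: "l * d 4 \<noteq> 0" using l by simp
      obtain c where c: "c \<noteq> 0" "f 0 = c * d 0" "f 1 = c * d 1" "f 4 * c ^ n = l * d 4"
        using curve_param_unique[OF n u(1) u(2) t w] by blast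
      have f4: "f 4 \<noteq> 0" using c(4) t by auto
      have "f = bundle_act n c (f 4 / d 4) d"
      proof (rule cspace5_eqI)
        show "f \<in> cspace 5" using dD bundle_dom_cspace by blast
        have *: "f 4 / d 4 * c ^ n = l" using c(4) False by (simp add: field_simps)
        show "f 2 = bundle_act n c (f 4 / d 4) d 2" "f 3 = bundle_act n c (f 4 / d 4) d 3"
          unfolding bundle_act_simps * by (fact xy)+
      qed (use c False in simp_all)
      then have "bundle_class n f = bundle_class n d"
        using bundle_class_act[OF dD(1), of c "f 4 / d 4" n] c(1) f4 False by simp
      then show ?thesis by simp
    qed
  next
    assume R: "bundle_class n d = bundle_class n f \<or> (d 4 = 0 \<and> f 4 = 0 \<and> (d 2 = 0 \<and> f 2 = 0 \<or> d 3 = 0 \<and> f 3 = 0))"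
    have zero: "cone_point n ?b x y 0 u0 u1 = cone_point n ?b x y 0 v0 v1" for x y u0 u1 v0 v1
      by (rule cone_point_cong) simp
    consider l m where "l \<noteq> 0" "m \<noteq> 0" "f = bundle_act n l m d" | "d 4 = 0" "f 4 = 0" "d 2 = 0" "f 2 = 0"
      | "d 4 = 0" "f 4 = 0" "d 3 = 0" "f 3 = 0"
      using R bundle_class_eq_iff[OF dD] by blast
    then show "\<exists>l. l \<noteq> 0 \<and> surface_map n a f = scale n l (surface_map n a d)"
    proof cases
      case 1
      have *: "cone_point n ?b x y (m * d 4) (l * d 0) (l * d 1) = cone_point n ?b x y (m * l ^ n * d 4) (d 0) (d 1)" for x y
      proof (rule cone_point_cong)
        fix i assume "i \<le> n"
        then have "l ^ n = l ^ i * l ^ (n - i)" by (simp add: power_add[symmetric])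
        then show "m * d 4 * (l * d 0) ^ i * (l * d 1) ^ (n - i) = m * l ^ n * d 4 * d 0 ^ i * d 1 ^ (n - i)"
          by (simp add: power_mult_distrib)
      qed
      have "surface_map n a f = scale n (m * l ^ n) (surface_map n a d)"
        unfolding surface_map_def scale_cone_point 1(3) using * by simp
      then show ?thesis using 1 by (intro exI[of _ "m * l ^ n"]) simp
    next
      case 2
      then have "d 3 \<noteq> 0" "f 3 \<noteq> 0" using dD by (auto simp: bundle_dom_def)
      then show ?thesis
        using 2 zero[of 0 _ "f 0" "f 1" "d 0" "d 1"]
        by (intro exI[of _ "f 3 / d 3"]) (simp add: surface_map_def scale_cone_point)
    next
      case 3
      then have "d 2 \<noteq> 0" "f 2 \<noteq> 0" using dD by (auto simp: bundle_dom_def)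
      then show ?thesis
        using 3 zero[of _ 0 "f 0" "f 1" "d 0" "d 1"]
        by (intro exI[of _ "f 2 / d 2"]) (simp add: surface_map_def scale_cone_point)
    qed
  qed
qed

lemma section_at_infinity_iff:
  assumes d: "d \<in> surface_cone n a" and c: "c = 2 \<or> c = 3"
  shows "bundle_class n d \<in> section_at_infinity n a c \<longleftrightarrow> d 4 = 0 \<and> d c = 0"
proof -
  have dD: "d \<in> bundle_dom" using d surface_cone_dom by blast
  have "bundle_class n d \<in> pts (compact_surface n a)" using d by (simp add: pts_compact_surface)
  moreover have "(\<exists>p\<in>bundle_class n d. p 4 = 0 \<and> p c = 0) \<longleftrightarrow> d 4 = 0 \<and> d c = 0"
  proof
    assume "\<exists>p\<in>bundle_class n d. p 4 = 0 \<and> p c = 0"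
    then obtain l m where "l \<noteq> 0" "m \<noteq> 0" "bundle_act n l m d 4 = 0 \<and> bundle_act n l m d c = 0"
      by (auto simp: bundle_class_def bundle_rel_iff)
    then show "d 4 = 0 \<and> d c = 0" using c by auto
  next
    have "d \<in> bundle_class n d" using equiv_class_self[OF equiv_bundle_rel dD] by (simp add: bundle_class_def)
    then show "\<exists>p\<in>bundle_class n d. p 4 = 0 \<and> p c = 0" if "d 4 = 0 \<and> d c = 0" using that by blast
  qed
  ultimately show ?thesis by (simp add: section_at_infinity_def)
qed

text \<open>Expresses the contraction through \<open>surface_map\<close>, so that equality of
  classes and the real structure can be read off in the family.\<close>

lemma contract_class_eq:
  assumes d: "d \<in> surface_cone n a"
  shows "contract_class n a d = {bundle_class n f | f. f \<in> surface_cone n a \<and>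
     family_class n (surface_map n a f) = family_class n (surface_map n a d)}"
proof -
  have "(bundle_class n d, bundle_class n f) \<in> contract_rel n a \<longleftrightarrow>
      family_class n (surface_map n a d) = family_class n (surface_map n a f)" if f: "f \<in> surface_cone n a" for f
    unfolding surface_map_class_eq_iff[OF d f] contract_rel_def
    using d f section_at_infinity_iff by (auto simp: pts_compact_surface)
  then show ?thesis
    unfolding contract_class_def
    by (auto simp: contract_rel_def pts_compact_surface) (metis (mono_tags, lifting))+
qed

lemma contract_class_eq_iff:
  assumes "d \<in> surface_cone n a" "f \<in> surface_cone n a"
  shows "contract_class n a d = contract_class n a f \<longleftrightarrow>
    family_class n (surface_map n a d) = family_class n (surface_map n a f)"
proof
  assume "contract_class n a d = contract_class n a f"
  then have "bundle_class n f \<in> contract_class n a d" unfolding contract_class_eq[OF assms(2)] using assms by auto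
  then obtain g where g: "bundle_class n f = bundle_class n g" "g \<in> surface_cone n a"
    "family_class n (surface_map n a g) = family_class n (surface_map n a d)"
    unfolding contract_class_eq[OF assms(1)] by auto
  then show "family_class n (surface_map n a d) = family_class n (surface_map n a f)"
    using surface_map_class_eq_iff[OF assms(2) g(2)] by simp
qed (simp add: contract_class_eq assms)

section \<open>The real structure on the minitwistor space\<close>

definition surface_conj :: "(nat \<Rightarrow> complex) \<Rightarrow> nat \<Rightarrow> complex" where
  "surface_conj p = vec [cnj (p 0), cnj (p 1), cnj (p 3), cnj (p 2), cnj (p 4)]"

lemma surface_conj_cone:
  assumes d: "d \<in> surface_cone n a" shows "surface_conj d \<in> surface_cone n a"
proof -
  have "cnj (d 2 * d 3) = cnj (surface_form n a (d 0) (d 1) * d 4 ^ 2)" using d by (simp add: surface_cone_def)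
  also have "\<dots> = surface_form n a (cnj (d 0)) (cnj (d 1)) * cnj (d 4) ^ 2" by (simp add: surface_form_def)
  finally show ?thesis
    using d by (auto simp: surface_cone_def surface_conj_def bundle_dom_def mult.commute)
qed

lemma surface_conj_invol: "p \<in> cspace 5 \<Longrightarrow> surface_conj (surface_conj p) = p"
  by (rule cspace5_eqI) (simp_all add: surface_conj_def)

lemma surface_conj_act: "surface_conj (bundle_act n l m p) = bundle_act n (cnj l) (cnj m) (surface_conj p)"
  by (rule cspace5_eqI) (simp_all add: surface_conj_def)

lemma surface_conj_class:
  assumes d: "d \<in> surface_cone n a" shows "surface_conj ` bundle_class n d = bundle_class n (surface_conj d)"
proof -
  have dD: "d \<in> bundle_dom" "surface_conj d \<in> bundle_dom" using d surface_conj_cone surface_cone_dom by blast+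
  have "bundle_class n p = {bundle_act n l m p | l m. l \<noteq> 0 \<and> m \<noteq> 0}" if "p \<in> bundle_dom" for p
    using that by (intro set_eqI) (simp add: bundle_class_def bundle_rel_iff, blast)
  note cl = this[OF dD(1)] this[OF dD(2)]
  show ?thesis
    unfolding cl
  proof (intro set_eqI iffI)
    fix q assume "q \<in> surface_conj ` {bundle_act n l m d | l m. l \<noteq> 0 \<and> m \<noteq> 0}"
    then obtain l m where "l \<noteq> 0" "m \<noteq> 0" "q = surface_conj (bundle_act n l m d)" by blast
    then show "q \<in> {bundle_act n l m (surface_conj d) | l m. l \<noteq> 0 \<and> m \<noteq> 0}"
    proof -
      have "q = bundle_act n (cnj l) (cnj m) (surface_conj d)" "cnj l \<noteq> 0" "cnj m \<noteq> 0"
        using \<open>l \<noteq> 0\<close> \<open>m \<noteq> 0\<close> \<open>q = surface_conj (bundle_act n l m d)\<close> by (simp_all add: surface_conj_act)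
      then show ?thesis by blast
    qed
  next
    fix q assume "q \<in> {bundle_act n l m (surface_conj d) | l m. l \<noteq> 0 \<and> m \<noteq> 0}"
    then obtain l m where "l \<noteq> 0" "m \<noteq> 0" "q = bundle_act n l m (surface_conj d)" by blast
    then have "q = surface_conj (bundle_act n (cnj l) (cnj m) d)" "cnj l \<noteq> 0" "cnj m \<noteq> 0" by (simp_all add: surface_conj_act)
    then show "q \<in> surface_conj ` {bundle_act n l m d | l m. l \<noteq> 0 \<and> m \<noteq> 0}" by blast
  qed
qed

lemma surface_map_conj: "surface_map n a (surface_conj d) = conj_swap n (surface_map n a d)"
proof
  fix i
  have r: "cnj (param n a i) = param n a i" by (simp add: param_def)
  show "surface_map n a (surface_conj d) i = conj_swap n (surface_map n a d) i"
    using r by (simp add: surface_map_def conj_swap_def cone_point_def surface_conj_def real_scale_def)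
qed

lemma minitwistor_real_class:
  assumes d: "d \<in> surface_cone n a"
  shows "minitwistor_real (contract_class n a d) = contract_class n a (surface_conj d)"
proof -
  have mr: "minitwistor_real = image (image surface_conj)"
    by (simp add: minitwistor_real_def surface_conj_def[abs_def])
  have key: "family_class n (surface_map n a (surface_conj f)) = family_class n (surface_map n a (surface_conj g))"
    if "f \<in> surface_cone n a" "g \<in> surface_cone n a"
      "family_class n (surface_map n a f) = family_class n (surface_map n a g)" for f g
    unfolding surface_map_conj
    using that family_real_class[OF fibre_cone_family_cone[OF surface_map_fibre]] by metis
  have inv: "surface_conj (surface_conj f) = f" if "f \<in> surface_cone n a" for f
    using that surface_conj_invol surface_cone_dom bundle_dom_cspace by blast
  show ?thesis
    unfolding mr contract_class_eq[OF d] contract_class_eq[OF surface_conj_cone[OF d]]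
  proof (intro set_eqI iffI)
    fix P assume "P \<in> (`) surface_conj ` {bundle_class n f | f. f \<in> surface_cone n a \<and>
       family_class n (surface_map n a f) = family_class n (surface_map n a d)}"
    then obtain f where "f \<in> surface_cone n a" "family_class n (surface_map n a f) = family_class n (surface_map n a d)"
      "P = surface_conj ` bundle_class n f" by blast
    then show "P \<in> {bundle_class n f | f. f \<in> surface_cone n a \<and>
       family_class n (surface_map n a f) = family_class n (surface_map n a (surface_conj d))}"
      using surface_conj_class surface_conj_cone key d by blast
  next
    fix P assume "P \<in> {bundle_class n f | f. f \<in> surface_cone n a \<and>
       family_class n (surface_map n a f) = family_class n (surface_map n a (surface_conj d))}"
    then obtain f where f: "f \<in> surface_cone n a" "P = bundle_class n f"
      "family_class n (surface_map n a f) = family_class n (surface_map n a (surface_conj d))" by blast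
    have "family_class n (surface_map n a (surface_conj f)) = family_class n (surface_map n a d)"
      using key[OF f(1) surface_conj_cone[OF d] f(3)] inv[OF d] by simp
    moreover have "P = surface_conj ` bundle_class n (surface_conj f)"
      using surface_conj_class[OF surface_conj_cone[OF f(1)]] inv[OF f(1)] f(2) by simp
    ultimately show "P \<in> (`) surface_conj ` {bundle_class n f | f. f \<in> surface_cone n a \<and>
       family_class n (surface_map n a f) = family_class n (surface_map n a d)}"
      using surface_conj_cone[OF f(1)] by blast
  qed
qed

text \<open>Inverts \<open>surface_map\<close> once parameters of the curve point are chosen.
  Arbitrary choices give surjectivity, holomorphic choices give local sections.\<close>

lemma surface_map_section:
  assumes e: "e \<in> fibre_cone n (param n a)" and u: "u0 \<noteq> 0 \<or> u1 \<noteq> 0"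
    and w: "\<And>i. i \<le> n \<Longrightarrow> curve_coord n e i = t * u0 ^ i * u1 ^ (n - i)"
  defines "d \<equiv> vec [u0, u1, real_scale n a * e (2 * n), real_scale n a * e (2 * n + 1), t]"
  shows "d \<in> surface_cone n a" "surface_map n a d = e"
proof -
  let ?k = "real_scale n a"
  have k: "?k \<noteq> 0" by (rule real_scale_power2(2)[of n a, OF pos])
  note E = fibre_cone_eq_cone_point[OF e w]
  show "surface_map n a d = e"
    using E(1) k by (simp add: surface_map_def d_def)
  have "?k * e (2 * n) * (?k * e (2 * n + 1)) = ?k ^ 2 * (e (2 * n) * e (2 * n + 1))" by (simp add: power2_eq_square mult_ac)
  also have "\<dots> = ?k ^ 2 * (t ^ 2 * binary_form n (param n a) u0 u1)" by (simp only: E(2))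
  also have "\<dots> = surface_form n a u0 u1 * t ^ 2"
    by (simp only: surface_form_binary[of n a, OF pos] mult_ac)
  finally have "?k * e (2 * n) * (?k * e (2 * n + 1)) = surface_form n a u0 u1 * t ^ 2" .
  moreover have "d 0 = u0" "d 1 = u1" "d 2 = ?k * e (2 * n)" "d 3 = ?k * e (2 * n + 1)" "d 4 = t" by (simp_all add: d_def)
  ultimately have eq: "d 2 * d 3 = surface_form n a (d 0) (d 1) * d 4 ^ 2" by (simp only:)
  have "(e (2 * n), e (2 * n + 1), t) \<noteq> (0, 0, 0)"
  proof
    assume z: "(e (2 * n), e (2 * n + 1), t) = (0, 0, 0)"
    obtain c where c: "c \<in> {2 * n..<3 * n + 3}" "e c \<noteq> 0"
      using fibre_cone_family_cone[OF e] unfolding family_cone_def by blast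
    have "cone_point n b 0 0 0 u0 u1 c = 0" for b using c(1) by (simp add: cone_point_def)
    then show False using fun_cong[OF E(1), of c] z c(2) by simp
  qed
  then have "d \<in> bundle_dom" using u k by (auto simp: bundle_dom_def d_def)
  then show "d \<in> surface_cone n a" using eq by (simp add: surface_cone_def)
qed

text \<open>Where the first or last curve coordinate is nonzero, the curve parameters are
  holomorphic functions of the point, so \<open>surface_map\<close> has a holomorphic section and
  \<open>h\<close> is a composition with it. The remaining points are vertices, to which
  \<open>vertex_extension\<close> applies.\<close>

lemma surface_descent:
  assumes Z: "openin (top_of_set (fibre_cone n (param n a))) Z"
    and hom: "\<And>e l. e \<in> Z \<Longrightarrow> l \<noteq> 0 \<Longrightarrow> scale n l e \<in> Z \<and> h (scale n l e) = h e"
    and hc: "continuous_on Z h"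
    and hl: "lhol 5 {d \<in> surface_cone n a. surface_map n a d \<in> Z} (\<lambda>d. h (surface_map n a d))"
  shows "lhol (3 * n + 3) Z h"
proof -
  let ?N = "3 * n + 3" and ?k = "real_scale n a"
  have ZF: "Z \<subseteq> fibre_cone n (param n a)" using Z by (auto simp: openin_open)
  have ZN: "Z \<subseteq> cspace ?N" using ZF fibre_cone_cspace by blast
  have gen: "lhol ?N S h" if S: "S \<subseteq> Z" and UV: "lhol ?N S U" "lhol ?N S V" "lhol ?N S T" "\<And>e. e \<in> S \<Longrightarrow> U e \<noteq> 0 \<or> V e \<noteq> 0"
    and w: "\<And>e i. e \<in> S \<Longrightarrow> i \<le> n \<Longrightarrow> curve_coord n e i = T e * U e ^ i * V e ^ (n - i)" for S U V T
  proof -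
    let ?s = "\<lambda>e. vec [U e, V e, ?k * e (2 * n), ?k * e (2 * n + 1), T e]"
    have SN: "S \<subseteq> cspace ?N" using S ZN by blast
    have sec: "?s e \<in> surface_cone n a" "surface_map n a (?s e) = e" if "e \<in> S" for e
      using surface_map_section[OF _ UV(4)[OF that] w[OF that]] S ZF that by auto
    have "lhol ?N S (\<lambda>e. h (surface_map n a (?s e)))"
    proof (rule lhol_compose[OF hl _ _ SN])
      fix i :: nat assume "i < 5"
      then consider "i = 0" | "i = 1" | "i = 2" | "i = 3" | "i = 4" by linarith
      then show "lhol ?N S (\<lambda>e. ?s e i)"
        by cases (use UV in \<open>auto intro!: lhol_mult lhol_const lhol_coord SN\<close>)
    qed (use sec S in auto)
    moreover have "h e = h (surface_map n a (?s e))" if "e \<in> S" for e by (simp only: sec(2)[OF that])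
    ultimately show ?thesis using lhol_cong[of S h "\<lambda>e. h (surface_map n a (?s e))"] by simp
  qed
  let ?Z1 = "{e \<in> Z. e (2 * n + 2) \<noteq> 0}" and ?Z2 = "{e \<in> Z. e (3 * n + 2) \<noteq> 0}"
  have oc: "on_curve n (curve_coord n e)" if "e \<in> Z" for e using fibre_coneD(2) ZF that by blast
  have l1: "lhol ?N ?Z1 h"
  proof (rule gen[of ?Z1 "\<lambda>e. e (2 * n + 3) / e (2 * n + 2)" "\<lambda>_. 1" "\<lambda>e. e (2 * n + 2)"])
    show "curve_coord n e i = e (2 * n + 2) * (e (2 * n + 3) / e (2 * n + 2)) ^ i * 1 ^ (n - i)" if "e \<in> ?Z1" "i \<le> n" for e i
      using curve_first_coord[OF oc _ that(2) n] that(1) by blast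
  qed (use ZN in \<open>auto intro!: lhol_divide lhol_const lhol_coord\<close>)
  have l2: "lhol ?N ?Z2 h"
  proof (rule gen[of ?Z2 "\<lambda>_. 1" "\<lambda>e. e (3 * n + 1) / e (3 * n + 2)" "\<lambda>e. e (3 * n + 2)"])
    show "curve_coord n e i = e (3 * n + 2) * 1 ^ i * (e (3 * n + 1) / e (3 * n + 2)) ^ (n - i)" if "e \<in> ?Z2" "i \<le> n" for e i
      using curve_last_coord[OF oc _ that(2) n] that(1) by blast
  qed (use ZN in \<open>auto intro!: lhol_divide lhol_const lhol_coord\<close>)
  let ?Z12 = "{e \<in> Z. e (2 * n + 2) \<noteq> 0 \<or> e (3 * n + 2) \<noteq> 0}"
  have Z12: "openin (top_of_set Z) ?Z1" "openin (top_of_set Z) ?Z2" by (rule openin_coord_nonzero)+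
  have reg: "lhol ?N ?Z12 h"
  proof (rule lhol_local')
    fix e assume e: "e \<in> ?Z12"
    have "openin (top_of_set ?Z12) ?Z1" "openin (top_of_set ?Z12) ?Z2"
      using Z12 by (auto elim!: openin_subset_trans)
    then show "\<exists>T. openin (top_of_set ?Z12) T \<and> e \<in> T \<and> lhol ?N T h" using e l1 l2 by blast
  qed (use ZN in auto)
  show ?thesis
  proof (rule lhol_local)
    fix e assume e: "e \<in> Z"
    show "\<exists>V. openin (top_of_set (cspace ?N)) V \<and> e \<in> V \<and> lhol ?N (V \<inter> Z) h"
    proof (cases "e (2 * n + 2) = 0 \<and> e (3 * n + 2) = 0")
      case True
      then show ?thesis using vertex_extension[OF n param_cspace Z e hom hc reg] by blast
    next
      case False
      let ?V1 = "{e \<in> cspace ?N. e (2 * n + 2) \<noteq> 0}" and ?V2 = "{e \<in> cspace ?N. e (3 * n + 2) \<noteq> 0}"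
      have "openin (top_of_set (cspace ?N)) ?V1" "openin (top_of_set (cspace ?N)) ?V2" by (rule openin_coord_nonzero)+
      moreover have "lhol ?N (?V1 \<inter> Z) h" by (rule lhol_subset[OF l1]) auto
      moreover have "lhol ?N (?V2 \<inter> Z) h" by (rule lhol_subset[OF l2]) auto
      ultimately show ?thesis using False e ZN by blast
    qed
  qed
qed

lemma has_fibre_minitwistor:
  "has_fibre (family n) (2 * n) (base_map n) (family_real n) (param n a) (minitwistor n a) minitwistor_real"
proof (rule has_fibreI[OF n param_cspace uniformized_minitwistor compact_minitwistor, where \<Psi> = "surface_map n a" and g = surface_conj])
  have SN: "surface_cone n a \<subseteq> cspace 5" using surface_cone_dom bundle_dom_cspace by blast
  show "lhol 5 (surface_cone n a) (\<lambda>d. surface_map n a d i)" for i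
    unfolding surface_map_def
    by (intro lhol_cone_point lhol_divide lhol_coord lhol_const SN) (use real_scale_power2(2)[of n a, OF pos] in auto)
  show "\<exists>d\<in>surface_cone n a. family_class n (surface_map n a d) = family_class n e" if e: "e \<in> fibre_cone n (param n a)" for e
  proof -
    obtain t u0 u1 where u: "u0 \<noteq> 0 \<or> u1 \<noteq> 0" "\<And>i. i \<le> n \<Longrightarrow> curve_coord n e i = t * u0 ^ i * u1 ^ (n - i)"
      using curve_param_general[OF n fibre_coneD(2)[OF e]] by metis
    show ?thesis
      by (rule bexI[OF _ surface_map_section(1)[OF e u]]) (simp only: surface_map_section(2)[OF e u])
  qed
qed (rule surface_map_conj | fact surface_map_fibre contract_class_eq_iff surface_descent surface_conj_cone minitwistor_real_class)+

end

subsection \<open>The quotient of the quadric\<close>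

definition Q_act :: "complex \<Rightarrow> complex \<Rightarrow> (nat \<Rightarrow> complex) \<Rightarrow> nat \<Rightarrow> complex" where
  "Q_act l m p = vec [l * p 0, l * p 1, m * p 2, m * p 3]"

definition Q_class :: "(nat \<Rightarrow> complex) \<Rightarrow> (nat \<Rightarrow> complex) set" where
  "Q_class p = Q_rel `` {p}"

text \<open>On roots of unity \<open>cnj \<omega>\<close> is the inverse of \<omega>, so this is the
  rotation by \<omega> in \<zeta> and by its inverse in \<eta>.\<close>

definition rotate_Q :: "complex \<Rightarrow> (nat \<Rightarrow> complex) \<Rightarrow> nat \<Rightarrow> complex" where
  "rotate_Q \<omega> p = vec [\<omega> * p 0, p 1, cnj \<omega> * p 2, p 3]"

text \<open>The invariants \<zeta>^n, \<eta>^n and the powers of z = \<zeta> \<eta>, cleared of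
  denominators by the common factor \<open>d 1 ^ n * d 3 ^ n\<close>.\<close>

definition Q_map :: "nat \<Rightarrow> (nat \<Rightarrow> complex) \<Rightarrow> nat \<Rightarrow> complex" where
  "Q_map n d = cone_point n (\<lambda>_. 0) (d 0 ^ n * d 3 ^ n) (d 1 ^ n * d 2 ^ n) 1 (d 0 * d 2) (d 1 * d 3)"

definition Zn_class :: "nat \<Rightarrow> (nat \<Rightarrow> complex) \<Rightarrow> (nat \<Rightarrow> complex) set set" where
  "Zn_class n d = Zn_rel n `` {Q_class d}"

lemma vec4 [simp]:
  "vec [a, b, c, d] 0 = a" "vec [a, b, c, d] (Suc 0) = b" "vec [a, b, c, d] 2 = c" "vec [a, b, c, d] 3 = d"
  by (simp_all add: vec_def eval_nat_numeral)

lemma vec4_cspace [simp]: "vec [a, b, c, d] \<in> cspace 4"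
  by (simp add: vec_def cspace_def)

lemma cspace4_eqI:
  assumes "p \<in> cspace 4" "q \<in> cspace 4" "p 0 = q 0" "p 1 = q 1" "p 2 = q 2" "p 3 = q 3"
  shows "p = q"
proof
  fix i :: nat
  consider "i = 0" | "i = 1" | "i = 2" | "i = 3" | "i \<ge> 4" by linarith
  then show "p i = q i" using assms by cases (auto simp: cspace_def)
qed

lemma Q_act_simps [simp]:
  "Q_act l m p 0 = l * p 0" "Q_act l m p (Suc 0) = l * p 1" "Q_act l m p 2 = m * p 2"
  "Q_act l m p 3 = m * p 3" "Q_act l m p \<in> cspace 4"
  by (simp_all add: Q_act_def)

lemma rotate_Q_simps [simp]:
  "rotate_Q \<omega> p 0 = \<omega> * p 0" "rotate_Q \<omega> p (Suc 0) = p 1" "rotate_Q \<omega> p 2 = cnj \<omega> * p 2"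
  "rotate_Q \<omega> p 3 = p 3" "rotate_Q \<omega> p \<in> cspace 4"
  by (simp_all add: rotate_Q_def)

lemma Q_act_dom: "p \<in> Q_dom \<Longrightarrow> l \<noteq> 0 \<Longrightarrow> m \<noteq> 0 \<Longrightarrow> Q_act l m p \<in> Q_dom"
  by (auto simp: Q_dom_def)

lemma Q_act_act: "Q_act l m (Q_act l' m' p) = Q_act (l * l') (m * m') p"
  by (rule cspace4_eqI) (simp_all add: mult_ac)

lemma Q_act_1: "p \<in> cspace 4 \<Longrightarrow> Q_act 1 1 p = p"
  by (rule cspace4_eqI) simp_all

lemma rotate_Q_act: "rotate_Q \<omega> (Q_act l m p) = Q_act l m (rotate_Q \<omega> p)"
  by (rule cspace4_eqI) (simp_all add: mult_ac)

lemma rotate_Q_rotate: "rotate_Q \<omega> (rotate_Q \<omega>' p) = rotate_Q (\<omega> * \<omega>') p"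
  by (rule cspace4_eqI) (simp_all add: mult_ac)

lemma rotate_Q_dom: "p \<in> Q_dom \<Longrightarrow> \<omega> \<noteq> 0 \<Longrightarrow> rotate_Q \<omega> p \<in> Q_dom"
  by (auto simp: Q_dom_def)

lemma Q_dom_cspace: "Q_dom \<subseteq> cspace 4"
  by (auto simp: Q_dom_def)

lemma Q_rel_iff: "(p, q) \<in> Q_rel \<longleftrightarrow> p \<in> Q_dom \<and> (\<exists>l m. l \<noteq> 0 \<and> m \<noteq> 0 \<and> q = Q_act l m p)"
  unfolding Q_rel_def Q_act_def[symmetric] using Q_act_dom by auto

lemma Q_class_orbit: "p \<in> Q_dom \<Longrightarrow> Q_class p = {Q_act l m p | l m. l \<noteq> 0 \<and> m \<noteq> 0}"
  by (intro set_eqI) (simp add: Q_class_def Q_rel_iff, blast)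

lemma Q_class_eq_iff:
  assumes "p \<in> Q_dom" "q \<in> Q_dom"
  shows "Q_class p = Q_class q \<longleftrightarrow> (\<exists>l m. l \<noteq> 0 \<and> m \<noteq> 0 \<and> q = Q_act l m p)"
proof
  assume "Q_class p = Q_class q"
  moreover have "q \<in> Q_class q"
  proof -
    have "q = Q_act 1 1 q" using Q_act_1 assms Q_dom_cspace by auto
    then show ?thesis unfolding Q_class_orbit[OF assms(2)] by (metis (mono_tags, lifting) mem_Collect_eq one_neq_zero)
  qed
  ultimately have "q \<in> Q_class p" by simp
  then show "\<exists>l m. l \<noteq> 0 \<and> m \<noteq> 0 \<and> q = Q_act l m p" unfolding Q_class_orbit[OF assms(1)] by blast
next
  assume "\<exists>l m. l \<noteq> 0 \<and> m \<noteq> 0 \<and> q = Q_act l m p"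
  then obtain l m where lm: "l \<noteq> 0" "m \<noteq> 0" "q = Q_act l m p" by blast
  show "Q_class p = Q_class q"
    unfolding Q_class_orbit[OF assms(1)] Q_class_orbit[OF assms(2)]
  proof (intro set_eqI iffI)
    fix r assume "r \<in> {Q_act l m p | l m. l \<noteq> 0 \<and> m \<noteq> 0}"
    then obtain a b where "a \<noteq> 0" "b \<noteq> 0" "r = Q_act a b p" by blast
    then have "r = Q_act (a / l) (b / m) q" "a / l \<noteq> 0" "b / m \<noteq> 0" using lm by (simp_all add: Q_act_act)
    then show "r \<in> {Q_act l m q | l m. l \<noteq> 0 \<and> m \<noteq> 0}" by blast
  next
    fix r assume "r \<in> {Q_act l m q | l m. l \<noteq> 0 \<and> m \<noteq> 0}"
    then obtain a b where "a \<noteq> 0" "b \<noteq> 0" "r = Q_act a b q" by blast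
    then have "r = Q_act (a * l) (b * m) p" "a * l \<noteq> 0" "b * m \<noteq> 0" using lm by (simp_all add: Q_act_act)
    then show "r \<in> {Q_act l m p | l m. l \<noteq> 0 \<and> m \<noteq> 0}" by blast
  qed
qed

lemma uniformized_Q: "uniformized 4 Q_dom Q_class Q_space"
  using uniformized_quotient[OF uniformized_affine[OF Q_dom_cspace], of Q_rel]
  by (simp add: Q_space_def Q_class_def[abs_def])

lemma uniformized_Q_mod_Zn: "uniformized 4 Q_dom (Zn_class n) (Q_mod_Zn n)"
  using uniformized_quotient[OF uniformized_Q, of "Zn_rel n"]
  by (simp add: Q_mod_Zn_def Zn_class_def[abs_def])

lemma compact_Q_mod_Zn: "compact_space (Top (Q_mod_Zn n))"
proof -
  note uD = uniformizedD[OF uniformized_Q_mod_Zn[of n]]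
  let ?K = "{d. \<exists>j\<in>{0, 1}. cmod (d j) = 1} \<inter> {d. \<exists>k\<in>{2, 3}. cmod (d k) = 1} \<inter> cspace 4"
  let ?B = "Pi\<^sub>E UNIV (\<lambda>_. cball (0::complex) 1)"
  have ex: "{d :: nat \<Rightarrow> complex. \<exists>j\<in>I. cmod (d j) = 1} = (\<Union>j\<in>I. {d. cmod (d j) = 1})" for I by auto
  have cl: "closed {d :: nat \<Rightarrow> complex. cmod (d j) = 1}" for j by (intro closed_Collect_eq continuous_intros)
  have "closed ?K" unfolding ex by (intro closed_Int closed_UN ballI finite.intros cl closed_cspace)
  then have "compact (?K \<inter> ?B)" by (rule closed_Int_compact) (intro compact_Pi_UNIV compact_cball)
  moreover have sub: "?K \<inter> ?B \<subseteq> Q_dom" by (auto simp: Q_dom_def)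
  ultimately have "compactin (top_of_set Q_dom) (?K \<inter> ?B)" by (simp add: compactin_subtopology)
  then have "compactin (Top (Q_mod_Zn n)) (Zn_class n ` (?K \<inter> ?B))"
    by (rule image_compactin) (rule uD(6))
  moreover have "Zn_class n ` (?K \<inter> ?B) = pts (Q_mod_Zn n)"
  proof
    show "Zn_class n ` (?K \<inter> ?B) \<subseteq> pts (Q_mod_Zn n)" using sub uD(3) by blast
    show "pts (Q_mod_Zn n) \<subseteq> Zn_class n ` (?K \<inter> ?B)"
    proof
      fix y assume "y \<in> pts (Q_mod_Zn n)"
      then obtain d where d: "d \<in> Q_dom" "y = Zn_class n d" using uD(3) by blast
      have max: "\<exists>j\<in>{i, i'}. d j \<noteq> 0 \<and> cmod (d i) \<le> cmod (d j) \<and> cmod (d i') \<le> cmod (d j)"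
        if "d i \<noteq> 0 \<or> d i' \<noteq> 0" for i i'
        using that by (cases "cmod (d i) \<le> cmod (d i')") auto
      obtain j where j: "j \<in> {0, 1}" "d j \<noteq> 0" "cmod (d 0) \<le> cmod (d j)" "cmod (d 1) \<le> cmod (d j)"
        using max[of 0 1] d(1) by (auto simp: Q_dom_def)
      obtain k where k: "k \<in> {2, 3}" "d k \<noteq> 0" "cmod (d 2) \<le> cmod (d k)" "cmod (d 3) \<le> cmod (d k)"
        using max[of 2 3] d(1) by (auto simp: Q_dom_def)
      define h where "h = Q_act (1 / d j) (1 / d k) d"
      have hQ: "h \<in> Q_dom" unfolding h_def by (rule Q_act_dom) (use d j k in auto)
      have "Q_class d = Q_class h" unfolding Q_class_eq_iff[OF d(1) hQ] using j k
        by (intro exI[of _ "1 / d j"] exI[of _ "1 / d k"]) (simp add: h_def)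
      then have "Zn_class n h = y" using d by (simp add: Zn_class_def)
      have h: "h 0 = d 0 / d j" "h (Suc 0) = d 1 / d j" "h 2 = d 2 / d k" "h 3 = d 3 / d k" by (simp_all add: h_def)
      have "cmod (h j) = 1" using j(1,2) h by auto
      moreover have "cmod (h k) = 1" using k(1,2) h by auto
      ultimately have hK: "h \<in> ?K" using j(1) k(1) hQ Q_dom_cspace by auto
      have "cmod (h i) \<le> 1" for i
      proof -
        have hc: "h \<in> cspace 4" using hQ Q_dom_cspace by blast
        consider "i = 0" | "i = 1" | "i = 2" | "i = 3" | "i \<ge> 4" by linarith
        then show ?thesis
          using j(2-4) k(2-4) hc by cases (auto simp: h norm_divide divide_simps cspace_def)
      qed
      then have "h \<in> ?B" by auto
      then show "y \<in> Zn_class n ` (?K \<inter> ?B)" using hK \<open>Zn_class n h = y\<close> by blast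
    qed
  qed
  ultimately show ?thesis by (simp add: compact_space_def)
qed

lemma zero_cspace: "(\<lambda>_. 0) \<in> cspace N"
  by (simp add: cspace_def)

section \<open>Fibres of the map given by the invariants\<close>

lemma Q_map_fibre:
  assumes "n \<ge> 1" "d \<in> Q_dom" shows "Q_map n d \<in> fibre_cone n (\<lambda>_. 0)"
  unfolding Q_map_def
proof (rule cone_point_fibre[OF zero_cspace])
  show "d 0 ^ n * d 3 ^ n * (d 1 ^ n * d 2 ^ n) = 1\<^sup>2 * binary_form n (\<lambda>_. 0) (d 0 * d 2) (d 1 * d 3)"
    by (simp add: binary_form_zero power_mult_distrib)
  show "d 0 ^ n * d 3 ^ n \<noteq> 0 \<or> d 1 ^ n * d 2 ^ n \<noteq> 0 \<or> 1 \<noteq> (0::complex) \<and> (d 0 * d 2 \<noteq> 0 \<or> d 1 * d 3 \<noteq> 0)"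
    using assms by (auto simp: Q_dom_def)
qed

lemma cone_point_scale_curve:
  assumes "c ^ n = s" shows "cone_point n b x y t (c * u0) (c * u1) = cone_point n b x y (s * t) u0 u1"
proof (rule cone_point_cong)
  fix i assume "i \<le> n"
  then have "s = c ^ i * c ^ (n - i)" using assms by (simp add: power_add[symmetric])
  then show "t * (c * u0) ^ i * (c * u1) ^ (n - i) = s * t * u0 ^ i * u1 ^ (n - i)"
    by (simp add: power_mult_distrib)
qed

lemma Q_map_act: "Q_map n (Q_act l m d) = scale n (l ^ n * m ^ n) (Q_map n d)"
proof -
  have c: "(l * m) ^ n = l ^ n * m ^ n" by (rule power_mult_distrib)
  have "Q_act l m d 0 * Q_act l m d 2 = (l * m) * (d 0 * d 2)" "Q_act l m d 1 * Q_act l m d 3 = (l * m) * (d 1 * d 3)"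
    "Q_act l m d 0 ^ n * Q_act l m d 3 ^ n = l ^ n * m ^ n * (d 0 ^ n * d 3 ^ n)"
    "Q_act l m d 1 ^ n * Q_act l m d 2 ^ n = l ^ n * m ^ n * (d 1 ^ n * d 2 ^ n)"
    by (simp_all add: power_mult_distrib mult_ac)
  then show ?thesis
    unfolding Q_map_def scale_cone_point by (simp only: cone_point_scale_curve[OF c])
qed

lemma root_of_unity_cnj: "\<omega> ^ n = 1 \<Longrightarrow> n \<ge> 1 \<Longrightarrow> \<omega> * cnj \<omega> = 1"
proof -
  assume "\<omega> ^ n = 1" "n \<ge> 1"
  then have "cmod \<omega> ^ n = 1" by (metis norm_one norm_power)
  then have "cmod \<omega> = 1" using \<open>n \<ge> 1\<close> power_eq_imp_eq_base[of "cmod \<omega>" n 1] by simp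
  then show ?thesis by (simp add: complex_norm_square[symmetric])
qed

lemma Q_map_rotate:
  assumes "n \<ge> 1" "\<omega> ^ n = 1" shows "Q_map n (rotate_Q \<omega> d) = Q_map n d"
proof -
  have 1: "\<omega> * cnj \<omega> = 1" by (rule root_of_unity_cnj[OF assms(2,1)])
  have 2: "cnj \<omega> ^ n = 1" using assms(2) by (metis complex_cnj_one complex_cnj_power)
  have "\<omega> * d 0 * (cnj \<omega> * d 2) = (\<omega> * cnj \<omega>) * (d 0 * d 2)" by (simp only: mult_ac)
  then have "rotate_Q \<omega> d 0 * rotate_Q \<omega> d 2 = d 0 * d 2" using 1 by simp
  moreover have "rotate_Q \<omega> d 1 = d 1" "rotate_Q \<omega> d 3 = d 3" "rotate_Q \<omega> d 0 ^ n = d 0 ^ n" "rotate_Q \<omega> d 2 ^ n = d 2 ^ n"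
    using 2 assms(2) by (simp_all add: power_mult_distrib)
  ultimately show ?thesis by (simp only: Q_map_def)
qed

text \<open>With \<open>t = 1\<close> on both sides the rescaling of the curve parameters is an n-th
  root of unity. The hypotheses have the shape delivered by \<open>cone_point_eqD\<close>; u0 = u1 =
  0 is included, with \<open>c = 1\<close>.\<close>

lemma Q_map_orbit_aux:
  assumes n: "n \<ge> 1" and l: "l * 1 = (1::complex)"
    and w: "\<And>i. i \<le> n \<Longrightarrow> 1 * v0 ^ i * v1 ^ (n - i) = l * 1 * u0 ^ i * u1 ^ (n - i)"
  obtains c where "c ^ n = 1" "v0 = c * u0" "v1 = c * u1"
proof -
  have l1: "l = 1" using l by simp
  show ?thesis
  proof (cases "u0 = 0 \<and> u1 = 0")
    case True
    have "v1 ^ n = 0" "v0 ^ n = 0" using w[of 0] w[of n] True n by (auto simp: power_0_left)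
    then show ?thesis using that[of 1] True by simp
  next
    case False
    have "v0 \<noteq> 0 \<or> v1 \<noteq> 0"
    proof (rule ccontr)
      assume "\<not> (v0 \<noteq> 0 \<or> v1 \<noteq> 0)"
      then have "u1 ^ n = 0" "u0 ^ n = 0" using w[of 0] w[of n] l1 n by (auto simp: power_0_left)
      then show False using False by simp
    qed
    then obtain c where "c \<noteq> 0" "v0 = c * u0" "v1 = c * u1" "1 * c ^ n = 1"
      using curve_param_unique[OF n, of u0 u1 v0 v1 1 1] False w l1 by auto
    then show ?thesis using that by simp
  qed
qed

text \<open>If x \<noteq> 0, the pair \<eta>, 1 / \<zeta> consists of finite curve parameters with
  \<open>t = 1\<close>, determined up to a common root of unity, which is a rotation; if y \<noteq>
  0, the same holds for \<zeta>, 1 / \<eta>. Otherwise (\<zeta>, \<eta>) is (0, 0) or (infinity,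
  infinity), and these points are fixed by the group.\<close>

lemma Q_map_orbit:
  assumes n: "n \<ge> 1" and d: "d \<in> Q_dom" and f: "f \<in> Q_dom" and l: "l \<noteq> 0" and eq: "Q_map n f = scale n l (Q_map n d)"
  obtains \<omega> \<mu> \<nu> where "\<omega> ^ n = 1" "\<mu> \<noteq> 0" "\<nu> \<noteq> 0" "f = Q_act \<mu> \<nu> (rotate_Q \<omega> d)"
proof -
  \<comment> \<open>It suffices to match the two points after each has been rescaled separately,
    because rescalings commute with rotations.\<close>
  have norm: thesis
    if ac: "a \<noteq> 0" "b \<noteq> 0" "a' \<noteq> 0" "b' \<noteq> 0" and \<omega>: "\<omega> ^ n = 1" "\<mu> \<noteq> 0" "\<nu> \<noteq> 0"
      and e: "Q_act a' b' f = Q_act \<mu> \<nu> (rotate_Q \<omega> (Q_act a b d))" for a b a' b' \<omega> \<mu> \<nu>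
  proof -
    have "f = Q_act (1 / a') (1 / b') (Q_act a' b' f)"
      using ac Q_act_1[of f] f Q_dom_cspace by (auto simp: Q_act_act)
    also have "\<dots> = Q_act (1 / a' * \<mu> * a) (1 / b' * \<nu> * b) (rotate_Q \<omega> d)"
      unfolding e rotate_Q_act Q_act_act by (simp add: mult_ac)
    finally show ?thesis using that ac \<omega> \<open>\<And>\<omega> \<mu> \<nu>. \<lbrakk>\<omega> ^ n = 1; \<mu> \<noteq> 0; \<nu> \<noteq> 0; f = Q_act \<mu> \<nu> (rotate_Q \<omega> d)\<rbrakk> \<Longrightarrow> thesis\<close>
      by (metis (no_types, lifting) divide_eq_0_iff mult_eq_0_iff one_neq_zero)
  qed
  note D = cone_point_eqD[OF eq[unfolded Q_map_def scale_cone_point]]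
  have xd: "f 0 ^ n * f 3 ^ n = l * (d 0 ^ n * d 3 ^ n)" by (rule D(1))
  have yd: "f 1 ^ n * f 2 ^ n = l * (d 1 ^ n * d 2 ^ n)" by (rule D(2))
  have wd: "1 * (f 0 * f 2) ^ i * (f 1 * f 3) ^ (n - i) = l * 1 * (d 0 * d 2) ^ i * (d 1 * d 3) ^ (n - i)" if "i \<le> n" for i
    by (rule D(3)[OF that])
  have dd: "d 0 \<noteq> 0 \<or> d 1 \<noteq> 0" "d 2 \<noteq> 0 \<or> d 3 \<noteq> 0" "f 0 \<noteq> 0 \<or> f 1 \<noteq> 0" "f 2 \<noteq> 0 \<or> f 3 \<noteq> 0"
    using d f by (auto simp: Q_dom_def)
  have inv: "(1 / c) ^ n = 1" "cnj (1 / c) = c" "c \<noteq> 0" "cnj c = 1 / c" if "c ^ n = 1" for c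
  proof -
    have "c * cnj c = 1" by (rule root_of_unity_cnj[OF that n])
    then show c: "c \<noteq> 0" and "cnj c = 1 / c" by (auto simp: eq_divide_eq mult.commute)
    then show "cnj (1 / c) = c" by simp
    show "(1 / c) ^ n = 1" using that by (simp add: power_divide)
  qed
  have split: "s ^ i * s ^ (n - i) = s ^ n" if "i \<le> n" for s :: complex and i using that by (simp add: power_add[symmetric])
  consider "d 0 \<noteq> 0" "d 3 \<noteq> 0" | "d 1 \<noteq> 0" "d 2 \<noteq> 0" | "d 0 = 0" "d 2 = 0" | "d 1 = 0" "d 3 = 0" using dd by blast
  then show thesis
  proof cases
    case 1
    then have "f 0 ^ n * f 3 ^ n \<noteq> 0" using xd l by simp
    then have f03: "f 0 \<noteq> 0" "f 3 \<noteq> 0" using n by auto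
    have "1 * (f 2 / f 3) ^ i * (f 1 / f 0) ^ (n - i) = 1 * 1 * (d 2 / d 3) ^ i * (d 1 / d 0) ^ (n - i)" if i: "i \<le> n" for i
    proof -
      have "(f 2 / f 3) ^ i * (f 1 / f 0) ^ (n - i) * (f 0 ^ n * f 3 ^ n) = (f 0 * f 2) ^ i * (f 1 * f 3) ^ (n - i)"
        unfolding split[OF i, symmetric] using f03 by (simp add: power_mult_distrib power_divide)
      also have "\<dots> = l * ((d 0 * d 2) ^ i * (d 1 * d 3) ^ (n - i))" using wd[OF i] by simp
      also have "(d 0 * d 2) ^ i * (d 1 * d 3) ^ (n - i) = (d 2 / d 3) ^ i * (d 1 / d 0) ^ (n - i) * (d 0 ^ n * d 3 ^ n)"
        unfolding split[OF i, symmetric] using 1 by (simp add: power_mult_distrib power_divide)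
      finally have "(f 2 / f 3) ^ i * (f 1 / f 0) ^ (n - i) * (f 0 ^ n * f 3 ^ n) =
          (d 2 / d 3) ^ i * (d 1 / d 0) ^ (n - i) * (f 0 ^ n * f 3 ^ n)"
        unfolding xd by (simp only: mult_ac)
      then show ?thesis using f03 by simp
    qed
    then obtain c where c: "c ^ n = 1" "f 2 / f 3 = c * (d 2 / d 3)" "f 1 / f 0 = c * (d 1 / d 0)"
      using Q_map_orbit_aux[OF n, of 1] by (metis mult_1)
    show thesis
    \<comment> \<open>The rotation by \<open>1 / c\<close> turns the entry 1 of the normalized first
      pair into \<open>1 / c\<close>; the scalar \<open>c\<close> restores it.\<close>
    proof (rule norm[of "1 / d 0" "1 / d 3" "1 / f 0" "1 / f 3" "1 / c" c 1])
      show "Q_act (1 / f 0) (1 / f 3) f = Q_act c 1 (rotate_Q (1 / c) (Q_act (1 / d 0) (1 / d 3) d))"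
        by (rule cspace4_eqI) (use c inv[OF c(1)] 1 f03 in simp_all)
    qed (use 1 f03 inv[OF c(1)] in auto)
  next
    case 2
    then have "f 1 ^ n * f 2 ^ n \<noteq> 0" using yd l by simp
    then have f12: "f 1 \<noteq> 0" "f 2 \<noteq> 0" using n by auto
    have "1 * (f 0 / f 1) ^ i * (f 3 / f 2) ^ (n - i) = 1 * 1 * (d 0 / d 1) ^ i * (d 3 / d 2) ^ (n - i)" if i: "i \<le> n" for i
    proof -
      have "(f 0 / f 1) ^ i * (f 3 / f 2) ^ (n - i) * (f 1 ^ n * f 2 ^ n) = (f 0 * f 2) ^ i * (f 1 * f 3) ^ (n - i)"
        unfolding split[OF i, symmetric] using f12 by (simp add: power_mult_distrib power_divide)
      also have "\<dots> = l * ((d 0 * d 2) ^ i * (d 1 * d 3) ^ (n - i))" using wd[OF i] by simp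
      also have "(d 0 * d 2) ^ i * (d 1 * d 3) ^ (n - i) = (d 0 / d 1) ^ i * (d 3 / d 2) ^ (n - i) * (d 1 ^ n * d 2 ^ n)"
        unfolding split[OF i, symmetric] using 2 by (simp add: power_mult_distrib power_divide)
      finally have "(f 0 / f 1) ^ i * (f 3 / f 2) ^ (n - i) * (f 1 ^ n * f 2 ^ n) =
          (d 0 / d 1) ^ i * (d 3 / d 2) ^ (n - i) * (f 1 ^ n * f 2 ^ n)"
        unfolding yd by (simp only: mult_ac)
      then show ?thesis using f12 by simp
    qed
    then obtain c where c: "c ^ n = 1" "f 0 / f 1 = c * (d 0 / d 1)" "f 3 / f 2 = c * (d 3 / d 2)"
      using Q_map_orbit_aux[OF n, of 1] by (metis mult_1)
    show thesis
    \<comment> \<open>Here the second pair has its normalized entry multiplied by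
      \<open>cnj c = 1 / c\<close>, and the scalar \<open>c\<close> on that pair restores
      it.\<close>
    proof (rule norm[of "1 / d 1" "1 / d 2" "1 / f 1" "1 / f 2" c 1 c])
      show "Q_act (1 / f 1) (1 / f 2) f = Q_act 1 c (rotate_Q c (Q_act (1 / d 1) (1 / d 2) d))"
        by (rule cspace4_eqI) (use c inv[OF c(1)] 2 f12 in simp_all)
    qed (use 2 f12 c inv[OF c(1)] in auto)
  next
    case 3
    then have d13: "d 1 \<noteq> 0" "d 3 \<noteq> 0" using dd by auto
    have "(f 0 * f 2) ^ n = 0" using wd[of n] 3 n by (simp add: power_0_left)
    then have "f 0 = 0 \<or> f 2 = 0" by simp
    moreover have "(f 1 * f 3) ^ n \<noteq> 0" using wd[of 0] d13 l by simp
    then have "f 1 * f 3 \<noteq> 0" using n by (auto simp: power_0_left)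
    then have f13: "f 1 \<noteq> 0" "f 3 \<noteq> 0" by auto
    moreover have "f 0 ^ n * f 3 ^ n = 0" "f 1 ^ n * f 2 ^ n = 0" using xd yd 3 n by (auto simp: power_0_left)
    ultimately have z: "f 0 = 0" "f 2 = 0" by auto
    show thesis
    proof (rule norm[of 1 1 1 1 1 "f 1 / d 1" "f 3 / d 3"])
      show "Q_act 1 1 f = Q_act (f 1 / d 1) (f 3 / d 3) (rotate_Q 1 (Q_act 1 1 d))"
        by (rule cspace4_eqI) (use z 3 d13 in simp_all)
    qed (use d13 f13 in auto)
  next
    case 4
    then have d02: "d 0 \<noteq> 0" "d 2 \<noteq> 0" using dd by auto
    have "(f 0 * f 2) ^ n \<noteq> 0" using wd[of n] d02 l by simp
    then have "f 0 * f 2 \<noteq> 0" using n by (auto simp: power_0_left)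
    then have f02: "f 0 \<noteq> 0" "f 2 \<noteq> 0" by auto
    moreover have "f 0 ^ n * f 3 ^ n = 0" "f 1 ^ n * f 2 ^ n = 0" using xd yd 4 n by (auto simp: power_0_left)
    ultimately have z: "f 1 = 0" "f 3 = 0" by auto
    show thesis
    proof (rule norm[of 1 1 1 1 1 "f 0 / d 0" "f 2 / d 2"])
      show "Q_act 1 1 f = Q_act (f 0 / d 0) (f 2 / d 2) (rotate_Q 1 (Q_act 1 1 d))"
        by (rule cspace4_eqI) (use z 4 d02 in simp_all)
    qed (use d02 f02 in auto)
  qed
qed

lemma Zn_gen_class:
  assumes d: "d \<in> Q_dom"
  shows "(Zn_gen n ^^ j) (Q_class d) = Q_class (rotate_Q (cis (2 * pi / n) ^ j) d)"
proof (induction j)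
  case 0
  have "rotate_Q 1 d = d" by (rule cspace4_eqI) (use d Q_dom_cspace in auto)
  then show ?case by simp
next
  case (Suc j)
  let ?\<omega> = "cis (2 * pi / n)"
  have g: "Zn_gen n = image (rotate_Q ?\<omega>)"
    by (simp add: Zn_gen_def rotate_Q_def[abs_def] cis_cnj)
  have f: "rotate_Q (?\<omega> ^ j) d \<in> Q_dom" by (rule rotate_Q_dom[OF d]) simp
  have f': "rotate_Q (?\<omega> ^ Suc j) d \<in> Q_dom" by (rule rotate_Q_dom[OF d]) simp
  have "rotate_Q ?\<omega> ` Q_class (rotate_Q (?\<omega> ^ j) d) = Q_class (rotate_Q (?\<omega> ^ Suc j) d)"
    unfolding Q_class_orbit[OF f] Q_class_orbit[OF f']
  proof (intro set_eqI iffI)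
    fix q assume "q \<in> rotate_Q ?\<omega> ` {Q_act l m (rotate_Q (?\<omega> ^ j) d) | l m. l \<noteq> 0 \<and> m \<noteq> 0}"
    then obtain l m where "l \<noteq> 0" "m \<noteq> 0" "q = rotate_Q ?\<omega> (Q_act l m (rotate_Q (?\<omega> ^ j) d))" by blast
    then have "q = Q_act l m (rotate_Q (?\<omega> ^ Suc j) d)" "l \<noteq> 0" "m \<noteq> 0"
      by (simp_all add: rotate_Q_act rotate_Q_rotate)
    then show "q \<in> {Q_act l m (rotate_Q (?\<omega> ^ Suc j) d) | l m. l \<noteq> 0 \<and> m \<noteq> 0}" by blast
  next
    fix q assume "q \<in> {Q_act l m (rotate_Q (?\<omega> ^ Suc j) d) | l m. l \<noteq> 0 \<and> m \<noteq> 0}"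
    then obtain l m where "l \<noteq> 0" "m \<noteq> 0" "q = Q_act l m (rotate_Q (?\<omega> ^ Suc j) d)" by blast
    then have "q = rotate_Q ?\<omega> (Q_act l m (rotate_Q (?\<omega> ^ j) d))" "l \<noteq> 0" "m \<noteq> 0"
      by (simp_all add: rotate_Q_act rotate_Q_rotate)
    then show "q \<in> rotate_Q ?\<omega> ` {Q_act l m (rotate_Q (?\<omega> ^ j) d) | l m. l \<noteq> 0 \<and> m \<noteq> 0}" by blast
  qed
  then show ?case using Suc by (simp add: g)
qed

lemma root_of_unity_power:
  assumes "\<omega> ^ n = 1" "n \<ge> 1" obtains j where "\<omega> = cis (2 * pi / n) ^ j"
proof -
  have "\<omega> \<in> {z. z ^ n = 1}" using assms by simp
  then obtain j where "\<omega> = exp (2 * of_real pi * \<i> * of_nat j / of_nat n)"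
    using complex_roots_unity[OF assms(2)] by auto
  also have "\<dots> = cis (real j * (2 * pi / n))" by (simp add: cis_conv_exp mult_ac)
  also have "\<dots> = cis (2 * pi / n) ^ j" by (rule Complex.DeMoivre[symmetric])
  finally show ?thesis using that by blast
qed

text \<open>The root of unity found in \<open>Q_map_orbit\<close> is a nonnegative power of the
  generator, which is all that \<open>Zn_rel\<close> provides.\<close>

lemma Zn_rel_iff:
  assumes n: "n \<ge> 1" and d: "d \<in> Q_dom" and f: "f \<in> Q_dom"
  shows "(Q_class d, Q_class f) \<in> Zn_rel n \<longleftrightarrow> family_class n (Q_map n d) = family_class n (Q_map n f)"
proof -
  have iff: "family_class n (Q_map n d) = family_class n (Q_map n f) \<longleftrightarrow> (\<exists>l. l \<noteq> 0 \<and> Q_map n f = scale n l (Q_map n d))"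
    by (rule family_class_eq_iff) (use Q_map_fibre n d f fibre_cone_family_cone in blast)+
  have P: "Q_class d \<in> pts Q_space" "Q_class f \<in> pts Q_space" using d f uniformizedD(3)[OF uniformized_Q] by blast+
  show ?thesis
    unfolding iff
  proof
    assume "(Q_class d, Q_class f) \<in> Zn_rel n"
    then obtain j where "Q_class f = (Zn_gen n ^^ j) (Q_class d)" by (auto simp: Zn_rel_def)
    then have j: "Q_class (rotate_Q (cis (2 * pi / n) ^ j) d) = Q_class f" using Zn_gen_class[OF d] by simp
    have r: "rotate_Q (cis (2 * pi / n) ^ j) d \<in> Q_dom" by (rule rotate_Q_dom[OF d]) simp
    obtain l m where lm: "l \<noteq> 0" "m \<noteq> 0" "f = Q_act l m (rotate_Q (cis (2 * pi / n) ^ j) d)"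
      using j unfolding Q_class_eq_iff[OF r f] by blast
    have "(cis (2 * pi / n) ^ j) ^ n = 1" using cis_root_power[OF n] by (metis mult.commute power_mult power_one)
    then have "Q_map n f = scale n (l ^ n * m ^ n) (Q_map n d)" unfolding lm(3) Q_map_act by (simp add: Q_map_rotate[OF n])
    then show "\<exists>l. l \<noteq> 0 \<and> Q_map n f = scale n l (Q_map n d)" using lm by (intro exI[of _ "l ^ n * m ^ n"]) simp
  next
    assume "\<exists>l. l \<noteq> 0 \<and> Q_map n f = scale n l (Q_map n d)"
    then obtain l where l: "l \<noteq> 0" "Q_map n f = scale n l (Q_map n d)" by blast
    obtain \<omega> \<mu> \<nu> where \<omega>: "\<omega> ^ n = 1" "\<mu> \<noteq> 0" "\<nu> \<noteq> 0" "f = Q_act \<mu> \<nu> (rotate_Q \<omega> d)"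
      using Q_map_orbit[OF n d f l] by blast
    obtain j where j: "\<omega> = cis (2 * pi / n) ^ j" using root_of_unity_power[OF \<omega>(1) n] by blast
    have r: "rotate_Q \<omega> d \<in> Q_dom" by (rule rotate_Q_dom[OF d]) (simp add: j)
    have "Q_class (rotate_Q \<omega> d) = Q_class f" unfolding Q_class_eq_iff[OF r f] using \<omega> by blast
    then have "Q_class f = (Zn_gen n ^^ j) (Q_class d)" unfolding Zn_gen_class[OF d] j by simp
    then show "(Q_class d, Q_class f) \<in> Zn_rel n" using P by (auto simp: Zn_rel_def)
  qed
qed

lemma Zn_class_eq:
  assumes n: "n \<ge> 1" and d: "d \<in> Q_dom"
  shows "Zn_class n d = {Q_class f | f. f \<in> Q_dom \<and> family_class n (Q_map n f) = family_class n (Q_map n d)}"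
proof (intro set_eqI iffI)
  fix P assume "P \<in> Zn_class n d"
  then have P: "(Q_class d, P) \<in> Zn_rel n" by (simp add: Zn_class_def)
  then have "P \<in> pts Q_space" by (simp add: Zn_rel_def)
  then obtain f where "f \<in> Q_dom" "P = Q_class f" using uniformizedD(3)[OF uniformized_Q] by blast
  then show "P \<in> {Q_class f | f. f \<in> Q_dom \<and> family_class n (Q_map n f) = family_class n (Q_map n d)}"
    using P Zn_rel_iff[OF n d] by auto
next
  fix P assume "P \<in> {Q_class f | f. f \<in> Q_dom \<and> family_class n (Q_map n f) = family_class n (Q_map n d)}"
  then obtain f where "f \<in> Q_dom" "P = Q_class f" "family_class n (Q_map n f) = family_class n (Q_map n d)" by blast
  then show "P \<in> Zn_class n d" using Zn_rel_iff[OF n d] by (simp add: Zn_class_def)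
qed

lemma Zn_class_eq_iff:
  assumes n: "n \<ge> 1" and d: "d \<in> Q_dom" and f: "f \<in> Q_dom"
  shows "Zn_class n d = Zn_class n f \<longleftrightarrow> family_class n (Q_map n d) = family_class n (Q_map n f)"
proof
  assume eq: "Zn_class n d = Zn_class n f"
  have "Q_class f \<in> Zn_class n f" unfolding Zn_class_eq[OF n f] using f by blast
  then have "Q_class f \<in> Zn_class n d" by (simp only: eq)
  then have "(Q_class d, Q_class f) \<in> Zn_rel n" by (simp add: Zn_class_def)
  then show "family_class n (Q_map n d) = family_class n (Q_map n f)" using Zn_rel_iff[OF n d f] by simp
qed (simp only: Zn_class_eq[OF n d] Zn_class_eq[OF n f])

section \<open>The real structure on the quotient of the quadric\<close>

definition Q_conj :: "(nat \<Rightarrow> complex) \<Rightarrow> nat \<Rightarrow> complex" where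
  "Q_conj p = vec [cnj (p 2), cnj (p 3), cnj (p 0), cnj (p 1)]"

lemma Q_conj_dom: "d \<in> Q_dom \<Longrightarrow> Q_conj d \<in> Q_dom"
  by (auto simp: Q_dom_def Q_conj_def)

lemma Q_conj_invol: "p \<in> Q_dom \<Longrightarrow> Q_conj (Q_conj p) = p"
  by (rule cspace4_eqI) (auto simp: Q_conj_def Q_dom_def)

lemma Q_conj_act: "Q_conj (Q_act l m p) = Q_act (cnj m) (cnj l) (Q_conj p)"
  by (rule cspace4_eqI) (simp_all add: Q_conj_def)

lemma Q_conj_class:
  assumes d: "d \<in> Q_dom" shows "Q_conj ` Q_class d = Q_class (Q_conj d)"
  unfolding Q_class_orbit[OF d] Q_class_orbit[OF Q_conj_dom[OF d]]
proof (intro set_eqI iffI)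
  fix q assume "q \<in> Q_conj ` {Q_act l m d | l m. l \<noteq> 0 \<and> m \<noteq> 0}"
  then obtain l m where "l \<noteq> 0" "m \<noteq> 0" "q = Q_conj (Q_act l m d)" by blast
  then have "q = Q_act (cnj m) (cnj l) (Q_conj d)" "cnj m \<noteq> 0" "cnj l \<noteq> 0" by (simp_all add: Q_conj_act)
  then show "q \<in> {Q_act l m (Q_conj d) | l m. l \<noteq> 0 \<and> m \<noteq> 0}" by blast
next
  fix q assume "q \<in> {Q_act l m (Q_conj d) | l m. l \<noteq> 0 \<and> m \<noteq> 0}"
  then obtain l m where "l \<noteq> 0" "m \<noteq> 0" "q = Q_act l m (Q_conj d)" by blast
  then have "q = Q_conj (Q_act (cnj m) (cnj l) d)" "cnj m \<noteq> 0" "cnj l \<noteq> 0" by (simp_all add: Q_conj_act)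
  then show "q \<in> Q_conj ` {Q_act l m d | l m. l \<noteq> 0 \<and> m \<noteq> 0}" by blast
qed

lemma Q_map_conj: "Q_map n (Q_conj d) = conj_swap n (Q_map n d)"
proof
  fix i show "Q_map n (Q_conj d) i = conj_swap n (Q_map n d) i"
    by (simp add: Q_map_def conj_swap_def cone_point_def Q_conj_def mult.commute)
qed

lemma Q_real_class:
  assumes n: "n \<ge> 1" and d: "d \<in> Q_dom"
  shows "Q_mod_Zn_real (Zn_class n d) = Zn_class n (Q_conj d)"
proof -
  have mr: "Q_mod_Zn_real = image (image Q_conj)"
    by (simp add: Q_mod_Zn_real_def Q_conj_def[abs_def])
  have key: "family_class n (Q_map n (Q_conj f)) = family_class n (Q_map n (Q_conj g))"
    if "f \<in> Q_dom" "g \<in> Q_dom" "family_class n (Q_map n f) = family_class n (Q_map n g)" for f g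
    unfolding Q_map_conj
    using that family_real_class[OF fibre_cone_family_cone[OF Q_map_fibre[OF n]]] by metis
  show ?thesis
    unfolding mr Zn_class_eq[OF n d] Zn_class_eq[OF n Q_conj_dom[OF d]]
  proof (intro set_eqI iffI)
    fix P assume "P \<in> (`) Q_conj ` {Q_class f | f. f \<in> Q_dom \<and> family_class n (Q_map n f) = family_class n (Q_map n d)}"
    then obtain f where f: "f \<in> Q_dom" "family_class n (Q_map n f) = family_class n (Q_map n d)" "P = Q_conj ` Q_class f" by blast
    then show "P \<in> {Q_class f | f. f \<in> Q_dom \<and> family_class n (Q_map n f) = family_class n (Q_map n (Q_conj d))}"
      using Q_conj_class Q_conj_dom key[OF f(1) d f(2)] by blast
  next
    fix P assume "P \<in> {Q_class f | f. f \<in> Q_dom \<and> family_class n (Q_map n f) = family_class n (Q_map n (Q_conj d))}"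
    then obtain f where f: "f \<in> Q_dom" "P = Q_class f" "family_class n (Q_map n f) = family_class n (Q_map n (Q_conj d))" by blast
    have "family_class n (Q_map n (Q_conj f)) = family_class n (Q_map n d)"
      using key[OF f(1) Q_conj_dom[OF d] f(3)] Q_conj_invol[OF d] by simp
    moreover have "P = Q_conj ` Q_class (Q_conj f)"
      using Q_conj_class[OF Q_conj_dom[OF f(1)]] Q_conj_invol[OF f(1)] f(2) by simp
    ultimately show "P \<in> (`) Q_conj ` {Q_class f | f. f \<in> Q_dom \<and> family_class n (Q_map n f) = family_class n (Q_map n d)}"
      using Q_conj_dom[OF f(1)] by blast
  qed
qed

section \<open>Lifting points of the limit fibre to the quadric\<close>

definition node_section :: "bool \<Rightarrow> complex \<Rightarrow> complex \<Rightarrow> nat \<Rightarrow> complex" where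
  "node_section s a b = (if s then vec [a, 1, b, 1] else vec [1, b, 1, a])"

text \<open>The flag \<open>s\<close> selects the chart around (0, 0) or around (infinity,
  infinity). In the latter a = 1 / \<eta> and b = 1 / \<zeta>, in this order, so that x = a^n and y
  = b^n in both charts.\<close>

lemma Q_map_node_section: "Q_map n (node_section s a b) = node_point n s a b"
  by (cases s) (simp_all add: Q_map_def node_section_def node_point_def mult.commute)

lemma node_section_dom: "node_section s a b \<in> Q_dom"
  by (auto simp: node_section_def Q_dom_def)

lemma Q_map_surj:
  assumes n: "n \<ge> 1" and e: "e \<in> fibre_cone n (\<lambda>_. 0)"
  shows "\<exists>d\<in>Q_dom. family_class n (Q_map n d) = family_class n e"
proof -
  let ?F = "fibre_cone n (\<lambda>_. 0)"
  have ec: "e \<in> family_cone n" by (rule fibre_cone_family_cone[OF e])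
  have nf: "normal_form n c e \<in> ?F" "normal_form n c e c = 1" "family_class n (normal_form n c e) = family_class n e"
    if "e c \<noteq> 0" "c \<ge> 2 * n" for c
    using that fibre_cone_scale[OF e] normal_form_coord[of e c n] normal_form_class[OF ec] by (auto simp: normal_form_def)
  have suff: ?thesis if "d \<in> Q_dom" "Q_map n d = normal_form n c e" "e c \<noteq> 0" "c \<ge> 2 * n" for c d
    using that nf(3)[OF that(3,4)] by (intro bexI[of _ d]) simp_all
  consider "e (2 * n) \<noteq> 0" | "e (2 * n + 1) \<noteq> 0" | "e (2 * n) = 0" "e (2 * n + 1) = 0" by blast
  then show ?thesis
  proof cases
    case 1
    note f = nf[OF 1 order_refl]
    obtain u0 u1 where u: "\<And>i. i \<le> n \<Longrightarrow> curve_coord n (normal_form n (2 * n) e) i = 1 * u0 ^ i * u1 ^ (n - i)"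
      using curve_param[OF n fibre_coneD(2)[OF f(1)]] by blast
    note E = fibre_cone_eq_cone_point[OF f(1) u]
    have "normal_form n (2 * n) e (2 * n + 1) = u0 ^ n * u1 ^ n" using E(2) f(2) by (simp add: binary_form_zero)
    \<comment> \<open>Normalized to x = 1 the equation gives y = (u0 u1)^n, which is matched by 1 /
      \<zeta> = u1 and \<eta> = u0.\<close>
    moreover have "Q_map n (vec [1, u1, u0, 1]) = cone_point n (\<lambda>_. 0) 1 (u0 ^ n * u1 ^ n) 1 u0 u1"
      by (simp add: Q_map_def mult.commute)
    ultimately have "Q_map n (vec [1, u1, u0, 1]) = cone_point n (\<lambda>_. 0)
        (normal_form n (2 * n) e (2 * n)) (normal_form n (2 * n) e (2 * n + 1)) 1 u0 u1"
      by (simp only: f(2))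
    also have "\<dots> = normal_form n (2 * n) e" by (rule E(1)[symmetric])
    finally have "Q_map n (vec [1, u1, u0, 1]) = normal_form n (2 * n) e" .
    then show ?thesis by (rule suff[rotated]) (use 1 in \<open>auto simp: Q_dom_def\<close>)
  next
    case 2
    have "2 * n + 1 \<ge> 2 * n" by simp
    note f = nf[OF 2 this]
    obtain u0 u1 where u: "\<And>i. i \<le> n \<Longrightarrow> curve_coord n (normal_form n (2 * n + 1) e) i = 1 * u0 ^ i * u1 ^ (n - i)"
      using curve_param[OF n fibre_coneD(2)[OF f(1)]] by blast
    note E = fibre_cone_eq_cone_point[OF f(1) u]
    have "normal_form n (2 * n + 1) e (2 * n) = u0 ^ n * u1 ^ n" using E(2) f(2) by (simp add: binary_form_zero)
    moreover have "Q_map n (vec [u0, 1, 1, u1]) = cone_point n (\<lambda>_. 0) (u0 ^ n * u1 ^ n) 1 1 u0 u1"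
      by (simp add: Q_map_def)
    ultimately have "Q_map n (vec [u0, 1, 1, u1]) = cone_point n (\<lambda>_. 0)
        (normal_form n (2 * n + 1) e (2 * n)) (normal_form n (2 * n + 1) e (2 * n + 1)) 1 u0 u1"
      by (simp only: f(2))
    also have "\<dots> = normal_form n (2 * n + 1) e" by (rule E(1)[symmetric])
    finally have "Q_map n (vec [u0, 1, 1, u1]) = normal_form n (2 * n + 1) e" .
    then show ?thesis by (rule suff[rotated]) (use 2 in \<open>auto simp: Q_dom_def\<close>)
  next
    case 3
    obtain s where s: "e (node_coord n s) \<noteq> 0"
    proof -
      have "2 * n + 2 + n = 3 * n + 2" by simp
      then have "e (2 * n + 2) \<noteq> 0 \<or> e (3 * n + 2) \<noteq> 0" using family_cone_chart[OF ec] 3 by metis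
      then show ?thesis using that[of True] that[of False] by (auto simp: node_coord_def)
    qed
    have c: "node_coord n s \<ge> 2 * n" by (simp add: node_coord_def)
    note f = nf[OF s c]
    let ?f = "normal_form n (node_coord n s) e"
    have z: "?f (2 * n) = 0" "?f (2 * n + 1) = 0" using 3 by (simp_all add: normal_form_def scale_def)
    then have "?f (node_z n s) = 0" using node_product[OF n f(1,2)] n by simp
    then have "node_point n s 0 0 = ?f" using z n by (intro node_chart[OF n f(1,2)]) (simp_all add: power_0_left)
    then have "Q_map n (node_section s 0 0) = ?f" by (simp add: Q_map_node_section)
    then show ?thesis using suff[OF node_section_dom _ s c] by blast
  qed
qed

lemma lhol_holomorphic_compose:
  assumes S: "open S" and f: "f holomorphic_on S" and X: "lhol N T X" and XS: "\<And>p. p \<in> T \<Longrightarrow> X p \<in> S"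
  shows "lhol N T (\<lambda>p. f (X p))"
proof -
  let ?S = "{p \<in> cspace 1. p 0 \<in> S}"
  have oS: "openin (top_of_set (cspace 1)) ?S"
  proof -
    have "open ((\<lambda>p::nat \<Rightarrow> complex. p 0) -` S)"
      by (rule open_vimage[OF S continuous_on_coord_id])
    moreover have "?S = cspace 1 \<inter> (\<lambda>p. p 0) -` S" by auto
    ultimately show ?thesis by auto
  qed
  have "(\<lambda>p. f (p 0)) \<in> ahol 1 ?S"
    unfolding ahol_iff
  proof (intro conjI ballI allI impI)
    show "continuous_on ?S (\<lambda>p. f (p 0))"
      by (rule continuous_on_compose2[OF holomorphic_on_imp_continuous_on[OF f] continuous_on_coord_id]) auto
    fix p and i :: nat assume p: "p \<in> ?S" and i: "i < 1"
    have "f field_differentiable at (p 0)" using f S p by (simp add: holomorphic_on_imp_differentiable_at)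
    then show "(\<lambda>w. f ((p(i := w)) 0)) field_differentiable at (p i)" using i by simp
  qed
  then have "lhol 1 ?S (\<lambda>p. f (p 0))" by (rule ahol_imp_lhol[OF oS]) simp
  then have "lhol N T (\<lambda>p. f (pair (X p) 0 0))"
    by (rule lhol_compose) (use X XS lhol_sub_cspace[OF X] in \<open>auto simp: cspace_def pair_def\<close>)
  then show ?thesis by simp
qed

text \<open>The principal logarithm is applied to \<open>X / X0\<close>, which has positive real
  part on the disc about \<open>X0\<close> whose boundary circle passes through 0.\<close>

lemma local_root:
  assumes "X0 \<noteq> (0::complex)" "n \<ge> 1"
  obtains S rt where "open S" "X0 \<in> S" "rt holomorphic_on S" "\<And>X. X \<in> S \<Longrightarrow> rt X ^ n = X \<and> X \<noteq> 0"
proof -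
  obtain r where r: "X0 = r ^ n" using exists_complex_root[of n X0] assms by auto
  define rt where "rt = (\<lambda>X. r * exp (Ln (X / X0) / of_nat n))"
  have S: "X / X0 \<notin> \<real>\<^sub>\<le>\<^sub>0 \<and> X \<noteq> 0" if "X \<in> ball X0 (cmod X0)" for X
  proof -
    have "cmod (X / X0 - 1) = cmod (X - X0) / cmod X0" using assms(1) by (simp add: norm_divide[symmetric] diff_divide_distrib)
    then have "cmod (X / X0 - 1) < 1" using that assms(1) by (simp add: dist_norm norm_minus_commute)
    moreover have "\<bar>Re (X / X0 - 1)\<bar> \<le> cmod (X / X0 - 1)" by (rule abs_Re_le_cmod)
    ultimately have "Re (X / X0) > 0" by simp
    then show ?thesis by (auto simp: complex_nonpos_Reals_iff)
  qed
  show ?thesis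
  proof (rule that[of "ball X0 (cmod X0)" rt])
    show "rt holomorphic_on ball X0 (cmod X0)"
      unfolding rt_def using S assms by (intro holomorphic_intros) auto
    show "rt X ^ n = X \<and> X \<noteq> 0" if "X \<in> ball X0 (cmod X0)" for X
    proof -
      have "rt X ^ n = X0 * exp (Ln (X / X0))"
        using assms(2) by (simp add: rt_def power_mult_distrib r exp_of_nat_mult[symmetric])
      then show ?thesis using S[OF that] assms(1) by simp
    qed
  qed (use assms in auto)
qed

text \<open>Three strata, in a forced order. Where x or y is nonzero and the point is no vertex, a
  local n-th root yields a holomorphic section of \<open>Q_map\<close>. Next come the points x = y =
  0, whose punctured neighbourhoods belong to the first stratum. The vertices are last, since
  \<open>vertex_extension\<close> asks for holomorphy at every point with nonzero first or last
  curve coordinate, including those treated in the second step.\<close>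

lemma Q_descent:
  assumes n: "n \<ge> 1" and Z: "openin (top_of_set (fibre_cone n (\<lambda>_. 0))) Z"
    and hom: "\<And>e l. e \<in> Z \<Longrightarrow> l \<noteq> 0 \<Longrightarrow> scale n l e \<in> Z \<and> h (scale n l e) = h e"
    and hc: "continuous_on Z h"
    and hl: "lhol 4 {d \<in> Q_dom. Q_map n d \<in> Z} (\<lambda>d. h (Q_map n d))"
  shows "lhol (3 * n + 3) Z h"
proof -
  let ?N = "3 * n + 3" and ?F = "fibre_cone n (\<lambda>_. 0)"
  have ZF: "Z \<subseteq> ?F" using Z by (auto simp: openin_open)
  have ZN: "Z \<subseteq> cspace ?N" using ZF fibre_cone_cspace by blast
  have smooth: "\<exists>V. openin (top_of_set (cspace ?N)) V \<and> e0 \<in> V \<and> lhol ?N (V \<inter> Z) h"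
    if e0: "e0 \<in> Z" "e0 (node_coord n s) \<noteq> 0" and k: "k = 2 * n \<or> k = 2 * n + 1" "e0 k \<noteq> 0" for e0 s k
  proof -
    let ?c = "node_coord n s" and ?z = "node_z n s"
    have c: "?c \<ge> 2 * n" "?c < ?N" by (simp_all add: node_coord_def)
    have z: "?z \<ge> 2 * n" using n by (simp add: node_z_def)
    have k2: "k \<ge> 2 * n" using k by auto
    let ?n = "normal_form n ?c"
    have X0: "?n e0 k \<noteq> 0" using k k2 e0 by (simp add: normal_form_def scale_def)
    obtain S rt where S: "open S" "?n e0 k \<in> S" "rt holomorphic_on S" "\<And>X. X \<in> S \<Longrightarrow> rt X ^ n = X \<and> X \<noteq> 0"
      using local_root[OF X0 n] by metis
    let ?C = "{e \<in> cspace ?N. e ?c \<noteq> 0}"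
    have nl: "lhol ?N ?C (\<lambda>e. ?n e i)" for i by (rule lhol_normal_form) auto
    define V where "V = ?C \<inter> (\<lambda>e. ?n e k) -` S"
    have "openin (top_of_set ?C) V"
      unfolding V_def by (rule continuous_openin_preimage_gen[OF lhol_continuous[OF nl] S(1)])
    then have oV: "openin (top_of_set (cspace ?N)) V" using openin_coord_nonzero openin_trans by blast
    have e0V: "e0 \<in> V" using e0 ZN S(2) by (auto simp: V_def)
    let ?W = "V \<inter> Z"
    have WN: "?W \<subseteq> cspace ?N" using ZN by auto
    have nW: "lhol ?N ?W (\<lambda>e. ?n e i)" for i by (rule lhol_subset[OF nl]) (auto simp: V_def)
    have rl: "lhol ?N ?W (\<lambda>e. rt (?n e k))"
      by (rule lhol_holomorphic_compose[OF S(1,3) nW]) (auto simp: V_def)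
    have r0: "rt (?n e k) ^ n = ?n e k" "rt (?n e k) \<noteq> 0" if "e \<in> ?W" for e
    proof -
      have *: "rt (?n e k) ^ n = ?n e k \<and> ?n e k \<noteq> 0" using S(4)[of "?n e k"] that by (auto simp: V_def)
      then show "rt (?n e k) ^ n = ?n e k" "rt (?n e k) \<noteq> 0" using n by (auto simp: power_0_left)
    qed
    \<comment> \<open>The root is taken of whichever of x, y is nonzero; the other root is z divided
      by it, so that \<open>A e * B e\<close> is exactly z.\<close>
    define A where "A = (\<lambda>e. if k = 2 * n then rt (?n e k) else ?n e ?z / rt (?n e k))"
    define B where "B = (\<lambda>e. if k = 2 * n then ?n e ?z / rt (?n e k) else rt (?n e k))"
    have q: "lhol ?N ?W (\<lambda>e. ?n e ?z / rt (?n e k))" by (rule lhol_divide[OF nW rl r0(2)])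
    have AB: "lhol ?N ?W A" "lhol ?N ?W B" unfolding A_def B_def using rl q by (cases "k = 2 * n"; simp)+
    have pt: "node_point n s (A e) (B e) = ?n e" if e: "e \<in> ?W" for e
    proof (rule node_chart[OF n])
      have ec: "e ?c \<noteq> 0" using e by (auto simp: V_def)
      show f: "?n e \<in> ?F" unfolding normal_form_def by (rule fibre_cone_scale) (use e ZF ec in auto)
      show f1: "?n e ?c = 1" by (rule normal_form_coord[where e = e and c = ?c, OF ec c(1)])
      have p: "?n e (2 * n) * ?n e (2 * n + 1) = ?n e ?z ^ n" by (rule node_product[OF n f f1])
      have rn: "rt (?n e k) ^ n \<noteq> 0" by (rule power_not_zero[OF r0(2)[OF e]])
      show "A e * B e = ?n e ?z" using r0(2)[OF e] by (cases "k = 2 * n") (simp_all add: A_def B_def)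
      show "A e ^ n = ?n e (2 * n)"
      proof (cases "k = 2 * n")
        case True then show ?thesis using r0(1)[OF e] by (simp add: A_def)
      next
        case False
        then have "k = 2 * n + 1" using k by simp
        then show ?thesis using False r0[OF e] rn p by (simp add: A_def power_divide field_simps)
      qed
      show "B e ^ n = ?n e (2 * n + 1)"
      proof (cases "k = 2 * n")
        case True then show ?thesis using r0[OF e] rn p by (simp add: B_def power_divide field_simps)
      next
        case False
        then have "k = 2 * n + 1" using k by simp
        then show ?thesis using False r0(1)[OF e] by (simp add: B_def)
      qed
    qed
    have hn: "?n e \<in> Z" "h (?n e) = h e" if "e \<in> ?W" for e
      using hom[of e "1 / e ?c"] that by (auto simp: normal_form_def V_def)
    have "lhol ?N ?W (\<lambda>e. h (Q_map n (node_section s (A e) (B e))))"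
    proof (rule lhol_compose[OF hl _ _ WN])
      fix i :: nat assume "i < 4"
      then consider "i = 0" | "i = 1" | "i = 2" | "i = 3" by linarith
      then show "lhol ?N ?W (\<lambda>e. node_section s (A e) (B e) i)"
        by cases (use AB in \<open>cases s; auto simp: node_section_def intro!: lhol_const WN\<close>)+
    qed (use node_section_dom hn pt in \<open>auto simp: Q_map_node_section\<close>)
    moreover have "h e = h (Q_map n (node_section s (A e) (B e)))" if "e \<in> ?W" for e
      using pt[OF that] hn[OF that] by (simp add: Q_map_node_section)
    ultimately have "lhol ?N ?W h" using lhol_cong[of ?W h "\<lambda>e. h (Q_map n (node_section s (A e) (B e)))"] by simp
    then show ?thesis using oV e0V by blast
  qed
  let ?Z1 = "{e \<in> Z. e (2 * n + 2) \<noteq> 0 \<or> e (3 * n + 2) \<noteq> 0}"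
  have sm: "\<exists>V. openin (top_of_set (cspace ?N)) V \<and> e \<in> V \<and> lhol ?N (V \<inter> T) h"
    if e: "e \<in> ?Z1" "e (2 * n) \<noteq> 0 \<or> e (2 * n + 1) \<noteq> 0" and T: "T \<subseteq> Z" for e T
  proof -
    obtain s where s: "e (node_coord n s) \<noteq> 0"
      using e(1) that[of True] that[of False] by (auto simp: node_coord_def)
    obtain k where "k = 2 * n \<or> k = 2 * n + 1" "e k \<noteq> 0" using e(2) by blast
    then obtain V where V: "openin (top_of_set (cspace ?N)) V" "e \<in> V" "lhol ?N (V \<inter> Z) h"
      using smooth[of e s k] e(1) s by blast
    have "lhol ?N (V \<inter> T) h" by (rule lhol_subset[OF V(3)]) (use T in auto)
    then show ?thesis using V by blast
  qed
  have oZ1: "openin (top_of_set ?F) ?Z1"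
  proof -
    have "openin (top_of_set Z) ({e \<in> Z. e (2 * n + 2) \<noteq> 0} \<union> {e \<in> Z. e (3 * n + 2) \<noteq> 0})"
      by (intro openin_Un openin_coord_nonzero)
    moreover have "{e \<in> Z. e (2 * n + 2) \<noteq> 0} \<union> {e \<in> Z. e (3 * n + 2) \<noteq> 0} = ?Z1" by auto
    ultimately show ?thesis using openin_trans[OF _ Z] by simp
  qed
  have hom1: "scale n l e \<in> ?Z1 \<and> h (scale n l e) = h e" if "e \<in> ?Z1" "l \<noteq> 0" for e l
    using hom[of e l] that by (auto simp: scale_def)
  have hc1: "continuous_on ?Z1 h" by (rule continuous_on_subset[OF hc]) auto
  have reg1: "lhol ?N {e \<in> ?Z1. e (2 * n) \<noteq> 0 \<or> e (2 * n + 1) \<noteq> 0} h"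
  proof (rule lhol_local)
    fix e assume "e \<in> {e \<in> ?Z1. e (2 * n) \<noteq> 0 \<or> e (2 * n + 1) \<noteq> 0}"
    then show "\<exists>V. openin (top_of_set (cspace ?N)) V \<and> e \<in> V \<and> lhol ?N (V \<inter> {e \<in> ?Z1. e (2 * n) \<noteq> 0 \<or> e (2 * n + 1) \<noteq> 0}) h"
      by (intro sm) auto
  qed
  have reg: "lhol ?N ?Z1 h"
  proof (rule lhol_local)
    fix e assume e: "e \<in> ?Z1"
    show "\<exists>V. openin (top_of_set (cspace ?N)) V \<and> e \<in> V \<and> lhol ?N (V \<inter> ?Z1) h"
    proof (cases "e (2 * n) \<noteq> 0 \<or> e (2 * n + 1) \<noteq> 0")
      case True
      then show ?thesis by (intro sm[OF e]) auto
    next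
      case False
      then show ?thesis using node_extension[OF n oZ1 e hom1 hc1 reg1] by blast
    qed
  qed
  show ?thesis
  proof (rule lhol_local)
    fix e assume e: "e \<in> Z"
    show "\<exists>V. openin (top_of_set (cspace ?N)) V \<and> e \<in> V \<and> lhol ?N (V \<inter> Z) h"
    proof (cases "e \<in> ?Z1")
      case False
      then show ?thesis using vertex_extension[OF n zero_cspace Z e hom hc reg] e by blast
    next
      case True
      obtain V where V: "openin (top_of_set (cspace ?N)) V" "e \<in> V" "lhol ?N (V \<inter> ?Z1) h"
      proof (cases "e (2 * n) \<noteq> 0 \<or> e (2 * n + 1) \<noteq> 0")
        case True
        have "?Z1 \<subseteq> Z" by blast
        then show ?thesis using sm[OF \<open>e \<in> ?Z1\<close> True] that by blast
      next
        case False
        then show ?thesis using node_extension[OF n oZ1 \<open>e \<in> ?Z1\<close> hom1 hc1 reg1] that by blast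
      qed
      let ?O1 = "{e \<in> cspace ?N. e (2 * n + 2) \<noteq> 0} \<union> {e \<in> cspace ?N. e (3 * n + 2) \<noteq> 0}"
      have "openin (top_of_set (cspace ?N)) (V \<inter> ?O1)"
        by (intro openin_Int openin_Un V(1) openin_coord_nonzero)
      moreover have "V \<inter> ?O1 \<inter> Z = V \<inter> ?Z1" using ZN by auto
      ultimately show ?thesis using V True ZN by (intro exI[of _ "V \<inter> ?O1"]) auto
    qed
  qed
qed

lemma has_fibre_Q_mod_Zn:
  assumes n: "n \<ge> 1"
  shows "has_fibre (family n) (2 * n) (base_map n) (family_real n) (\<lambda>_. 0) (Q_mod_Zn n) Q_mod_Zn_real"
proof (rule has_fibreI[OF n zero_cspace uniformized_Q_mod_Zn compact_Q_mod_Zn, where \<Psi> = "Q_map n" and g = Q_conj])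
  show "lhol 4 Q_dom (\<lambda>d. Q_map n d i)" for i
    unfolding Q_map_def
    by (intro lhol_cone_point lhol_mult lhol_power lhol_coord lhol_const Q_dom_cspace)
  show "lhol (3 * n + 3) Z h" if "openin (top_of_set (fibre_cone n (\<lambda>_. 0))) Z"
    "\<And>e l. e \<in> Z \<Longrightarrow> l \<noteq> 0 \<Longrightarrow> scale n l e \<in> Z \<and> h (scale n l e) = h e" "continuous_on Z h"
    "lhol 4 {d \<in> Q_dom. Q_map n d \<in> Z} (\<lambda>d. h (Q_map n d))" for Z h
    using Q_descent[OF n that] .
  show "\<exists>d\<in>Q_dom. family_class n (Q_map n d) = family_class n e" if "e \<in> fibre_cone n (\<lambda>_. 0)" for e
    by (rule Q_map_surj[OF n that])
qed (use n in \<open>auto simp: Q_map_fibre Zn_class_eq_iff Q_conj_dom Q_real_class Q_map_conj\<close>)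

theorem proposition3p2:
  fixes n :: nat
  assumes "n \<ge> 2"
  shows "\<exists>(X :: (nat \<Rightarrow> complex) set fspace) B \<pi> \<tau>.
    flat_family X (2 * n) B \<pi> \<and> (\<lambda>_. 0) \<in> B \<and>
    real_structure X \<tau> \<and> (\<forall>x\<in>pts X. \<forall>i. \<pi> (\<tau> x) i = cnj (\<pi> x i)) \<and>
    (\<forall>a :: nat \<Rightarrow> real. strict_mono_on {1..2 * n} a \<and> a (n + 1) > 0 \<and> param n a \<in> B \<longrightarrow>
       has_fibre X (2 * n) \<pi> \<tau> (param n a) (minitwistor n a) minitwistor_real) \<and>
    has_fibre X (2 * n) \<pi> \<tau> (\<lambda>_. 0) (Q_mod_Zn n) Q_mod_Zn_real"
proof (intro exI conjI allI impI ballI)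
  have n: "n \<ge> 1" using assms by simp
  show "flat_family (family n) (2 * n) (cspace (2 * n)) (base_map n)" by (rule flat_family_family[OF n])
  show "(\<lambda>_. 0) \<in> cspace (2 * n)" by (rule zero_cspace)
  show "real_structure (family n) (family_real n)" by (rule real_structure_family)
  show "base_map n (family_real n x) i = cnj (base_map n x i)" if "x \<in> pts (family n)" for x i
    by (rule base_map_real[OF that])
  show "has_fibre (family n) (2 * n) (base_map n) (family_real n) (\<lambda>_. 0) (Q_mod_Zn n) Q_mod_Zn_real"
    by (rule has_fibre_Q_mod_Zn[OF n])
  fix a :: "nat \<Rightarrow> real"
  assume "strict_mono_on {1..2 * n} a \<and> a (n + 1) > 0 \<and> param n a \<in> cspace (2 * n)"
  then have "a (n + k + 1) > 0" if "k < n" for k using strict_mono_pos[of n a k] that by blast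
  then show "has_fibre (family n) (2 * n) (base_map n) (family_real n) (param n a) (minitwistor n a) minitwistor_real"
    by (intro has_fibre_minitwistor n)
qed

end
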